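(* Let $D\subset\mathbb{R}^d$ be an open set, $u_M:D\to\mathbb{R}$ a Lebesgue measurable function, $g\in H^1(D)$ a given initial datum and $F\in L^2(D;\mathbb{R}^d)$. Then there are functions $u\in\mathcal U_{\mathcal N}(D,g)$ and $\mu\in L^\infty(D\times[0,+\infty))$ such that $(u,\mu)$ is an enthalpy solution of the Stefan problem in $D\times[0,+\infty)$ with melting temperature $u_M$, heat source $F$, and: - Neumann boundary conditions on $\partial D$, that is, $u(\cdot,t)\in H^1(D)$ for all $t\ge0$ and the identity $$\int_D(u+\mu)\eta\,dx\Big|_{t=t_1}^{t_2}=\int_{t_1}^{t_2}\int_D\big[(u+\mu)\partial_t\eta-\nabla u\cdot\nabla\eta-F\cdot\nabla\eta\big]\,dx\,dt$$ holds for all $0\le t_1<t_2<+\infty$ and all $\eta\in C^\infty_c(\mathbb{R}^d\times[0,+\infty))$; - initial temperature $u(x,0)=g(x)$; - initial mushy coefficient $\mu(x,0)=\mathbb 1_{\Omega_g^+}(x)-\mathbb 1_{\Omega_g^-}(x)$, where $\Omega_g^+=\{x\in D:g(x)>0\}$ and $\Omega_g^-=\{x\in D:g(x)<0\}$.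
   Context: For $D\subset\mathbb{R}^d$ open and $T\in(0,+\infty]$, $D_T:=D\times[0,T)$; $\nabla$ is the gradient in $x$ only. $\mathcal U:=\{u:D\times[0,+\infty)\to\mathbb{R}: u\in H^1(D_T)\ \forall T>0\}$ and $\mathcal U_{\mathcal N}(D,g):=\{u\in\mathcal U:u(\cdot,0)=g\}$. Enthalpy solution in $D_T$, with melting temperature $u_M:D\to\mathbb{R}$ and heat source $F$, Neumann case: a pair of measurable functions $u,\mu:D_T\to\mathbb{R}$ such that (i) $u\in L^2_{loc}([0,T);H^1(D))$ and $\partial_tu\in L^2_{loc}([0,T);L^2(D))$ (so $u(\cdot,t)$ is understood as the representative continuous in $t$ with values in $L^2(D)$); (ii) $\mu:[0,T)\to L^\infty(D)$ is continuous for the weak-$\ast$ topology of $L^\infty(D)=(L^1(D))^*$; (iii) for all $t\in[0,T)$ and a.e. $x\in D$: $\mu(x,t)=1$ if $u(x,t)>u_M(x)$ and $\mu(x,t)=-1$ if $u(x,t)<u_M(x)$; (iv) the integral identity displayed in the claim holds for all $0\le t_1<t_2<T$ and all $\eta\in C^\infty_c(\mathbb{R}^d\times\mathbb{R})$.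
   Formalization: The sets in the initial mushy coefficient are taken as Ω_g^+={g>u_M} and Ω_g^-={g<u_M} instead of {g>0} and {g<0}; as printed the claim fails, e.g. for u_M=1, g=1/2, F=0 on a ball, where (iii) at t=0 forces μ=-1; for u_M=0 the two agree. *)

theory Defs
  imports "HOL-Analysis.Analysis"
begin

section \<open>Smooth test functions\<close>

definition partial_deriv :: "'a::euclidean_space \<Rightarrow> ('a \<Rightarrow> real) \<Rightarrow> 'a \<Rightarrow> real" where
  "partial_deriv b f x = frechet_derivative f (at x) b"

primrec C_k :: "nat \<Rightarrow> ('a::euclidean_space \<Rightarrow> real) \<Rightarrow> bool" where
  "C_k 0 f \<longleftrightarrow> continuous_on UNIV f"
| "C_k (Suc k) f \<longleftrightarrow> (\<forall>x. f differentiable (at x)) \<and> (\<forall>b\<in>Basis. C_k k (partial_deriv b f))"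

definition Cc_infinity :: "'a::euclidean_space set \<Rightarrow> ('a \<Rightarrow> real) set" where
  "Cc_infinity U =
     {\<phi>. (\<forall>k. C_k k \<phi>) \<and> compact (closure {x. \<phi> x \<noteq> 0}) \<and> closure {x. \<phi> x \<noteq> 0} \<subseteq> U}"

text \<open>Smooth compactly supported functions on the closed half space \<open>t \<ge> 0\<close>, smooth up to
  \<open>t = 0\<close> and not required to vanish there: restrictions of test functions on the whole
  space-time. The values for \<open>t < 0\<close> are irrelevant.\<close>

definition Cc_infinity_half :: "('a::euclidean_space \<times> real \<Rightarrow> real) set" where
  "Cc_infinity_half = {\<eta>. \<exists>\<zeta>\<in>Cc_infinity UNIV. \<forall>x. \<forall>t\<ge>0. \<eta> (x, t) = \<zeta> (x, t)}"

definition grad_x :: "('a::euclidean_space \<times> real \<Rightarrow> real) \<Rightarrow> 'a \<times> real \<Rightarrow> 'a" where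
  "grad_x \<eta> = (\<lambda>(x, t). \<Sum>b\<in>Basis. partial_deriv b (\<lambda>y. \<eta> (y, t)) x *\<^sub>R b)"

definition deriv_t :: "('a::euclidean_space \<times> real \<Rightarrow> real) \<Rightarrow> 'a \<times> real \<Rightarrow> real" where
  "deriv_t \<eta> = (\<lambda>(x, t). deriv (\<lambda>s. \<eta> (x, s)) t)"


section \<open>Lebesgue and Sobolev spaces\<close>

text \<open>Elements are functions, not equivalence classes; values outside the domain are irrelevant.\<close>

definition L2_space :: "'a::euclidean_space set \<Rightarrow> ('a \<Rightarrow> 'b::euclidean_space) set" where
  "L2_space U = {f. f \<in> borel_measurable (lebesgue_on U) \<and>
                    integrable (lebesgue_on U) (\<lambda>x. (norm (f x))\<^sup>2)}"

definition Linf_space :: "'a::euclidean_space set \<Rightarrow> ('a \<Rightarrow> real) set" where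
  "Linf_space U = {f. f \<in> borel_measurable (lebesgue_on U) \<and>
                      (\<exists>C. AE x in lebesgue_on U. \<bar>f x\<bar> \<le> C)}"

definition locally_integrable_on :: "'a::euclidean_space set \<Rightarrow> ('a \<Rightarrow> real) \<Rightarrow> bool" where
  "locally_integrable_on U f \<longleftrightarrow>
     (\<forall>K. compact K \<longrightarrow> K \<subseteq> U \<longrightarrow> integrable (lebesgue_on K) f)"

definition has_weak_partial ::
    "'a::euclidean_space set \<Rightarrow> 'a \<Rightarrow> ('a \<Rightarrow> real) \<Rightarrow> ('a \<Rightarrow> real) \<Rightarrow> bool" where
  "has_weak_partial U b f h \<longleftrightarrow>
     locally_integrable_on U f \<and> locally_integrable_on U h \<and>
     (\<forall>\<phi>\<in>Cc_infinity U.
        (LINT x|lebesgue_on U. f x * partial_deriv b \<phi> x) = - (LINT x|lebesgue_on U. h x * \<phi> x))"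

definition has_weak_gradient ::
    "'a::euclidean_space set \<Rightarrow> ('a \<Rightarrow> real) \<Rightarrow> ('a \<Rightarrow> 'a) \<Rightarrow> bool" where
  "has_weak_gradient U f G \<longleftrightarrow> (\<forall>b\<in>Basis. has_weak_partial U b f (\<lambda>x. G x \<bullet> b))"

definition H1_space :: "'a::euclidean_space set \<Rightarrow> ('a \<Rightarrow> real) set" where
  "H1_space U = {f. f \<in> L2_space U \<and> (\<exists>G\<in>L2_space U. has_weak_gradient U f G)}"

text \<open>For \<open>f \<in> H1_space U\<close> the weak gradient is unique almost everywhere, so the choice below
  only selects a representative.\<close>

definition weak_grad :: "'a::euclidean_space set \<Rightarrow> ('a \<Rightarrow> real) \<Rightarrow> 'a \<Rightarrow> 'a" where
  "weak_grad U f = (SOME G. G \<in> L2_space U \<and> has_weak_gradient U f G)"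

definition H1_norm_sq :: "'a::euclidean_space set \<Rightarrow> ('a \<Rightarrow> real) \<Rightarrow> real" where
  "H1_norm_sq U f = (LINT x|lebesgue_on U. (f x)\<^sup>2 + (norm (weak_grad U f x))\<^sup>2)"


section \<open>Functions on the space-time cylinder\<close>

definition time_ivl :: "ereal \<Rightarrow> real set" where
  "time_ivl T = {t. 0 \<le> t \<and> ereal t < T}"

abbreviation (input) slice :: "('a \<times> real \<Rightarrow> real) \<Rightarrow> real \<Rightarrow> 'a \<Rightarrow> real" where
  "slice u t \<equiv> (\<lambda>x. u (x, t))"

text \<open>For a jointly measurable \<open>u\<close>, whose slices have weak gradients, the map from \<open>t\<close> to the slice
  at \<open>t\<close> is automatically strongly measurable with values in the separable space \<open>H\<^sup>1(D)\<close>, so only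
  the square integrability of its norm has to be required.\<close>

definition L2_loc_H1 :: "'a::euclidean_space set \<Rightarrow> ereal \<Rightarrow> ('a \<times> real \<Rightarrow> real) \<Rightarrow> bool" where
  "L2_loc_H1 D T u \<longleftrightarrow>
     u \<in> borel_measurable (lebesgue_on (D \<times> time_ivl T)) \<and>
     (AE t in lebesgue_on (time_ivl T). slice u t \<in> H1_space D) \<and>
     (\<forall>T'>0. ereal T' < T \<longrightarrow> integrable (lebesgue_on {0..T'}) (\<lambda>t. H1_norm_sq D (slice u t)))"

text \<open>\<open>L\<^sup>2(0,T';L\<^sup>2(D))\<close> is identified with \<open>L\<^sup>2(D \<times> (0,T'))\<close>, and the time derivative is taken in the
  sense of distributions on the open cylinder.\<close>

definition time_deriv_L2_loc :: "'a::euclidean_space set \<Rightarrow> ereal \<Rightarrow> ('a \<times> real \<Rightarrow> real) \<Rightarrow> bool" where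
  "time_deriv_L2_loc D T u \<longleftrightarrow>
     (\<exists>w. has_weak_partial (D \<times> {t. 0 < t \<and> ereal t < T}) (0, 1) u w \<and>
          (\<forall>T'>0. ereal T' < T \<longrightarrow> w \<in> L2_space (D \<times> {0<..<T'})))"

definition continuous_L2_valued :: "'a::euclidean_space set \<Rightarrow> ereal \<Rightarrow> ('a \<times> real \<Rightarrow> real) \<Rightarrow> bool" where
  "continuous_L2_valued D T u \<longleftrightarrow>
     (\<forall>t\<in>time_ivl T. slice u t \<in> L2_space D) \<and>
     (\<forall>t\<in>time_ivl T.
        ((\<lambda>s. LINT x|lebesgue_on D. (u (x, s) - u (x, t))\<^sup>2) \<longlongrightarrow> 0) (at t within time_ivl T))"

definition weak_star_continuous :: "'a::euclidean_space set \<Rightarrow> ereal \<Rightarrow> ('a \<times> real \<Rightarrow> real) \<Rightarrow> bool" where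
  "weak_star_continuous D T \<mu> \<longleftrightarrow>
     (\<forall>t\<in>time_ivl T. slice \<mu> t \<in> Linf_space D) \<and>
     (\<forall>f. integrable (lebesgue_on D) f \<longrightarrow>
        continuous_on (time_ivl T) (\<lambda>t. LINT x|lebesgue_on D. \<mu> (x, t) * f x))"

text \<open>\<open>H\<^sup>1(D\<^sub>T)\<close> is \<open>H\<^sup>1\<close> of the open cylinder, which differs from \<open>D \<times> [0,T)\<close> by a null set.\<close>

definition space_U :: "'a::euclidean_space set \<Rightarrow> ('a \<times> real \<Rightarrow> real) set" where
  "space_U D = {u. \<forall>T>0. u \<in> H1_space (D \<times> {0<..<T})}"

text \<open>The condition \<open>u(\<cdot>,0) = g\<close> only makes sense for the representative of \<open>u\<close> that is continuous in
  time with values in \<open>L\<^sup>2(D)\<close>; \<open>u\<close> is required to be that representative.\<close>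

definition space_U_N :: "'a::euclidean_space set \<Rightarrow> ('a \<Rightarrow> real) \<Rightarrow> ('a \<times> real \<Rightarrow> real) set" where
  "space_U_N D g =
     {u \<in> space_U D. continuous_L2_valued D \<infinity> u \<and> (AE x in lebesgue_on D. u (x, 0) = g x)}"


section \<open>Enthalpy solutions of the Stefan problem\<close>

definition enthalpy_identity ::
    "'a::euclidean_space set \<Rightarrow> ('a \<Rightarrow> 'a) \<Rightarrow> ('a \<times> real \<Rightarrow> real) \<Rightarrow> ('a \<times> real \<Rightarrow> real)
     \<Rightarrow> real \<Rightarrow> real \<Rightarrow> ('a \<times> real \<Rightarrow> real) \<Rightarrow> bool" where
  "enthalpy_identity D F u \<mu> t\<^sub>1 t\<^sub>2 \<eta> \<longleftrightarrow>
     (LINT x|lebesgue_on D. (u (x, t\<^sub>2) + \<mu> (x, t\<^sub>2)) * \<eta> (x, t\<^sub>2)) -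
     (LINT x|lebesgue_on D. (u (x, t\<^sub>1) + \<mu> (x, t\<^sub>1)) * \<eta> (x, t\<^sub>1)) =
     (LINT t|lebesgue_on {t\<^sub>1..t\<^sub>2}. LINT x|lebesgue_on D.
        (u (x, t) + \<mu> (x, t)) * deriv_t \<eta> (x, t)
        - weak_grad D (slice u t) x \<bullet> grad_x \<eta> (x, t)
        - F x \<bullet> grad_x \<eta> (x, t))"

definition enthalpy_solution_Neumann ::
    "'a::euclidean_space set \<Rightarrow> ereal \<Rightarrow> ('a \<Rightarrow> real) \<Rightarrow> ('a \<Rightarrow> 'a)
     \<Rightarrow> ('a \<times> real \<Rightarrow> real) \<Rightarrow> ('a \<times> real \<Rightarrow> real) \<Rightarrow> bool" where
  "enthalpy_solution_Neumann D T u\<^sub>M F u \<mu> \<longleftrightarrow>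
     u \<in> borel_measurable (lebesgue_on (D \<times> time_ivl T)) \<and>
     \<mu> \<in> borel_measurable (lebesgue_on (D \<times> time_ivl T)) \<and>
     L2_loc_H1 D T u \<and> time_deriv_L2_loc D T u \<and> continuous_L2_valued D T u \<and>
     weak_star_continuous D T \<mu> \<and>
     (\<forall>t\<in>time_ivl T. AE x in lebesgue_on D.
        (u (x, t) > u\<^sub>M x \<longrightarrow> \<mu> (x, t) = 1) \<and> (u (x, t) < u\<^sub>M x \<longrightarrow> \<mu> (x, t) = - 1)) \<and>
     (\<forall>t\<^sub>1 t\<^sub>2. 0 \<le> t\<^sub>1 \<longrightarrow> t\<^sub>1 < t\<^sub>2 \<longrightarrow> ereal t\<^sub>2 < T \<longrightarrow>
        (\<forall>\<eta>\<in>Cc_infinity UNIV. enthalpy_identity D F u \<mu> t\<^sub>1 t\<^sub>2 \<eta>))"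

text \<open>The phases of the initial datum are taken relative to the melting temperature; for
  \<open>u\<^sub>M = 0\<close> they are \<open>{g > 0}\<close> and \<open>{g < 0}\<close>. For a general \<open>u\<^sub>M\<close> the latter sets are incompatible
  with an enthalpy solution, whose constraint at time 0 forces \<open>\<mu>(\<cdot>,0) = -1\<close> almost everywhere
  on \<open>{g < u\<^sub>M}\<close> and \<open>\<mu>(\<cdot>,0) = 1\<close> almost everywhere on \<open>{g > u\<^sub>M}\<close>.\<close>

definition Omega_plus :: "'a set \<Rightarrow> ('a \<Rightarrow> real) \<Rightarrow> ('a \<Rightarrow> real) \<Rightarrow> 'a set" where
  "Omega_plus D u\<^sub>M g = {x\<in>D. g x > u\<^sub>M x}"

definition Omega_minus :: "'a set \<Rightarrow> ('a \<Rightarrow> real) \<Rightarrow> ('a \<Rightarrow> real) \<Rightarrow> 'a set" where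
  "Omega_minus D u\<^sub>M g = {x\<in>D. g x < u\<^sub>M x}"

end

theory Submission
  imports Defs "HOL-Analysis.Analysis"
begin

text \<open>The solution is the limit of the linearised time stepping scheme of Berger, Brezis and Rogers.
  The enthalpy is \<open>g + \<mu>\<^sub>0 + z\<close> with increments \<open>z\<close> starting at \<open>0\<close>; a step of size \<open>h\<close> passes to
  \<open>z + p - u\<close>, where \<open>u = \<gamma>(z)\<close> is the temperature and \<open>p\<close> solves the linear Neumann problem
  \<open>p - h div (\<nabla>p + F) = u\<close>. Since \<open>\<gamma>\<close> is firmly nonexpansive, \<open>h |\<nabla>p + F|\<^sup>2 + |p - u|\<^sup>2\<close> decreases along
  the scheme, and the loss controls the squared increments of \<open>u\<close>; hence uniform bounds in
  \<open>H\<^sup>1\<close> of space-time. Two dyadic levels of the scheme are compared by testing the integrated equations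
  with the difference of the two solutions times a spatial cutoff, so that the temperatures
  converge strongly on bounded sets at every time. Gradients and phases converge only weakly, but this
  suffices: the equation is linear in them, and the phase constraint passes to the limit by weak-strong
  convergence. No compact embedding is used, so \<open>D\<close> may be an arbitrary open set. Weak continuity of the
  gradient in time makes the enthalpy tested with a smooth function continuously differentiable, which
  gives the integral identity at all times.\<close>

section \<open>Hilbert spaces\<close>

text \<open>The obstacle is that \<open>D\<close> may have infinite measure and a rough boundary,
  while the phase is merely bounded, so that the enthalpy is in general not in L2. Hence the scheme
  runs on increments, and the uniqueness argument for the Stefan problem (test the time-integrated
  difference of two solutions with the difference of the temperatures) is made quantitative and
  local. A cutoff \<kappa> leaves the commutator term \<open>p\<close> grad \<kappa>, which does not
  vanish with the step size; it is made small by spreading \<kappa> out, harmlessly, because the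
  lower bound of \<kappa> on a fixed ball does not depend on the size of its gradient. The estimate
  so obtained is integrated in time; the Hoelder bound in time turns it into one at each time, by
  averaging over a short window. So the whole sequence converges at each time, and the equation
  hands this convergence on to gradients and phases, where it need only be checked on total sets of
  test vectors. What remains is measure theory: limits taken time by time must be fitted together
  into jointly measurable functions whose slices are right at every single time.\<close>

lemma nested_convex_sets_min_norm:
  fixes C :: "nat \<Rightarrow> 'h::{real_inner, complete_space} set"
  assumes conv: "\<And>n. convex (C n)"
    and dec: "\<And>m n. m \<le> n \<Longrightarrow> C n \<subseteq> C m"
    and bdd: "\<And>n. \<exists>x\<in>C n. norm x \<le> B"
  shows "\<exists>s x. (\<forall>n. s n \<in> C n) \<and> s \<longlonglongrightarrow> x \<and>
           (\<forall>n. \<forall>c\<in>C n. (norm (s n))\<^sup>2 \<le> (norm c)\<^sup>2 + 1 / Suc n)"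
proof -
  \<comment> \<open>Used twice: a constant family \<open>C\<close> yields projections onto closed
    subspaces, the convex hulls of the tails of a sequence yield Mazur's theorem.\<close>
  define d where "d n = Inf ((\<lambda>c. (norm c)\<^sup>2) ` C n)" for n
  have bb: "bdd_below ((\<lambda>c. (norm c)\<^sup>2) ` C n)" for n
    by (rule bdd_belowI[where m=0]) auto
  have ne: "C n \<noteq> {}" for n using bdd[of n] by auto
  have d_le: "d n \<le> (norm c)\<^sup>2" if "c \<in> C n" for n c
    unfolding d_def using bb that by (auto intro: cInf_lower)
  have "\<exists>c\<in>C n. (norm c)\<^sup>2 < d n + 1 / Suc n" for n
  proof -
    have "d n < d n + 1 / Suc n" by simp
    then show ?thesis unfolding d_def
      using cInf_less_iff[of "(\<lambda>c. (norm c)\<^sup>2) ` C n"] ne bb by fastforce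
  qed
  then obtain s where s: "\<And>n. s n \<in> C n" "\<And>n. (norm (s n))\<^sup>2 < d n + 1 / Suc n" by metis
  have dB: "d n \<le> B\<^sup>2" for n
  proof -
    obtain x where "x \<in> C n" "norm x \<le> B" using bdd by auto
    then show ?thesis using d_le[of x n] power_mono[of "norm x" B 2] by auto
  qed
  have inc: "incseq d"
    unfolding incseq_def d_def using dec ne bb by (auto intro!: cInf_superset_mono image_mono)
  have d0: "0 \<le> d n" for n
    unfolding d_def using ne by (intro cInf_greatest) auto
  have "Bseq d"
    by (intro BseqI'[where K="B\<^sup>2"]) (use dB d0 in auto)
  then have "Cauchy d"
    using Bseq_monoseq_convergent inc incseq_def monoseq_def convergent_Cauchy by metis
  \<comment> \<open>Parallelogram law: the midpoint of \<open>s m\<close> and \<open>s n\<close>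
    lies in the larger set \<open>C n\<close>, so its squared norm is at least \<open>d n\<close>.
    Convergence of \<open>d\<close> then makes the near-minimisers a Cauchy sequence.\<close>
  have close: "(norm (s m - s n))\<^sup>2 \<le> 2 * (d m - d n) + 4 / Suc n" if "n \<le> m" for m n
  proof -
    have "(1/2) *\<^sub>R s m + (1/2) *\<^sub>R s n \<in> C n"
      using conv[of n] s(1)[of n] s(1)[of m] dec[OF that]
      by (auto intro!: convexD)
    then have "d n \<le> (norm ((1/2) *\<^sub>R (s m + s n)))\<^sup>2"
      using d_le by (simp add: scaleR_right_distrib)
    also have "\<dots> = (norm (s m + s n))\<^sup>2 / 4" by (simp add: power_divide power_mult_distrib)
    finally have "4 * d n \<le> (norm (s m + s n))\<^sup>2" by simp
    moreover have "(norm (s m - s n))\<^sup>2 + (norm (s m + s n))\<^sup>2 = 2 * (norm (s m))\<^sup>2 + 2 * (norm (s n))\<^sup>2"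
      by (simp add: power2_norm_eq_inner algebra_simps inner_commute)
    moreover have "1 / real (Suc m) \<le> 1 / Suc n" using that by (simp add: frac_le)
    ultimately show ?thesis using s(2)[of m] s(2)[of n] by argo
  qed
  have "Cauchy s"
  proof (rule CauchyI)
    fix e :: real assume "0 < e"
    then have e2: "0 < e\<^sup>2 / 8" by simp
    obtain M1 where M1: "\<And>m n. m \<ge> M1 \<Longrightarrow> n \<ge> M1 \<Longrightarrow> norm (d m - d n) < e\<^sup>2 / 8"
      using CauchyD[OF \<open>Cauchy d\<close> e2] by blast
    obtain M2 where M2: "1 / real (Suc M2) < e\<^sup>2 / 8"
      using nat_approx_posE[OF e2] by blast
    have *: "norm (s m - s n) < e" if "n \<ge> max M1 M2" "m \<ge> n" for m n
    proof -
      have "1 / real (Suc n) \<le> 1 / Suc M2" using that by (simp add: frac_le)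
      then have 1: "1 / real (Suc n) < e\<^sup>2 / 8" using M2 by linarith
      have "norm (d m - d n) < e\<^sup>2 / 8" using that by (intro M1) auto
      then have 2: "d m - d n < e\<^sup>2 / 8"
        unfolding real_norm_def by (rule order.strict_trans1[OF abs_ge_self])
      have 3: "(norm (s m - s n))\<^sup>2 \<le> 2 * (d m - d n) + 4 * (1 / Suc n)" using close[of n m] that by simp
      have "0 < e\<^sup>2" using \<open>0 < e\<close> by simp
      moreover have "x < E" if "x \<le> 2 * a + 4 * r" "a < E / 8" "r < E / 8" "0 < E" for x a r E :: real
        using that by linarith
      ultimately have "(norm (s m - s n))\<^sup>2 < e\<^sup>2" using 1 2 3 by blast
      then show ?thesis using \<open>0 < e\<close> by (simp add: power2_less_imp_less)
    qed
    show "\<exists>M. \<forall>m\<ge>M. \<forall>n\<ge>M. norm (s m - s n) < e"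
      using * norm_minus_commute by (metis linorder_le_cases)
  qed
  then obtain x where "s \<longlonglongrightarrow> x" using Cauchy_convergent convergent_def by blast
  moreover have "(norm (s n))\<^sup>2 \<le> (norm c)\<^sup>2 + 1 / Suc n" if "c \<in> C n" for n c
    using s(2)[of n] d_le[OF that] by linarith
  ultimately show ?thesis using s(1) by blast
qed

lemma subspace_projection:
  fixes V :: "'h::{real_inner, complete_space} set"
  assumes V: "subspace V" and cl: "closed V"
  shows "\<exists>x\<in>V. \<forall>v\<in>V. inner (y - x) v = 0"
proof -
  define C where "C (n::nat) = (\<lambda>v. v - y) ` V" for n
  have "convex (C n)" for n
    unfolding C_def using subspace_imp_convex[OF V] convex_translation_subtract by blast
  moreover have "\<exists>x\<in>C n. norm x \<le> norm y" for n
    unfolding C_def using subspace_0[OF V] by (auto intro!: bexI[of _ 0])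
  ultimately obtain s x where s: "\<And>n. s n \<in> C n" "s \<longlonglongrightarrow> x"
      "\<And>n c. c \<in> C n \<Longrightarrow> (norm (s n))\<^sup>2 \<le> (norm c)\<^sup>2 + 1 / Suc n"
    using nested_convex_sets_min_norm[of C "norm y"] unfolding C_def by blast
  define p where "p = x + y"
  have "p \<in> V"
  proof (rule closed_sequentially[OF cl])
    show "s n + y \<in> V" for n using s(1)[of n] by (auto simp: C_def)
    show "(\<lambda>n. s n + y) \<longlonglongrightarrow> p" unfolding p_def by (intro tendsto_intros s)
  qed
  have min: "(norm x)\<^sup>2 \<le> (norm (v - y))\<^sup>2" if "v \<in> V" for v
  proof (rule LIMSEQ_le)
    show "(\<lambda>n. (norm (s n))\<^sup>2) \<longlonglongrightarrow> (norm x)\<^sup>2" by (intro tendsto_intros s)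
    show "(\<lambda>n. (norm (v - y))\<^sup>2 + 1 / Suc n) \<longlonglongrightarrow> (norm (v - y))\<^sup>2"
      using tendsto_add[OF tendsto_const LIMSEQ_inverse_real_of_nat, of "(norm (v - y))\<^sup>2"]
      by (simp add: inverse_eq_divide)
    show "\<exists>N. \<forall>n\<ge>N. (norm (s n))\<^sup>2 \<le> (norm (v - y))\<^sup>2 + 1 / Suc n"
      using s(3)[of "v - y"] that by (auto simp: C_def)
  qed
  have "inner (y - p) v = 0" if "v \<in> V" for v
  proof (cases "v = 0")
    case False
    \<comment> \<open>The step length that minimises the distance to \<open>y\<close> along the line
      through \<open>p\<close> in direction \<open>v\<close>.\<close>
    define t where "t = inner (y - p) v / inner v v"
    have vv: "inner v v > 0" using False by simp
    have "p + t *\<^sub>R v \<in> V" using V \<open>p \<in> V\<close> that by (simp add: subspace_add subspace_scale)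
    from min[OF this] have "inner (y - p) (y - p) \<le> inner (p + t *\<^sub>R v - y) (p + t *\<^sub>R v - y)"
      by (simp add: p_def power2_norm_eq_inner)
    also have "\<dots> = inner (y - p) (y - p) - 2 * t * inner (y - p) v + t * (t * inner v v)"
      by (simp add: algebra_simps inner_commute)
    also have "t * inner v v = inner (y - p) v" using vv by (simp add: t_def)
    finally have "t * inner (y - p) v \<le> 0" by (simp add: algebra_simps)
    then have "(inner (y - p) v)\<^sup>2 / inner v v \<le> 0"
      by (simp add: t_def power2_eq_square)
    then have "(inner (y - p) v)\<^sup>2 \<le> 0" using vv by (simp add: divide_le_0_iff)
    then show ?thesis by simp
  qed simp
  with \<open>p \<in> V\<close> show ?thesis by blast
qed

lemma subspace_closure:
  fixes V :: "'h::real_normed_vector set"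
  assumes V: "subspace V"
  shows "subspace (closure V)"
proof (rule subspaceI)
  show "0 \<in> closure V" using subspace_0[OF V] closure_subset by blast
next
  fix x y assume "x \<in> closure V" "y \<in> closure V"
  then obtain a b where "\<And>n. a n \<in> V" "a \<longlonglongrightarrow> x" "\<And>n. b n \<in> V" "b \<longlonglongrightarrow> y"
    by (auto simp: closure_sequential)
  then show "x + y \<in> closure V" unfolding closure_sequential
    by (intro exI[of _ "\<lambda>n. a n + b n"]) (auto intro: tendsto_add subspace_add[OF V])
next
  fix c x assume "x \<in> closure V"
  then obtain a where "\<And>n. a n \<in> V" "a \<longlonglongrightarrow> x" by (auto simp: closure_sequential)
  then show "c *\<^sub>R x \<in> closure V" unfolding closure_sequential
    by (intro exI[of _ "\<lambda>n. c *\<^sub>R a n"]) (auto intro: tendsto_scaleR subspace_scale[OF V])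
qed

text \<open>Riesz representation for a functional given by its graph. The form suits functionals
  defined on test functions, where different functions may give the same vector: the bound alone
  forces the graph to be single-valued. The representing vector comes from projecting
  \<open>(0, 1)\<close> onto the closed graph; the residual is orthogonal to the graph, and the
  bound keeps its last component away from zero.\<close>

lemma riesz_graph:
  fixes W :: "('h::{real_inner, complete_space} \<times> real) set"
  assumes W: "subspace W" and bd: "\<And>a s. (a, s) \<in> W \<Longrightarrow> \<bar>s\<bar> \<le> B * norm a"
  shows "\<exists>w. \<forall>(a, s)\<in>W. s = inner w a"
proof -
  have bd': "\<bar>s\<bar> \<le> B * norm a" if "(a, s) \<in> closure W" for a s
  proof -
    have "closed {x::'h \<times> real. \<bar>snd x\<bar> \<le> B * norm (fst x)}"
      by (intro closed_Collect_le continuous_intros)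
    then have "closure W \<subseteq> {x. \<bar>snd x\<bar> \<le> B * norm (fst x)}"
      using bd by (intro closure_minimal) auto
    then show ?thesis using that by auto
  qed
  obtain a s where as: "(a, s) \<in> closure W"
      and orth: "\<And>v. v \<in> closure W \<Longrightarrow> inner ((0, 1) - (a, s)) v = 0"
    using subspace_projection[OF subspace_closure[OF W] closed_closure, of "(0, 1)"] by force
  have ne: "s \<noteq> 1"
  proof
    assume "s = 1"
    with orth[OF as] have "a = 0" by (simp add: inner_prod_def)
    with bd'[OF as] \<open>s = 1\<close> show False by simp
  qed
  have "t = inner ((1 / (1 - s)) *\<^sub>R a) b" if "(b, t) \<in> W" for b t
  proof -
    have "(b, t) \<in> closure W" using that closure_subset by blast
    from orth[OF this] have "(1 - s) * t = inner a b" by (simp add: inner_prod_def algebra_simps)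
    then show ?thesis using ne by (simp add: field_simps)
  qed
  then show ?thesis by blast
qed

lemma orthogonal_total_imp_closed_subspace_UNIV:
  fixes S W :: "'h::{real_inner, complete_space} set"
  assumes tot: "\<And>f. (\<And>\<phi>. \<phi> \<in> S \<Longrightarrow> inner f \<phi> = 0) \<Longrightarrow> f = 0"
    and W: "subspace W" "closed W" "S \<subseteq> W"
  shows "W = UNIV"
proof -
  have "y \<in> W" for y
  proof -
    obtain x where x: "x \<in> W" "\<forall>v\<in>W. inner (y - x) v = 0"
      using subspace_projection[OF W(1,2)] by blast
    then have "y - x = 0" using tot[of "y - x"] W(3) by auto
    then show ?thesis using x by simp
  qed
  then show ?thesis by auto
qed

text \<open>Boundedness of \<open>x\<close> makes the pairings with nearby vectors uniformly close,
  so convergence passes to limits of test vectors. Together with totality this reduces weak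
  convergence to a set of convenient tests.\<close>

lemma closed_convergent_inner:
  fixes x :: "nat \<Rightarrow> 'h::real_inner"
  assumes bd: "\<And>n. norm (x n) \<le> B"
  shows "subspace {\<phi>. convergent (\<lambda>n. inner (x n) \<phi>)}" "closed {\<phi>. convergent (\<lambda>n. inner (x n) \<phi>)}"
proof -
  show "subspace {\<phi>. convergent (\<lambda>n. inner (x n) \<phi>)}"
    by (rule subspaceI) (auto simp: inner_add_right convergent_add convergent_const
        intro!: convergent_mult)
  show "closed {\<phi>. convergent (\<lambda>n. inner (x n) \<phi>)}"
  proof (subst closed_sequential_limits, intro allI impI)
    fix f \<phi> assume f: "(\<forall>n. f n \<in> {\<phi>. convergent (\<lambda>n. inner (x n) \<phi>)}) \<and> f \<longlonglongrightarrow> \<phi>"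
    have B0: "0 \<le> B" using bd[of 0] norm_ge_zero[of "x 0"] by linarith
    have "Cauchy (\<lambda>n. inner (x n) \<phi>)"
    proof (rule CauchyI)
      fix e :: real assume "0 < e"
      define e' where "e' = e / (4 * (B + 1))"
      have "0 < e'" using B0 \<open>0 < e\<close> by (simp add: e'_def)
      then obtain k where k: "norm (f k - \<phi>) < e'"
        using f by (meson LIMSEQ_D order_refl)
      have c: "Cauchy (\<lambda>n. inner (x n) (f k))" using f by (auto intro: convergent_Cauchy)
      have "0 < e / 2" using \<open>0 < e\<close> by simp
      from CauchyD[OF c this]
      obtain M where M: "\<And>m n. m \<ge> M \<Longrightarrow> n \<ge> M \<Longrightarrow> norm (inner (x m) (f k) - inner (x n) (f k)) < e / 2"
        by blast
      have d: "\<bar>inner (x n) (f k - \<phi>)\<bar> \<le> e / 4" for n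
      proof -
        have "\<bar>inner (x n) (f k - \<phi>)\<bar> \<le> norm (x n) * norm (f k - \<phi>)" by (rule Cauchy_Schwarz_ineq2)
        also have "\<dots> \<le> (B + 1) * e'"
          using bd[of n] k B0 by (intro mult_mono) auto
        also have "\<dots> = e / 4" using B0 by (simp add: e'_def field_simps add_nonneg_eq_0_iff)
        finally show ?thesis .
      qed
      show "\<exists>M. \<forall>m\<ge>M. \<forall>n\<ge>M. norm (inner (x m) \<phi> - inner (x n) \<phi>) < e"
      proof (intro exI allI impI)
        fix m n assume "m \<ge> M" "n \<ge> M"
        from M[OF this] d[of m] d[of n] show "norm (inner (x m) \<phi> - inner (x n) \<phi>) < e"
          unfolding real_norm_def inner_diff_right by linarith
      qed
    qed
    then show "\<phi> \<in> {\<phi>. convergent (\<lambda>n. inner (x n) \<phi>)}" by (simp add: Cauchy_convergent)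
  qed
qed

text \<open>Existence of a weak limit of the whole sequence, without weak compactness. This matters
  for sequences depending on time: no subsequence has to be chosen, hence none that varies with the
  time.\<close>

lemma weak_limit_exists:
  fixes x :: "nat \<Rightarrow> 'h::{real_inner, complete_space}"
  assumes bd: "\<And>n. norm (x n) \<le> B"
    and tot: "\<And>f. (\<And>\<phi>. \<phi> \<in> S \<Longrightarrow> inner f \<phi> = 0) \<Longrightarrow> f = 0"
    and conv: "\<And>\<phi>. \<phi> \<in> S \<Longrightarrow> convergent (\<lambda>n. inner (x n) \<phi>)"
  shows "\<exists>y. \<forall>\<phi>. (\<lambda>n. inner (x n) \<phi>) \<longlonglongrightarrow> inner y \<phi>"
proof -
  have "{\<phi>. convergent (\<lambda>n. inner (x n) \<phi>)} = UNIV"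
    using conv by (intro orthogonal_total_imp_closed_subspace_UNIV[of S, OF tot] closed_convergent_inner[OF bd]) auto
  then have lim: "(\<lambda>n. inner (x n) \<phi>) \<longlonglongrightarrow> lim (\<lambda>n. inner (x n) \<phi>)" for \<phi>
    by (auto simp: convergent_LIMSEQ_iff)
  define l where "l \<phi> = lim (\<lambda>n. inner (x n) \<phi>)" for \<phi>
  have l: "(\<lambda>n. inner (x n) \<phi>) \<longlonglongrightarrow> l \<phi>" for \<phi> unfolding l_def by (rule lim)
  have add: "l (\<phi> + \<psi>) = l \<phi> + l \<psi>" for \<phi> \<psi>
    using LIMSEQ_unique[OF l[of "\<phi> + \<psi>"]] tendsto_add[OF l[of \<phi>] l[of \<psi>]] by (simp add: inner_add_right)
  have sc: "l (c *\<^sub>R \<phi>) = c * l \<phi>" for c \<phi>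
    using LIMSEQ_unique[OF l[of "c *\<^sub>R \<phi>"]] tendsto_mult[OF tendsto_const[of c] l[of \<phi>]] by simp
  have lb: "\<bar>l \<phi>\<bar> \<le> B * norm \<phi>" for \<phi>
  proof (rule LIMSEQ_le_const2)
    show "(\<lambda>n. \<bar>inner (x n) \<phi>\<bar>) \<longlonglongrightarrow> \<bar>l \<phi>\<bar>" using l by (intro tendsto_intros)
    show "\<exists>N. \<forall>n\<ge>N. \<bar>inner (x n) \<phi>\<bar> \<le> B * norm \<phi>"
      using Cauchy_Schwarz_ineq2 bd mult_right_mono[OF bd norm_ge_zero] order_trans by blast
  qed
  have "\<exists>w. \<forall>(a, s)\<in>range (\<lambda>\<phi>. (\<phi>, l \<phi>)). s = inner w a"
  proof (rule riesz_graph[where B=B])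
    show "subspace (range (\<lambda>\<phi>. (\<phi>, l \<phi>)))"
      by (rule subspaceI) (use sc[of 0 0] in \<open>auto simp: image_iff add sc zero_prod_def\<close>)
  qed (use lb in auto)
  then obtain w where "\<forall>\<phi>. l \<phi> = inner w \<phi>" by auto
  then have "(\<lambda>n. inner (x n) \<phi>) \<longlonglongrightarrow> inner w \<phi>" for \<phi> using l[of \<phi>] by simp
  then show ?thesis by blast
qed

text \<open>Weak lower semicontinuity of the norm, by testing with the limit itself.\<close>

lemma weak_limit_norm_le:
  fixes x :: "nat \<Rightarrow> 'h::real_inner"
  assumes "(\<lambda>n. inner (x n) y) \<longlonglongrightarrow> inner y y" and "\<exists>N. \<forall>n\<ge>N. norm (x n) \<le> B"
  shows "norm y \<le> B"
proof (cases "y = 0")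
  case True
  obtain N where "norm (x N) \<le> B" using assms(2) by auto
  then have "0 \<le> B" using norm_ge_zero[of "x N"] by linarith
  then show ?thesis using True by simp
next
  case False
  have "inner y y \<le> B * norm y"
  proof (rule LIMSEQ_le_const2[OF assms(1)])
    obtain N where N: "\<And>n. n \<ge> N \<Longrightarrow> norm (x n) \<le> B" using assms(2) by auto
    have "inner (x n) y \<le> B * norm y" if "n \<ge> N" for n
      using norm_cauchy_schwarz[of "x n" y] mult_right_mono[OF N[OF that] norm_ge_zero[of y]] by linarith
    then show "\<exists>N. \<forall>n\<ge>N. inner (x n) y \<le> B * norm y" by blast
  qed
  then have "norm y * norm y \<le> B * norm y" by (simp add: norm_eq_sqrt_inner)
  then show ?thesis using False by simp
qed

text \<open>The near-minimisers of the norm in the convex hulls of the tails converge strongly. The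
  limit is not prescribed; it is identified later through weak limits, with which convex
  combinations of tails are compatible.\<close>

lemma mazur:
  fixes x :: "nat \<Rightarrow> 'h::{real_inner, complete_space}"
  assumes bd: "\<And>n. norm (x n) \<le> B"
  shows "\<exists>I c y. (\<forall>n. finite (I n) \<and> I n \<subseteq> {n..} \<and> (\<forall>i\<in>I n. 0 \<le> c n i) \<and> sum (c n) (I n) = 1) \<and>
           (\<lambda>n. \<Sum>i\<in>I n. c n i *\<^sub>R x i) \<longlonglongrightarrow> (y::'h)"
proof -
  define C where "C n = convex hull (x ` {n..})" for n
  have "\<exists>s y. (\<forall>n. s n \<in> C n) \<and> s \<longlonglongrightarrow> y \<and>
           (\<forall>n. \<forall>c\<in>C n. (norm (s n))\<^sup>2 \<le> (norm c)\<^sup>2 + 1 / Suc n)"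
  proof (rule nested_convex_sets_min_norm)
    show "\<exists>z\<in>C n. norm z \<le> B" for n
      unfolding C_def using bd[of n] by (intro bexI[of _ "x n"] hull_inc) auto
  qed (auto simp: C_def intro!: hull_mono)
  then obtain s y where s: "\<And>n. s n \<in> C n" "s \<longlonglongrightarrow> y" by blast
  have "\<exists>I c. finite I \<and> I \<subseteq> {n..} \<and> (\<forall>i\<in>I. 0 \<le> c i) \<and> sum c I = 1 \<and> (\<Sum>i\<in>I. c i *\<^sub>R x i) = s n" for n
  proof -
    obtain S u where S: "finite S" "S \<subseteq> x ` {n..}" "\<forall>v\<in>S. 0 \<le> u v" "sum u S = 1" "(\<Sum>v\<in>S. u v *\<^sub>R v) = s n"
      using s(1)[of n] unfolding C_def convex_hull_explicit by blast
    obtain I where I: "I \<subseteq> {n..}" "inj_on x I" "S = x ` I"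
      using S(2) by (meson subset_image_inj)
    have "finite I" using I S(1) finite_imageD by blast
    then show ?thesis using S I
      by (intro exI[of _ I] exI[of _ "u \<circ> x"]) (auto simp: sum.reindex)
  qed
  then obtain I c where Ic: "\<And>n. finite (I n) \<and> I n \<subseteq> {n..} \<and> (\<forall>i\<in>I n. 0 \<le> c n i) \<and> sum (c n) (I n) = 1"
      "\<And>n. (\<Sum>i\<in>I n. c n i *\<^sub>R x i) = s n" by metis
  have "(\<lambda>n. \<Sum>i\<in>I n. c n i *\<^sub>R x i) \<longlonglongrightarrow> y" using s(2) Ic(2) by simp
  then show ?thesis using Ic(1) by (intro exI[of _ I] exI[of _ c] exI[of _ y]) simp
qed

lemma convex_combinations_tendsto:
  fixes a :: "nat \<Rightarrow> real"
  assumes "\<And>n. finite (I n) \<and> I n \<subseteq> {n..} \<and> (\<forall>i\<in>I n. 0 \<le> c n i) \<and> sum (c n) (I n) = 1"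
    and "a \<longlonglongrightarrow> l"
  shows "(\<lambda>n. \<Sum>i\<in>I n. c n i * a i) \<longlonglongrightarrow> l"
proof (rule LIMSEQ_I)
  fix e :: real assume "0 < e"
  then obtain N where N: "\<And>n. n \<ge> N \<Longrightarrow> norm (a n - l) < e / 2"
    using LIMSEQ_D[OF assms(2), of "e/2"] by auto
  have "norm ((\<Sum>i\<in>I n. c n i * a i) - l) < e" if "n \<ge> N" for n
  proof -
    have "(\<Sum>i\<in>I n. c n i * a i) - l = (\<Sum>i\<in>I n. c n i * (a i - l))"
      using assms(1)[of n] by (simp add: right_diff_distrib sum_subtractf sum_distrib_right[symmetric])
    also have "norm \<dots> \<le> (\<Sum>i\<in>I n. c n i * (e / 2))"
    proof (rule sum_norm_le)
      fix i assume i: "i \<in> I n"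
      then have "0 \<le> c n i" "norm (a i - l) \<le> e / 2"
        using assms(1)[of n] N[of i] that by auto
      then show "norm (c n i * (a i - l)) \<le> c n i * (e / 2)"
        using mult_left_mono[of "norm (a i - l)" "e / 2" "c n i"] by (simp add: abs_mult)
    qed
    also have "\<dots> = e / 2" using assms(1)[of n] by (simp add: sum_divide_distrib[symmetric] sum_distrib_right[symmetric])
    finally show ?thesis using \<open>0 < e\<close> by simp
  qed
  then show "\<exists>N. \<forall>n\<ge>N. norm ((\<Sum>i\<in>I n. c n i * a i) - l) < e" by blast
qed

section \<open>The linearised time stepping scheme\<close>

text \<open>\<open>\<Gamma>\<close> stands for the graph of the weak gradient with Neumann conditions, \<open>\<gamma>\<close> for the map from the enthalpy
  increment to the temperature, and \<open>G\<^sub>0\<close> for the gradient of the initial temperature.\<close>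

locale enthalpy_scheme =
  fixes \<Gamma> :: "('h::{real_inner, complete_space} \<times> 'k::{real_inner, complete_space}) set"
    and F :: 'k and \<gamma> :: "'h \<Rightarrow> 'h" and G\<^sub>0 :: 'k
  assumes sub: "subspace \<Gamma>" and cl: "closed \<Gamma>"
    and firm: "\<And>a b. (norm (\<gamma> a - \<gamma> b))\<^sup>2 \<le> inner (\<gamma> a - \<gamma> b) (a - b)"
    and init: "(\<gamma> 0, G\<^sub>0) \<in> \<Gamma>"
begin

section \<open>The linear Neumann problem of one time step\<close>

lemma resolvent_ex:
  assumes h: "h > 0"
  shows "\<exists>x. x \<in> \<Gamma> \<and> (\<forall>(\<phi>, L)\<in>\<Gamma>. inner (fst x - u) \<phi> + h * inner (snd x + F) L = 0)"
proof -
  define f where "f x = (fst x, sqrt h *\<^sub>R snd x)" for x :: "'h \<times> 'k"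
  have lin: "linear f" unfolding f_def by (intro linearI) (auto simp: algebra_simps)
  have fV: "f ` \<Gamma> = {x. (fst x, (1 / sqrt h) *\<^sub>R snd x) \<in> \<Gamma>}"
    using h by (force simp: f_def image_iff)
  have "closed (f ` \<Gamma>)" unfolding fV
    using closed_vimage[OF cl, of "\<lambda>x. (fst x, (1 / sqrt h) *\<^sub>R snd x)"] by (simp add: vimage_def continuous_intros)
  from subspace_projection[OF linear_subspace_image[OF lin sub] this, of "(u, - (sqrt h *\<^sub>R F))"]
  obtain x where x: "x \<in> \<Gamma>" "\<And>v. v \<in> \<Gamma> \<Longrightarrow> inner ((u, - (sqrt h *\<^sub>R F)) - f x) (f v) = 0"
    by auto
  have "inner (fst x - u) \<phi> + h * inner (snd x + F) L = 0" if "(\<phi>, L) \<in> \<Gamma>" for \<phi> L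
  proof -
    have "sqrt h * sqrt h = h" using h by simp
    then have "h * inner (snd x + F) L = sqrt h * (sqrt h * inner (snd x + F) L)"
      by (metis mult.assoc)
    then show ?thesis
      using x(2)[OF that] by (simp add: f_def inner_prod_def algebra_simps)
  qed
  then show ?thesis using x(1) by (intro exI[of _ x]) auto
qed

definition resolvent :: "real \<Rightarrow> 'h \<Rightarrow> 'h \<times> 'k" where
  "resolvent h u = (SOME x. x \<in> \<Gamma> \<and> (\<forall>(\<phi>, L)\<in>\<Gamma>. inner (fst x - u) \<phi> + h * inner (snd x + F) L = 0))"

primrec z :: "real \<Rightarrow> nat \<Rightarrow> 'h" where
  "z h 0 = 0"
| "z h (Suc k) = z h k + fst (resolvent h (\<gamma> (z h k))) - \<gamma> (z h k)"

definition u :: "real \<Rightarrow> nat \<Rightarrow> 'h" where "u h k = \<gamma> (z h k)"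
definition p :: "real \<Rightarrow> nat \<Rightarrow> 'h" where "p h k = fst (resolvent h (u h k))"
definition q :: "real \<Rightarrow> nat \<Rightarrow> 'k" where "q h k = snd (resolvent h (u h k))"
definition \<delta> :: "real \<Rightarrow> nat \<Rightarrow> 'h" where "\<delta> h k = z h (Suc k) - z h k"
text \<open>The size of the initial flux, finite because the initial temperature has a gradient. The
  a priori bounds of the scheme are all expressed by it.\<close>

definition A :: real where "A = norm (G\<^sub>0 + F)"

lemma \<delta>_eq: "\<delta> h k = p h k - u h k"
  by (simp add: \<delta>_def p_def u_def)

lemma resolvent:
  assumes "h > 0"
  shows pq_mem: "(p h k, q h k) \<in> \<Gamma>"
    and pq_eq: "(\<phi>, L) \<in> \<Gamma> \<Longrightarrow> inner (\<delta> h k) \<phi> = - h * inner (q h k + F) L"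
proof -
  have "resolvent h (u h k) \<in> \<Gamma> \<and> (\<forall>(\<phi>, L)\<in>\<Gamma>. inner (fst (resolvent h (u h k)) - u h k) \<phi> + h * inner (snd (resolvent h (u h k)) + F) L = 0)"
    unfolding resolvent_def by (rule someI_ex[OF resolvent_ex[OF assms]])
  then have *: "resolvent h (u h k) \<in> \<Gamma>"
    "\<And>\<phi> L. (\<phi>, L) \<in> \<Gamma> \<Longrightarrow> inner (p h k - u h k) \<phi> + h * inner (q h k + F) L = 0"
    unfolding p_def q_def by blast+
  show "(p h k, q h k) \<in> \<Gamma>" using *(1) by (simp add: p_def q_def)
  show "inner (\<delta> h k) \<phi> = - h * inner (q h k + F) L" if "(\<phi>, L) \<in> \<Gamma>"
    using *(2)[OF that] unfolding \<delta>_eq by linarith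
qed

section \<open>Energy decay and a priori bounds\<close>

lemma A_nonneg [simp]: "0 \<le> A" by (simp add: A_def)

text \<open>The equation of step \<open>Suc k\<close> is tested with the difference of consecutive
  \<open>p\<close>, which is \<open>c + a - b\<close>. Polarisation on both sides leaves the squared
  norm of \<open>b - c\<close>. Since \<open>b\<close> is the increment of \<open>z\<close> that
  produces the increment \<open>c\<close> of the temperature, \<open>firm\<close> bounds that square
  by the square of \<open>b\<close> minus the square of \<open>c\<close>; the last term is the
  dissipation.\<close>

lemma energy_step:
  assumes h: "h > 0"
  shows "h * (norm (q h (Suc k) + F))\<^sup>2 + (norm (\<delta> h (Suc k)))\<^sup>2 + (norm (u h (Suc k) - u h k))\<^sup>2
         \<le> h * (norm (q h k + F))\<^sup>2 + (norm (\<delta> h k))\<^sup>2"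
proof -
  define a b c where "a = \<delta> h (Suc k)" and "b = \<delta> h k" and "c = u h (Suc k) - u h k"
  define Q Q' where "Q = q h (Suc k) + F" and "Q' = q h k + F"
  have dp: "p h (Suc k) - p h k = c + a - b" by (simp add: a_def b_def c_def \<delta>_eq)
  have "(p h (Suc k), q h (Suc k)) - (p h k, q h k) \<in> \<Gamma>"
    using pq_mem[OF h] subspace_diff[OF sub] by blast
  then have "(c + a - b, Q - Q') \<in> \<Gamma>" by (simp add: dp Q_def Q'_def)
  from pq_eq[OF h this, of "Suc k"] have 1: "inner a (c + a - b) = - h * inner Q (Q - Q')"
    by (simp add: a_def Q_def)
  have 1: "inner a (c + a - b) = - (h * inner Q (Q - Q'))" using 1 by simp
  have 2: "(norm c)\<^sup>2 \<le> inner c b"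
    using firm[of "z h (Suc k)" "z h k"] by (simp add: c_def b_def u_def \<delta>_def)
  have "2 * (h * inner Q (Q - Q')) = h * (norm Q)\<^sup>2 - h * (norm Q')\<^sup>2 + h * (norm (Q - Q'))\<^sup>2"
    by (simp add: power2_norm_eq_inner algebra_simps inner_commute)
  moreover have "0 \<le> h * (norm (Q - Q'))\<^sup>2" using h by simp
  moreover have "2 * inner a (c + a - b) = (norm a)\<^sup>2 - ((norm b)\<^sup>2 - 2 * inner c b + (norm c)\<^sup>2) + (norm (a - b + c))\<^sup>2"
    by (simp add: power2_norm_eq_inner algebra_simps inner_commute)
  moreover have "0 \<le> (norm (a - b + c))\<^sup>2" by simp
  ultimately have "h * (norm Q)\<^sup>2 + (norm a)\<^sup>2 + (norm c)\<^sup>2 \<le> h * (norm Q')\<^sup>2 + (norm b)\<^sup>2"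
    using 1 2 by linarith
  then show ?thesis by (simp add: a_def b_def c_def Q_def Q'_def)
qed

text \<open>Step \<open>0\<close> is tested with \<open>p h 0 - \<gamma> 0\<close>, which is
  admissible because \<open>init\<close> provides a gradient of the initial temperature.\<close>

lemma energy_init:
  assumes h: "h > 0"
  shows "h * (norm (q h 0 + F))\<^sup>2 + (norm (\<delta> h 0))\<^sup>2 \<le> h * A\<^sup>2"
proof -
  define Q Q' where "Q = q h 0 + F" and "Q' = G\<^sub>0 + F"
  have u0: "u h 0 = \<gamma> 0" by (simp add: u_def)
  have "(p h 0, q h 0) - (\<gamma> 0, G\<^sub>0) \<in> \<Gamma>"
    using pq_mem[OF h] init subspace_diff[OF sub] by blast
  then have "(\<delta> h 0, Q - Q') \<in> \<Gamma>" by (simp add: \<delta>_eq u0 Q_def Q'_def)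
  from pq_eq[OF h this, of 0] have 1: "(norm (\<delta> h 0))\<^sup>2 = - (h * inner Q (Q - Q'))"
    by (simp add: Q_def power2_norm_eq_inner)
  have "2 * (h * inner Q (Q - Q')) = h * (norm Q)\<^sup>2 - h * (norm Q')\<^sup>2 + h * (norm (Q - Q'))\<^sup>2"
    by (simp add: power2_norm_eq_inner algebra_simps inner_commute)
  moreover have "0 \<le> h * (norm (Q - Q'))\<^sup>2" using h by simp
  ultimately have "h * (norm Q)\<^sup>2 + 2 * (norm (\<delta> h 0))\<^sup>2 \<le> h * (norm Q')\<^sup>2"
    using 1 by linarith
  moreover have "0 \<le> (norm (\<delta> h 0))\<^sup>2" by simp
  ultimately show ?thesis unfolding Q_def Q'_def A_def by linarith
qed

lemma energy:
  assumes h: "h > 0"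
  shows "h * (norm (q h k + F))\<^sup>2 + (norm (\<delta> h k))\<^sup>2 + (\<Sum>i<k. (norm (u h (Suc i) - u h i))\<^sup>2) \<le> h * A\<^sup>2"
proof (induction k)
  case 0
  then show ?case using energy_init[OF h] by simp
next
  case (Suc k)
  then show ?case using energy_step[OF h, of k] by simp
qed

text \<open>After division by \<open>h\<close> this bounds the discrete time derivative of the
  temperature in L2 of space-time, uniformly in the step size and in the number of steps.\<close>

lemma dissipation:
  assumes h: "h > 0"
  shows "(\<Sum>i<k. (norm (u h (Suc i) - u h i))\<^sup>2) \<le> h * A\<^sup>2"
proof -
  have "0 \<le> h * (norm (q h k + F))\<^sup>2" "0 \<le> (norm (\<delta> h k))\<^sup>2" using h by simp_all
  then show ?thesis using energy[OF h, of k] by linarith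
qed

lemma q_bound:
  assumes h: "h > 0"
  shows "norm (q h k + F) \<le> A"
proof -
  have "0 \<le> (\<Sum>i<k. (norm (u h (Suc i) - u h i))\<^sup>2)" by (intro sum_nonneg) auto
  then have "h * (norm (q h k + F))\<^sup>2 \<le> h * A\<^sup>2"
    using energy[OF h, of k] zero_le_power2[of "norm (\<delta> h k)"] by linarith
  then have "(norm (q h k + F))\<^sup>2 \<le> A\<^sup>2" using h by simp
  then show ?thesis by (rule power2_le_imp_le) simp
qed

text \<open>By \<open>\<delta>_eq\<close> this is also the gap between \<open>p\<close>, which has a
  gradient, and the temperature \<open>u\<close>, which need not have one; both therefore share
  their limit.\<close>

lemma \<delta>_bound:
  assumes h: "h > 0"
  shows "norm (\<delta> h k) \<le> A * sqrt h"
proof -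
  have "0 \<le> (\<Sum>i<k. (norm (u h (Suc i) - u h i))\<^sup>2)" by (intro sum_nonneg) auto
  moreover have "0 \<le> h * (norm (q h k + F))\<^sup>2" using h by simp
  ultimately have "(norm (\<delta> h k))\<^sup>2 \<le> h * A\<^sup>2"
    using energy[OF h, of k] by linarith
  also have "\<dots> = (A * sqrt h)\<^sup>2" using h by (simp add: power_mult_distrib)
  finally show ?thesis by (rule power2_le_imp_le) (use h in simp)
qed

lemma norm_sum_squared_le:
  fixes f :: "nat \<Rightarrow> 'x::real_normed_vector"
  shows "(norm (\<Sum>i\<in>I. f i))\<^sup>2 \<le> real (card I) * (\<Sum>i\<in>I. (norm (f i))\<^sup>2)"
proof -
  have "(norm (\<Sum>i\<in>I. f i))\<^sup>2 \<le> (\<Sum>i\<in>I. norm (f i))\<^sup>2"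
    by (intro power_mono norm_sum) auto
  also have "\<dots> \<le> real (card I) * (\<Sum>i\<in>I. (norm (f i))\<^sup>2)"
    using sum_squared_le_sum_of_squares[of "\<lambda>i. norm (f i)" I] by (simp add: mult.commute)
  finally show ?thesis .
qed

lemma u_increment_le:
  assumes "k \<le> l"
  shows "(norm (u h l - u h k))\<^sup>2 \<le> real (l - k) * (\<Sum>i=k..<l. (norm (u h (Suc i) - u h i))\<^sup>2)"
  using norm_sum_squared_le[of "\<lambda>i. u h (Suc i) - u h i" "{k..<l}"] sum_Suc_diff'[OF assms, of "u h"]
  by simp

text \<open>Cauchy-Schwarz over the steps between \<open>k\<close> and \<open>l\<close>: a bound on
  the time derivative in L2 gives Hoelder continuity of order 1/2.\<close>

lemma u_hoelder:
  assumes h: "h > 0" and "k \<le> l"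
  shows "(norm (u h l - u h k))\<^sup>2 \<le> A\<^sup>2 * (h * real (l - k))"
proof -
  have "(\<Sum>i=k..<l. (norm (u h (Suc i) - u h i))\<^sup>2) \<le> (\<Sum>i<l. (norm (u h (Suc i) - u h i))\<^sup>2)"
    by (intro sum_mono2) auto
  also have "\<dots> \<le> h * A\<^sup>2" by (rule dissipation[OF h])
  finally have "real (l - k) * (\<Sum>i=k..<l. (norm (u h (Suc i) - u h i))\<^sup>2) \<le> real (l - k) * (h * A\<^sup>2)"
    by (intro mult_left_mono) auto
  with u_increment_le[OF assms(2), of h] show ?thesis by (simp add: algebra_simps)
qed

text \<open>\<open>X\<close> and \<open>Y\<close> stand for the multiplication of functions and of gradients with a cutoff function
  \<open>\<kappa>\<close>, and \<open>B p\<close> for the commutator term \<open>p \<nabla>\<kappa>\<close>. The bound with \<open>N\<close> expresses that enthalpy and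
  temperature differ by a bounded function, hence locally by a bounded amount in \<open>L\<^sup>2\<close>.\<close>

definition cutoff :: "('h \<Rightarrow> 'h) \<Rightarrow> ('k \<Rightarrow> 'k) \<Rightarrow> ('h \<Rightarrow> 'k) \<Rightarrow> real \<Rightarrow> real \<Rightarrow> bool" where
  "cutoff X Y B N \<epsilon> \<longleftrightarrow>
     linear X \<and> linear Y \<and>
     (\<forall>a b. inner (X a) b = inner a (X b)) \<and>
     (\<forall>a b. inner (Y a) b = inner a (Y b)) \<and>
     (\<forall>a. norm (X a) \<le> norm a) \<and>
     (\<forall>a. norm (Y a) \<le> norm a) \<and>
     (\<forall>a. 0 \<le> inner (X a) a) \<and>
     (\<forall>a. 0 \<le> inner (Y a) a) \<and>
     (\<forall>a b. inner (X (\<gamma> a - \<gamma> b)) (\<gamma> a - \<gamma> b) \<le> inner (X (a - b)) (\<gamma> a - \<gamma> b)) \<and>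
     (\<forall>a b e. \<bar>inner (X (a - b)) e\<bar> \<le> (N + norm (\<gamma> a - \<gamma> b)) * norm e) \<and>
     (\<forall>p. norm (B p) \<le> \<epsilon> * norm p) \<and>
     (\<forall>p G. (p, G) \<in> \<Gamma> \<longrightarrow> (X p, Y G + B p) \<in> \<Gamma>)"

section \<open>Comparison of two step sizes\<close>

lemma cutoffD:
  assumes "cutoff X Y B N \<epsilon>"
  shows "linear X" "linear Y"
    "\<And>a b. inner (X a) b = inner a (X b)" "\<And>a b. inner (Y a) b = inner a (Y b)"
    "\<And>a. norm (X a) \<le> norm a" "\<And>a. norm (Y a) \<le> norm a"
    "\<And>a. 0 \<le> inner (X a) a" "\<And>a. 0 \<le> inner (Y a) a"
    "\<And>a b. inner (X (\<gamma> a - \<gamma> b)) (\<gamma> a - \<gamma> b) \<le> inner (X (a - b)) (\<gamma> a - \<gamma> b)"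
    "\<And>a b e. \<bar>inner (X (a - b)) e\<bar> \<le> (N + norm (\<gamma> a - \<gamma> b)) * norm e"
    "\<And>p. norm (B p) \<le> \<epsilon> * norm p"
    "\<And>p G. (p, G) \<in> \<Gamma> \<Longrightarrow> (X p, Y G + B p) \<in> \<Gamma>"
  using assms unfolding cutoff_def by blast+

text \<open>Inside a coarse step the coarse enthalpy is interpolated linearly, so that on the fine
  grid both enthalpies advance by \<open>h\<^sub>2\<close> times a flux. In the difference the
  source \<open>F\<close> and the common initial value cancel, and only the time integral of the
  difference of the gradients remains.\<close>

lemma two_level_identity:
  assumes h2: "h\<^sub>2 > 0" and m: "m > 0" and h1: "h\<^sub>1 = real m * h\<^sub>2" and mem: "(\<phi>, L) \<in> \<Gamma>"
  shows "inner (z h\<^sub>1 (j div m) + (real (j mod m) / real m) *\<^sub>R \<delta> h\<^sub>1 (j div m) - z h\<^sub>2 j) \<phi> =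
         - inner (\<Sum>i<j. h\<^sub>2 *\<^sub>R (q h\<^sub>1 (i div m) - q h\<^sub>2 i)) L"
proof (induction j)
  case 0
  then show ?case by simp
next
  case (Suc j)
  have h1': "h\<^sub>1 > 0" using h1 h2 m by simp
  define k where "k = j div m"
  have "z h\<^sub>1 (Suc j div m) + (real (Suc j mod m) / real m) *\<^sub>R \<delta> h\<^sub>1 (Suc j div m)
      = z h\<^sub>1 k + (real (Suc (j mod m)) / real m) *\<^sub>R \<delta> h\<^sub>1 k"
  proof (cases "Suc (j mod m) = m")
    case True
    then have "Suc j mod m = 0" "Suc j div m = Suc k" by (auto simp: mod_Suc div_Suc k_def)
    then show ?thesis using True m by (simp add: \<delta>_def del: z.simps)
  next
    case False
    then have "Suc j mod m = Suc (j mod m)" "Suc j div m = k" by (auto simp: mod_Suc div_Suc k_def)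
    then show ?thesis by (simp del: z.simps)
  qed
  moreover have "(real (Suc (j mod m)) / real m) *\<^sub>R \<delta> h\<^sub>1 k
      = (real (j mod m) / real m) *\<^sub>R \<delta> h\<^sub>1 k + (1 / real m) *\<^sub>R \<delta> h\<^sub>1 k"
    by (simp add: scaleR_add_left[symmetric] add_divide_distrib[symmetric])
  moreover have "z h\<^sub>2 (Suc j) = z h\<^sub>2 j + \<delta> h\<^sub>2 j" by (simp add: \<delta>_def)
  ultimately have "z h\<^sub>1 (Suc j div m) + (real (Suc j mod m) / real m) *\<^sub>R \<delta> h\<^sub>1 (Suc j div m) - z h\<^sub>2 (Suc j)
      = (z h\<^sub>1 k + (real (j mod m) / real m) *\<^sub>R \<delta> h\<^sub>1 k - z h\<^sub>2 j) + ((1 / real m) *\<^sub>R \<delta> h\<^sub>1 k - \<delta> h\<^sub>2 j)"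
    by (simp del: z.simps)
  moreover have "inner ((1 / real m) *\<^sub>R \<delta> h\<^sub>1 k - \<delta> h\<^sub>2 j) \<phi> = - inner (h\<^sub>2 *\<^sub>R (q h\<^sub>1 k - q h\<^sub>2 j)) L"
  proof -
    have "inner (\<delta> h\<^sub>1 k) \<phi> = - (real m * (h\<^sub>2 * inner (q h\<^sub>1 k + F) L))"
      using pq_eq[OF h1' mem, of k] h1 by simp
    then have "inner ((1 / real m) *\<^sub>R \<delta> h\<^sub>1 k) \<phi> = - (h\<^sub>2 * inner (q h\<^sub>1 k + F) L)"
      using m by simp
    then show ?thesis using pq_eq[OF h2 mem, of j]
      by (simp add: inner_diff_left inner_add_left algebra_simps)
  qed
  ultimately show ?case using Suc.IH by (simp add: k_def inner_add_left del: z.simps)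
qed

lemma u_dist_le:
  assumes h: "h > 0" and "k \<le> l" and "h * real (l - k) \<le> T"
  shows "norm (u h l - u h k) \<le> A * sqrt T"
proof -
  have T: "0 \<le> T" using assms by (smt (verit) mult_nonneg_nonneg of_nat_0_le_iff)
  have "(norm (u h l - u h k))\<^sup>2 \<le> A\<^sup>2 * T"
    using u_hoelder[OF assms(1,2)] mult_left_mono[OF assms(3), of "A\<^sup>2"] by simp
  also have "\<dots> = (A * sqrt T)\<^sup>2" using T by (simp add: power_mult_distrib)
  finally show ?thesis by (rule power2_le_imp_le) (use T in simp)
qed

text \<open>The identity is tested with \<open>X P\<close>, the cut-off difference of the two linear
  solutions. The enthalpy side dominates \<open>S j\<close> by monotonicity, up to the gap between
  \<open>P\<close> and the difference \<open>U\<close> of the temperatures and up to the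
  interpolation term \<open>r\<close>, both of order \<open>sqrt h\<^sub>1\<close>. The flux side
  telescopes to minus a nonnegative square. The commutator \<open>B P\<close> costs \<epsilon>; it
  is the only error that does not vanish with the step. \<open>M\<close> bounds \<open>P\<close>:
  twice the Hoelder bound up to time \<open>T\<close>, plus the two gaps.\<close>

lemma two_level_integral_estimate:
  assumes X: "cutoff X Y B N \<epsilon>" and eps: "0 \<le> \<epsilon>" "0 \<le> N"
    and h2: "h\<^sub>2 > 0" and m: "m > 0" and h1: "h\<^sub>1 = real m * h\<^sub>2" and h1_le: "h\<^sub>1 \<le> 1"
    and T: "real J * h\<^sub>2 \<le> T"
  defines "M \<equiv> 2 * A * sqrt T + 2 * A"
  shows "h\<^sub>2 * (\<Sum>j<J. inner (X (u h\<^sub>1 (j div m) - u h\<^sub>2 j)) (u h\<^sub>1 (j div m) - u h\<^sub>2 j))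
     \<le> T * (sqrt h\<^sub>1 * (A * (3 * A + 2 * N + 3 * M)) + \<epsilon> * (2 * A * T * M))"
proof -
  note lin = cutoffD(1,2)[OF X] and sa = cutoffD(3,4)[OF X] and nX = cutoffD(5)[OF X]
    and nY = cutoffD(6)[OF X] and posY = cutoffD(8)[OF X] and firmX = cutoffD(9)[OF X]
    and bdX = cutoffD(10)[OF X] and B = cutoffD(11)[OF X] and mem = cutoffD(12)[OF X]
  have h1': "h\<^sub>1 > 0" using h1 h2 m by simp
  have h21: "h\<^sub>2 \<le> h\<^sub>1" using h1 h2 m by simp
  have T0: "0 \<le> T" using T h2 by (smt (verit) mult_nonneg_nonneg of_nat_0_le_iff)
  have M0: "0 \<le> M" unfolding M_def using T0 by simp
  \<comment> \<open>The common size of the discretisation errors; quantities of order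
    \<open>h\<^sub>2\<close> are absorbed through
    \<open>h\<^sub>2 \<le> h\<^sub>1 = s * s \<le> s\<close>.\<close>
  define s where "s = sqrt h\<^sub>1"
  have s3: "0 < s" "s \<le> 1" "sqrt h\<^sub>2 \<le> s"
    using h1' h1_le h21 by (auto simp: s_def)
  have "h\<^sub>1 = s * s" using h1' by (simp add: s_def)
  moreover have "s * s \<le> s * 1" using s3 by (intro mult_left_mono) auto
  ultimately have "h\<^sub>2 \<le> s" using h21 by simp
  note s = s3 this
  define d where "d j = h\<^sub>2 *\<^sub>R (q h\<^sub>1 (j div m) - q h\<^sub>2 j)" for j
  \<comment> \<open>The time integral of the difference of the gradients. Its increments are the
    \<open>d j\<close>, so pairing \<open>Q j\<close> with the next difference of gradients is a
    discrete derivative of a square.\<close>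
  define Q where "Q j = (\<Sum>i<j. d i)" for j
  have nd: "norm (d j) \<le> h\<^sub>2 * (2 * A)" for j
  proof -
    have "norm (q h\<^sub>1 (j div m) - q h\<^sub>2 j)
        = norm ((q h\<^sub>1 (j div m) + F) - (q h\<^sub>2 j + F))" by simp
    also have "\<dots> \<le> 2 * A"
      using norm_triangle_ineq4[of "q h\<^sub>1 (j div m) + F" "q h\<^sub>2 j + F"]
        q_bound[OF h1', of "j div m"] q_bound[OF h2, of j] by linarith
    finally show ?thesis using h2 by (simp add: d_def)
  qed
  have nQ: "norm (Q j) \<le> 2 * A * T" if "j < J" for j
  proof -
    have "norm (Q j) \<le> (\<Sum>i<j. h\<^sub>2 * (2 * A))" unfolding Q_def by (intro sum_norm_le nd)
    also have "\<dots> = (real j * h\<^sub>2) * (2 * A)" by simp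
    also have "\<dots> \<le> T * (2 * A)"
      using that T h2 by (intro mult_right_mono order_trans[OF _ T]) (auto intro: mult_right_mono)
    finally show ?thesis by (simp add: mult.commute)
  qed
  define S where "S j = inner (X (u h\<^sub>1 (j div m) - u h\<^sub>2 j)) (u h\<^sub>1 (j div m) - u h\<^sub>2 j)" for j
  define K where "K = s * (A * (A + 2 * N + 3 * M)) + \<epsilon> * (2 * A * T * M)"
  have step: "S j \<le> K - inner (Y (Q j)) (q h\<^sub>1 (j div m) - q h\<^sub>2 j)" if j: "j < J" for j
  proof -
    define k where "k = j div m"
    define U where "U = u h\<^sub>1 k - u h\<^sub>2 j"
    define P where "P = p h\<^sub>1 k - p h\<^sub>2 j"
    define r where "r = (real (j mod m) / real m) *\<^sub>R \<delta> h\<^sub>1 k"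
    define a where "a = z h\<^sub>1 k"
    define b where "b = z h\<^sub>2 j"
    have \<delta>1: "norm (\<delta> h\<^sub>1 k) \<le> A * s" using \<delta>_bound[OF h1'] by (simp add: s_def)
    have \<delta>2: "norm (\<delta> h\<^sub>2 j) \<le> A * s"
      using \<delta>_bound[OF h2, of j] mult_left_mono[OF s(3) A_nonneg] by linarith
    have "real j * h\<^sub>2 \<le> T" using j T h2 by (smt (verit) mult_right_mono of_nat_less_iff)
    moreover have "h\<^sub>1 * real k \<le> h\<^sub>2 * real j"
    proof -
      have "m * k \<le> j" by (simp add: k_def)
      then have "real m * real k \<le> real j" by (metis of_nat_le_iff of_nat_mult)
      then show ?thesis using h2 by (simp add: h1 mult.commute mult.left_commute)
    qed
    ultimately have "norm (u h\<^sub>1 k - u h\<^sub>1 0) \<le> A * sqrt T" "norm (u h\<^sub>2 j - u h\<^sub>2 0) \<le> A * sqrt T"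
      by (intro u_dist_le h1' h2; simp add: mult.commute)+
    moreover have "U = (u h\<^sub>1 k - u h\<^sub>1 0) - (u h\<^sub>2 j - u h\<^sub>2 0)" by (simp add: U_def u_def)
    ultimately have "norm U \<le> A * sqrt T + A * sqrt T"
      using norm_triangle_le_diff[OF add_mono] by metis
    then have nU: "norm U \<le> M - 2 * A" by (simp add: M_def algebra_simps)
    have P: "P = U + (\<delta> h\<^sub>1 k - \<delta> h\<^sub>2 j)" by (simp add: P_def U_def \<delta>_eq)
    have n\<delta>: "norm (\<delta> h\<^sub>1 k - \<delta> h\<^sub>2 j) \<le> 2 * (A * s)"
      using norm_triangle_ineq4[of "\<delta> h\<^sub>1 k" "\<delta> h\<^sub>2 j"] \<delta>1 \<delta>2 by linarith
    have "A * s \<le> A" using s by (simp add: mult_left_le)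
    then have nP: "norm P \<le> M"
      unfolding P using norm_triangle_ineq[of U "\<delta> h\<^sub>1 k - \<delta> h\<^sub>2 j"] nU n\<delta> by linarith
    have nr: "norm r \<le> A * s"
    proof -
      have "real (j mod m) / real m \<le> 1" using m by (simp add: less_imp_le)
      then have "norm r \<le> 1 * norm (\<delta> h\<^sub>1 k)" unfolding r_def norm_scaleR by (intro mult_right_mono) auto
      then show ?thesis using \<delta>1 by simp
    qed
    have PG: "(P, q h\<^sub>1 k - q h\<^sub>2 j) \<in> \<Gamma>"
      using subspace_diff[OF sub pq_mem[OF h1', of k] pq_mem[OF h2, of j]] by (simp add: P_def)
    have "inner (a + r - b) (X P) = - inner (Q j) (Y (q h\<^sub>1 k - q h\<^sub>2 j) + B P)"
      using two_level_identity[OF h2 m h1 mem[OF PG], of j]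
      by (simp add: a_def b_def r_def k_def Q_def d_def)
    then have "inner (X (a - b)) P = - inner r (X P) - inner (Y (Q j)) (q h\<^sub>1 k - q h\<^sub>2 j) - inner (Q j) (B P)"
      by (simp add: sa inner_add_left inner_add_right inner_diff_left)
    moreover have "\<bar>inner r (X P)\<bar> \<le> (A * s) * M"
      by (intro order_trans[OF Cauchy_Schwarz_ineq2] mult_mono nr order_trans[OF nX nP]) (use s in auto)
    moreover have "\<bar>inner (Q j) (B P)\<bar> \<le> (2 * A * T) * (\<epsilon> * M)"
      using T0 eps by (intro order_trans[OF Cauchy_Schwarz_ineq2] mult_mono nQ[OF j] order_trans[OF B] nP mult_left_mono) auto
    moreover have "S j \<le> inner (X (a - b)) U"
      using firmX[of a b] by (simp add: S_def U_def k_def a_def b_def u_def)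
    \<comment> \<open>Monotonicity is available for \<open>U\<close>, the equation for
      \<open>P\<close>. The exchange pairs the enthalpy difference with the gaps, and this is where
      the local bound with \<open>N\<close> enters.\<close>
    moreover have "inner (X (a - b)) U = inner (X (a - b)) P - inner (X (a - b)) (\<delta> h\<^sub>1 k - \<delta> h\<^sub>2 j)"
      by (simp add: P inner_add_right)
    moreover have "\<bar>inner (X (a - b)) (\<delta> h\<^sub>1 k - \<delta> h\<^sub>2 j)\<bar> \<le> (N + M) * (2 * (A * s))"
    proof -
      have "norm U \<le> M" using nU A_nonneg by linarith
      then have "N + norm (\<gamma> a - \<gamma> b) \<le> N + M" by (simp add: U_def u_def a_def b_def)
      then show ?thesis
        using eps M0 by (intro order_trans[OF bdX] mult_mono n\<delta>) auto
    qed
    ultimately have "S j \<le> (A * s) * M + (2 * A * T) * (\<epsilon> * M) + (N + M) * (2 * (A * s))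
        - inner (Y (Q j)) (q h\<^sub>1 k - q h\<^sub>2 j)"
      by linarith
    moreover have "(A * s) * M + (2 * A * T) * (\<epsilon> * M) + (N + M) * (2 * (A * s)) \<le> K"
      using s by (simp add: K_def algebra_simps)
    ultimately show ?thesis by (simp add: k_def)
  qed
  have "h\<^sub>2 * (\<Sum>j<i. S j) \<le> real i * h\<^sub>2 * (K + 2 * A\<^sup>2 * s) - inner (Y (Q i)) (Q i) / 2" if "i \<le> J" for i
    using that
  \<comment> \<open>Discrete product rule for \<open>inner (Y (Q i)) (Q i) / 2\<close>. Its defect,
    half of \<open>inner (Y (d i)) (d i)\<close>, is of second order in \<open>h\<^sub>2\<close> and
    produces the additional \<open>2 * A\<^sup>2 * s\<close> per unit of time.\<close>
  proof (induction i)
    case 0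
    then show ?case using linear_0[OF lin(2)] by (simp add: Q_def)
  next
    case (Suc i)
    have "h\<^sub>2 * S i \<le> h\<^sub>2 * (K - inner (Y (Q i)) (q h\<^sub>1 (i div m) - q h\<^sub>2 i))"
      using step[of i] Suc.prems h2 by (intro mult_left_mono) auto
    also have "\<dots> = h\<^sub>2 * K - inner (Y (Q i)) (d i)" by (simp add: d_def right_diff_distrib)
    finally have 1: "h\<^sub>2 * S i \<le> h\<^sub>2 * K - inner (Y (Q i)) (d i)" .
    have "Q (Suc i) = Q i + d i" by (simp add: Q_def)
    then have 2: "inner (Y (Q (Suc i))) (Q (Suc i)) = inner (Y (Q i)) (Q i) + 2 * inner (Y (Q i)) (d i) + inner (Y (d i)) (d i)"
      using sa(2)[of "d i" "Q i"] by (simp add: linear_add[OF lin(2)] inner_add_left inner_add_right inner_commute)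
    have "inner (Y (d i)) (d i) \<le> (h\<^sub>2 * (2 * A)) * (h\<^sub>2 * (2 * A))"
      using h2 by (intro order_trans[OF norm_cauchy_schwarz] mult_mono nd order_trans[OF nY nd]) auto
    also have "\<dots> = 4 * (A\<^sup>2 * h\<^sub>2 * h\<^sub>2)" by (simp add: power2_eq_square)
    also have "\<dots> \<le> 4 * (A\<^sup>2 * h\<^sub>2 * s)" using s h2 by (intro mult_left_mono) auto
    finally have 3: "inner (Y (d i)) (d i) \<le> 4 * (A\<^sup>2 * h\<^sub>2 * s)" .
    have 4: "real (Suc i) * h\<^sub>2 * (K + 2 * A\<^sup>2 * s) = real i * h\<^sub>2 * (K + 2 * A\<^sup>2 * s) + h\<^sub>2 * K + 2 * (A\<^sup>2 * h\<^sub>2 * s)"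
      by (simp add: algebra_simps)
    have 5: "h\<^sub>2 * (\<Sum>j<Suc i. S j) = h\<^sub>2 * (\<Sum>j<i. S j) + h\<^sub>2 * S i" by (simp add: distrib_left)
    have "h\<^sub>2 * (\<Sum>j<i. S j) \<le> real i * h\<^sub>2 * (K + 2 * A\<^sup>2 * s) - inner (Y (Q i)) (Q i) / 2"
      using Suc by simp
    moreover have "a + b \<le> r + k + 2 * w - (y + 2 * yd + e) / 2"
      if "a \<le> r - y / 2" "b \<le> k - yd" "e \<le> 4 * w" for a b r k w y yd e :: real
      using that by argo
    ultimately show ?case unfolding 4 5 2 using 1 3 by blast
  qed
  from this[of J] have "h\<^sub>2 * (\<Sum>j<J. S j) \<le> real J * h\<^sub>2 * (K + 2 * A\<^sup>2 * s)"
    using posY[of "Q J"] by simp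
  also have "\<dots> \<le> T * (K + 2 * A\<^sup>2 * s)"
    using T0 eps M0 s by (intro mult_right_mono T) (auto simp: K_def)
  also have "K + 2 * A\<^sup>2 * s = s * (A * (3 * A + 2 * N + 3 * M)) + \<epsilon> * (2 * A * T * M)"
    by (simp add: K_def algebra_simps power2_eq_square)
  finally show ?thesis by (simp add: S_def s_def)
qed

text \<open>The parallelogram law for the semi-inner product given by \<open>X\<close>, applied to
  \<open>b\<close> and \<open>a - b\<close>.\<close>

lemma semi_inner_split:
  fixes a b :: 'h
  assumes lin: "linear X" and sa: "\<And>a b. inner (X a) b = inner a (X b)"
    and pos: "\<And>a. 0 \<le> inner (X a) a" and nX: "\<And>a. norm (X a) \<le> norm a"
  shows "inner (X a) a \<le> 2 * inner (X b) b + 2 * (norm (a - b))\<^sup>2"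
proof -
  have "inner (X a) a + inner (X (a - 2 *\<^sub>R b)) (a - 2 *\<^sub>R b)
      = 2 * inner (X b) b + 2 * inner (X (a - b)) (a - b)"
    by (simp add: linear_diff[OF lin] linear_scale[OF lin] inner_diff_left inner_diff_right algebra_simps)
  moreover have "inner (X (a - b)) (a - b) \<le> (norm (a - b))\<^sup>2"
    unfolding power2_eq_square by (intro order_trans[OF norm_cauchy_schwarz] mult_right_mono nX) simp
  ultimately show ?thesis using pos[of "a - 2 *\<^sub>R b"] by linarith
qed

text \<open>The integrated estimate is averaged over a window of \<open>L\<close> fine steps
  starting at \<open>j\<close>. Within the window the difference of the temperatures moves by at
  most \<open>2 * A * sqrt (\<tau> + h\<^sub>1)\<close>, and its squared norm, doubled by
  \<open>semi_inner_split\<close>, gives the two terms with \<open>8 * A\<^sup>2\<close>.\<close>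

lemma two_level_pointwise_estimate:
  assumes X: "cutoff X Y B N \<epsilon>" and eps: "0 \<le> \<epsilon>" "0 \<le> N"
    and h2: "h\<^sub>2 > 0" and m: "m > 0" and h1: "h\<^sub>1 = real m * h\<^sub>2" and h1_le: "h\<^sub>1 \<le> 1"
    and L: "L > 0" and T: "real (j + L) * h\<^sub>2 \<le> T"
  defines "M \<equiv> 2 * A * sqrt T + 2 * A" and "\<tau> \<equiv> real L * h\<^sub>2"
  shows "inner (X (u h\<^sub>1 (j div m) - u h\<^sub>2 j)) (u h\<^sub>1 (j div m) - u h\<^sub>2 j)
     \<le> 2 * T / \<tau> * (sqrt h\<^sub>1 * (A * (3 * A + 2 * N + 3 * M)) + \<epsilon> * (2 * A * T * M))
       + 8 * A\<^sup>2 * \<tau> + 8 * A\<^sup>2 * h\<^sub>1"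
proof -
  have h1': "h\<^sub>1 > 0" using h1 h2 m by simp
  have \<tau>: "\<tau> > 0" using L h2 by (simp add: \<tau>_def)
  note lin = cutoffD(1)[OF X] and sa = cutoffD(3)[OF X] and nX = cutoffD(5)[OF X] and pos = cutoffD(7)[OF X]
  define v where "v i = u h\<^sub>1 (i div m) - u h\<^sub>2 i" for i
  define S where "S i = inner (X (v i)) (v i)" for i
  have near: "S j \<le> 2 * S i + (8 * A\<^sup>2 * \<tau> + 8 * A\<^sup>2 * h\<^sub>1)" if i: "j \<le> i" "i < j + L" for i
  proof -
    have "real (i - j) * h\<^sub>2 \<le> \<tau>" unfolding \<tau>_def using i h2 by (intro mult_right_mono) auto
    then have 1: "norm (u h\<^sub>2 i - u h\<^sub>2 j) \<le> A * sqrt (\<tau> + h\<^sub>1)"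
      using h1' by (intro u_dist_le h2 i) (simp add: mult.commute)
    have kk: "j div m \<le> i div m" using i by (simp add: div_le_mono)
    \<comment> \<open>Over the window the coarse index may advance by up to one coarse step more
      than the length of the window allows; hence \<open>\<tau> + h\<^sub>1\<close> instead of
      \<tau>.\<close>
    have "m * (i div m) \<le> i" "j < m * (j div m) + m"
      using dividend_less_times_div[OF m, of j] by simp_all
    then have "m * (i div m) - m * (j div m) \<le> (i - j) + m" using i by linarith
    then have "m * (i div m - j div m) \<le> (i - j) + m" by (simp only: diff_mult_distrib2)
    then have "real m * real (i div m - j div m) \<le> real (i - j) + real m"
      by (metis of_nat_add of_nat_le_iff of_nat_mult)
    then have "(real m * real (i div m - j div m)) * h\<^sub>2 \<le> (real (i - j) + real m) * h\<^sub>2"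
      using h2 by (intro mult_right_mono) auto
    then have "h\<^sub>1 * real (i div m - j div m) \<le> \<tau> + h\<^sub>1"
      using \<open>real (i - j) * h\<^sub>2 \<le> \<tau>\<close> by (simp add: h1 algebra_simps)
    then have 2: "norm (u h\<^sub>1 (i div m) - u h\<^sub>1 (j div m)) \<le> A * sqrt (\<tau> + h\<^sub>1)"
      by (intro u_dist_le h1' kk)
    have "v j - v i = (u h\<^sub>2 i - u h\<^sub>2 j) - (u h\<^sub>1 (i div m) - u h\<^sub>1 (j div m))" by (simp add: v_def)
    then have "norm (v j - v i) \<le> A * sqrt (\<tau> + h\<^sub>1) + A * sqrt (\<tau> + h\<^sub>1)"
      using norm_triangle_le_diff[OF add_mono[OF 1 2]] by simp
    then have "(norm (v j - v i))\<^sup>2 \<le> (2 * (A * sqrt (\<tau> + h\<^sub>1)))\<^sup>2" by (intro power_mono) auto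
    also have "\<dots> = 4 * A\<^sup>2 * \<tau> + 4 * A\<^sup>2 * h\<^sub>1" using \<tau> h1' by (simp add: power_mult_distrib algebra_simps)
    finally show ?thesis
      using semi_inner_split[OF lin sa pos nX, of "v j" "v i"] by (simp add: S_def)
  qed
  have "\<tau> * S j = h\<^sub>2 * (\<Sum>i=j..<j+L. S j)" by (simp add: \<tau>_def)
  also have "\<dots> \<le> h\<^sub>2 * (\<Sum>i=j..<j+L. 2 * S i + (8 * A\<^sup>2 * \<tau> + 8 * A\<^sup>2 * h\<^sub>1))"
    using h2 by (intro mult_left_mono sum_mono near) auto
  also have "\<dots> = 2 * (h\<^sub>2 * (\<Sum>i=j..<j+L. S i)) + \<tau> * (8 * A\<^sup>2 * \<tau> + 8 * A\<^sup>2 * h\<^sub>1)"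
    by (simp add: sum.distrib sum_distrib_left[symmetric] \<tau>_def distrib_left)
  also have "\<dots> \<le> 2 * (T * (sqrt h\<^sub>1 * (A * (3 * A + 2 * N + 3 * M)) + \<epsilon> * (2 * A * T * M)))
      + \<tau> * (8 * A\<^sup>2 * \<tau> + 8 * A\<^sup>2 * h\<^sub>1)"
  proof -
    have "(\<Sum>i=j..<j+L. S i) \<le> (\<Sum>i<j+L. S i)"
      using pos by (intro sum_mono2) (auto simp: S_def)
    then have "h\<^sub>2 * (\<Sum>i=j..<j+L. S i) \<le> h\<^sub>2 * (\<Sum>i<j+L. S i)" using h2 by simp
    also have "\<dots> \<le> T * (sqrt h\<^sub>1 * (A * (3 * A + 2 * N + 3 * M)) + \<epsilon> * (2 * A * T * M))"
      unfolding S_def v_def M_def by (rule two_level_integral_estimate[OF X eps h2 m h1 h1_le T])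
    finally show ?thesis by simp
  qed
  finally have "\<tau> * S j / \<tau> \<le> (2 * (T * (sqrt h\<^sub>1 * (A * (3 * A + 2 * N + 3 * M)) + \<epsilon> * (2 * A * T * M)))
      + \<tau> * (8 * A\<^sup>2 * \<tau> + 8 * A\<^sup>2 * h\<^sub>1)) / \<tau>"
    using \<tau> by (intro divide_right_mono) auto
  then show ?thesis using \<tau> by (simp add: S_def v_def add_divide_distrib)
qed

section \<open>Dyadic levels and the local Cauchy property\<close>

definition U :: "nat \<Rightarrow> real \<Rightarrow> 'h" where
  "U n t = u (1 / 2 ^ n) (nat \<lfloor>t * 2 ^ n\<rfloor>)"

text \<open>Dyadic time grids are nested: the coarse cell containing \<open>t\<close> has the index
  that the two-level estimates attach to the fine cell.\<close>

lemma floor_dyadic_div: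
  fixes t :: real
  assumes "m \<le> n" "0 \<le> t"
  shows "nat \<lfloor>t * 2 ^ n\<rfloor> div 2 ^ (n - m) = nat \<lfloor>t * 2 ^ m\<rfloor>"
proof -
  have "(2::real) ^ n = 2 ^ m * 2 ^ (n - m)" using assms by (simp add: power_add[symmetric])
  then have "t * 2 ^ n / real_of_int (2 ^ (n - m)) = t * 2 ^ m" by simp
  then have "\<lfloor>t * 2 ^ m\<rfloor> = \<lfloor>t * 2 ^ n\<rfloor> div 2 ^ (n - m)"
    using floor_divide_real_eq_div[of "2 ^ (n - m)" "t * 2 ^ n"] by simp
  then show ?thesis using assms by (simp add: nat_div_distrib nat_power_eq)
qed

text \<open>The order of the choices is the point. The window \<open>1 / 2 ^ l\<close> is fixed
  first, against the Hoelder error; it enters \<open>b\<close>, which fixes the admissible gradient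
  of the cutoff; the cutoff determines \<open>N\<close>, which enters \<open>w\<close>; the level
  comes last. Since \<open>c\<close> is given before all of them, this is not circular.\<close>

lemma locally_Cauchy:
  assumes cut: "\<And>\<epsilon>. \<epsilon> > 0 \<Longrightarrow> \<exists>X Y B N. 0 \<le> N \<and> cutoff X Y B N \<epsilon> \<and> (\<forall>x. S x \<le> c * inner (X x) x)"
    and c: "0 < c" and t: "0 \<le> t" and e: "0 < e"
  shows "\<exists>n\<^sub>0. \<forall>m\<ge>n\<^sub>0. \<forall>n\<ge>m. S (U m t - U n t) < e"
proof -
  \<comment> \<open>One unit of time beyond \<open>t\<close> leaves room for the averaging window,
    whose length is at most \<open>1\<close>.\<close>
  define T where "T = t + 1"
  define M where "M = 2 * A * sqrt T + 2 * A"
  have T: "T > 0" using t by (simp add: T_def)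
  have M: "M \<ge> 0" using T by (simp add: M_def)
  define a where "a = 8 * A\<^sup>2 + 1"
  have a: "a > 0" by (simp add: a_def add_nonneg_pos)
  have pw: "\<exists>l. c * a * (1 / 2 ^ l) < d" if "0 < d" for d
  proof -
    have "0 < d / (c * a)" using that c a by simp
    from real_arch_pow_inv[OF this, of "1/2"]
    obtain l where "(1/2::real) ^ l < d / (c * a)" by auto
    then show ?thesis using c a by (intro exI[of _ l]) (simp add: field_simps power_divide)
  qed
  obtain l where l: "c * a * (1 / 2 ^ l) < e / 4" using pw[of "e / 4"] e by auto
  define b where "b = c * (2 * T * 2 ^ l) * (2 * A * T * M) + 1"
  have b: "b > 0" using c T M by (simp add: b_def add_nonneg_pos)
  obtain X Y B N where N: "0 \<le> N" and X: "cutoff X Y B N (e / (4 * b))" and S: "\<And>x. S x \<le> c * inner (X x) x"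
    using cut[of "e / (4 * b)"] b e by auto
  define w where "w = c * (2 * T * 2 ^ l) * (A * (3 * A + 2 * N + 3 * M)) + 1"
  have w: "w > 0" using c T M N by (simp add: w_def add_nonneg_pos)
  obtain n1 where n1: "(1/2::real) ^ n1 < (e / (4 * w))\<^sup>2"
    using real_arch_pow_inv[of "(e / (4 * w))\<^sup>2" "1/2"] e w by auto
  have "S (U m t - U n t) < e" if mn: "max n1 l \<le> m" "m \<le> n" for m n
  proof -
    define h1 h2 :: real where "h1 = 1 / 2 ^ m" and "h2 = 1 / 2 ^ n"
    define j where "j = nat \<lfloor>t * 2 ^ n\<rfloor>"
    define \<epsilon> where "\<epsilon> = e / (4 * b)"
    have h: "0 < h2" "h1 \<le> 1" "0 < h1" by (auto simp: h1_def h2_def)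
    have "(2::real) ^ n = 2 ^ m * 2 ^ (n - m)" using mn by (simp add: power_add[symmetric])
    then have h12: "h1 = real (2 ^ (n - m)) * h2" by (simp add: h1_def h2_def)
    have "(2::real) ^ n = 2 ^ l * 2 ^ (n - l)" using mn by (simp add: power_add[symmetric])
    then have \<tau>: "real (2 ^ (n - l)) * h2 = 1 / 2 ^ l" by (simp add: h2_def)
    have jt: "real j * h2 \<le> t"
    proof -
      have "real j \<le> t * 2 ^ n" using t by (simp add: j_def)
      then show ?thesis by (simp add: h2_def field_simps)
    qed
    have "real (j + 2 ^ (n - l)) * h2 = real j * h2 + 1 / 2 ^ l" using \<tau> by (simp add: distrib_right)
    also have "\<dots> \<le> T" using jt by (simp add: T_def add_mono)
    finally have TT: "real (j + 2 ^ (n - l)) * h2 \<le> T" .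
    have "0 \<le> e / (4 * b)" "0 < (2::nat) ^ (n - m)" "0 < (2::nat) ^ (n - l)" using e b by simp_all
    from two_level_pointwise_estimate[OF X this(1) N h(1) this(2) h12 h(2) this(3) TT]
    have "inner (X (u h1 (j div 2 ^ (n - m)) - u h2 j)) (u h1 (j div 2 ^ (n - m)) - u h2 j)
       \<le> 2 * T / (1 / 2 ^ l) * (sqrt h1 * (A * (3 * A + 2 * N + 3 * M)) + \<epsilon> * (2 * A * T * M))
       + 8 * A\<^sup>2 * (1 / 2 ^ l) + 8 * A\<^sup>2 * h1"
      unfolding \<tau> M_def \<epsilon>_def .
    moreover have "j div 2 ^ (n - m) = nat \<lfloor>t * 2 ^ m\<rfloor>"
      unfolding j_def using mn t by (intro floor_dyadic_div) auto
    ultimately have 1: "inner (X (U m t - U n t)) (U m t - U n t)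
       \<le> 2 * T * 2 ^ l * (sqrt h1 * (A * (3 * A + 2 * N + 3 * M)) + \<epsilon> * (2 * A * T * M))
       + 8 * A\<^sup>2 * (1 / 2 ^ l) + 8 * A\<^sup>2 * h1"
      by (simp add: U_def h1_def h2_def j_def)
    have "h1 = (1/2) ^ m" by (simp add: h1_def power_divide)
    also have "\<dots> \<le> (1/2) ^ n1" using mn by (intro power_decreasing) auto
    finally have "h1 < (e / (4 * w))\<^sup>2" using n1 by linarith
    then have "sqrt h1 < e / (4 * w)" using e w by (intro real_less_lsqrt) auto
    then have i1: "w * sqrt h1 < e / 4" using w by (simp add: field_simps)
    have i2: "b * \<epsilon> = e / 4" using b by (simp add: \<epsilon>_def)
    have h1l: "h1 \<le> 1 / 2 ^ l" using mn unfolding h1_def by (intro divide_left_mono power_increasing) auto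
    have "c * (8 * A\<^sup>2) * (1 / 2 ^ l) \<le> c * a * (1 / 2 ^ l)"
      unfolding a_def using c by (intro mult_right_mono mult_left_mono) auto
    then have i3: "c * (8 * A\<^sup>2) * (1 / 2 ^ l) < e / 4" using l by linarith
    have "c * (8 * A\<^sup>2) * h1 \<le> c * (8 * A\<^sup>2) * (1 / 2 ^ l)"
      using h1l c by (intro mult_left_mono) auto
    then have i4: "c * (8 * A\<^sup>2) * h1 < e / 4" using i3 by linarith
    have \<epsilon>: "\<epsilon> > 0" using e b by (simp add: \<epsilon>_def)
    have "c * (2 * T * 2 ^ l * (sqrt h1 * (A * (3 * A + 2 * N + 3 * M)) + \<epsilon> * (2 * A * T * M))
       + 8 * A\<^sup>2 * (1 / 2 ^ l) + 8 * A\<^sup>2 * h1)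
       = (w - 1) * sqrt h1 + (b - 1) * \<epsilon> + c * (8 * A\<^sup>2) * (1 / 2 ^ l) + c * (8 * A\<^sup>2) * h1"
      by (simp add: w_def b_def algebra_simps)
    also have "\<dots> \<le> w * sqrt h1 + b * \<epsilon> + c * (8 * A\<^sup>2) * (1 / 2 ^ l) + c * (8 * A\<^sup>2) * h1"
      using h \<epsilon> real_sqrt_ge_zero[of h1] unfolding left_diff_distrib by linarith
    also have "\<dots> < e" using i1 i2 i3 i4 by linarith
    finally have "c * (2 * T * 2 ^ l * (sqrt h1 * (A * (3 * A + 2 * N + 3 * M)) + \<epsilon> * (2 * A * T * M))
       + 8 * A\<^sup>2 * (1 / 2 ^ l) + 8 * A\<^sup>2 * h1) < e" .
    then show ?thesis
      using S[of "U m t - U n t"] mult_left_mono[OF 1, of c] c by linarith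
  qed
  then show ?thesis by blast
qed

end

section \<open>The Hilbert space of square integrable functions\<close>

text \<open>Borel functions on the whole space, with functions on a domain extended by zero: one
  type then serves all domains and can be made an instance of the class of complete inner product
  spaces.\<close>

definition sqint :: "('a::euclidean_space \<Rightarrow> 'b::euclidean_space) \<Rightarrow> bool" where
  "sqint f \<longleftrightarrow> f \<in> borel_measurable borel \<and> integrable lborel (\<lambda>x. (norm (f x))\<^sup>2)"

lemma sqint_measurable [measurable_dest]: "sqint f \<Longrightarrow> f \<in> borel_measurable borel"
  by (simp add: sqint_def)

lemma sqint_integrable: "sqint f \<Longrightarrow> integrable lborel (\<lambda>x. (norm (f x))\<^sup>2)"
  by (simp add: sqint_def)

lemma sqint_bound:
  assumes [measurable]: "f \<in> borel_measurable borel" and g: "integrable lborel g"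
    and le: "AE x in lborel. (norm (f x))\<^sup>2 \<le> g x"
  shows "sqint f"
  unfolding sqint_def
proof
  show "integrable lborel (\<lambda>x. (norm (f x))\<^sup>2)"
    by (rule Bochner_Integration.integrable_bound[OF g]) (use le in \<open>auto elim!: AE_mp\<close>)
qed simp

lemma sqint_0 [simp]: "sqint (\<lambda>x. 0)"
  by (simp add: sqint_def)

lemma sqint_add:
  assumes "sqint f" "sqint g"
  shows "sqint (\<lambda>x. f x + g x)"
proof (rule sqint_bound)
  show "integrable lborel (\<lambda>x. 2 * (norm (f x))\<^sup>2 + 2 * (norm (g x))\<^sup>2)"
    using assms by (intro Bochner_Integration.integrable_add integrable_mult_right sqint_integrable)
  have "(norm (a + b))\<^sup>2 \<le> 2 * (norm a)\<^sup>2 + 2 * (norm b)\<^sup>2" for a b :: 'b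
  proof -
    have "(norm (a + b))\<^sup>2 + (norm (a - b))\<^sup>2 = 2 * (norm a)\<^sup>2 + 2 * (norm b)\<^sup>2"
      by (simp add: power2_norm_eq_inner algebra_simps inner_commute)
    moreover have "0 \<le> (norm (a - b))\<^sup>2" by simp
    ultimately show ?thesis by linarith
  qed
  then show "AE x in lborel. (norm (f x + g x))\<^sup>2 \<le> 2 * (norm (f x))\<^sup>2 + 2 * (norm (g x))\<^sup>2" by simp
qed (use assms in measurable)

lemma sqint_scaleR: "sqint f \<Longrightarrow> sqint (\<lambda>x. c *\<^sub>R f x)"
  by (auto simp: sqint_def power_mult_distrib)

lemma sqint_uminus: "sqint f \<Longrightarrow> sqint (\<lambda>x. - f x)"
  by (simp add: sqint_def)

lemma sqint_diff: "sqint f \<Longrightarrow> sqint g \<Longrightarrow> sqint (\<lambda>x. f x - g x)"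
  using sqint_add[of f "\<lambda>x. - g x"] sqint_uminus[of g] by simp

lemma sqint_inner_integrable:
  assumes "sqint f" "sqint g"
  shows "integrable lborel (\<lambda>x. f x \<bullet> g x)"
proof (rule Bochner_Integration.integrable_bound)
  show "integrable lborel (\<lambda>x. (norm (f x))\<^sup>2 + (norm (g x))\<^sup>2)"
    using assms by (intro Bochner_Integration.integrable_add sqint_integrable)
  have "\<bar>a \<bullet> b\<bar> \<le> (norm a)\<^sup>2 + (norm b)\<^sup>2" for a b :: 'b
  proof -
    have "\<bar>a \<bullet> b\<bar> \<le> norm a * norm b" by (rule Cauchy_Schwarz_ineq2)
    moreover have "0 \<le> (norm a - norm b)\<^sup>2" "0 \<le> (norm a)\<^sup>2" "0 \<le> (norm b)\<^sup>2" by simp_all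
    ultimately show ?thesis unfolding power2_diff by linarith
  qed
  then show "AE x in lborel. norm (f x \<bullet> g x) \<le> norm ((norm (f x))\<^sup>2 + (norm (g x))\<^sup>2)" by simp
qed (use assms in measurable)

definition L2_rel :: "('a::euclidean_space \<Rightarrow> 'b::euclidean_space) \<Rightarrow> ('a \<Rightarrow> 'b) \<Rightarrow> bool" where
  "L2_rel f g \<longleftrightarrow> sqint f \<and> sqint g \<and> (AE x in lborel. f x = g x)"

quotient_type (overloaded) ('a, 'b) L2 = "'a::euclidean_space \<Rightarrow> 'b::euclidean_space" / partial: L2_rel
proof (rule part_equivpI)
  show "\<exists>f::'a \<Rightarrow> 'b. L2_rel f f" by (rule exI[of _ "\<lambda>x. 0"]) (simp add: L2_rel_def)
  show "symp (L2_rel :: ('a \<Rightarrow> 'b) \<Rightarrow> _)" by (auto simp: symp_def L2_rel_def elim!: AE_mp)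
  show "transp (L2_rel :: ('a \<Rightarrow> 'b) \<Rightarrow> _)"
    by (auto simp: transp_def L2_rel_def elim!: AE_mp)
qed

instantiation L2 :: (euclidean_space, euclidean_space) real_vector
begin

lift_definition zero_L2 :: "('a, 'b) L2" is "\<lambda>x. 0" by (simp add: L2_rel_def)
lift_definition plus_L2 :: "('a, 'b) L2 \<Rightarrow> ('a, 'b) L2 \<Rightarrow> ('a, 'b) L2" is "\<lambda>f g x. f x + g x"
  by (auto simp: L2_rel_def sqint_add elim!: AE_mp)
lift_definition minus_L2 :: "('a, 'b) L2 \<Rightarrow> ('a, 'b) L2 \<Rightarrow> ('a, 'b) L2" is "\<lambda>f g x. f x - g x"
  by (auto simp: L2_rel_def sqint_diff elim!: AE_mp)
lift_definition uminus_L2 :: "('a, 'b) L2 \<Rightarrow> ('a, 'b) L2" is "\<lambda>f x. - f x"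
  by (auto simp: L2_rel_def sqint_uminus elim!: AE_mp)
lift_definition scaleR_L2 :: "real \<Rightarrow> ('a, 'b) L2 \<Rightarrow> ('a, 'b) L2" is "\<lambda>c f x. c *\<^sub>R f x"
  by (auto simp: L2_rel_def sqint_scaleR elim!: AE_mp)
instance
proof
  fix a b c :: "('a, 'b) L2" and r s :: real
  show "a + b + c = a + (b + c)" by transfer (auto simp: L2_rel_def sqint_add add.assoc)
  show "a + b = b + a" by transfer (auto simp: L2_rel_def sqint_add add.commute)
  show "0 + a = a" by transfer (auto simp: L2_rel_def)
  show "- a + a = 0" by transfer (auto simp: L2_rel_def)
  show "a - b = a + - b" by transfer (auto simp: L2_rel_def sqint_diff sqint_add sqint_uminus)
  show "r *\<^sub>R (a + b) = r *\<^sub>R a + r *\<^sub>R b"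
    by transfer (auto simp: L2_rel_def sqint_scaleR sqint_add scaleR_add_right)
  show "(r + s) *\<^sub>R a = r *\<^sub>R a + s *\<^sub>R a"
    by transfer (auto simp: L2_rel_def sqint_scaleR sqint_add scaleR_add_left)
  show "r *\<^sub>R s *\<^sub>R a = (r * s) *\<^sub>R a" by transfer (auto simp: L2_rel_def sqint_scaleR)
  show "1 *\<^sub>R a = a" by transfer (auto simp: L2_rel_def)
qed

end

instantiation L2 :: (euclidean_space, euclidean_space) real_inner
begin

lift_definition inner_L2 :: "('a, 'b) L2 \<Rightarrow> ('a, 'b) L2 \<Rightarrow> real" is "\<lambda>f g. LINT x|lborel. f x \<bullet> g x"
  by (rule integral_cong_AE) (auto simp: L2_rel_def elim!: AE_mp dest: sqint_measurable)

definition norm_L2 :: "('a, 'b) L2 \<Rightarrow> real" where "norm_L2 f = sqrt (inner f f)"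
definition dist_L2 :: "('a, 'b) L2 \<Rightarrow> ('a, 'b) L2 \<Rightarrow> real" where "dist_L2 f g = norm (f - g)"
definition sgn_L2 :: "('a, 'b) L2 \<Rightarrow> ('a, 'b) L2" where "sgn_L2 f = f /\<^sub>R norm f"
definition uniformity_L2 :: "(('a, 'b) L2 \<times> ('a, 'b) L2) filter" where
  "uniformity_L2 = (INF e\<in>{0<..}. principal {(x, y). dist x y < e})"
definition open_L2 :: "('a, 'b) L2 set \<Rightarrow> bool" where
  "open_L2 U \<longleftrightarrow> (\<forall>x\<in>U. \<forall>\<^sub>F (x', y) in uniformity. x' = x \<longrightarrow> y \<in> U)"

instance
proof
  fix a b c :: "('a, 'b) L2" and r s :: real
  show "dist a b = norm (a - b)" by (rule dist_L2_def)
  show "sgn a = a /\<^sub>R norm a" by (rule sgn_L2_def)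
  show "uniformity = (INF e\<in>{0<..}. principal {(x, y). dist (x::('a, 'b) L2) y < e})" by (rule uniformity_L2_def)
  show "open U \<longleftrightarrow> (\<forall>x\<in>U. \<forall>\<^sub>F (x', y) in uniformity. x' = x \<longrightarrow> y \<in> U)" for U :: "('a, 'b) L2 set"
    by (rule open_L2_def)
  show "inner a b = inner b a" by transfer (simp add: inner_commute)
  show "inner (a + b) c = inner a c + inner b c"
    by transfer (auto simp: L2_rel_def inner_add_left sqint_inner_integrable)
  show "inner (r *\<^sub>R a) b = r * inner a b"
    by transfer (auto simp: L2_rel_def)
  show "0 \<le> inner a a" by transfer (auto intro: integral_nonneg_AE)
  show "inner a a = 0 \<longleftrightarrow> a = 0"
  proof (transfer, goal_cases)
    case (1 f)
    then have f: "sqint f" by (simp add: L2_rel_def)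
    have "(LINT x|lborel. f x \<bullet> f x) = 0 \<longleftrightarrow> (AE x in lborel. f x \<bullet> f x = 0)"
      using sqint_inner_integrable[OF f f] by (intro integral_nonneg_eq_0_iff_AE) auto
    then show ?case using f by (simp add: L2_rel_def)
  qed
  show "norm a = sqrt (inner a a)" by (rule norm_L2_def)
qed

end

definition toL2 :: "('a::euclidean_space \<Rightarrow> 'b::euclidean_space) \<Rightarrow> ('a, 'b) L2" where "toL2 = abs_L2"
definition ofL2 :: "('a::euclidean_space, 'b::euclidean_space) L2 \<Rightarrow> 'a \<Rightarrow> 'b" where "ofL2 = rep_L2"

lemma ofL2_rel: "L2_rel (ofL2 F) (ofL2 F)"
  using Quotient_rep_reflp[OF Quotient_L2] by (simp add: ofL2_def)

lemma sqint_ofL2 [simp, intro]: "sqint (ofL2 F)"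
  using ofL2_rel[of F] by (simp add: L2_rel_def)

lemma measurable_ofL2 [measurable]: "ofL2 F \<in> borel_measurable borel"
  using sqint_ofL2 by (rule sqint_measurable)

lemma toL2_ofL2 [simp]: "toL2 (ofL2 F) = F"
  using Quotient_abs_rep[OF Quotient_L2] by (simp add: toL2_def ofL2_def)

lemma toL2_eq_iff: "sqint f \<Longrightarrow> sqint g \<Longrightarrow> toL2 f = toL2 g \<longleftrightarrow> (AE x in lborel. f x = g x)"
  using Quotient_rel[OF Quotient_L2, of f g] by (auto simp: L2_rel_def toL2_def)

lemma ofL2_toL2: "sqint f \<Longrightarrow> AE x in lborel. ofL2 (toL2 f) x = f x"
  using toL2_eq_iff[of "ofL2 (toL2 f)" f] by simp

lemma L2_eq_iff: "F = G \<longleftrightarrow> (AE x in lborel. ofL2 F x = ofL2 G x)"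
  using toL2_eq_iff[of "ofL2 F" "ofL2 G"] by simp

lemma toL2_add: "sqint f \<Longrightarrow> sqint g \<Longrightarrow> toL2 (\<lambda>x. f x + g x) = toL2 f + toL2 g"
  unfolding toL2_def by (simp add: plus_L2.abs_eq L2_rel_def)
lemma toL2_diff: "sqint f \<Longrightarrow> sqint g \<Longrightarrow> toL2 (\<lambda>x. f x - g x) = toL2 f - toL2 g"
  unfolding toL2_def by (simp add: minus_L2.abs_eq L2_rel_def)
lemma toL2_scaleR: "sqint f \<Longrightarrow> toL2 (\<lambda>x. c *\<^sub>R f x) = c *\<^sub>R toL2 f"
  unfolding toL2_def by (simp add: scaleR_L2.abs_eq L2_rel_def)
lemma toL2_0: "toL2 (\<lambda>x. 0) = 0"
  unfolding toL2_def by (simp add: zero_L2.abs_eq L2_rel_def)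
lemma inner_toL2: "sqint f \<Longrightarrow> sqint g \<Longrightarrow> inner (toL2 f) (toL2 g) = (LINT x|lborel. f x \<bullet> g x)"
  unfolding toL2_def by (simp add: inner_L2.abs_eq L2_rel_def)
lemma inner_ofL2: "inner F G = (LINT x|lborel. ofL2 F x \<bullet> ofL2 G x)"
  using inner_toL2[of "ofL2 F" "ofL2 G"] by simp
lemma norm_toL2: "sqint f \<Longrightarrow> (norm (toL2 f))\<^sup>2 = (LINT x|lborel. (norm (f x))\<^sup>2)"
  by (simp add: power2_norm_eq_inner inner_toL2)

lemma ofL2_add: "AE x in lborel. ofL2 (F + G) x = ofL2 F x + ofL2 G x"
  using toL2_eq_iff[of "ofL2 (F + G)" "\<lambda>x. ofL2 F x + ofL2 G x"] by (simp add: toL2_add sqint_add)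
lemma ofL2_diff: "AE x in lborel. ofL2 (F - G) x = ofL2 F x - ofL2 G x"
  using toL2_eq_iff[of "ofL2 (F - G)" "\<lambda>x. ofL2 F x - ofL2 G x"] by (simp add: toL2_diff sqint_diff)
lemma ofL2_scaleR: "AE x in lborel. ofL2 (c *\<^sub>R F) x = c *\<^sub>R ofL2 F x"
  using toL2_eq_iff[of "ofL2 (c *\<^sub>R F)" "\<lambda>x. c *\<^sub>R ofL2 F x"] by (simp add: toL2_scaleR sqint_scaleR)
lemma ofL2_0: "AE x in lborel. ofL2 0 x = 0"
  using toL2_eq_iff[of "ofL2 0" "\<lambda>x. 0"] by (simp add: toL2_0)

lemma norm_L2_mono:
  assumes "sqint f" "sqint g" "AE x in lborel. norm (f x) \<le> norm (g x)"
  shows "norm (toL2 f) \<le> norm (toL2 g)"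
proof (rule power2_le_imp_le)
  show "(norm (toL2 f))\<^sup>2 \<le> (norm (toL2 g))\<^sup>2"
    unfolding norm_toL2[OF assms(1)] norm_toL2[OF assms(2)]
    by (rule integral_mono_AE) (use assms in \<open>auto simp: sqint_integrable intro: power_mono elim!: AE_mp\<close>)
qed simp

lemma fast_Cauchy_subsequence:
  fixes X :: "nat \<Rightarrow> 'x::metric_space"
  assumes "Cauchy X" and "\<And>k. 0 < e k"
  shows "\<exists>s. strict_mono s \<and> (\<forall>k. dist (X (s (Suc k))) (X (s k)) < e (k::nat))"
proof -
  have "\<forall>k. \<exists>N. \<forall>m\<ge>N. \<forall>n\<ge>N. dist (X m) (X n) < e k"
    using assms by (auto simp: Cauchy_def)
  then obtain N where N: "\<And>k m n. m \<ge> N k \<Longrightarrow> n \<ge> N k \<Longrightarrow> dist (X m) (X n) < e k" by metis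
  \<comment> \<open>The partial sum makes \<open>s\<close> dominate every earlier threshold, and the
    summand \<open>k\<close> makes it strictly increasing.\<close>
  define s where "s k = k + (\<Sum>i\<le>k. N i)" for k
  have "strict_mono s" unfolding strict_mono_Suc_iff by (auto simp: s_def)
  moreover have "N k \<le> s k" "N k \<le> s (Suc k)" for k
  proof -
    have "N k \<le> (\<Sum>i\<le>k. N i)" by (rule member_le_sum) auto
    then show "N k \<le> s k" "N k \<le> s (Suc k)" by (simp_all add: s_def)
  qed
  ultimately show ?thesis using N by (intro exI[of _ s]) auto
qed

text \<open>A sequence whose increments decay fast in norm converges almost everywhere, since the series
  of the weighted squares of its increments is integrable.\<close>

lemma fast_L2_AE_Cauchy:
  fixes f :: "nat \<Rightarrow> 'a::euclidean_space \<Rightarrow> 'b::euclidean_space"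
  assumes sq: "\<And>k. sqint (f k)"
    and fast: "\<And>k. (LINT x|lborel. (norm (f (Suc k) x - f k x))\<^sup>2) \<le> (1/8) ^ k"
  shows "AE x in lborel. Cauchy (\<lambda>k. f k x)"
proof -
  have [measurable]: "f k \<in> borel_measurable borel" for k using sq by (rule sqint_measurable)
  \<comment> \<open>The weight \<open>4 ^ k\<close> still leaves a series of integrals dominated by
    \<open>(1/2) ^ k\<close>, while at points where the series of the \<open>w k\<close> is finite
    it forces the increments themselves below a multiple of \<open>(1/2) ^ k\<close>.\<close>
  define w where "w k x = 4 ^ k * (norm (f (Suc k) x - f k x))\<^sup>2" for k x
  have [measurable]: "w k \<in> borel_measurable borel" for k unfolding w_def by measurable
  have int: "integrable lborel (w k)" for k
    unfolding w_def using sqint_integrable[OF sqint_diff[OF sq sq]] by auto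
  have w0: "0 \<le> w k x" for k x by (simp add: w_def)
  have "(\<integral>\<^sup>+x. ennreal (w k x) \<partial>lborel) \<le> ennreal ((1/2) ^ k)" for k
  proof -
    have "(\<integral>\<^sup>+x. ennreal (w k x) \<partial>lborel) = ennreal (LINT x|lborel. w k x)"
      by (rule nn_integral_eq_integral[OF int]) (simp add: w0)
    also have "(LINT x|lborel. w k x) \<le> 4 ^ k * (1/8) ^ k"
      unfolding w_def using fast[of k] by simp
    also have "(4::real) ^ k * (1/8) ^ k = (1/2) ^ k" by (simp add: power_mult_distrib[symmetric])
    finally show ?thesis by (simp add: ennreal_leI)
  qed
  then have "(\<integral>\<^sup>+x. (\<Sum>k. ennreal (w k x)) \<partial>lborel) \<le> (\<Sum>k. ennreal ((1/2) ^ k))"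
    by (subst nn_integral_suminf) (auto intro!: suminf_le)
  also have "\<dots> = ennreal (\<Sum>k. (1/2) ^ k)" by (intro suminf_ennreal_eq summable_sums) auto
  finally have "(\<integral>\<^sup>+x. (\<Sum>k. ennreal (w k x)) \<partial>lborel) \<noteq> \<infinity>" by (auto simp: top_unique)
  then have "AE x in lborel. (\<Sum>k. ennreal (w k x)) \<noteq> \<infinity>"
    by (intro nn_integral_noteq_infinite) auto
  then show ?thesis
  proof (rule AE_mp, intro AE_I2 impI)
    fix x assume fin: "(\<Sum>k. ennreal (w k x)) \<noteq> \<infinity>"
    define C where "C = enn2real (\<Sum>k. ennreal (w k x))"
    have wC: "w k x \<le> C" for k
    proof -
      have "ennreal (w k x) \<le> (\<Sum>k. ennreal (w k x))"
        using sum_le_suminf[OF summableI, of "{k}" "\<lambda>k. ennreal (w k x)"] by simp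
      also have "\<dots> = ennreal C" unfolding C_def using fin by (simp add: less_top)
      finally show ?thesis by (simp add: C_def)
    qed
    have le: "norm (f (Suc k) x - f k x) \<le> sqrt C * (1/2) ^ k" for k
    proof -
      have four: "(4::real) ^ k = (2 ^ k)\<^sup>2" by (simp add: power2_eq_square flip: power_mult_distrib)
      have "(2 ^ k * norm (f (Suc k) x - f k x))\<^sup>2 = w k x"
        by (simp add: w_def power_mult_distrib four[symmetric])
      then have "2 ^ k * norm (f (Suc k) x - f k x) \<le> sqrt C"
        using wC[of k] by (simp add: real_le_rsqrt)
      then show ?thesis by (simp add: field_simps power_divide)
    qed
    have "summable (\<lambda>k. f (Suc k) x - f k x)"
      by (rule summable_comparison_test'[OF _ le]) (auto intro!: summable_mult)
    then have "convergent (\<lambda>n. \<Sum>k<n. f (Suc k) x - f k x)" by (simp add: summable_iff_convergent)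
    then have "convergent (\<lambda>n. f n x - f 0 x)" using sum_lessThan_telescope[of "\<lambda>k. f k x"] by simp
    then have "convergent (\<lambda>n. (f n x - f 0 x) + f 0 x)" by (intro convergent_add convergent_const)
    then show "Cauchy (\<lambda>k. f k x)" by (simp add: convergent_Cauchy)
  qed
qed

instance L2 :: (euclidean_space, euclidean_space) complete_space
proof
  fix X :: "nat \<Rightarrow> ('a, 'b) L2"
  assume X: "Cauchy X"
  define e :: "nat \<Rightarrow> real" where "e k = sqrt ((1/8) ^ k)" for k
  obtain s where s: "strict_mono s" and fast: "\<And>k. dist (X (s (Suc k))) (X (s k)) < e k"
    using fast_Cauchy_subsequence[OF X, of e] by (auto simp: e_def)
  define f where "f k = ofL2 (X (s k))" for k
  have sq: "sqint (f k)" for k by (simp add: f_def)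
  have [measurable]: "f k \<in> borel_measurable borel" for k by (simp add: f_def)
  have dist_eq: "(LINT x|lborel. (norm (f k x - f l x))\<^sup>2) = (dist (X (s k)) (X (s l)))\<^sup>2" for k l
    using norm_toL2[OF sqint_diff[OF sq[of k] sq[of l]]] toL2_diff[OF sq[of k] sq[of l]]
    by (simp add: f_def dist_norm)
  have "AE x in lborel. Cauchy (\<lambda>k. f k x)"
  proof (rule fast_L2_AE_Cauchy[OF sq])
    fix k
    have "(dist (X (s (Suc k))) (X (s k)))\<^sup>2 \<le> (e k)\<^sup>2"
      using fast[of k] by (intro power_mono) auto
    then show "(LINT x|lborel. (norm (f (Suc k) x - f k x))\<^sup>2) \<le> (1/8) ^ k"
      by (simp add: dist_eq e_def)
  qed
  then have AE: "AE x in lborel. (\<lambda>k. f k x) \<longlonglongrightarrow> lim (\<lambda>k. f k x)"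
    by (auto simp: Cauchy_convergent_iff convergent_LIMSEQ_iff elim!: AE_mp)
  define g where "g x = lim (\<lambda>k. f k x)" for x
  have [measurable]: "g \<in> borel_measurable borel"
    unfolding g_def by (rule borel_measurable_lim_metric) measurable
  \<comment> \<open>Fatou's lemma: the distance of the almost everywhere limit \<open>g\<close> from
    \<open>f k\<close> is at most the lower limit of the distances between members of the Cauchy
    subsequence.\<close>
  have key: "\<exists>K. \<forall>k\<ge>K. (\<integral>\<^sup>+x. ennreal ((norm (g x - f k x))\<^sup>2) \<partial>lborel) \<le> ennreal (d\<^sup>2)" if "0 < d" for d
  proof -
    have "Cauchy (X \<circ> s)" using X s by (rule Cauchy_subseq_Cauchy)
    then obtain K where K: "\<And>k l. k \<ge> K \<Longrightarrow> l \<ge> K \<Longrightarrow> dist (X (s k)) (X (s l)) < d"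
      using metric_CauchyD[OF _ \<open>0 < d\<close>, of "X \<circ> s"] by (auto simp: comp_def)
    have "(\<integral>\<^sup>+x. ennreal ((norm (g x - f k x))\<^sup>2) \<partial>lborel) \<le> ennreal (d\<^sup>2)" if "k \<ge> K" for k
    proof -
      have "(\<integral>\<^sup>+x. ennreal ((norm (g x - f k x))\<^sup>2) \<partial>lborel)
          = (\<integral>\<^sup>+x. liminf (\<lambda>l. ennreal ((norm (f l x - f k x))\<^sup>2)) \<partial>lborel)"
      proof (rule nn_integral_cong_AE, rule AE_mp[OF AE], intro AE_I2 impI)
        fix x assume "(\<lambda>k. f k x) \<longlonglongrightarrow> lim (\<lambda>k. f k x)"
        then have "(\<lambda>l. ennreal ((norm (f l x - f k x))\<^sup>2)) \<longlonglongrightarrow> ennreal ((norm (g x - f k x))\<^sup>2)"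
          unfolding g_def by (intro tendsto_intros) auto
        then show "ennreal ((norm (g x - f k x))\<^sup>2) = liminf (\<lambda>l. ennreal ((norm (f l x - f k x))\<^sup>2))"
          using lim_imp_Liminf[OF sequentially_bot] by metis
      qed
      also have "\<dots> \<le> liminf (\<lambda>l. \<integral>\<^sup>+x. ennreal ((norm (f l x - f k x))\<^sup>2) \<partial>lborel)"
        by (rule nn_integral_liminf) measurable
      also have "\<dots> \<le> ennreal (d\<^sup>2)"
      proof (rule Liminf_le, simp, rule eventually_sequentiallyI[of K])
        fix l assume "l \<ge> K"
        have "(\<integral>\<^sup>+x. ennreal ((norm (f l x - f k x))\<^sup>2) \<partial>lborel) = ennreal ((dist (X (s l)) (X (s k)))\<^sup>2)"
          unfolding dist_eq[symmetric] using sqint_integrable[OF sqint_diff[OF sq sq]]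
          by (intro nn_integral_eq_integral) auto
        also have "\<dots> \<le> ennreal (d\<^sup>2)"
          using K[OF \<open>l \<ge> K\<close> \<open>k \<ge> K\<close>] by (intro ennreal_leI power_mono) auto
        finally show "(\<integral>\<^sup>+x. ennreal ((norm (f l x - f k x))\<^sup>2) \<partial>lborel) \<le> ennreal (d\<^sup>2)" .
      qed
      finally show ?thesis .
    qed
    then show ?thesis by blast
  qed
  have sqd: "sqint (\<lambda>x. g x - f k x)" if "(\<integral>\<^sup>+x. ennreal ((norm (g x - f k x))\<^sup>2) \<partial>lborel) \<le> ennreal (d\<^sup>2)" for k d
    unfolding sqint_def using that le_less_trans[OF that ennreal_less_top]
    by (auto simp: integrable_iff_bounded)
  obtain K where "\<forall>k\<ge>K. (\<integral>\<^sup>+x. ennreal ((norm (g x - f k x))\<^sup>2) \<partial>lborel) \<le> ennreal (1\<^sup>2)"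
    using key[of 1] by auto
  then have "sqint (\<lambda>x. (g x - f K x) + f K x)" by (intro sqint_add sqd[of K 1] sq) auto
  then have g: "sqint g" by simp
  have "(X \<circ> s) \<longlonglongrightarrow> toL2 g"
  proof (rule metric_LIMSEQ_I)
    fix r :: real assume "0 < r"
    then obtain K where K: "\<And>k. k \<ge> K \<Longrightarrow> (\<integral>\<^sup>+x. ennreal ((norm (g x - f k x))\<^sup>2) \<partial>lborel) \<le> ennreal ((r / 2)\<^sup>2)"
      using key[of "r / 2"] by auto
    have "dist ((X \<circ> s) k) (toL2 g) < r" if "k \<ge> K" for k
    proof -
      have "ennreal ((norm (toL2 g - X (s k)))\<^sup>2) = (\<integral>\<^sup>+x. ennreal ((norm (g x - f k x))\<^sup>2) \<partial>lborel)"
        using norm_toL2[OF sqint_diff[OF g sq[of k]]] toL2_diff[OF g sq[of k]]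
          sqint_integrable[OF sqint_diff[OF g sq[of k]]]
        by (subst nn_integral_eq_integral) (auto simp: f_def)
      also have "\<dots> \<le> ennreal ((r / 2)\<^sup>2)" using K[OF that] .
      finally have "(norm (toL2 g - X (s k)))\<^sup>2 \<le> (r / 2)\<^sup>2" by (subst (asm) ennreal_le_iff) auto
      then have "norm (toL2 g - X (s k)) \<le> r / 2" by (rule power2_le_imp_le) (use \<open>0 < r\<close> in simp)
      then show ?thesis using \<open>0 < r\<close> by (simp add: dist_norm norm_minus_commute)
    qed
    then show "\<exists>K. \<forall>k\<ge>K. dist ((X \<circ> s) k) (toL2 g) < r" by blast
  qed
  then have "X \<longlonglongrightarrow> toL2 g" by (rule Cauchy_converges_subseq[OF X s])
  then show "convergent X" by (auto simp: convergent_def)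
qed

section \<open>Multiplication by bounded functions\<close>

lemma sqint_mult:
  assumes f: "sqint f" and [measurable]: "c \<in> borel_measurable borel" and c: "\<And>x. \<bar>c x\<bar> \<le> K"
  shows "sqint (\<lambda>x. c x *\<^sub>R f x)"
proof (rule sqint_bound)
  show "integrable lborel (\<lambda>x. K\<^sup>2 * (norm (f x))\<^sup>2)"
    using sqint_integrable[OF f] by simp
  have "(norm (c x *\<^sub>R f x))\<^sup>2 \<le> K\<^sup>2 * (norm (f x))\<^sup>2" for x
  proof -
    have "\<bar>c x\<bar>\<^sup>2 \<le> K\<^sup>2" using c by (intro power_mono) auto
    then show ?thesis by (simp add: power_mult_distrib mult_right_mono)
  qed
  then show "AE x in lborel. (norm (c x *\<^sub>R f x))\<^sup>2 \<le> K\<^sup>2 * (norm (f x))\<^sup>2" by simp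
qed (use f in measurable)

definition mulL2 :: "('a::euclidean_space \<Rightarrow> real) \<Rightarrow> ('a, 'b::euclidean_space) L2 \<Rightarrow> ('a, 'b) L2" where
  "mulL2 c F = toL2 (\<lambda>x. c x *\<^sub>R ofL2 F x)"

context
  fixes c :: "'a::euclidean_space \<Rightarrow> real" and K :: real
  assumes meas [measurable]: "c \<in> borel_measurable borel" and bounded: "\<And>x. \<bar>c x\<bar> \<le> K"
begin

lemma ofL2_mulL2: "AE x in lborel. ofL2 (mulL2 c F) x = c x *\<^sub>R ofL2 F x"
  unfolding mulL2_def by (rule ofL2_toL2) (rule sqint_mult[OF sqint_ofL2 meas bounded])

lemma mulL2_toL2:
  assumes "sqint f"
  shows "mulL2 c (toL2 f) = toL2 (\<lambda>x. c x *\<^sub>R f x)"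
  unfolding mulL2_def
  by (subst toL2_eq_iff) (use ofL2_toL2[OF assms] in \<open>auto intro!: sqint_mult[OF _ meas bounded] assms elim!: AE_mp\<close>)

lemma linear_mulL2: "linear (mulL2 c :: ('a, 'b::euclidean_space) L2 \<Rightarrow> _)"
proof (rule linearI)
  fix F G :: "('a, 'b) L2" and r :: real
  show "mulL2 c (F + G) = mulL2 c F + mulL2 c G"
    unfolding mulL2_def
    by (subst toL2_add[symmetric]; (intro sqint_mult[OF _ meas bounded] sqint_ofL2)?)
       (subst toL2_eq_iff; use ofL2_add[of F G] in \<open>auto intro!: sqint_mult[OF _ meas bounded] sqint_add elim!: AE_mp simp: scaleR_add_right\<close>)
  show "mulL2 c (r *\<^sub>R F) = r *\<^sub>R mulL2 c F"
    unfolding mulL2_def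
    by (subst toL2_scaleR[symmetric]; (intro sqint_mult[OF _ meas bounded] sqint_ofL2)?)
       (subst toL2_eq_iff; use ofL2_scaleR[of r F] in \<open>auto intro!: sqint_mult[OF _ meas bounded] sqint_scaleR elim!: AE_mp simp: scaleR_left_commute simp del: scaleR_scaleR\<close>)
qed

lemma inner_mulL2: "inner (mulL2 c F) G = (LINT x|lborel. c x * (ofL2 F x \<bullet> ofL2 G x))"
  unfolding inner_ofL2
  by (rule integral_cong_AE) (use ofL2_mulL2[of F] in \<open>auto elim!: AE_mp\<close>)

lemma mulL2_self_adjoint: "inner (mulL2 c F) G = inner F (mulL2 c G)"
  using inner_mulL2[of F G] inner_mulL2[of G F] by (simp add: inner_commute)

lemma norm_mulL2_le: "norm (mulL2 c F) \<le> K * norm F"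
proof -
  have K: "0 \<le> K" using bounded[of undefined] by linarith
  have "norm (mulL2 c F) \<le> norm (toL2 (\<lambda>x. K *\<^sub>R ofL2 F x))"
    unfolding mulL2_def using K bounded
    by (intro norm_L2_mono sqint_mult[OF sqint_ofL2 meas bounded] sqint_scaleR) (auto intro!: mult_right_mono)
  also have "\<dots> = K * norm F" using K by (simp add: toL2_scaleR)
  finally show ?thesis .
qed

lemma inner_mulL2_nonneg: "(\<And>x. 0 \<le> c x) \<Longrightarrow> 0 \<le> inner (mulL2 c F) F"
  unfolding inner_mulL2 by (intro integral_nonneg_AE) auto

end

section \<open>Calculus of test functions\<close>

lemma partial_deriv_eq: "(f has_derivative f') (at x) \<Longrightarrow> partial_deriv b f x = f' b"
  unfolding partial_deriv_def using frechet_derivative_at by metis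

lemma has_derivative_frechet: "f differentiable (at x) \<Longrightarrow> (f has_derivative frechet_derivative f (at x)) (at x)"
  by (simp add: frechet_derivative_works)

lemma C_k_continuous: "C_k k f \<Longrightarrow> continuous_on UNIV f"
  by (cases k) (auto simp: continuous_on_eq_continuous_at intro: differentiable_imp_continuous_within)

lemma C_k_Suc_imp: "C_k (Suc k) f \<Longrightarrow> C_k k f"
proof (induction k arbitrary: f)
  case 0
  then have "continuous_on UNIV f" by (rule C_k_continuous)
  then show ?case by simp
qed auto

lemma partial_deriv_const: "partial_deriv b (\<lambda>x. c) = (\<lambda>x. 0)"
  by (auto simp: fun_eq_iff intro!: partial_deriv_eq[THEN trans] derivative_eq_intros)

lemma C_k_const [simp]: "C_k k (\<lambda>x. c)"
  by (induction k arbitrary: c) (auto simp: partial_deriv_const)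

lemma partial_deriv_add:
  "f differentiable (at x) \<Longrightarrow> g differentiable (at x) \<Longrightarrow>
   partial_deriv b (\<lambda>x. f x + g x) x = partial_deriv b f x + partial_deriv b g x"
  by (rule partial_deriv_eq[THEN trans, OF has_derivative_add[OF has_derivative_frechet has_derivative_frechet]])
     (auto simp: partial_deriv_def)

lemma partial_deriv_mult:
  "f differentiable (at x) \<Longrightarrow> g differentiable (at x) \<Longrightarrow>
   partial_deriv b (\<lambda>x. f x * g x) x = f x * partial_deriv b g x + partial_deriv b f x * g x"
  by (rule partial_deriv_eq[THEN trans, OF has_derivative_mult[OF has_derivative_frechet has_derivative_frechet]])
     (auto simp: partial_deriv_def)

lemma C_k_add: "C_k k f \<Longrightarrow> C_k k g \<Longrightarrow> C_k k (\<lambda>x. f x + g x)"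
proof (induction k arbitrary: f g)
  case 0
  then show ?case by (auto intro: continuous_on_add)
next
  case (Suc k)
  then have "partial_deriv b (\<lambda>x. f x + g x) = (\<lambda>x. partial_deriv b f x + partial_deriv b g x)" for b
    by (auto simp: fun_eq_iff intro!: partial_deriv_add)
  then show ?case using Suc by (auto intro!: differentiable_add)
qed

lemma C_k_mult: "C_k k f \<Longrightarrow> C_k k g \<Longrightarrow> C_k k (\<lambda>x. f x * g x)"
proof (induction k arbitrary: f g)
  case 0
  then show ?case by (auto intro: continuous_on_mult)
next
  case (Suc k)
  then have "partial_deriv b (\<lambda>x. f x * g x) = (\<lambda>x. f x * partial_deriv b g x + partial_deriv b f x * g x)" for b
    by (auto simp: fun_eq_iff intro!: partial_deriv_mult)
  moreover have "C_k k f" "C_k k g" using Suc.prems C_k_Suc_imp by blast+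
  ultimately show ?case using Suc by (auto intro!: differentiable_mult C_k_add)
qed

lemma C_k_diff: "C_k k f \<Longrightarrow> C_k k g \<Longrightarrow> C_k k (\<lambda>x. f x - g x)"
  using C_k_add[OF _ C_k_mult[OF C_k_const[of k "- 1"]], of f g] by simp

lemma C_k_prod: "finite I \<Longrightarrow> (\<And>i. i \<in> I \<Longrightarrow> C_k k (f i)) \<Longrightarrow> C_k k (\<lambda>x. \<Prod>i\<in>I. f i x)"
  by (induction I rule: finite_induct) (auto intro: C_k_mult)

lemma Cc_infinityD:
  assumes "\<phi> \<in> Cc_infinity U"
  shows "C_k k \<phi>" "compact (closure {x. \<phi> x \<noteq> 0})" "closure {x. \<phi> x \<noteq> 0} \<subseteq> U"
    "\<phi> differentiable (at x)" "continuous_on S \<phi>"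
proof -
  show 1: "C_k k \<phi>" for k using assms by (simp add: Cc_infinity_def)
  show "compact (closure {x. \<phi> x \<noteq> 0})" "closure {x. \<phi> x \<noteq> 0} \<subseteq> U" using assms by (simp_all add: Cc_infinity_def)
  show "\<phi> differentiable (at x)" using 1[of "Suc 0"] by simp
  show "continuous_on S \<phi>" using C_k_continuous[OF 1] continuous_on_subset by blast
qed

lemma Cc_infinity_support_zero: "x \<notin> closure {x. \<phi> x \<noteq> 0} \<Longrightarrow> \<phi> x = 0"
  using closure_subset[of "{x. \<phi> x \<noteq> 0}"] by auto

lemma Cc_infinityI:
  assumes "\<And>k. C_k k \<phi>" "compact K" "{x. \<phi> x \<noteq> 0} \<subseteq> K" "K \<subseteq> U"
  shows "\<phi> \<in> Cc_infinity U"
proof -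
  have "closure {x. \<phi> x \<noteq> 0} \<subseteq> K" using assms by (intro closure_minimal compact_imp_closed) auto
  moreover from this have "K \<inter> closure {x. \<phi> x \<noteq> 0} = closure {x. \<phi> x \<noteq> 0}" by blast
  then have "compact (closure {x. \<phi> x \<noteq> 0})"
    using compact_Int_closed[OF assms(2) closed_closure, of "{x. \<phi> x \<noteq> 0}"] by (simp only:)
  ultimately show ?thesis using assms by (auto simp: Cc_infinity_def)
qed

lemma Cc_infinity_mono: "\<phi> \<in> Cc_infinity U \<Longrightarrow> U \<subseteq> V \<Longrightarrow> \<phi> \<in> Cc_infinity V"
  by (auto simp: Cc_infinity_def)

lemma Cc_infinity_zero: "(\<lambda>x. 0) \<in> Cc_infinity U"
  by (auto simp: Cc_infinity_def)

lemma Cc_infinity_mult: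
  assumes "\<phi> \<in> Cc_infinity U" "\<And>k. C_k k \<kappa>"
  shows "(\<lambda>x. \<kappa> x * \<phi> x) \<in> Cc_infinity U"
  by (rule Cc_infinityI[OF _ Cc_infinityD(2)[OF assms(1)] _ Cc_infinityD(3)[OF assms(1)]])
     (use assms in \<open>auto intro!: C_k_mult Cc_infinityD(1)[OF assms(1)] simp: closure_subset[THEN subsetD]\<close>)

lemma Cc_infinity_scale: "\<phi> \<in> Cc_infinity U \<Longrightarrow> (\<lambda>x. c * \<phi> x) \<in> Cc_infinity U"
  by (rule Cc_infinity_mult) auto

lemma Cc_infinity_add:
  assumes "\<phi> \<in> Cc_infinity U" "\<psi> \<in> Cc_infinity U"
  shows "(\<lambda>x. \<phi> x + \<psi> x) \<in> Cc_infinity U"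
proof (rule Cc_infinityI)
  show "compact (closure {x. \<phi> x \<noteq> 0} \<union> closure {x. \<psi> x \<noteq> 0})"
    using assms by (intro compact_Un Cc_infinityD)
  show "{x. \<phi> x + \<psi> x \<noteq> 0} \<subseteq> closure {x. \<phi> x \<noteq> 0} \<union> closure {x. \<psi> x \<noteq> 0}"
  proof
    fix x assume "x \<in> {x. \<phi> x + \<psi> x \<noteq> 0}"
    then have "\<phi> x \<noteq> 0 \<or> \<psi> x \<noteq> 0" by auto
    then show "x \<in> closure {x. \<phi> x \<noteq> 0} \<union> closure {x. \<psi> x \<noteq> 0}"
      using Cc_infinity_support_zero[of x \<phi>] Cc_infinity_support_zero[of x \<psi>] by blast
  qed
qed (use assms in \<open>auto intro: C_k_add Cc_infinityD dest: Cc_infinityD(3)[THEN subsetD]\<close>)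

lemma partial_deriv_zero_outside:
  assumes "x \<notin> closure {x. \<phi> x \<noteq> 0}"
  shows "partial_deriv b \<phi> x = 0"
proof -
  have "((\<lambda>x. 0) has_derivative (\<lambda>x. 0)) (at x)" by simp
  then have "(\<phi> has_derivative (\<lambda>x. 0)) (at x)"
  proof (rule has_derivative_transform_within_open)
    show "open (- closure {x. \<phi> x \<noteq> 0})" by (rule open_Compl[OF closed_closure])
    show "x \<in> - closure {x. \<phi> x \<noteq> 0}" using assms by blast
    show "0 = \<phi> y" if "y \<in> - closure {x. \<phi> x \<noteq> 0}" for y
      using Cc_infinity_support_zero[of y \<phi>] that by (metis ComplD)
  qed
  then show ?thesis by (rule partial_deriv_eq)
qed

lemma Cc_infinity_partial_deriv:
  assumes "\<phi> \<in> Cc_infinity U" "b \<in> Basis"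
  shows "partial_deriv b \<phi> \<in> Cc_infinity U"
proof (rule Cc_infinityI[OF _ Cc_infinityD(2)[OF assms(1)] _ Cc_infinityD(3)[OF assms(1)]])
  show "C_k k (partial_deriv b \<phi>)" for k using Cc_infinityD(1)[OF assms(1), of "Suc k"] assms(2) by simp
  show "{x. partial_deriv b \<phi> x \<noteq> 0} \<subseteq> closure {x. \<phi> x \<noteq> 0}"
    using partial_deriv_zero_outside by force
qed

lemma Cc_infinity_bounded:
  assumes "\<phi> \<in> Cc_infinity U"
  shows "\<exists>M. \<forall>x. \<bar>\<phi> x\<bar> \<le> M"
proof -
  have "bounded (\<phi> ` closure {x. \<phi> x \<noteq> 0})"
    using assms by (intro compact_imp_bounded compact_continuous_image Cc_infinityD(5) Cc_infinityD(2))
  then obtain M where M: "\<And>x. x \<in> closure {x. \<phi> x \<noteq> 0} \<Longrightarrow> \<bar>\<phi> x\<bar> \<le> M"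
    by (auto simp: bounded_iff)
  have "\<bar>\<phi> x\<bar> \<le> max M 0" for x
    using M[of x] Cc_infinity_support_zero[of x \<phi>] by (cases "x \<in> closure {x. \<phi> x \<noteq> 0}") auto
  then show ?thesis by blast
qed

lemma Cc_infinity_measurable: "\<phi> \<in> Cc_infinity U \<Longrightarrow> \<phi> \<in> borel_measurable borel"
  by (intro borel_measurable_continuous_onI Cc_infinityD(5))

subsection \<open>Bump functions\<close>

text \<open>The division by powers of \<open>t\<close> makes the family closed under
  differentiation, up to linear combinations; smoothness then follows by induction on the order, for
  all \<open>j\<close> at once. The case \<open>j = 0\<close> is the usual flat function.\<close>

definition bump1 :: "nat \<Rightarrow> real \<Rightarrow> real" where
  "bump1 j t = (if t > 0 then exp (- 1 / t) / t ^ j else 0)"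

lemma bump1_tendsto_0: "(bump1 j \<longlongrightarrow> 0) (at 0)"
proof -
  have "((\<lambda>t. (inverse t) ^ j / exp (inverse t)) \<longlongrightarrow> (0::real)) (at_right 0)"
    by (rule filterlim_compose[OF tendsto_power_div_exp_0 filterlim_inverse_at_top_right])
  moreover have "\<forall>\<^sub>F t in at_right 0. (inverse t) ^ j / exp (inverse t) = bump1 j t"
    by (auto simp: eventually_at_filter bump1_def exp_minus field_simps power_inverse)
  ultimately have 1: "(bump1 j \<longlongrightarrow> 0) (at_right 0)" by (rule Lim_transform_eventually)
  have "\<forall>\<^sub>F t in at_left 0. 0 = bump1 j t"
    by (auto simp: eventually_at_filter bump1_def)
  then have "(bump1 j \<longlongrightarrow> 0) (at_left 0)" by (rule Lim_transform_eventually[OF tendsto_const])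
  with 1 show ?thesis by (simp add: filterlim_split_at)
qed

text \<open>At the origin the difference quotient of \<open>bump1 j\<close> is again a member of the
  family, \<open>bump1 (Suc j)\<close>, and all members tend to zero there because the exponential
  beats every power.\<close>

lemma bump1_has_derivative:
  "(bump1 j has_real_derivative bump1 (j + 2) t - real j * bump1 (Suc j) t) (at t)"
proof (cases t "0::real" rule: linorder_cases)
  case less
  have "((\<lambda>t. 0) has_real_derivative 0) (at t)" by simp
  then have "(bump1 j has_real_derivative 0) (at t)"
    by (rule has_field_derivative_transform_within_open[where S="{..<0}"]) (use less in \<open>auto simp: bump1_def\<close>)
  then show ?thesis using less by (simp add: bump1_def)
next
  case equal
  have "((\<lambda>h. (bump1 j (0 + h) - bump1 j 0) / h) \<longlongrightarrow> 0) (at 0)"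
  proof (rule Lim_transform_eventually[OF bump1_tendsto_0[of "Suc j"]])
    show "\<forall>\<^sub>F h in at 0. bump1 (Suc j) h = (bump1 j (0 + h) - bump1 j 0) / h"
      by (auto simp: eventually_at_filter bump1_def)
  qed
  then show ?thesis using equal by (simp add: DERIV_def bump1_def)
next
  case greater
  have "((\<lambda>t. exp (- 1 / t) / t ^ j) has_real_derivative bump1 (j + 2) t - real j * bump1 (Suc j) t) (at t)"
  proof -
    have p: "real j * t ^ (j - Suc 0) = real j * t ^ j / t" using greater by (cases j) auto
    have e: "((\<lambda>t. exp (- 1 / t)) has_real_derivative exp (- 1 / t) / t\<^sup>2) (at t)"
      using greater by (auto intro!: derivative_eq_intros simp: power2_eq_square)
    have q: "((\<lambda>t. t ^ j) has_real_derivative real j * t ^ j / t) (at t)"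
      using DERIV_pow[of j t] p by simp
    have t: "t ^ j \<noteq> 0" using greater by simp
    have "(exp (- 1 / t) / t\<^sup>2 * t ^ j - exp (- 1 / t) * (real j * t ^ j / t)) / (t ^ j * t ^ j)
        = exp (- 1 / t) / t\<^sup>2 / t ^ j - real j * (exp (- 1 / t) / t / t ^ j)"
      using t by (simp add: diff_divide_distrib)
    also have "\<dots> = bump1 (j + 2) t - real j * bump1 (Suc j) t"
      using greater by (simp add: bump1_def power_add power2_eq_square)
    finally show ?thesis using DERIV_divide[OF e q t] by simp
  qed
  then show ?thesis
    by (rule has_field_derivative_transform_within_open[where S="{0<..}"]) (use greater in \<open>auto simp: bump1_def\<close>)
qed

lemma C_k_bump1_affine: "C_k k (\<lambda>x. bump1 j (c * (x \<bullet> b) + d))" for b :: "'a::euclidean_space"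
proof (induction k arbitrary: j)
  case 0
  have "isCont (bump1 j) t" for t using bump1_has_derivative DERIV_isCont by blast
  then have "continuous_on UNIV (bump1 j)" by (simp add: continuous_at_imp_continuous_on)
  then show ?case by (auto intro!: continuous_on_compose2[of UNIV "bump1 j"] continuous_intros)
next
  case (Suc k)
  have D: "((\<lambda>x. bump1 j (c * (x \<bullet> b) + d)) has_derivative
      (\<lambda>h. (bump1 (j + 2) (c * (x \<bullet> b) + d) - real j * bump1 (Suc j) (c * (x \<bullet> b) + d)) * (c * (h \<bullet> b)))) (at x)" for x
    by (rule has_derivative_compose[of "\<lambda>x. c * (x \<bullet> b) + d", OF _ bump1_has_derivative[unfolded has_field_derivative_def], THEN has_derivative_eq_rhs])
       (auto intro!: derivative_eq_intros)
  have "partial_deriv e (\<lambda>x. bump1 j (c * (x \<bullet> b) + d)) =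
      (\<lambda>x. (bump1 (j + 2) (c * (x \<bullet> b) + d) - real j * bump1 (Suc j) (c * (x \<bullet> b) + d)) * (c * (e \<bullet> b)))" for e
    by (auto simp: fun_eq_iff partial_deriv_eq[OF D])
  moreover have "(\<lambda>x. bump1 j (c * (x \<bullet> b) + d)) differentiable (at x)" for x
    using D by (auto simp: differentiable_def)
  ultimately show ?case using Suc by (auto intro!: C_k_mult C_k_diff)
qed

text \<open>A smooth function that is positive exactly on the open box. Large \<open>n\<close> gives
  approximations of the indicator of the box; \<open>n = 1\<close> serves as a fixed bump.\<close>

definition box_bump :: "real \<Rightarrow> 'a::euclidean_space \<Rightarrow> 'a \<Rightarrow> 'a \<Rightarrow> real" where
  "box_bump n l r x = (\<Prod>b\<in>Basis. bump1 0 (n * (x \<bullet> b) + - (n * (l \<bullet> b))) * bump1 0 ((- n) * (x \<bullet> b) + n * (r \<bullet> b)))"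

lemma C_k_box_bump: "C_k k (box_bump n l r)"
  unfolding box_bump_def by (intro C_k_prod C_k_mult C_k_bump1_affine finite_Basis)

lemma bump1_0_le: "0 \<le> bump1 0 t" "bump1 0 t \<le> 1"
  by (auto simp: bump1_def)

lemma box_bump_nonneg: "0 \<le> box_bump n l r x"
  unfolding box_bump_def by (intro prod_nonneg) (simp add: bump1_0_le)

lemma box_bump_le_1: "box_bump n l r x \<le> 1"
  unfolding box_bump_def by (intro prod_le_1) (auto simp: bump1_0_le mult_le_one)

lemma box_bump_nonzero_iff: "n > 0 \<Longrightarrow> box_bump n l r x \<noteq> 0 \<longleftrightarrow> x \<in> box l r"
proof -
  assume n: "n > 0"
  have pos: "bump1 0 s \<noteq> 0 \<longleftrightarrow> 0 < s" for s by (simp add: bump1_def)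
  have "0 < n * a + - (n * b) \<longleftrightarrow> b < a" "0 < (- n) * a + n * b \<longleftrightarrow> a < b" for a b
    using n by simp_all
  then show ?thesis by (simp add: box_bump_def pos mem_box del: mult_minus_left)
qed

lemma box_bump_in_Cc:
  assumes "n > 0" "cbox l r \<subseteq> U"
  shows "box_bump n l r \<in> Cc_infinity U"
  by (rule Cc_infinityI[OF C_k_box_bump compact_cbox _ assms(2)])
     (use box_bump_nonzero_iff[OF assms(1), of l r] box_subset_cbox[of l r] in auto)

lemma box_bump_tendsto: "(\<lambda>n. box_bump (real (Suc n)) l r x) \<longlonglongrightarrow> indicator (box l r) x"
proof (cases "x \<in> box l r")
  case True
  have lim: "(\<lambda>n. bump1 0 (real (Suc n) * s)) \<longlonglongrightarrow> 1" if "s > 0" for s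
  proof -
    have "(\<lambda>n. exp (- (inverse (real (Suc n)) / s))) \<longlonglongrightarrow> exp (- (0 / s))"
      using that by (intro tendsto_intros LIMSEQ_inverse_real_of_nat) auto
    then show ?thesis using that by (simp add: bump1_def divide_inverse mult.commute)
  qed
  have "(\<lambda>n. box_bump (real (Suc n)) l r x) \<longlonglongrightarrow> (\<Prod>b\<in>(Basis::'a set). 1 * 1)"
    unfolding box_bump_def
  proof (intro tendsto_prod tendsto_mult)
    fix b :: 'a assume b: "b \<in> Basis"
    have e: "real (Suc n) * (x \<bullet> b) + - (real (Suc n) * (l \<bullet> b)) = real (Suc n) * (x \<bullet> b - l \<bullet> b)"
      "- real (Suc n) * (x \<bullet> b) + real (Suc n) * (r \<bullet> b) = real (Suc n) * (r \<bullet> b - x \<bullet> b)" for n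
      by (simp_all only: right_diff_distrib)
    show "(\<lambda>n. bump1 0 (real (Suc n) * (x \<bullet> b) + - (real (Suc n) * (l \<bullet> b)))) \<longlonglongrightarrow> 1"
      unfolding e by (rule lim) (use True b in \<open>simp add: mem_box\<close>)
    show "(\<lambda>n. bump1 0 (- real (Suc n) * (x \<bullet> b) + real (Suc n) * (r \<bullet> b))) \<longlonglongrightarrow> 1"
      unfolding e by (rule lim) (use True b in \<open>simp add: mem_box\<close>)
  qed
  then show ?thesis using True by simp
next
  case False
  then have "box_bump (real (Suc n)) l r x = 0" for n
    using box_bump_nonzero_iff[of "real (Suc n)" l r x] by auto
  then show ?thesis using False by simp
qed

lemma AE_box_iff_cbox: "AE x in lborel. x \<in> cbox l r \<longrightarrow> x \<in> box l (r::'a::euclidean_space)"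
proof -
  have "cbox l r - box l r \<in> null_sets lborel"
    using negligible_frontier_interval[of l r]
    by (simp add: negligible_iff_null_sets null_sets_completion_iff)
  then show ?thesis by (rule AE_not_in[THEN AE_mp]) (auto intro!: AE_I2)
qed

lemma integral_box_eq_0:
  fixes f :: "'a::euclidean_space \<Rightarrow> real"
  assumes [measurable]: "f \<in> borel_measurable borel"
    and int: "integrable lborel (\<lambda>x. indicator (cbox l r) x * f x)"
    and U: "cbox l r \<subseteq> U"
    and zero: "\<And>\<phi>. \<phi> \<in> Cc_infinity U \<Longrightarrow> (LINT x|lborel. f x * \<phi> x) = 0"
  shows "(LINT x|lborel. indicator (box l r) x * f x) = 0"
proof -
  have "(\<lambda>n. LINT x|lborel. f x * box_bump (real (Suc n)) l r x) \<longlonglongrightarrow> (LINT x|lborel. f x * indicator (box l r) x)"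
  proof (rule integral_dominated_convergence)
    show "integrable lborel (\<lambda>x. \<bar>indicator (cbox l r) x * f x\<bar>)" using int by (rule integrable_abs)
    show "AE x in lborel. norm (f x * box_bump (real (Suc n)) l r x) \<le> \<bar>indicator (cbox l r) x * f x\<bar>" for n
    proof (rule AE_I2)
      fix x :: 'a
      have "\<bar>box_bump (real (Suc n)) l r x\<bar> \<le> indicator (cbox l r) x"
        using box_bump_nonzero_iff[of "real (Suc n)" l r x] box_bump_nonneg[of "real (Suc n)" l r x]
          box_bump_le_1[of "real (Suc n)" l r x] box_subset_cbox[of l r]
        by (cases "x \<in> box l r") auto
      then have "\<bar>f x\<bar> * \<bar>box_bump (real (Suc n)) l r x\<bar> \<le> \<bar>f x\<bar> * indicator (cbox l r) x"
        by (intro mult_left_mono) auto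
      then show "norm (f x * box_bump (real (Suc n)) l r x) \<le> \<bar>indicator (cbox l r) x * f x\<bar>"
        by (simp add: abs_mult mult.commute)
    qed
    show "AE x in lborel. (\<lambda>n. f x * box_bump (real (Suc n)) l r x) \<longlonglongrightarrow> f x * indicator (box l r) x"
      by (intro AE_I2 tendsto_mult tendsto_const box_bump_tendsto)
    show "(\<lambda>x. f x * box_bump (real (Suc n)) l r x) \<in> borel_measurable lborel" for n
      using borel_measurable_continuous_onI[OF C_k_continuous[OF C_k_box_bump]] by measurable
  qed measurable
  moreover have "(LINT x|lborel. f x * box_bump (real (Suc n)) l r x) = 0" for n
    using U by (intro zero box_bump_in_Cc) auto
  ultimately show ?thesis by (simp add: LIMSEQ_const_iff mult.commute)
qed

text \<open>The fundamental lemma of the calculus of variations, localised to a closed box in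
  \<open>U\<close>. Box bumps give a vanishing integral over every subbox; open boxes form an
  intersection-stable generator of the Borel sets, so all Borel sets follow, and a density with
  vanishing integrals is zero.\<close>

lemma test_functions_determine:
  fixes f :: "'a::euclidean_space \<Rightarrow> real"
  assumes U: "open U" and f [measurable]: "f \<in> borel_measurable borel"
    and int: "\<And>K. compact K \<Longrightarrow> K \<subseteq> U \<Longrightarrow> integrable lborel (\<lambda>x. indicator K x * f x)"
    and zero: "\<And>\<phi>. \<phi> \<in> Cc_infinity U \<Longrightarrow> (LINT x|lborel. f x * \<phi> x) = 0"
  shows "AE x in lborel. x \<in> U \<longrightarrow> f x = 0"
proof -
  have box0: "AE x in lborel. x \<in> cbox l r \<longrightarrow> f x = 0" if lr: "cbox l r \<subseteq> U" for l r
  proof -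
    \<comment> \<open>Truncation makes the function globally integrable; as boxes intersect in
      boxes, its integral over a box is again an integral of \<open>f\<close> over a box inside
      \<open>U\<close>.\<close>
    define h where "h x = indicator (box l r) x * f x" for x
    have [measurable]: "h \<in> borel_measurable borel" unfolding h_def by measurable
    have h: "integrable lborel h"
      by (rule Bochner_Integration.integrable_bound[OF int[OF compact_cbox lr]])
         (use box_subset_cbox[of l r] in \<open>auto simp: h_def indicator_def\<close>)
    have set_h: "set_integrable lborel A h" if "A \<in> sets borel" for A
      unfolding set_integrable_def using h that by (intro integrable_mult_indicator) auto
    have h0: "(LINT x|lborel. h x) = 0"
      unfolding h_def by (rule integral_box_eq_0[OF f int[OF compact_cbox lr] lr zero])
    have "(LINT x:A|lborel. h x) = (LINT x:A|lborel. 0)" if A: "A \<in> sets borel" for A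
    proof -
      have A: "A \<in> sigma_sets UNIV (range (\<lambda>(a, b). box a b))" using A by (simp add: borel_eq_box)
      have "box p q \<in> range (\<lambda>(a, b). box a (b::'a))" for p q
        using rangeI[of "\<lambda>(a, b). box a (b::'a)" "(p, q)"] by simp
      then have "Int_stable (range (\<lambda>(a, b). box a (b::'a)))"
        by (auto intro!: Int_stableI simp: box_Int_box)
      moreover have "range (\<lambda>(a, b). box a (b::'a)) \<subseteq> Pow UNIV" by simp
      ultimately have "(LINT x:A|lborel. h x) = 0"
        using A
      proof (induction A rule: sigma_sets_induct_disjoint)
        case (basic A)
        then obtain a b where A: "A = box a b" by auto
        obtain c d where cd: "box a b \<inter> box l r = box c d" "cbox a b \<inter> cbox l r = cbox c d"
          using box_Int_box[of a b l r] Int_interval[of a b l r] by blast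
        have "(LINT x:A|lborel. h x) = (LINT x|lborel. indicator (box c d) x * f x)"
          unfolding set_lebesgue_integral_def A h_def cd(1)[symmetric]
          by (auto simp: indicator_inter_arith mult.assoc intro!: Bochner_Integration.integral_cong)
        also have "\<dots> = 0"
          using cd(2) lr by (intro integral_box_eq_0[OF f int _ zero] compact_cbox) auto
        finally show ?case .
      next
        case empty
        then show ?case by (simp add: set_lebesgue_integral_def)
      next
        case (compl A)
        then have [measurable]: "A \<in> sets borel" by (simp add: borel_eq_box)
        have "(LINT x:(A \<union> (UNIV - A))|lborel. h x) = (LINT x:A|lborel. h x) + (LINT x:UNIV - A|lborel. h x)"
          by (rule set_integral_Un) (auto intro!: set_h)
        moreover have "A \<union> (UNIV - A) = UNIV" by auto
        ultimately show ?case using compl h0 by (simp add: set_lebesgue_integral_def)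
      next
        case (union A)
        then have m: "A i \<in> sets borel" for i by (auto simp: borel_eq_box)
        have "(LINT x:(\<Union>i. A i)|lborel. h x) = (\<Sum>i. (LINT x:(A i)|lborel. h x))"
          using union(1) m by (intro lebesgue_integral_countable_add set_h) (auto simp: disjoint_family_on_def)
        then show ?case using union by simp
      qed
      then show ?thesis by (simp add: set_lebesgue_integral_def)
    qed
    then have "AE x in lborel. h x = 0" by (intro density_unique_real h) auto
    with AE_box_iff_cbox[of l r] show ?thesis by eventually_elim (auto simp: h_def)
  qed
  obtain \<D> where D: "countable \<D>" "\<D> \<subseteq> Pow U" "\<And>X. X \<in> \<D> \<Longrightarrow> \<exists>a b. X = cbox a b" "\<Union>\<D> = U"
    using open_countable_Union_open_cbox[OF U] by metis
  have "AE x in lborel. \<forall>X\<in>\<D>. x \<in> X \<longrightarrow> f x = 0"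
    using D(1) by (rule AE_ball_countable[THEN iffD2]) (use D(2,3) box0 in blast)
  then show ?thesis by eventually_elim (use D(4) in blast)
qed

lemma integrable_indicator_compact:
  "compact K \<Longrightarrow> integrable lborel (indicator K :: 'a::euclidean_space \<Rightarrow> real)"
  using emeasure_compact_finite[of K] by (intro integrable_real_indicator) (auto intro: borel_compact)

lemma integrable_compact_support:
  fixes f :: "'a::euclidean_space \<Rightarrow> real"
  assumes "f \<in> borel_measurable borel" "\<And>x. \<bar>f x\<bar> \<le> M" "compact K" "\<And>x. x \<notin> K \<Longrightarrow> f x = 0"
  shows "integrable lborel f"
proof (rule Bochner_Integration.integrable_bound)
  show "integrable lborel (\<lambda>x. M * indicator K x :: real)"
    by (intro integrable_mult_right integrable_indicator_compact assms(3))
  show "AE x in lborel. norm (f x) \<le> norm (M * indicator K x :: real)"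
    using assms by (auto simp: indicator_def intro: order_trans[OF _ abs_ge_self])
qed (use assms in measurable)

lemma Cc_infinity_integrable:
  assumes "\<phi> \<in> Cc_infinity U"
  shows "integrable lborel \<phi>"
proof -
  obtain M where "\<And>x. \<bar>\<phi> x\<bar> \<le> M" using Cc_infinity_bounded[OF assms] by blast
  then show ?thesis
    by (rule integrable_compact_support[OF Cc_infinity_measurable[OF assms] _ Cc_infinityD(2)[OF assms]])
       (rule Cc_infinity_support_zero)
qed

lemma integral_translation:
  fixes f :: "'a::euclidean_space \<Rightarrow> real"
  assumes "integrable lborel f"
  shows "integrable lborel (\<lambda>x. f (x + c))" "(LINT x|lborel. f (x + c)) = (LINT x|lborel. f x)"
proof -
  have "integrable (distr lborel borel ((+) c)) f" using assms by (simp add: lborel_distr_plus)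
  then show "integrable lborel (\<lambda>x. f (x + c))"
    by (subst (asm) integrable_distr_eq) (use assms in \<open>auto simp: add.commute\<close>)
  have "(LINT x|lborel. f x) = (LINT x|distr lborel borel ((+) c). f x)" by (simp add: lborel_distr_plus)
  also have "\<dots> = (LINT x|lborel. f (c + x))"
    by (rule integral_distr) (use assms in auto)
  finally show "(LINT x|lborel. f (x + c)) = (LINT x|lborel. f x)" by (simp add: add.commute)
qed

text \<open>Supplies the dominating constant for difference quotients, in space directions and, with
  \<open>b = (0, 1)\<close>, in time.\<close>

lemma directional_mean_value:
  assumes diff: "\<And>x. f differentiable (at x)" and M: "\<And>x. \<bar>partial_deriv b f x\<bar> \<le> M"
  shows "\<bar>f (x + s *\<^sub>R b) - f x\<bar> \<le> M * \<bar>s\<bar>"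
proof -
  have D: "((\<lambda>r. f (x + r *\<^sub>R b)) has_vector_derivative partial_deriv b f (x + r *\<^sub>R b)) (at r within S)" for r S
  proof -
    have "((\<lambda>r. x + r *\<^sub>R b) has_derivative (\<lambda>h. h *\<^sub>R b)) (at r within S)"
      by (auto intro!: derivative_eq_intros)
    from has_derivative_compose[OF this has_derivative_frechet[OF diff]]
    have "((\<lambda>r. f (x + r *\<^sub>R b)) has_derivative (\<lambda>h. frechet_derivative f (at (x + r *\<^sub>R b)) (h *\<^sub>R b))) (at r within S)" .
    moreover have "linear (frechet_derivative f (at (x + r *\<^sub>R b)))"
      using linear_frechet_derivative[OF diff] .
    ultimately show ?thesis
      by (simp add: has_vector_derivative_def partial_deriv_def linear_scale)
  qed
  have "norm (f (x + s *\<^sub>R b) - f (x + 0 *\<^sub>R b)) \<le> M * norm (s - 0)"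
  proof (rule differentiable_bound[of UNIV "\<lambda>r. f (x + r *\<^sub>R b)" "\<lambda>r h. h *\<^sub>R partial_deriv b f (x + r *\<^sub>R b)"])
    fix r :: real
    show "((\<lambda>r. f (x + r *\<^sub>R b)) has_derivative (\<lambda>h. h *\<^sub>R partial_deriv b f (x + r *\<^sub>R b))) (at r within UNIV)"
      using D[of r UNIV] by (simp add: has_vector_derivative_def)
    show "onorm (\<lambda>h. h *\<^sub>R partial_deriv b f (x + r *\<^sub>R b)) \<le> M"
    proof (rule onorm_le)
      fix h :: real
      show "norm (h *\<^sub>R partial_deriv b f (x + r *\<^sub>R b)) \<le> M * norm h"
        using mult_right_mono[OF M, of "\<bar>h\<bar>" "x + r *\<^sub>R b"] by (simp add: abs_mult mult.commute)
    qed
  qed auto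
  then show ?thesis by simp
qed

lemma partial_deriv_limit:
  assumes "f differentiable (at x)"
  shows "(\<lambda>n. (f (x + inverse (real (Suc n)) *\<^sub>R b) - f x) / inverse (real (Suc n))) \<longlonglongrightarrow> partial_deriv b f x"
proof -
  have "((\<lambda>r. x + r *\<^sub>R b) has_derivative (\<lambda>h. h *\<^sub>R b)) (at 0)"
    by (auto intro!: derivative_eq_intros)
  from has_derivative_compose[OF this, of f "frechet_derivative f (at x)"] has_derivative_frechet[OF assms]
  have "((\<lambda>r. f (x + r *\<^sub>R b)) has_derivative (\<lambda>h. frechet_derivative f (at x) (h *\<^sub>R b))) (at 0)" by simp
  moreover have "frechet_derivative f (at x) (h *\<^sub>R b) = partial_deriv b f x * h" for h
    using linear_scale[OF linear_frechet_derivative[OF assms], of h b] by (simp add: partial_deriv_def)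
  ultimately have "((\<lambda>r. f (x + r *\<^sub>R b)) has_real_derivative partial_deriv b f x) (at 0)"
    by (simp only: has_field_derivative_def)
  then have "((\<lambda>h. (f (x + h *\<^sub>R b) - f x) / h) \<longlongrightarrow> partial_deriv b f x) (at 0)"
    by (simp add: DERIV_def)
  then show ?thesis
    by (rule filterlim_compose)
       (use LIMSEQ_inverse_real_of_nat in \<open>auto simp: filterlim_at simp del: of_nat_Suc intro!: always_eventually\<close>)
qed

text \<open>The integrals of the difference quotients vanish by translation invariance.\<close>

lemma integral_partial_deriv_eq_0:
  assumes f: "f \<in> Cc_infinity UNIV" and b: "b \<in> Basis"
  shows "(LINT x|lborel. partial_deriv b f x) = 0"
proof -
  define s where "s n = inverse (real (Suc n))" for n
  have s: "0 < s n" "s n \<le> 1" for n by (auto simp: s_def inverse_le_1_iff)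
  define d where "d n x = (f (x + s n *\<^sub>R b) - f x) / s n" for n x
  obtain M where M: "\<And>x. \<bar>partial_deriv b f x\<bar> \<le> M"
    using Cc_infinity_bounded[OF Cc_infinity_partial_deriv[OF f b]] by blast
  have M0: "0 \<le> M" using M[of undefined] by linarith
  obtain R where R: "closure {x. f x \<noteq> 0} \<subseteq> cball 0 R"
    using compact_imp_bounded[OF Cc_infinityD(2)[OF f]] unfolding bounded_iff by (metis mem_cball_0 subsetI)
  note [measurable] = Cc_infinity_measurable[OF f] Cc_infinity_measurable[OF Cc_infinity_partial_deriv[OF f b]]
  have fi: "integrable lborel f" by (rule Cc_infinity_integrable[OF f])
  have "(\<lambda>n. LINT x|lborel. d n x) \<longlonglongrightarrow> (LINT x|lborel. partial_deriv b f x)"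
  proof (rule integral_dominated_convergence)
    \<comment> \<open>The increments \<open>s n\<close> are at most \<open>1\<close>, so all
      difference quotients vanish outside the ball of radius \<open>R + 1\<close>.\<close>
    show "integrable lborel (\<lambda>x::'a. M * indicator (cball 0 (R + 1)) x)"
      by (intro integrable_mult_right integrable_indicator_compact compact_cball)
    show "AE x in lborel. (\<lambda>n. d n x) \<longlonglongrightarrow> partial_deriv b f x"
      unfolding d_def s_def by (intro AE_I2 partial_deriv_limit Cc_infinityD(4)[OF f])
    show "AE x in lborel. norm (d n x) \<le> M * indicator (cball 0 (R + 1)) x" for n
    proof (rule AE_I2)
      fix x :: 'a
      show "norm (d n x) \<le> M * indicator (cball 0 (R + 1)) x"
      proof (cases "x \<in> cball 0 (R + 1)")
        case True
        have "\<bar>f (x + s n *\<^sub>R b) - f x\<bar> \<le> M * \<bar>s n\<bar>"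
          by (rule directional_mean_value[OF Cc_infinityD(4)[OF f] M])
        then show ?thesis using True s[of n] by (simp add: d_def divide_le_eq)
      next
        case False
        have "norm x \<le> norm (x + s n *\<^sub>R b) + norm (s n *\<^sub>R b)"
          using norm_triangle_ineq4[of "x + s n *\<^sub>R b" "s n *\<^sub>R b"] by simp
        moreover have "norm (s n *\<^sub>R b) \<le> 1" using s[of n] b by simp
        ultimately have "x + s n *\<^sub>R b \<notin> cball 0 R" "x \<notin> cball 0 R" using False by auto
        then have "f (x + s n *\<^sub>R b) = 0" "f x = 0"
          using R Cc_infinity_support_zero[of "x + s n *\<^sub>R b" f] Cc_infinity_support_zero[of x f] by blast+
        then show ?thesis using False by (simp add: d_def)
      qed
    qed
    show "d n \<in> borel_measurable lborel" for n unfolding d_def by measurable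
  qed measurable
  moreover have "(LINT x|lborel. d n x) = 0" for n
    unfolding d_def using integral_translation[OF fi] fi by simp
  ultimately show ?thesis by (simp add: LIMSEQ_const_iff)
qed

text \<open>Only \<open>g\<close> has compact support, which suffices for the product; the
  derivative of the product integrates to zero.\<close>

lemma integration_by_parts:
  assumes f: "\<And>k. C_k k f" and g: "g \<in> Cc_infinity U" and b: "b \<in> Basis"
  shows "(LINT x|lborel. f x * partial_deriv b g x) = - (LINT x|lborel. partial_deriv b f x * g x)"
proof -
  have d: "f differentiable (at x)" "g differentiable (at x)" for x
    using f[of "Suc 0"] Cc_infinityD(4)[OF g] by auto
  have "C_k k (partial_deriv b f)" for k using f[of "Suc k"] b by simp
  then have i: "integrable lborel (\<lambda>x. f x * partial_deriv b g x)" "integrable lborel (\<lambda>x. partial_deriv b f x * g x)"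
    using f g b by (auto intro!: Cc_infinity_integrable Cc_infinity_mult Cc_infinity_partial_deriv)
  have "(\<lambda>x. f x * g x) \<in> Cc_infinity UNIV"
    using Cc_infinity_mult[OF g f] by (rule Cc_infinity_mono) simp
  from integral_partial_deriv_eq_0[OF this b] show ?thesis
    using i by (simp add: partial_deriv_mult d)
qed

subsection \<open>Test functions on space-time\<close>

lemma partial_deriv_slice:
  assumes "f differentiable (at (x, t))"
  shows "partial_deriv b (\<lambda>x. f (x, t)) x = partial_deriv (b, 0) f (x, t)"
proof -
  have "((\<lambda>x. (x, t)) has_derivative (\<lambda>h. (h, 0))) (at x)" by (auto intro!: derivative_eq_intros)
  from partial_deriv_eq[OF has_derivative_compose[OF this has_derivative_frechet[OF assms]], of b]
  show ?thesis by (simp add: partial_deriv_def)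
qed

lemma has_derivative_time:
  fixes f :: "'a::euclidean_space \<times> real \<Rightarrow> real"
  assumes "f differentiable (at (x, t))"
  shows "((\<lambda>s. f (x, s)) has_real_derivative partial_deriv (0, 1) f (x, t)) (at t)"
proof -
  have "((\<lambda>s. (x, s)) has_derivative (\<lambda>h. (0, h))) (at t)" by (auto intro!: derivative_eq_intros)
  from has_derivative_compose[OF this has_derivative_frechet[OF assms]]
  have D: "((\<lambda>s. f (x, s)) has_derivative (\<lambda>h. frechet_derivative f (at (x, t)) (0, h))) (at t)" .
  have "frechet_derivative f (at (x, t)) (0, h) = partial_deriv (0, 1) f (x, t) * h" for h
    using linear_scale[OF linear_frechet_derivative[OF assms], of h "(0, 1)"] by (simp add: partial_deriv_def)
  with D show ?thesis by (simp add: has_field_derivative_def)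
qed

lemma C_k_slice:
  fixes f :: "'a::euclidean_space \<times> 'b::euclidean_space \<Rightarrow> real"
  shows "C_k k f \<Longrightarrow> C_k k (\<lambda>x. f (x, t))"
proof (induction k arbitrary: f)
  case 0
  then show ?case by (auto intro!: continuous_on_compose2[of UNIV f] continuous_intros)
next
  case (Suc k)
  then have d: "f differentiable (at z)" for z by (cases z) simp
  have "(\<lambda>x. f (x, t)) differentiable (at x)" for x
  proof -
    have "((\<lambda>x. (x, t)) has_derivative (\<lambda>h. (h, 0))) (at x)" by (auto intro!: derivative_eq_intros)
    from has_derivative_compose[OF this has_derivative_frechet[OF d]] show ?thesis
      by (auto simp: differentiable_def)
  qed
  moreover have "partial_deriv b (\<lambda>x. f (x, t)) = (\<lambda>x. partial_deriv (b, 0) f (x, t))" for b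
    using partial_deriv_slice[OF d] by auto
  moreover have "(b, 0) \<in> (Basis :: ('a \<times> 'b) set)" if "b \<in> Basis" for b using that by (simp add: Basis_prod_def)
  ultimately show ?case using Suc by simp
qed

lemma Cc_infinity_slice:
  fixes f :: "'a::euclidean_space \<times> 'b::euclidean_space \<Rightarrow> real"
  assumes f: "f \<in> Cc_infinity W" and W: "fst ` W \<subseteq> U"
  shows "(\<lambda>x. f (x, t)) \<in> Cc_infinity U"
proof (rule Cc_infinityI)
  show "C_k k (\<lambda>x. f (x, t))" for k by (intro C_k_slice Cc_infinityD(1)[OF f])
  show "compact (fst ` closure {z. f z \<noteq> 0})"
    by (intro compact_continuous_image continuous_intros Cc_infinityD(2)[OF f])
  show "{x. f (x, t) \<noteq> 0} \<subseteq> fst ` closure {z. f z \<noteq> 0}"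
    using closure_subset[of "{z. f z \<noteq> 0}"] by force
  show "fst ` closure {z. f z \<noteq> 0} \<subseteq> U" using Cc_infinityD(3)[OF f] W by blast
qed

section \<open>Restricted Lebesgue measure and Borel representatives\<close>

lemma AE_lebesgue_on_iff:
  assumes "S \<in> sets borel"
  shows "(AE x in lebesgue_on S. P x) \<longleftrightarrow> (AE x in lborel. x \<in> S \<longrightarrow> P x)"
  using assms by (simp add: AE_restrict_space_iff AE_completion_iff)

lemma lebesgue_on_borel_representative_real:
  fixes f :: "'a::euclidean_space \<Rightarrow> real"
  assumes S: "S \<in> sets borel" and f: "f \<in> borel_measurable (lebesgue_on S)"
  shows "\<exists>f'\<in>borel_measurable borel. (\<forall>x. x \<notin> S \<longrightarrow> f' x = 0) \<and> (AE x in lborel. x \<in> S \<longrightarrow> f x = f' x)"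
proof -
  have "(\<lambda>x. indicator S x *\<^sub>R f x) \<in> borel_measurable lebesgue"
    using f S by (subst (asm) borel_measurable_restrict_space_iff) auto
  then obtain g where g: "g \<in> borel_measurable lborel" "AE x in lborel. indicator S x *\<^sub>R f x = g x"
    using completion_ex_borel_measurable_real by blast
  show ?thesis
  proof (intro bexI[of _ "\<lambda>x. indicator S x * g x"] conjI)
    show "AE x in lborel. x \<in> S \<longrightarrow> f x = indicator S x * g x"
      using g(2) by eventually_elim auto
  qed (use g S in auto)
qed

lemma lebesgue_on_borel_representative:
  fixes f :: "'a::euclidean_space \<Rightarrow> 'b::euclidean_space"
  assumes S: "S \<in> sets borel" and f: "f \<in> borel_measurable (lebesgue_on S)"
  shows "\<exists>f'\<in>borel_measurable borel. (\<forall>x. x \<notin> S \<longrightarrow> f' x = 0) \<and> (AE x in lborel. x \<in> S \<longrightarrow> f x = f' x)"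
proof -
  have "(\<lambda>x. f x \<bullet> b) \<in> borel_measurable (lebesgue_on S)" for b using f by measurable
  then have "\<forall>b. \<exists>f'. f' \<in> borel_measurable borel \<and> (\<forall>x. x \<notin> S \<longrightarrow> f' x = 0) \<and> (AE x in lborel. x \<in> S \<longrightarrow> f x \<bullet> b = f' x)"
    using lebesgue_on_borel_representative_real[OF S] by blast
  then obtain g where g: "\<And>b. g b \<in> borel_measurable borel" "\<And>b x. x \<notin> S \<Longrightarrow> g b x = 0"
      "\<And>b. AE x in lborel. x \<in> S \<longrightarrow> f x \<bullet> b = g b x" by metis
  have "AE x in lborel. \<forall>b\<in>Basis. x \<in> S \<longrightarrow> f x \<bullet> b = g b x"
    using g(3) by (intro AE_finite_allI) auto
  then have "AE x in lborel. x \<in> S \<longrightarrow> f x = (\<Sum>b\<in>Basis. g b x *\<^sub>R b)"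
  proof eventually_elim
    case (elim x)
    then show ?case using euclidean_representation[of "f x"] by (metis (mono_tags, lifting) sum.cong)
  qed
  then show ?thesis
    using g(1,2) by (intro bexI[of _ "\<lambda>x. \<Sum>b\<in>Basis. g b x *\<^sub>R b"]) auto
qed

context
  fixes S :: "'a::euclidean_space set" and h h' :: "'a \<Rightarrow> 'b::euclidean_space"
  assumes S [measurable]: "S \<in> sets borel" and h' [measurable]: "h' \<in> borel_measurable borel"
    and eq: "AE x in lborel. x \<in> S \<longrightarrow> h x = h' x"
begin

lemma AE_indicator_eq: "AE x in lebesgue. indicator S x *\<^sub>R h' x = indicator S x *\<^sub>R h x"
  unfolding AE_completion_iff using eq by eventually_elim (auto simp: indicator_def)

lemma measurable_indicator_lebesgue:
  "(\<lambda>x. indicator S x *\<^sub>R h' x) \<in> borel_measurable lebesgue" "(\<lambda>x. indicator S x *\<^sub>R h x) \<in> borel_measurable lebesgue"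
proof -
  have "(\<lambda>x. indicator S x *\<^sub>R h' x) \<in> borel_measurable lborel" by measurable
  then show "(\<lambda>x. indicator S x *\<^sub>R h' x) \<in> borel_measurable lebesgue" by (rule measurable_completion)
  then show "(\<lambda>x. indicator S x *\<^sub>R h x) \<in> borel_measurable lebesgue"
    using AE_indicator_eq by (rule borel_measurable_AE)
qed

lemma measurable_lebesgue_on: "h \<in> borel_measurable (lebesgue_on S)"
  using S measurable_indicator_lebesgue(2) by (subst borel_measurable_restrict_space_iff) auto

lemma integral_lebesgue_on_eq: "(LINT x|lebesgue_on S. h x) = (LINT x|lborel. indicator S x *\<^sub>R h' x)"
proof -
  have "(LINT x|lebesgue_on S. h x) = (LINT x|lebesgue. indicator S x *\<^sub>R h x)"
    using S by (intro integral_restrict_space) auto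
  also have "\<dots> = (LINT x|lebesgue. indicator S x *\<^sub>R h' x)"
    using AE_indicator_eq measurable_indicator_lebesgue
    by (intro integral_cong_AE) (auto elim!: AE_mp)
  also have "\<dots> = (LINT x|lborel. indicator S x *\<^sub>R h' x)"
    by (rule integral_completion) measurable
  finally show ?thesis .
qed

lemma integrable_lebesgue_on_iff: "integrable (lebesgue_on S) h \<longleftrightarrow> integrable lborel (\<lambda>x. indicator S x *\<^sub>R h' x)"
proof -
  have "integrable (lebesgue_on S) h \<longleftrightarrow> integrable lebesgue (\<lambda>x. indicator S x *\<^sub>R h x)"
    using S by (intro integrable_restrict_space) auto
  also have "\<dots> \<longleftrightarrow> integrable lebesgue (\<lambda>x. indicator S x *\<^sub>R h' x)"
    using AE_indicator_eq measurable_indicator_lebesgue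
    by (intro integrable_cong_AE) (auto elim!: AE_mp)
  also have "\<dots> \<longleftrightarrow> integrable lborel (\<lambda>x. indicator S x *\<^sub>R h' x)"
    by (rule integrable_completion) measurable
  finally show ?thesis .
qed

end

lemma L2_space_iff:
  fixes h h' :: "'a::euclidean_space \<Rightarrow> 'b::euclidean_space"
  assumes S [measurable]: "S \<in> sets borel" and h' [measurable]: "h' \<in> borel_measurable borel"
    and eq: "AE x in lborel. x \<in> S \<longrightarrow> h x = h' x"
  shows "h \<in> L2_space S \<longleftrightarrow> sqint (\<lambda>x. indicator S x *\<^sub>R h' x)"
proof -
  have "integrable (lebesgue_on S) (\<lambda>x. (norm (h x))\<^sup>2) \<longleftrightarrow> integrable lborel (\<lambda>x. indicator S x *\<^sub>R (norm (h' x))\<^sup>2)"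
    by (rule integrable_lebesgue_on_iff[OF S]) (use eq in \<open>auto elim!: AE_mp\<close>)
  also have "(\<lambda>x. indicator S x *\<^sub>R (norm (h' x))\<^sup>2) = (\<lambda>x. (norm (indicator S x *\<^sub>R h' x))\<^sup>2)"
    by (auto simp: indicator_def fun_eq_iff)
  finally show ?thesis
    using measurable_lebesgue_on[OF assms] by (simp add: L2_space_def sqint_def)
qed

lemma L2_space_representative:
  fixes h :: "'a::euclidean_space \<Rightarrow> 'b::euclidean_space"
  assumes S: "S \<in> sets borel" and h: "h \<in> L2_space S"
  shows "\<exists>h'. sqint h' \<and> (\<forall>x. x \<notin> S \<longrightarrow> h' x = 0) \<and> (AE x in lborel. x \<in> S \<longrightarrow> h x = h' x)"
proof -
  have "h \<in> borel_measurable (lebesgue_on S)" using h by (simp add: L2_space_def)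
  then obtain h' where h': "h' \<in> borel_measurable borel" "\<forall>x. x \<notin> S \<longrightarrow> h' x = 0" "AE x in lborel. x \<in> S \<longrightarrow> h x = h' x"
    using lebesgue_on_borel_representative[OF S] by blast
  have "(\<lambda>x. indicator S x *\<^sub>R h' x) = h'" using h'(2) by (auto simp: indicator_def fun_eq_iff)
  then have "sqint h'" using h L2_space_iff[OF S h'(1,3)] by simp
  with h' show ?thesis by blast
qed

section \<open>Weak gradients\<close>

lemma sqint_bounded_compact_support:
  fixes f :: "'a::euclidean_space \<Rightarrow> 'b::euclidean_space"
  assumes [measurable]: "f \<in> borel_measurable borel" and "\<And>x. norm (f x) \<le> M" "compact K" "\<And>x. x \<notin> K \<Longrightarrow> f x = 0"
  shows "sqint f"
proof -
  have "integrable lborel (\<lambda>x. (norm (f x))\<^sup>2)"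
  proof (rule integrable_compact_support[OF _ _ assms(3)])
    show "\<bar>(norm (f x))\<^sup>2\<bar> \<le> M\<^sup>2" for x using assms(2)[of x] by (auto intro: power_mono)
  qed (use assms(4) in auto)
  then show ?thesis by (simp add: sqint_def)
qed

lemma Cc_infinity_sqint:
  assumes "\<phi> \<in> Cc_infinity U"
  shows "sqint \<phi>"
proof -
  obtain M where "\<And>x. \<bar>\<phi> x\<bar> \<le> M" using Cc_infinity_bounded[OF assms] by blast
  then show ?thesis
    by (intro sqint_bounded_compact_support[OF Cc_infinity_measurable[OF assms] _ Cc_infinityD(2)[OF assms]])
       (auto intro: Cc_infinity_support_zero)
qed

lemma sqint_scaleR_left: "sqint f \<Longrightarrow> sqint (\<lambda>x. f x *\<^sub>R b)"
  by (auto simp: sqint_def power_mult_distrib)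

definition classical_grad :: "('a::euclidean_space \<Rightarrow> real) \<Rightarrow> 'a \<Rightarrow> 'a" where
  "classical_grad \<phi> x = (\<Sum>b\<in>Basis. partial_deriv b \<phi> x *\<^sub>R b)"

lemma classical_grad_inner: "b \<in> Basis \<Longrightarrow> classical_grad \<phi> x \<bullet> b = partial_deriv b \<phi> x"
  by (simp add: classical_grad_def inner_sum_left inner_Basis if_distrib sum.delta' cong: if_cong)

lemma sqint_sum: "finite I \<Longrightarrow> (\<And>i. i \<in> I \<Longrightarrow> sqint (f i)) \<Longrightarrow> sqint (\<lambda>x. \<Sum>i\<in>I. f i x)"
  by (induction I rule: finite_induct) (auto intro: sqint_add)

lemma sqint_classical_grad: "\<phi> \<in> Cc_infinity U \<Longrightarrow> sqint (classical_grad \<phi>)"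
  unfolding classical_grad_def
  by (intro sqint_sum sqint_scaleR_left Cc_infinity_sqint Cc_infinity_partial_deriv) auto

text \<open>The graph of the weak gradient on H1 of \<open>D\<close>, with function and gradient
  extended by zero. No boundary values are prescribed, so an equation tested with the whole graph
  carries the Neumann condition as its natural boundary condition. As an intersection of kernels of
  continuous maps it is a closed subspace, for any open \<open>D\<close>.\<close>

definition gradL2 :: "'a::euclidean_space set \<Rightarrow> (('a, real) L2 \<times> ('a, 'a) L2) set" where
  "gradL2 D = {(p, G). mulL2 (indicator D) p = p \<and> mulL2 (indicator D) G = G \<and>
     (\<forall>b\<in>Basis. \<forall>\<phi>\<in>Cc_infinity D. inner p (toL2 (partial_deriv b \<phi>)) = - inner G (toL2 (\<lambda>x. \<phi> x *\<^sub>R b)))}"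

lemma inner_toL2_right:
  assumes "sqint f"
  shows "inner p (toL2 f) = (LINT x|lborel. ofL2 p x \<bullet> f x)"
  using inner_toL2[OF sqint_ofL2[of p] assms] by simp

lemma mulL2_indicator_linear:
  assumes "D \<in> sets borel"
  shows "linear (mulL2 (indicator D))"
  by (rule linear_mulL2[where K=1]) (use assms in \<open>auto simp: indicator_def\<close>)

lemma norm_mulL2_indicator_le:
  assumes "D \<in> sets borel"
  shows "norm (mulL2 (indicator D) F) \<le> norm F"
  using norm_mulL2_le[of "indicator D" 1 F] assms by (auto simp: indicator_def)

lemma ofL2_mulL2_indicator:
  assumes "D \<in> sets borel"
  shows "AE x in lborel. ofL2 (mulL2 (indicator D) F) x = indicator D x *\<^sub>R ofL2 F x"
  by (rule ofL2_mulL2[where K=1]) (use assms in \<open>auto simp: indicator_def\<close>)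

lemma mulL2_indicator_eq_iff:
  assumes "D \<in> sets borel"
  shows "mulL2 (indicator D) F = F \<longleftrightarrow> (AE x in lborel. x \<notin> D \<longrightarrow> ofL2 F x = 0)"
proof
  assume "mulL2 (indicator D) F = F"
  then have "AE x in lborel. ofL2 F x = indicator D x *\<^sub>R ofL2 F x"
    using ofL2_mulL2_indicator[OF assms, of F] by simp
  then show "AE x in lborel. x \<notin> D \<longrightarrow> ofL2 F x = 0" by eventually_elim auto
next
  assume "AE x in lborel. x \<notin> D \<longrightarrow> ofL2 F x = 0"
  then show "mulL2 (indicator D) F = F"
    unfolding L2_eq_iff using ofL2_mulL2_indicator[OF assms, of F]
    by eventually_elim (auto simp: indicator_def split: if_splits)
qed

lemma continuous_mulL2_indicator:
  assumes "D \<in> sets borel"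
  shows "continuous_on S (mulL2 (indicator D))"
proof -
  have "bounded_linear (mulL2 (indicator D))"
    by (intro bounded_linear_intro[where K=1])
       (simp_all add: linear_add[OF mulL2_indicator_linear[OF assms]]
         linear_scale[OF mulL2_indicator_linear[OF assms]] norm_mulL2_indicator_le[OF assms])
  then show ?thesis by (rule linear_continuous_on)
qed

lemma gradL2_subspace:
  assumes "D \<in> sets borel"
  shows "subspace (gradL2 D)"
  by (rule subspaceI)
     (auto simp: gradL2_def zero_prod_def inner_add_left linear_0[OF mulL2_indicator_linear[OF assms]]
       linear_add[OF mulL2_indicator_linear[OF assms]] linear_scale[OF mulL2_indicator_linear[OF assms]])

lemma gradL2_closed:
  fixes D :: "'a::euclidean_space set"
  assumes "D \<in> sets borel"
  shows "closed (gradL2 D)"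
proof -
  have "gradL2 D = {x. mulL2 (indicator D) (fst x) = fst x} \<inter> {x. mulL2 (indicator D) (snd x) = snd x} \<inter>
     (\<Inter>b\<in>Basis. \<Inter>\<phi>\<in>Cc_infinity D. {x. inner (fst x) (toL2 (partial_deriv b \<phi>)) = - inner (snd x) (toL2 (\<lambda>x. \<phi> x *\<^sub>R b))})"
    by (auto simp: gradL2_def)
  moreover have "closed \<dots>"
    by (intro closed_Int closed_INT ballI closed_Collect_eq continuous_intros
        continuous_on_compose2[OF continuous_mulL2_indicator[OF assms, of UNIV]]) auto
  ultimately show ?thesis by simp
qed

lemma measurable_classical_grad:
  assumes "\<And>j. C_k j \<kappa>"
  shows "\<kappa> \<in> borel_measurable borel" "classical_grad \<kappa> \<in> borel_measurable borel"
proof -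
  show "\<kappa> \<in> borel_measurable borel"
    using C_k_continuous[OF assms] by (rule borel_measurable_continuous_onI)
  have "C_k j (partial_deriv b \<kappa>)" if "b \<in> Basis" for b j using assms[of "Suc j"] that by simp
  then have "partial_deriv b \<kappa> \<in> borel_measurable borel" if "b \<in> Basis" for b
    using C_k_continuous that by (intro borel_measurable_continuous_onI) blast
  then show "classical_grad \<kappa> \<in> borel_measurable borel"
    unfolding classical_grad_def[abs_def] by (intro borel_measurable_sum borel_measurable_scaleR) auto
qed

lemma times_classical_grad:
  assumes k: "\<And>j. C_k j \<kappa>" and grad: "\<And>x. norm (classical_grad \<kappa> x) \<le> \<epsilon>"
  shows "sqint (\<lambda>x. ofL2 p x *\<^sub>R classical_grad \<kappa> x)"
    and "norm (toL2 (\<lambda>x. ofL2 p x *\<^sub>R classical_grad \<kappa> x)) \<le> \<epsilon> * norm p"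
proof -
  note [measurable] = measurable_classical_grad[OF k]
  define v where "v x = ofL2 p x *\<^sub>R classical_grad \<kappa> x" for x
  have e0: "0 \<le> \<epsilon>" using grad[of undefined] norm_ge_zero order_trans by blast
  have nv: "norm (v x) \<le> norm (\<epsilon> *\<^sub>R ofL2 p x)" for x
    unfolding v_def using mult_left_mono[OF grad[of x], of "\<bar>ofL2 p x\<bar>"] e0 by (simp add: mult.commute)
  have v: "sqint v"
  proof (rule sqint_bound)
    show "integrable lborel (\<lambda>x. (norm (\<epsilon> *\<^sub>R ofL2 p x))\<^sup>2)"
      by (intro sqint_integrable sqint_scaleR sqint_ofL2)
    show "AE x in lborel. (norm (v x))\<^sup>2 \<le> (norm (\<epsilon> *\<^sub>R ofL2 p x))\<^sup>2"
      by (intro AE_I2 power_mono nv) auto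
  qed (unfold v_def, measurable)
  then show "sqint (\<lambda>x. ofL2 p x *\<^sub>R classical_grad \<kappa> x)" by (simp add: v_def[abs_def])
  have "norm (toL2 v) \<le> norm (toL2 (\<lambda>x. \<epsilon> *\<^sub>R ofL2 p x))"
    by (intro norm_L2_mono v sqint_scaleR sqint_ofL2 AE_I2 nv)
  then show "norm (toL2 (\<lambda>x. ofL2 p x *\<^sub>R classical_grad \<kappa> x)) \<le> \<epsilon> * norm p"
    unfolding toL2_scaleR[OF sqint_ofL2] toL2_ofL2 v_def[abs_def] using e0 by simp
qed

text \<open>The Leibniz rule, by moving \<kappa> onto the test function. The cutoff may be nonzero
  on the boundary of \<open>D\<close>: a product with a test function supported in \<open>D\<close>
  is again one.\<close>

lemma gradL2_cutoff:
  fixes D :: "'a::euclidean_space set"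
  assumes D: "D \<in> sets borel"
    and k: "\<And>j. C_k j \<kappa>" "\<And>x. \<bar>\<kappa> x\<bar> \<le> K" and grad: "\<And>x. norm (classical_grad \<kappa> x) \<le> \<epsilon>"
    and pG: "(p, G) \<in> gradL2 D"
  shows "(mulL2 \<kappa> p, mulL2 \<kappa> G + toL2 (\<lambda>x. ofL2 p x *\<^sub>R classical_grad \<kappa> x)) \<in> gradL2 D"
proof -
  note k' [measurable] = measurable_classical_grad(1)[OF k(1)]
  define v where "v x = ofL2 p x *\<^sub>R classical_grad \<kappa> x" for x
  have v: "sqint v" unfolding v_def[abs_def] by (rule times_classical_grad[OF k(1) grad])
  have p: "mulL2 (indicator D) p = p" and G: "mulL2 (indicator D) G = G"
    and w: "\<And>b \<phi>. b \<in> Basis \<Longrightarrow> \<phi> \<in> Cc_infinity D \<Longrightarrow> inner p (toL2 (partial_deriv b \<phi>)) = - inner G (toL2 (\<lambda>x. \<phi> x *\<^sub>R b))"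
    using pG by (auto simp: gradL2_def)
  have p0: "AE x in lborel. x \<notin> D \<longrightarrow> ofL2 p x = 0" using p mulL2_indicator_eq_iff[OF D] by blast
  have G0: "AE x in lborel. x \<notin> D \<longrightarrow> ofL2 G x = 0" using G mulL2_indicator_eq_iff[OF D] by blast
  have kp: "mulL2 (indicator D) (mulL2 \<kappa> p) = mulL2 \<kappa> p"
    unfolding mulL2_indicator_eq_iff[OF D] using p0 ofL2_mulL2[OF k' k(2), of p] by eventually_elim auto
  have kG: "mulL2 (indicator D) (mulL2 \<kappa> G + toL2 v) = mulL2 \<kappa> G + toL2 v"
    unfolding mulL2_indicator_eq_iff[OF D]
    using p0 G0 ofL2_mulL2[OF k' k(2), of G] ofL2_toL2[OF v] ofL2_add[of "mulL2 \<kappa> G" "toL2 v"]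
    by eventually_elim (auto simp: v_def)
  have "inner (mulL2 \<kappa> p) (toL2 (partial_deriv b \<phi>)) = - inner (mulL2 \<kappa> G + toL2 v) (toL2 (\<lambda>x. \<phi> x *\<^sub>R b))"
    if b: "b \<in> Basis" and \<phi>: "\<phi> \<in> Cc_infinity D" for b \<phi>
  proof -
    have k\<phi>: "(\<lambda>x. \<kappa> x * \<phi> x) \<in> Cc_infinity D" using Cc_infinity_mult[OF \<phi> k(1)] .
    have d: "\<kappa> differentiable (at x)" "\<phi> differentiable (at x)" for x
      using k(1)[of "Suc 0"] Cc_infinityD(4)[OF \<phi>] by auto
    have s1: "sqint (\<lambda>x. \<kappa> x *\<^sub>R partial_deriv b \<phi> x)"
      by (rule sqint_mult[OF _ k' k(2)]) (intro Cc_infinity_sqint[OF Cc_infinity_partial_deriv[OF \<phi> b]])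
    have "(\<lambda>x. partial_deriv b \<kappa> x * \<phi> x) \<in> Cc_infinity D"
      using k(1)[of "Suc _"] b by (intro Cc_infinity_mult[OF \<phi>]) auto
    then have s2: "sqint (\<lambda>x. partial_deriv b \<kappa> x * \<phi> x)" by (rule Cc_infinity_sqint)
    have eq: "partial_deriv b (\<lambda>x. \<kappa> x * \<phi> x) = (\<lambda>x. \<kappa> x *\<^sub>R partial_deriv b \<phi> x + partial_deriv b \<kappa> x * \<phi> x)"
      using d by (auto simp: partial_deriv_mult)
    have "inner (mulL2 \<kappa> p) (toL2 (partial_deriv b \<phi>)) = inner p (toL2 (\<lambda>x. \<kappa> x *\<^sub>R partial_deriv b \<phi> x))"
      by (simp add: mulL2_self_adjoint[OF k' k(2)] mulL2_toL2[OF k' k(2)]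
          Cc_infinity_sqint[OF Cc_infinity_partial_deriv[OF \<phi> b]])
    also have "toL2 (\<lambda>x. \<kappa> x *\<^sub>R partial_deriv b \<phi> x)
        = toL2 (partial_deriv b (\<lambda>x. \<kappa> x * \<phi> x)) - toL2 (\<lambda>x. partial_deriv b \<kappa> x * \<phi> x)"
      unfolding eq toL2_add[OF s1 s2] by simp
    also have "inner p \<dots> = - inner G (toL2 (\<lambda>x. (\<kappa> x * \<phi> x) *\<^sub>R b)) - inner p (toL2 (\<lambda>x. partial_deriv b \<kappa> x * \<phi> x))"
      by (simp add: inner_diff_right w[OF b k\<phi>])
    also have "toL2 (\<lambda>x. (\<kappa> x * \<phi> x) *\<^sub>R b) = mulL2 \<kappa> (toL2 (\<lambda>x. \<phi> x *\<^sub>R b))"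
      by (simp add: mulL2_toL2[OF k' k(2)] sqint_scaleR_left Cc_infinity_sqint[OF \<phi>])
    also have "inner p (toL2 (\<lambda>x. partial_deriv b \<kappa> x * \<phi> x)) = inner (toL2 v) (toL2 (\<lambda>x. \<phi> x *\<^sub>R b))"
      unfolding inner_toL2_right[OF s2] inner_toL2[OF v sqint_scaleR_left[OF Cc_infinity_sqint[OF \<phi>]]]
      using b by (simp add: v_def classical_grad_inner mult_ac)
    finally show ?thesis
      by (simp add: mulL2_self_adjoint[OF k' k(2)] inner_add_left)
  qed
  then show "(mulL2 \<kappa> p, mulL2 \<kappa> G + toL2 (\<lambda>x. ofL2 p x *\<^sub>R classical_grad \<kappa> x)) \<in> gradL2 D"
    using kp kG by (simp add: gradL2_def v_def[abs_def])
qed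

lemma mulL2_indicator_toL2:
  assumes D: "D \<in> sets borel" and f: "sqint f" and z: "\<And>x. x \<notin> D \<Longrightarrow> f x = 0"
  shows "mulL2 (indicator D) (toL2 f) = toL2 f"
  unfolding mulL2_indicator_eq_iff[OF D] using ofL2_toL2[OF f] by eventually_elim (use z in auto)

lemma Cc_infinity_zero_outside: "\<phi> \<in> Cc_infinity D \<Longrightarrow> x \<notin> D \<Longrightarrow> \<phi> x = 0"
  using Cc_infinityD(3)[of \<phi> D] Cc_infinity_support_zero[of x \<phi>] by blast

text \<open>Restrictions of smooth functions on the whole space are admissible tests even if they do
  not vanish on the boundary of \<open>D\<close>; the integration by parts is done against a
  \<open>\<phi>\<close> supported inside \<open>D\<close>. This is what admits the test functions of
  the Neumann identity.\<close>

lemma gradL2_smooth: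
  fixes D :: "'a::euclidean_space set"
  assumes D: "D \<in> sets borel" and \<eta>: "\<eta> \<in> Cc_infinity UNIV"
  shows "(mulL2 (indicator D) (toL2 \<eta>), mulL2 (indicator D) (toL2 (classical_grad \<eta>))) \<in> gradL2 D"
proof -
  have i: "indicator D \<in> borel_measurable borel" "\<And>x. \<bar>indicator D x :: real\<bar> \<le> 1"
    using D by (auto simp: indicator_def)
  have idem: "mulL2 (indicator D) (mulL2 (indicator D) F) = mulL2 (indicator D) F"
    for F :: "('a, 'b::euclidean_space) L2"
    unfolding mulL2_indicator_eq_iff[OF D] using ofL2_mulL2_indicator[OF D, of F] by eventually_elim simp
  have "inner (mulL2 (indicator D) (toL2 \<eta>)) (toL2 (partial_deriv b \<phi>))
      = - inner (mulL2 (indicator D) (toL2 (classical_grad \<eta>))) (toL2 (\<lambda>x. \<phi> x *\<^sub>R b))"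
    if b: "b \<in> Basis" and \<phi>: "\<phi> \<in> Cc_infinity D" for b \<phi>
  proof -
    note p = Cc_infinity_partial_deriv[OF \<phi> b]
    note s\<phi> = sqint_scaleR_left[OF Cc_infinity_sqint[OF \<phi>]]
    have 1: "mulL2 (indicator D) (toL2 (partial_deriv b \<phi>)) = toL2 (partial_deriv b \<phi>)"
      by (rule mulL2_indicator_toL2[OF D Cc_infinity_sqint[OF p] Cc_infinity_zero_outside[OF p]])
    have 2: "mulL2 (indicator D) (toL2 (\<lambda>x. \<phi> x *\<^sub>R b)) = toL2 (\<lambda>x. \<phi> x *\<^sub>R b)"
      by (rule mulL2_indicator_toL2[OF D s\<phi>]) (simp add: Cc_infinity_zero_outside[OF \<phi>])
    have "inner (toL2 \<eta>) (toL2 (partial_deriv b \<phi>)) = (LINT x|lborel. \<eta> x * partial_deriv b \<phi> x)"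
      by (simp add: inner_toL2 Cc_infinity_sqint[OF \<eta>] Cc_infinity_sqint[OF p])
    also have "\<dots> = - (LINT x|lborel. partial_deriv b \<eta> x * \<phi> x)"
      by (rule integration_by_parts[OF Cc_infinityD(1)[OF \<eta>] \<phi> b])
    also have "(LINT x|lborel. partial_deriv b \<eta> x * \<phi> x) = inner (toL2 (classical_grad \<eta>)) (toL2 (\<lambda>x. \<phi> x *\<^sub>R b))"
      using b by (simp add: inner_toL2 sqint_classical_grad[OF \<eta>] s\<phi> classical_grad_inner mult.commute)
    finally show ?thesis by (simp add: mulL2_self_adjoint[OF i] 1 2)
  qed
  then show ?thesis by (simp add: gradL2_def idem)
qed

lemma sqint_indicator_compact: "compact K \<Longrightarrow> sqint (indicator K :: 'a::euclidean_space \<Rightarrow> real)"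
proof (rule sqint_bounded_compact_support[where M=1])
  show "compact K \<Longrightarrow> (indicator K :: 'a \<Rightarrow> real) \<in> borel_measurable borel"
    by (intro borel_measurable_indicator borel_compact)
qed (auto simp: indicator_def)

lemma sqint_weighted_test:
  assumes "\<phi> \<in> Cc_infinity D" and w: "continuous_on UNIV w"
  shows "sqint (\<lambda>x. w x * \<phi> x)"
proof -
  let ?K = "closure {x. \<phi> x \<noteq> 0}"
  have c: "continuous_on S (\<lambda>x. w x * \<phi> x)" for S
    using continuous_on_subset[OF w] by (intro continuous_intros Cc_infinityD(5)[OF assms(1)]) auto
  obtain M where M: "\<And>x. x \<in> ?K \<Longrightarrow> norm (w x * \<phi> x) \<le> M"
    using compact_imp_bounded[OF compact_continuous_image[OF c Cc_infinityD(2)[OF assms(1)]]]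
    by (auto simp: bounded_iff)
  show ?thesis
  proof (rule sqint_bounded_compact_support[OF _ _ Cc_infinityD(2)[OF assms(1)]])
    show "norm (w x * \<phi> x) \<le> max M 0" for x
      using M[of x] Cc_infinity_support_zero[of x \<phi>] by (cases "x \<in> ?K") auto
    show "w x * \<phi> x = 0" if "x \<notin> ?K" for x using Cc_infinity_support_zero[OF that] by simp
  qed (rule borel_measurable_continuous_onI[OF c])
qed

text \<open>Applied with weight \<open>1\<close> to components of vector fields and with the growing
  weight to the phases; a positive weight can be divided out afterwards.\<close>

lemma weighted_test_functions_total:
  fixes f :: "('a::euclidean_space, real) L2"
  assumes D: "open D" and f: "mulL2 (indicator D) f = f" and w: "continuous_on UNIV w" "\<And>x. w x > 0"
    and zero: "\<And>\<phi>. \<phi> \<in> Cc_infinity D \<Longrightarrow> inner f (toL2 (\<lambda>x. w x * \<phi> x)) = 0"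
  shows "f = 0"
proof -
  have [measurable]: "w \<in> borel_measurable borel" using w(1) by (rule borel_measurable_continuous_onI)
  have "AE x in lborel. x \<in> D \<longrightarrow> w x * ofL2 f x = 0"
  proof (rule test_functions_determine[OF D])
    fix K :: "'a set" assume K: "compact K" "K \<subseteq> D"
    have [measurable]: "K \<in> sets borel" using K(1) by (rule borel_compact)
    obtain M where M: "\<And>x. x \<in> K \<Longrightarrow> norm (w x) \<le> M"
      using compact_imp_bounded[OF compact_continuous_image[OF continuous_on_subset[OF w(1)] K(1)]]
      by (auto simp: bounded_iff)
    have "sqint (\<lambda>x. indicator K x * w x)"
    proof (rule sqint_bounded_compact_support[where K=K])
      show "norm (indicator K x * w x) \<le> max M 0" for x using M[of x] by (cases "x \<in> K") auto
    qed (use K(1) in auto)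
    from sqint_inner_integrable[OF this sqint_ofL2[of f]]
    show "integrable lborel (\<lambda>x. indicator K x * (w x * ofL2 f x))" by (simp add: mult.assoc)
  next
    fix \<phi> assume "\<phi> \<in> Cc_infinity D"
    from zero[OF this, unfolded inner_toL2_right[OF sqint_weighted_test[OF this w(1)]]]
    show "(LINT x|lborel. w x * ofL2 f x * \<phi> x) = 0" by (simp add: mult_ac)
  qed measurable
  moreover have "AE x in lborel. x \<notin> D \<longrightarrow> ofL2 f x = 0"
    using f mulL2_indicator_eq_iff[of D f] D by simp
  moreover have "AE x in lborel. ofL2 (0 :: ('a, real) L2) x = 0" by (rule ofL2_0)
  ultimately show ?thesis unfolding L2_eq_iff
  proof eventually_elim
    case (elim x)
    then show ?case using w(2)[of x] by auto
  qed
qed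

lemma vector_test_functions_total:
  fixes G :: "('a::euclidean_space, 'a) L2"
  assumes D: "open D" and G: "mulL2 (indicator D) G = G"
    and zero: "\<And>b \<phi>. b \<in> Basis \<Longrightarrow> \<phi> \<in> Cc_infinity D \<Longrightarrow> inner G (toL2 (\<lambda>x. \<phi> x *\<^sub>R b)) = 0"
  shows "G = 0"
proof -
  have DB: "D \<in> sets borel" using D by simp
  have G0: "AE x in lborel. x \<notin> D \<longrightarrow> ofL2 G x = 0" using G mulL2_indicator_eq_iff[OF DB] by blast
  have "AE x in lborel. \<forall>b\<in>Basis. ofL2 G x \<bullet> b = 0"
  proof (intro AE_finite_allI finite_Basis)
    fix b :: 'a assume b: "b \<in> Basis"
    have sq: "sqint (\<lambda>x. ofL2 G x \<bullet> b)"
    proof (rule sqint_bound)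
      show "integrable lborel (\<lambda>x. (norm (ofL2 G x))\<^sup>2)" by (intro sqint_integrable sqint_ofL2)
      show "AE x in lborel. (norm (ofL2 G x \<bullet> b))\<^sup>2 \<le> (norm (ofL2 G x))\<^sup>2"
        by (intro AE_I2 power_mono) (use Basis_le_norm[OF b] in auto)
    qed measurable
    have "toL2 (\<lambda>x. ofL2 G x \<bullet> b) = 0"
    proof (rule weighted_test_functions_total[OF D, where w="\<lambda>x. 1"])
      show "mulL2 (indicator D) (toL2 (\<lambda>x. ofL2 G x \<bullet> b)) = toL2 (\<lambda>x. ofL2 G x \<bullet> b)"
        unfolding mulL2_indicator_eq_iff[OF DB] using G0 ofL2_toL2[OF sq] by eventually_elim auto
      fix \<phi> assume \<phi>: "\<phi> \<in> Cc_infinity D"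
      have "inner (toL2 (\<lambda>x. ofL2 G x \<bullet> b)) (toL2 \<phi>) = inner G (toL2 (\<lambda>x. \<phi> x *\<^sub>R b))"
        by (simp add: inner_toL2[OF sq Cc_infinity_sqint[OF \<phi>]]
            inner_toL2_right[OF sqint_scaleR_left[OF Cc_infinity_sqint[OF \<phi>]]] mult.commute)
      then show "inner (toL2 (\<lambda>x. ofL2 G x \<bullet> b)) (toL2 (\<lambda>x. 1 * \<phi> x)) = 0" using zero[OF b \<phi>] by simp
    qed (auto)
    then show "AE x in lborel. ofL2 G x \<bullet> b = 0"
      using toL2_eq_iff[OF sq sqint_0] by (simp add: toL2_0)
  qed
  moreover have "AE x in lborel. ofL2 (0 :: ('a, 'a) L2) x = 0" by (rule ofL2_0)
  ultimately show ?thesis unfolding L2_eq_iff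
  proof eventually_elim
    case (elim x)
    then have "ofL2 G x = 0" using euclidean_all_zero_iff[of "ofL2 G x"] by simp
    then show ?case using elim by simp
  qed
qed

lemma gradL2_unique:
  assumes D: "open D" and "(p, G) \<in> gradL2 D" "(p, H) \<in> gradL2 D"
  shows "G = H"
proof -
  have "(0, G - H) \<in> gradL2 D"
    using subspace_diff[OF gradL2_subspace assms(2,3)] D by simp
  then have "G - H = 0"
    by (intro vector_test_functions_total[OF D]) (auto simp: gradL2_def)
  then show ?thesis by simp
qed

lemma L2_space_locally_integrable:
  fixes f :: "'a::euclidean_space \<Rightarrow> real"
  assumes D: "D \<in> sets borel" and f: "f \<in> L2_space D"
  shows "locally_integrable_on D f"
  unfolding locally_integrable_on_def
proof (intro allI impI)
  fix K assume K: "compact K" "K \<subseteq> D"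
  obtain f' where f': "sqint f'" "AE x in lborel. x \<in> D \<longrightarrow> f x = f' x"
    using L2_space_representative[OF D f] by blast
  have "AE x in lborel. x \<in> K \<longrightarrow> f x = f' x" using f'(2) by eventually_elim (use K in auto)
  then have "integrable (lebesgue_on K) f \<longleftrightarrow> integrable lborel (\<lambda>x. indicator K x *\<^sub>R f' x)"
    by (intro integrable_lebesgue_on_iff borel_compact K sqint_measurable f')
  then show "integrable (lebesgue_on K) f"
    using sqint_inner_integrable[OF sqint_indicator_compact[OF K(1)] f'(1)] by simp
qed

lemma integral_lebesgue_on_inner:
  fixes f f' \<psi> \<psi>' :: "'a::euclidean_space \<Rightarrow> 'b::euclidean_space"
  assumes D: "D \<in> sets borel" and f': "sqint f'" "\<And>x. x \<notin> D \<Longrightarrow> f' x = 0" "AE x in lborel. x \<in> D \<longrightarrow> f x = f' x"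
    and \<psi>': "sqint \<psi>'" "AE x in lborel. x \<in> D \<longrightarrow> \<psi> x = \<psi>' x"
  shows "(LINT x|lebesgue_on D. f x \<bullet> \<psi> x) = inner (toL2 f') (toL2 \<psi>')"
    and "integrable (lebesgue_on D) (\<lambda>x. f x \<bullet> \<psi> x)"
proof -
  have [measurable]: "f' \<in> borel_measurable borel" "\<psi>' \<in> borel_measurable borel" "D \<in> sets borel"
    using f' \<psi>' D by (auto dest: sqint_measurable)
  have m: "(\<lambda>x. f' x \<bullet> \<psi>' x) \<in> borel_measurable borel" by measurable
  have eq: "AE x in lborel. x \<in> D \<longrightarrow> f x \<bullet> \<psi> x = f' x \<bullet> \<psi>' x"
    using f'(3) \<psi>'(2) by eventually_elim auto
  have i: "(\<lambda>x. indicator D x *\<^sub>R (f' x \<bullet> \<psi>' x)) = (\<lambda>x. f' x \<bullet> \<psi>' x)"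
    using f'(2) by (auto simp: indicator_def fun_eq_iff)
  show "(LINT x|lebesgue_on D. f x \<bullet> \<psi> x) = inner (toL2 f') (toL2 \<psi>')"
    using integral_lebesgue_on_eq[OF D m eq] by (simp only: i inner_toL2[OF f'(1) \<psi>'(1)])
  show "integrable (lebesgue_on D) (\<lambda>x. f x \<bullet> \<psi> x)"
    using integrable_lebesgue_on_iff[OF D m eq] sqint_inner_integrable[OF f'(1) \<psi>'(1)] by (simp only: i)
qed

text \<open>The dictionary between weak gradients of functions on \<open>D\<close> and membership in
  the graph. It is used in both directions: to enter the Hilbert space with the initial datum and to
  leave it with the solution.\<close>

lemma has_weak_gradient_iff:
  fixes f f' :: "'a::euclidean_space \<Rightarrow> real" and H H' :: "'a \<Rightarrow> 'a"
  assumes D: "D \<in> sets borel"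
    and f': "sqint f'" "\<And>x. x \<notin> D \<Longrightarrow> f' x = 0" "AE x in lborel. x \<in> D \<longrightarrow> f x = f' x"
    and H': "sqint H'" "\<And>x. x \<notin> D \<Longrightarrow> H' x = 0" "AE x in lborel. x \<in> D \<longrightarrow> H x = H' x"
  shows "has_weak_gradient D f H \<longleftrightarrow> (toL2 f', toL2 H') \<in> gradL2 D"
proof -
  have s: "(\<lambda>x. indicator D x *\<^sub>R f' x) = f'" "(\<lambda>x. indicator D x *\<^sub>R H' x) = H'"
    using f'(2) H'(2) by (auto simp: indicator_def fun_eq_iff)
  have fL: "f \<in> L2_space D" using L2_space_iff[OF D sqint_measurable[OF f'(1)] f'(3)] f'(1) s by simp
  have HL: "H \<in> L2_space D" using L2_space_iff[OF D sqint_measurable[OF H'(1)] H'(3)] H'(1) s by simp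
  have "locally_integrable_on D (\<lambda>x. H x \<bullet> b)" if b: "b \<in> Basis" for b
  proof (rule L2_space_locally_integrable[OF D])
    have m: "(\<lambda>x. H' x \<bullet> b) \<in> borel_measurable borel" using sqint_measurable[OF H'(1)] by measurable
    have sq: "sqint (\<lambda>x. indicator D x *\<^sub>R (H' x \<bullet> b))"
    proof (rule sqint_bound)
      show "integrable lborel (\<lambda>x. (norm (H' x))\<^sup>2)" by (rule sqint_integrable[OF H'(1)])
      show "AE x in lborel. (norm (indicator D x *\<^sub>R (H' x \<bullet> b)))\<^sup>2 \<le> (norm (H' x))\<^sup>2"
        using Basis_le_norm[OF b] by (intro AE_I2 power_mono) (auto simp: indicator_def)
    qed (use m D in measurable)
    show "(\<lambda>x. H x \<bullet> b) \<in> L2_space D"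
      by (rule L2_space_iff[OF D m, THEN iffD2, OF _ sq]) (use H'(3) in \<open>eventually_elim, auto\<close>)
  qed
  moreover have "locally_integrable_on D f" by (rule L2_space_locally_integrable[OF D fL])
  moreover have "(LINT x|lebesgue_on D. f x * partial_deriv b \<phi> x) = inner (toL2 f') (toL2 (partial_deriv b \<phi>))"
    if "b \<in> Basis" "\<phi> \<in> Cc_infinity D" for b \<phi>
    using integral_lebesgue_on_inner(1)[OF D f' Cc_infinity_sqint[OF Cc_infinity_partial_deriv[OF that(2,1)]], of "partial_deriv b \<phi>"] by simp
  moreover have "(LINT x|lebesgue_on D. (H x \<bullet> b) * \<phi> x) = inner (toL2 H') (toL2 (\<lambda>x. \<phi> x *\<^sub>R b))"
    if "b \<in> Basis" "\<phi> \<in> Cc_infinity D" for b \<phi>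
    using integral_lebesgue_on_inner(1)[OF D H' sqint_scaleR_left[OF Cc_infinity_sqint[OF that(2)]], of "\<lambda>x. \<phi> x *\<^sub>R b"]
    by (simp add: mult.commute)
  moreover have "mulL2 (indicator D) (toL2 f') = toL2 f'" "mulL2 (indicator D) (toL2 H') = toL2 H'"
    using f' H' by (auto intro!: mulL2_indicator_toL2[OF D])
  ultimately show ?thesis
    by (auto simp: has_weak_gradient_def has_weak_partial_def gradL2_def)
qed

lemma H1_space_imp_gradL2:
  fixes g :: "'a::euclidean_space \<Rightarrow> real"
  assumes D: "D \<in> sets borel" and g: "g \<in> H1_space D"
  shows "\<exists>g' G. sqint g' \<and> (\<forall>x. x \<notin> D \<longrightarrow> g' x = 0) \<and> (AE x in lborel. x \<in> D \<longrightarrow> g x = g' x) \<and>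
           (toL2 g', G) \<in> gradL2 D"
proof -
  obtain H where H: "H \<in> L2_space D" "has_weak_gradient D g H" and gL: "g \<in> L2_space D"
    using g by (auto simp: H1_space_def)
  obtain g' where g': "sqint g'" "\<And>x. x \<notin> D \<Longrightarrow> g' x = 0" "AE x in lborel. x \<in> D \<longrightarrow> g x = g' x"
    using L2_space_representative[OF D gL] by blast
  obtain H' where H': "sqint H'" "\<And>x. x \<notin> D \<Longrightarrow> H' x = 0" "AE x in lborel. x \<in> D \<longrightarrow> H x = H' x"
    using L2_space_representative[OF D H(1)] by blast
  show ?thesis using has_weak_gradient_iff[OF D g' H'] H(2) g' by blast
qed

lemma gradL2_imp_H1:
  fixes f :: "'a::euclidean_space \<Rightarrow> real"
  assumes D: "open D" and pG: "(p, G) \<in> gradL2 D" and f: "AE x in lborel. x \<in> D \<longrightarrow> f x = ofL2 p x"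
  shows "f \<in> H1_space D" and "AE x in lborel. x \<in> D \<longrightarrow> weak_grad D f x = ofL2 G x"
    and "H1_norm_sq D f = (norm p)\<^sup>2 + (norm G)\<^sup>2"
proof -
  have DB: "D \<in> sets borel" using D by simp
  have i: "indicator D \<in> borel_measurable borel" "\<And>x. \<bar>indicator D x :: real\<bar> \<le> 1"
    using DB by (auto simp: indicator_def)
  have pG': "mulL2 (indicator D) p = p" "mulL2 (indicator D) G = G" using pG by (auto simp: gradL2_def)
  define f' where "f' x = indicator D x *\<^sub>R ofL2 p x" for x
  define G' where "G' x = indicator D x *\<^sub>R ofL2 G x" for x
  have f': "sqint f'" "\<And>x. x \<notin> D \<Longrightarrow> f' x = 0" "AE x in lborel. x \<in> D \<longrightarrow> f x = f' x" and pf: "toL2 f' = p"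
    using sqint_mult[OF sqint_ofL2 i] f pG'(1) by (auto simp: f'_def[abs_def] mulL2_def simp del: real_scaleR_def elim!: AE_mp)
  have G': "sqint G'" "\<And>x. x \<notin> D \<Longrightarrow> G' x = 0" "AE x in lborel. x \<in> D \<longrightarrow> G' x = ofL2 G x" and GG: "toL2 G' = G"
    using sqint_mult[OF sqint_ofL2 i] pG'(2) by (auto simp: G'_def[abs_def] mulL2_def)
  have GL: "G' \<in> L2_space D"
    using L2_space_iff[OF DB sqint_measurable[OF G'(1)], of G'] sqint_mult[OF G'(1) i] by simp
  have fL: "f \<in> L2_space D"
    using L2_space_iff[OF DB sqint_measurable[OF f'(1)] f'(3)] sqint_mult[OF f'(1) i] by simp
  have wg: "has_weak_gradient D f G'"
    using has_weak_gradient_iff[OF DB f' G'(1,2), of G'] pG pf GG by simp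
  show "f \<in> H1_space D" using fL GL wg by (auto simp: H1_space_def)
  have W: "weak_grad D f \<in> L2_space D" "has_weak_gradient D f (weak_grad D f)"
    unfolding weak_grad_def using someI_ex[of "\<lambda>G. G \<in> L2_space D \<and> has_weak_gradient D f G"] GL wg by auto
  obtain W' where W': "sqint W'" "\<And>x. x \<notin> D \<Longrightarrow> W' x = 0" "AE x in lborel. x \<in> D \<longrightarrow> weak_grad D f x = W' x"
    using L2_space_representative[OF DB W(1)] by blast
  have "(p, toL2 W') \<in> gradL2 D" using has_weak_gradient_iff[OF DB f' W'] W(2) pf by simp
  \<comment> \<open>\<open>weak_grad\<close> is an arbitrary choice; uniqueness in the graph shows
    that it agrees almost everywhere with the gradient at hand.\<close>
  then have "toL2 W' = G" using gradL2_unique[OF D _ pG] by blast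
  then have WG: "AE x in lborel. W' x = ofL2 G x"
    using toL2_eq_iff[OF W'(1) sqint_ofL2[of G]] by simp
  show *: "AE x in lborel. x \<in> D \<longrightarrow> weak_grad D f x = ofL2 G x"
    using W'(3) WG by eventually_elim auto
  then have Wx: "AE x in lborel. x \<in> D \<longrightarrow> weak_grad D f x = G' x" using G'(3) by eventually_elim auto
  note 1 = integral_lebesgue_on_inner[OF DB f' f'(1,3)]
  note 2 = integral_lebesgue_on_inner[OF DB G'(1,2) Wx G'(1) Wx]
  show "H1_norm_sq D f = (norm p)\<^sup>2 + (norm G)\<^sup>2"
    using 1 2 by (simp add: H1_norm_sq_def power2_norm_eq_inner pf GG power2_eq_square[of "f _"])
qed

section \<open>Space-time functions\<close>

lemma toL2_dominated_convergence:
  fixes f :: "nat \<Rightarrow> 'a::euclidean_space \<Rightarrow> 'b::euclidean_space" and g :: "'a \<Rightarrow> 'c::euclidean_space"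
  assumes g: "sqint g" and [measurable]: "\<And>n. f n \<in> borel_measurable borel"
    and le: "\<And>n x. norm (f n x) \<le> norm (g x)" and lim: "\<And>x. (\<lambda>n. f n x) \<longlonglongrightarrow> l x"
  shows "(\<lambda>n. toL2 (f n)) \<longlonglongrightarrow> toL2 l"
proof -
  have [measurable]: "l \<in> borel_measurable borel"
    by (rule borel_measurable_LIMSEQ_metric[OF _ lim]) measurable
  have ll: "norm (l x) \<le> norm (g x)" for x
    using le by (intro LIMSEQ_le_const2[OF tendsto_norm[OF lim]]) auto
  have sq: "sqint (f n)" for n
    by (rule sqint_bound[OF _ sqint_integrable[OF g]]) (auto intro!: power_mono le)
  have sl: "sqint l"
    by (rule sqint_bound[OF _ sqint_integrable[OF g]]) (auto intro!: power_mono ll)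
  have gi: "integrable lborel (\<lambda>x. 4 * (norm (g x))\<^sup>2)" using sqint_integrable[OF g] by simp
  have "(\<lambda>n. LINT x|lborel. (norm (f n x - l x))\<^sup>2) \<longlonglongrightarrow> (LINT x::'a|lborel. (0::real))"
  proof (rule integral_dominated_convergence)
    show "integrable lborel (\<lambda>x. 4 * (norm (g x))\<^sup>2)" by (rule gi)
    have "(\<lambda>n. (norm (f n x - l x))\<^sup>2) \<longlonglongrightarrow> (norm (l x - l x))\<^sup>2" for x
      by (intro tendsto_intros lim)
    then show "AE x in lborel. (\<lambda>n. (norm (f n x - l x))\<^sup>2) \<longlonglongrightarrow> 0" by simp
    show "AE x in lborel. norm ((norm (f n x - l x))\<^sup>2) \<le> 4 * (norm (g x))\<^sup>2" for n
    proof (rule AE_I2)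
      fix x
      have "norm (f n x - l x) \<le> 2 * norm (g x)"
        using norm_triangle_ineq4[of "f n x" "l x"] le[of n x] ll[of x] by linarith
      then have "(norm (f n x - l x))\<^sup>2 \<le> (2 * norm (g x))\<^sup>2" by (intro power_mono) auto
      then show "norm ((norm (f n x - l x))\<^sup>2) \<le> 4 * (norm (g x))\<^sup>2" by (simp add: power_mult_distrib)
    qed
  qed measurable
  then have "(\<lambda>n. (norm (toL2 (f n) - toL2 l))\<^sup>2) \<longlonglongrightarrow> 0"
    by (simp add: norm_toL2[OF sqint_diff[OF sq sl]] toL2_diff[OF sq sl, symmetric])
  then have "(\<lambda>n. sqrt ((norm (toL2 (f n) - toL2 l))\<^sup>2)) \<longlonglongrightarrow> sqrt 0" by (rule tendsto_real_sqrt)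
  then show ?thesis by (simp add: tendsto_norm_zero_iff LIM_zero_iff)
qed

lemma norm_toL2_nn:
  assumes "sqint f"
  shows "ennreal ((norm (toL2 f))\<^sup>2) = (\<integral>\<^sup>+x. ennreal ((norm (f x))\<^sup>2) \<partial>lborel)"
  unfolding norm_toL2[OF assms] by (rule nn_integral_eq_integral[symmetric]) (auto intro: sqint_integrable assms)

lemma joint_nn_integral:
  fixes f :: "'a::euclidean_space \<times> real \<Rightarrow> ennreal"
  assumes "f \<in> borel_measurable borel"
  shows "(\<integral>\<^sup>+z. f z \<partial>lborel) = (\<integral>\<^sup>+t. (\<integral>\<^sup>+x. f (x, t) \<partial>lborel) \<partial>lborel)"
  using lborel_pair.nn_integral_snd[of f] assms by (simp add: lborel_prod)

text \<open>Tonelli turns bounds on the slices into square integrability in space-time. The factor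
  \<omega> serves both as a decaying weight and as an indicator of a time interval.\<close>

lemma joint_sqint:
  fixes F :: "'a::euclidean_space \<times> real \<Rightarrow> real" and X :: "real \<Rightarrow> ('a, real) L2" and \<omega> :: "real \<Rightarrow> real"
  assumes F [measurable]: "F \<in> borel_measurable borel" and w [measurable]: "\<omega> \<in> borel_measurable borel"
    and sl: "AE t in lborel. \<omega> t \<noteq> 0 \<longrightarrow> (AE x in lborel. F (x, t) = ofL2 (X t) x)"
    and bd: "\<And>t. \<omega> t \<noteq> 0 \<Longrightarrow> (\<omega> t * norm (X t))\<^sup>2 \<le> B t" and B: "integrable lborel B" "\<And>t. 0 \<le> B t"
  shows "sqint (\<lambda>z. \<omega> (snd z) * F z)"
    and "norm (toL2 (\<lambda>z. \<omega> (snd z) * F z)) \<le> sqrt (LINT t|lborel. B t)"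
proof -
  have m [measurable]: "(\<lambda>z. \<omega> (snd z) * F z) \<in> borel_measurable borel"
    unfolding borel_prod[symmetric] by (measurable, simp add: borel_prod)
  have "(\<integral>\<^sup>+z. ennreal ((norm (\<omega> (snd z) * F z))\<^sup>2) \<partial>lborel)
      = (\<integral>\<^sup>+t. (\<integral>\<^sup>+x. ennreal ((norm (\<omega> t * F (x, t)))\<^sup>2) \<partial>lborel) \<partial>lborel)"
    by (subst joint_nn_integral) simp_all
  also have "\<dots> \<le> (\<integral>\<^sup>+t. ennreal (B t) \<partial>lborel)"
  proof (rule nn_integral_mono_AE, rule AE_mp[OF sl], intro AE_I2 impI)
    fix t assume t: "\<omega> t \<noteq> 0 \<longrightarrow> (AE x in lborel. F (x, t) = ofL2 (X t) x)"
    show "(\<integral>\<^sup>+x. ennreal ((norm (\<omega> t * F (x, t)))\<^sup>2) \<partial>lborel) \<le> ennreal (B t)"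
    proof (cases "\<omega> t = 0")
      case False
      have "(\<integral>\<^sup>+x. ennreal ((norm (\<omega> t * F (x, t)))\<^sup>2) \<partial>lborel) = (\<integral>\<^sup>+x. ennreal ((norm (\<omega> t *\<^sub>R ofL2 (X t) x))\<^sup>2) \<partial>lborel)"
        by (rule nn_integral_cong_AE) (use t False in \<open>auto elim!: AE_mp\<close>)
      also have "\<dots> = ennreal ((norm (toL2 (\<lambda>x. \<omega> t *\<^sub>R ofL2 (X t) x)))\<^sup>2)"
        by (rule norm_toL2_nn[symmetric]) (intro sqint_scaleR sqint_ofL2)
      also have "\<dots> = ennreal ((\<omega> t * norm (X t))\<^sup>2)"
        unfolding toL2_scaleR[OF sqint_ofL2] by (simp add: power_mult_distrib)
      finally show ?thesis using bd[OF False] by (simp add: ennreal_leI)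
    qed simp
  qed
  also have "\<dots> = ennreal (LINT t|lborel. B t)" using B by (intro nn_integral_eq_integral) auto
  finally have le: "(\<integral>\<^sup>+z. ennreal ((norm (\<omega> (snd z) * F z))\<^sup>2) \<partial>lborel) \<le> ennreal (LINT t|lborel. B t)" .
  show sq: "sqint (\<lambda>z. \<omega> (snd z) * F z)"
    unfolding sqint_def using le_less_trans[OF le ennreal_less_top] by (auto simp: integrable_iff_bounded)
  have B0: "0 \<le> (LINT t|lborel. B t)" using B(2) by (intro integral_nonneg_AE) auto
  have "(norm (toL2 (\<lambda>z. \<omega> (snd z) * F z)))\<^sup>2 \<le> (LINT t|lborel. B t)"
    using le B0 unfolding norm_toL2_nn[OF sq, symmetric] by (subst (asm) ennreal_le_iff) auto
  then show "norm (toL2 (\<lambda>z. \<omega> (snd z) * F z)) \<le> sqrt (LINT t|lborel. B t)" by (rule real_le_rsqrt)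
qed

lemma inverse_square_integrable:
  "integrable lborel (\<lambda>t::real. indicator {0..} t / (1 + t)\<^sup>2)"
proof -
  have "((\<lambda>t::real. - (1 / (1 + t))) \<longlongrightarrow> - 0) at_top"
    by (intro tendsto_minus tendsto_divide_0[OF tendsto_const] filterlim_at_top_imp_at_infinity
        filterlim_tendsto_add_at_top[OF tendsto_const] filterlim_ident)
  then have lim: "((\<lambda>t::real. - (1 / (1 + t))) \<longlongrightarrow> 0) at_top" by simp
  have "(\<integral>\<^sup>+t. ennreal (1 / (1 + t)\<^sup>2) * indicator {0..} t \<partial>lborel) = ennreal (0 - - (1 / (1 + 0)))"
  proof (rule nn_integral_FTC_atLeast[OF _ _ _ lim])
    show "(\<lambda>t::real. 1 / (1 + t)\<^sup>2) \<in> borel_measurable borel" by measurable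
    show "((\<lambda>t. - (1 / (1 + t))) has_real_derivative 1 / (1 + t)\<^sup>2) (at t)" if "0 \<le> t" for t
      using that by (auto intro!: derivative_eq_intros simp: power2_eq_square field_simps)
  qed auto
  then have "(\<integral>\<^sup>+t. ennreal (norm (indicator {0..} t / (1 + t)\<^sup>2 :: real)) \<partial>lborel) < \<infinity>"
    by (subst nn_integral_cong[of _ _ "\<lambda>t. ennreal (1 / (1 + t)\<^sup>2) * indicator {0..} t"]) (auto simp: indicator_def)
  then show ?thesis by (intro integrableI_bounded) auto
qed

text \<open>Strongly convergent convex combinations of the approximations in space-time identify the slices
  of their limit at almost every time; the remaining times form a null set.\<close>

lemma joint_representative:
  fixes f :: "nat \<Rightarrow> 'a::euclidean_space \<times> real \<Rightarrow> real" and X :: "real \<Rightarrow> ('a, real) L2"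
  assumes f [measurable]: "\<And>n. f n \<in> borel_measurable borel"
    and sq: "\<And>n t. 0 \<le> t \<Longrightarrow> sqint (\<lambda>x. f n (x, t))"
    and bd: "\<And>n t. 0 \<le> t \<Longrightarrow> norm (toL2 (\<lambda>x. f n (x, t))) \<le> C * (1 + t)"
    and weak: "\<And>t \<phi>. 0 \<le> t \<Longrightarrow> (\<lambda>n. inner (toL2 (\<lambda>x. f n (x, t))) \<phi>) \<longlonglongrightarrow> inner (X t) \<phi>"
  shows "\<exists>u F. F \<in> borel_measurable borel \<and> (AE z in lborel. u z = F z) \<and>
           (AE t in lborel. 0 \<le> t \<longrightarrow> (AE x in lborel. F (x, t) = ofL2 (X t) x)) \<and>
           (\<forall>t\<ge>0. AE x in lborel. u (x, t) = ofL2 (X t) x)"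
proof -
  \<comment> \<open>The slices may grow linearly in time; this weight leaves a bound of order
    \<open>1 / (1 + t)\<close>, whose square is integrable over the half line.\<close>
  define \<omega> where "\<omega> t = indicator {0..} t / (1 + \<bar>t\<bar>)\<^sup>2" for t :: real
  have w [measurable]: "\<omega> \<in> borel_measurable borel" unfolding \<omega>_def by measurable
  define B where "B t = C\<^sup>2 * (indicator {0..} t / (1 + t)\<^sup>2)" for t :: real
  have B: "integrable lborel B" "\<And>t. 0 \<le> B t"
    unfolding B_def by (rule integrable_mult_right[OF inverse_square_integrable]) (simp add: indicator_def)
  define Fn where "Fn n z = \<omega> (snd z) * f n z" for n z
  have Xn: "AE t in lborel. \<omega> t \<noteq> 0 \<longrightarrow> (AE x in lborel. f n (x, t) = ofL2 (toL2 (\<lambda>x. f n (x, t))) x)" for n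
  proof (rule AE_I2, rule impI)
    fix t assume "\<omega> t \<noteq> 0"
    then have "0 \<le> t" by (auto simp: \<omega>_def indicator_def split: if_splits)
    show "AE x in lborel. f n (x, t) = ofL2 (toL2 (\<lambda>x. f n (x, t))) x"
      using ofL2_toL2[OF sq[OF \<open>0 \<le> t\<close>], of n] by eventually_elim simp
  qed
  have wB: "(\<omega> t * norm (toL2 (\<lambda>x. f n (x, t))))\<^sup>2 \<le> B t" if "\<omega> t \<noteq> 0" for n t
  proof -
    have t: "0 \<le> t" using that by (auto simp: \<omega>_def indicator_def split: if_splits)
    have "(\<omega> t * norm (toL2 (\<lambda>x. f n (x, t))))\<^sup>2 \<le> (\<omega> t * (C * (1 + t)))\<^sup>2"
      using t bd[OF t] by (intro power_mono mult_left_mono) (auto simp: \<omega>_def)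
    also have "\<omega> t * (C * (1 + t)) = C / (1 + t)" using t by (simp add: \<omega>_def power2_eq_square)
    also have "(C / (1 + t))\<^sup>2 = B t" using t by (simp add: B_def power_divide)
    finally show ?thesis .
  qed
  note J = joint_sqint[OF f w Xn wB B]
  have FnS: "sqint (Fn n)" for n unfolding Fn_def[abs_def] by (rule J(1))
  have FnB: "norm (toL2 (Fn n)) \<le> sqrt (LINT t|lborel. B t)" for n unfolding Fn_def[abs_def] by (rule J(2))
  have [measurable]: "Fn n \<in> borel_measurable borel" for n using FnS by (rule sqint_measurable)
  \<comment> \<open>Weak convergence of the slices gives no convergence in space-time norm. Convex
    combinations do converge strongly there, and slicewise they have the same weak limits.\<close>
  obtain I c Y where I: "\<And>n. finite (I n) \<and> I n \<subseteq> {n..} \<and> (\<forall>i\<in>I n. 0 \<le> c n i) \<and> sum (c n) (I n) = 1"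
    and Y: "(\<lambda>n. \<Sum>i\<in>I n. c n i *\<^sub>R toL2 (Fn i)) \<longlonglongrightarrow> Y"
    using mazur[of "\<lambda>n. toL2 (Fn n)", OF FnB] by blast
  define Gn where "Gn n z = (\<Sum>i\<in>I n. c n i *\<^sub>R Fn i z)" for n z
  have GnS: "sqint (Gn n)" and GnY: "toL2 (Gn n) = (\<Sum>i\<in>I n. c n i *\<^sub>R toL2 (Fn i))" for n
  proof -
    have "sqint (\<lambda>z. \<Sum>i\<in>S. c n i *\<^sub>R Fn i z) \<and> toL2 (\<lambda>z. \<Sum>i\<in>S. c n i *\<^sub>R Fn i z) = (\<Sum>i\<in>S. c n i *\<^sub>R toL2 (Fn i))"
      if "finite S" for S using that
    proof (induction S)
      case (insert i S)
      then show ?case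
        using sqint_add[OF sqint_scaleR[OF FnS[of i]]] toL2_add[OF sqint_scaleR[OF FnS[of i]]] toL2_scaleR[OF FnS[of i]]
        by (simp del: real_scaleR_def)
    qed (simp add: toL2_0)
    then show "sqint (Gn n)" "toL2 (Gn n) = (\<Sum>i\<in>I n. c n i *\<^sub>R toL2 (Fn i))"
      using I[of n] by (auto simp: Gn_def[abs_def])
  qed
  define y where "y = ofL2 Y"
  have y [measurable]: "y \<in> borel_measurable borel" and yS: "sqint y" by (auto simp: y_def)
  have [measurable]: "Gn n \<in> borel_measurable borel" for n using GnS by (rule sqint_measurable)
  define dn where "dn n z = (norm (Gn n z - y z))\<^sup>2" for n z
  have dnI: "integrable lborel (dn n)" for n
    unfolding dn_def using sqint_integrable[OF sqint_diff[OF GnS yS]] .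
  have dnI': "integrable (lborel \<Otimes>\<^sub>M lborel) (dn n)" for n using dnI by (simp add: lborel_prod)
  have "(\<lambda>n. (norm (toL2 (Gn n) - Y))\<^sup>2) \<longlonglongrightarrow> (norm (Y - Y))\<^sup>2"
    unfolding GnY by (intro tendsto_intros Y)
  moreover have "(norm (toL2 (Gn n) - Y))\<^sup>2 = (LINT z|lborel. dn n z)" for n
    using norm_toL2[OF sqint_diff[OF GnS yS]] toL2_diff[OF GnS yS] by (simp add: dn_def y_def)
  ultimately have lim0: "(\<lambda>n. LINT z|lborel. dn n z) \<longlonglongrightarrow> 0" by simp
  define Dn where "Dn n t = (LINT x|lborel. dn n (x, t))" for n t
  have dnI2: "integrable (lborel \<Otimes>\<^sub>M lborel) (\<lambda>(x, t). dn n (x, t))" for n using dnI' by simp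
  have Dn: "integrable lborel (Dn n)" "(LINT t|lborel. Dn n t) = (LINT z|lborel. dn n z)" for n
    using lborel_pair.integrable_snd[OF dnI2] lborel_pair.integral_snd[OF dnI2]
    by (auto simp: Dn_def[abs_def] lborel_prod)
  have Dn0: "0 \<le> Dn n t" for n t unfolding Dn_def dn_def by (intro integral_nonneg_AE) auto
  have "(\<lambda>n. LINT t|lborel. norm (Dn n t)) \<longlonglongrightarrow> 0"
    using lim0 Dn0 by (simp add: Dn)
  from tendsto_L1_AE_subseq[OF Dn(1) this]
  \<comment> \<open>Convergence in space-time makes the squared distances of the slices converge to
    zero in L1 of time; a subsequence then converges at almost every time, which identifies the
    slices of \<open>y\<close>.\<close>
  obtain r where r: "strict_mono r" "AE t in lborel. (\<lambda>n. Dn (r n) t) \<longlonglongrightarrow> 0" by blast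
  have AEd: "AE t in lborel. \<forall>n. integrable lborel (\<lambda>x. dn n (x, t))"
    unfolding AE_all_countable using lborel_pair.AE_integrable_snd[OF dnI2] by auto
  have slice_m: "(\<lambda>x. h (x, t)) \<in> borel_measurable borel" if "h \<in> borel_measurable borel" for h :: "'a \<times> real \<Rightarrow> real" and t
    using that by measurable
  have good: "AE t in lborel. 0 \<le> t \<longrightarrow> (AE x in lborel. (1 + \<bar>t\<bar>)\<^sup>2 * y (x, t) = ofL2 (X t) x)"
    using r(2) AEd
  proof eventually_elim
    case (elim t)
    show ?case
    proof
      assume t: "0 \<le> t"
      have wt: "\<omega> t = 1 / (1 + \<bar>t\<bar>)\<^sup>2" "\<omega> t \<noteq> 0" using t by (auto simp: \<omega>_def)
      define gt where "gt n x = Gn n (x, t)" for n x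
      have fs: "sqint (\<lambda>x. Fn i (x, t))" "toL2 (\<lambda>x. Fn i (x, t)) = \<omega> t *\<^sub>R toL2 (\<lambda>x. f i (x, t))" for i
        using sqint_scaleR[OF sq[OF t], of "\<omega> t" i] toL2_scaleR[OF sq[OF t], of "\<omega> t" i] by (simp_all add: Fn_def)
      have gs: "sqint (gt n)" and gY: "toL2 (gt n) = (\<Sum>i\<in>I n. c n i *\<^sub>R toL2 (\<lambda>x. Fn i (x, t)))" for n
      proof -
        have "sqint (\<lambda>x. \<Sum>i\<in>S. c n i *\<^sub>R Fn i (x, t)) \<and>
            toL2 (\<lambda>x. \<Sum>i\<in>S. c n i *\<^sub>R Fn i (x, t)) = (\<Sum>i\<in>S. c n i *\<^sub>R toL2 (\<lambda>x. Fn i (x, t)))"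
          if "finite S" for S using that
        proof (induction S)
          case (insert i S)
          then show ?case
            using sqint_add[OF sqint_scaleR[OF fs(1)[of i]]] toL2_add[OF sqint_scaleR[OF fs(1)[of i]]] toL2_scaleR[OF fs(1)[of i]]
            by (simp del: real_scaleR_def)
        qed (simp add: toL2_0)
        then show "sqint (gt n)" "toL2 (gt n) = (\<Sum>i\<in>I n. c n i *\<^sub>R toL2 (\<lambda>x. Fn i (x, t)))"
          using I[of n] by (auto simp: gt_def[abs_def] Gn_def)
      qed
      have "sqint (\<lambda>x. gt 0 x - y (x, t))"
        using elim(2) slice_m[OF y, of t] sqint_measurable[OF gs]
        by (auto simp: sqint_def dn_def gt_def)
      from sqint_diff[OF gs[of 0] this] have ys: "sqint (\<lambda>x. y (x, t))" by simp
      have "(norm (toL2 (gt n) - toL2 (\<lambda>x. y (x, t))))\<^sup>2 = Dn n t" for n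
        using norm_toL2[OF sqint_diff[OF gs ys]] toL2_diff[OF gs ys] by (simp add: Dn_def dn_def gt_def)
      then have "(\<lambda>n. sqrt ((norm (toL2 (gt (r n)) - toL2 (\<lambda>x. y (x, t))))\<^sup>2)) \<longlonglongrightarrow> sqrt 0"
        using elim(1) by (intro tendsto_real_sqrt) simp
      then have strong: "(\<lambda>n. toL2 (gt (r n))) \<longlonglongrightarrow> toL2 (\<lambda>x. y (x, t))"
        by (simp add: tendsto_norm_zero_iff LIM_zero_iff)
      have "inner (toL2 (\<lambda>x. y (x, t)) - \<omega> t *\<^sub>R X t) \<phi> = 0" for \<phi>
      proof -
        have "(\<lambda>n. \<Sum>i\<in>I n. c n i * (\<omega> t * inner (toL2 (\<lambda>x. f i (x, t))) \<phi>)) \<longlonglongrightarrow> \<omega> t * inner (X t) \<phi>"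
          by (rule convex_combinations_tendsto[OF I]) (intro tendsto_intros weak t)
        then have "(\<lambda>n. inner (toL2 (gt n)) \<phi>) \<longlonglongrightarrow> \<omega> t * inner (X t) \<phi>"
          by (simp add: gY fs(2) inner_sum_left mult.assoc)
        then have "(\<lambda>n. inner (toL2 (gt (r n))) \<phi>) \<longlonglongrightarrow> \<omega> t * inner (X t) \<phi>"
          using LIMSEQ_subseq_LIMSEQ[OF _ r(1)] by (auto simp: comp_def)
        moreover have "(\<lambda>n. inner (toL2 (gt (r n))) \<phi>) \<longlonglongrightarrow> inner (toL2 (\<lambda>x. y (x, t))) \<phi>"
          by (intro tendsto_intros strong)
        ultimately have "\<omega> t * inner (X t) \<phi> = inner (toL2 (\<lambda>x. y (x, t))) \<phi>" by (rule LIMSEQ_unique)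
        then show ?thesis by (simp add: inner_diff_left)
      qed
      from this[of "toL2 (\<lambda>x. y (x, t)) - \<omega> t *\<^sub>R X t"]
      have "toL2 (\<lambda>x. y (x, t)) = \<omega> t *\<^sub>R X t" by simp
      then have "toL2 (\<lambda>x. y (x, t)) = toL2 (\<lambda>x. \<omega> t *\<^sub>R ofL2 (X t) x)" by (simp only: toL2_scaleR[OF sqint_ofL2] toL2_ofL2)
      then have "AE x in lborel. y (x, t) = \<omega> t *\<^sub>R ofL2 (X t) x"
        using toL2_eq_iff[OF ys sqint_scaleR[OF sqint_ofL2]] by blast
      then show "AE x in lborel. (1 + \<bar>t\<bar>)\<^sup>2 * y (x, t) = ofL2 (X t) x"
        by eventually_elim (use wt in \<open>simp add: divide_eq_eq\<close>)
    qed
  qed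
  define F where "F z = (1 + \<bar>snd z\<bar>)\<^sup>2 * y z" for z
  have F: "F \<in> borel_measurable borel"
    unfolding F_def borel_prod[symmetric] by (measurable, simp add: borel_prod)
  have goodF: "AE t in lborel. 0 \<le> t \<longrightarrow> (AE x in lborel. F (x, t) = ofL2 (X t) x)"
    using good by (simp add: F_def)
  from goodF obtain N where N': "{t \<in> space lborel. \<not> (0 \<le> t \<longrightarrow> (AE x in lborel. F (x, t) = ofL2 (X t) x))} \<subseteq> N"
      "emeasure lborel N = 0" "N \<in> sets lborel" by (rule AE_E)
  have N: "N \<in> null_sets lborel" "\<And>t. t \<notin> N \<Longrightarrow> 0 \<le> t \<Longrightarrow> (AE x in lborel. F (x, t) = ofL2 (X t) x)"
    using N' by auto
  \<comment> \<open>At the exceptional times the slice is replaced by the prescribed limit. This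
    alters \<open>F\<close> on a null set of space-time only, yet makes every slice correct; joint
    measurability is kept in the completed sense.\<close>
  define u where "u z = (if snd z \<in> N then ofL2 (X (snd z)) (fst z) else F z)" for z
  have "AE z in lborel. u z = F z"
  proof (rule AE_I')
    have "emeasure (lborel \<Otimes>\<^sub>M lborel) ((UNIV :: 'a set) \<times> N) = emeasure lborel (UNIV::'a set) * emeasure lborel N"
      using N'(3) by (intro sigma_finite_measure.emeasure_pair_measure_Times sigma_finite_lborel) auto
    then have "emeasure (lborel :: ('a \<times> real) measure) ((UNIV :: 'a set) \<times> N) = 0"
      using N(1) by (simp add: lborel_prod null_sets_def)
    moreover have "UNIV \<times> N \<in> sets (lborel :: ('a \<times> real) measure)"
      using N(1) by (auto simp: null_sets_def lborel_prod[symmetric] intro!: pair_measureI)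
    ultimately show "UNIV \<times> N \<in> null_sets (lborel :: ('a \<times> real) measure)" by (simp add: null_sets_def)
    show "{z \<in> space lborel. u z \<noteq> F z} \<subseteq> UNIV \<times> N" by (auto simp: u_def split: if_splits)
  qed
  moreover have "AE x in lborel. u (x, t) = ofL2 (X t) x" if "0 \<le> t" for t
    using N(2)[OF _ that] by (cases "t \<in> N") (auto simp: u_def)
  ultimately show ?thesis using F goodF by blast
qed

subsection \<open>Weak derivatives from bounded functionals\<close>

text \<open>An L2 bound for the distributional derivative, tested on smooth functions, makes it an
  L2 function by Riesz. The graph form is convenient because the functional is defined on test
  functions, not on their classes.\<close>

lemma weak_partial_from_bound:
  fixes U :: "'c::euclidean_space set" and f f' :: "'c \<Rightarrow> real"
  assumes U: "open U" and b: "b \<in> Basis"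
    and f': "f' \<in> borel_measurable borel" "AE x in lborel. x \<in> U \<longrightarrow> f x = f' x"
    and loc: "locally_integrable_on U f"
    and bd: "\<And>\<phi>. \<phi> \<in> Cc_infinity U \<Longrightarrow> \<bar>LINT x|lborel. f' x * partial_deriv b \<phi> x\<bar> \<le> C * norm (toL2 \<phi>)"
  shows "\<exists>w\<in>L2_space U. has_weak_partial U b f w"
proof -
  have UB: "U \<in> sets borel" using U by simp
  note [measurable] = f'(1)
  define l where "l \<phi> = (LINT x|lborel. f' x * partial_deriv b \<phi> x)" for \<phi>
  have int: "integrable lborel (\<lambda>x. f' x * \<phi> x)" if \<phi>: "\<phi> \<in> Cc_infinity U" for \<phi>
  proof -
    let ?K = "closure {x. \<phi> x \<noteq> 0}"
    have K: "compact ?K" "?K \<subseteq> U" using Cc_infinityD(2,3)[OF \<phi>] by auto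
    have "AE x in lborel. x \<in> ?K \<longrightarrow> f x = f' x" using f'(2) by eventually_elim (use K in auto)
    then have "integrable (lebesgue_on ?K) f \<longleftrightarrow> integrable lborel (\<lambda>x. indicator ?K x *\<^sub>R f' x)"
      by (intro integrable_lebesgue_on_iff borel_compact K f')
    then have i: "integrable lborel (\<lambda>x. indicator ?K x * f' x)"
      using loc K by (simp add: locally_integrable_on_def)
    obtain M where M: "\<And>x. \<bar>\<phi> x\<bar> \<le> M" using Cc_infinity_bounded[OF \<phi>] by blast
    have M0: "0 \<le> M" using M[of undefined] by linarith
    show ?thesis
    proof (rule Bochner_Integration.integrable_bound)
      show "integrable lborel (\<lambda>x. M * (indicator ?K x * f' x))" using i by (rule integrable_mult_right)
      show "(\<lambda>x. f' x * \<phi> x) \<in> borel_measurable lborel" using Cc_infinity_measurable[OF \<phi>] by measurable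
      show "AE x in lborel. norm (f' x * \<phi> x) \<le> norm (M * (indicator ?K x * f' x))"
      proof (rule AE_I2)
        fix x
        show "norm (f' x * \<phi> x) \<le> norm (M * (indicator ?K x * f' x))"
          using Cc_infinity_support_zero[of x \<phi>] mult_right_mono[OF M[of x], of "\<bar>f' x\<bar>"] M0
          by (cases "x \<in> ?K") (auto simp: abs_mult mult.commute)
      qed
    qed
  qed
  have d: "\<phi> differentiable (at x)" if "\<phi> \<in> Cc_infinity U" for \<phi> x using Cc_infinityD(4)[OF that] .
  have add: "l (\<lambda>x. \<phi> x + \<psi> x) = l \<phi> + l \<psi>" if "\<phi> \<in> Cc_infinity U" "\<psi> \<in> Cc_infinity U" for \<phi> \<psi>
    unfolding l_def using int[OF Cc_infinity_partial_deriv[OF that(1) b]] int[OF Cc_infinity_partial_deriv[OF that(2) b]]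
    by (simp add: partial_deriv_add d that distrib_left)
  have sc: "l (\<lambda>x. c * \<phi> x) = c * l \<phi>" if "\<phi> \<in> Cc_infinity U" for c \<phi>
  proof -
    have "partial_deriv b (\<lambda>x. c * \<phi> x) = (\<lambda>x. c * partial_deriv b \<phi> x)"
      using partial_deriv_mult[of "\<lambda>x. c" _ \<phi> b] d[OF that] by (auto simp: partial_deriv_const)
    then show ?thesis by (simp add: l_def mult.left_commute)
  qed
  have "\<exists>w. \<forall>(a, s)\<in>(\<lambda>\<phi>. (toL2 \<phi>, l \<phi>)) ` Cc_infinity U. s = inner w a"
  proof (rule riesz_graph[where B=C])
    show "subspace ((\<lambda>\<phi>. (toL2 \<phi>, l \<phi>)) ` Cc_infinity U)"
    proof (rule subspaceI)
      have "l (\<lambda>x. 0) = 0" by (simp add: l_def partial_deriv_const)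
      then show "0 \<in> (\<lambda>\<phi>. (toL2 \<phi>, l \<phi>)) ` Cc_infinity U"
        by (intro image_eqI[of _ _ "\<lambda>x. 0"]) (auto simp: toL2_0 zero_prod_def Cc_infinity_zero)
    next
      fix x y assume "x \<in> (\<lambda>\<phi>. (toL2 \<phi>, l \<phi>)) ` Cc_infinity U" "y \<in> (\<lambda>\<phi>. (toL2 \<phi>, l \<phi>)) ` Cc_infinity U"
      then obtain \<phi> \<psi> where *: "\<phi> \<in> Cc_infinity U" "\<psi> \<in> Cc_infinity U" "x = (toL2 \<phi>, l \<phi>)" "y = (toL2 \<psi>, l \<psi>)" by auto
      show "x + y \<in> (\<lambda>\<phi>. (toL2 \<phi>, l \<phi>)) ` Cc_infinity U"
        by (rule image_eqI[of _ _ "\<lambda>x. \<phi> x + \<psi> x"])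
           (use * in \<open>auto simp: add toL2_add Cc_infinity_sqint intro: Cc_infinity_add\<close>)
    next
      fix c x assume "x \<in> (\<lambda>\<phi>. (toL2 \<phi>, l \<phi>)) ` Cc_infinity U"
      then obtain \<phi> where *: "\<phi> \<in> Cc_infinity U" "x = (toL2 \<phi>, l \<phi>)" by auto
      show "c *\<^sub>R x \<in> (\<lambda>\<phi>. (toL2 \<phi>, l \<phi>)) ` Cc_infinity U"
        by (rule image_eqI[of _ _ "\<lambda>x. c * \<phi> x"])
           (use * toL2_scaleR[OF Cc_infinity_sqint[OF *(1)], of c] in \<open>auto simp: sc intro: Cc_infinity_scale\<close>)
    qed
  qed (use bd in \<open>auto simp: l_def\<close>)
  then obtain W where W: "\<And>\<phi>. \<phi> \<in> Cc_infinity U \<Longrightarrow> l \<phi> = inner W (toL2 \<phi>)" by auto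
  \<comment> \<open>The minus sign is the one from integration by parts; the indicator extends the
    derivative by zero.\<close>
  define w where "w x = indicator U x *\<^sub>R ofL2 (- W) x" for x
  have wS: "sqint w" unfolding w_def[abs_def]
    by (rule sqint_mult[OF sqint_ofL2, where K=1]) (use UB in \<open>auto simp: indicator_def\<close>)
  have wL: "w \<in> L2_space U"
  proof -
    have "sqint (\<lambda>x. indicator U x *\<^sub>R w x)"
      by (rule sqint_mult[OF wS, where K=1]) (use UB in \<open>auto simp: indicator_def\<close>)
    then show ?thesis using L2_space_iff[OF UB sqint_measurable[OF wS], of w] by blast
  qed
  have "(LINT x|lebesgue_on U. f x * partial_deriv b \<phi> x) = - (LINT x|lebesgue_on U. w x * \<phi> x)"
    if \<phi>: "\<phi> \<in> Cc_infinity U" for \<phi>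
  proof -
    note p = Cc_infinity_partial_deriv[OF \<phi> b]
    have m: "(\<lambda>x. f' x * partial_deriv b \<phi> x) \<in> borel_measurable borel"
      using Cc_infinity_measurable[OF p] by measurable
    have e: "AE x in lborel. x \<in> U \<longrightarrow> f x * partial_deriv b \<phi> x = f' x * partial_deriv b \<phi> x"
      using f'(2) by eventually_elim auto
    have "(LINT x|lebesgue_on U. f x * partial_deriv b \<phi> x) = (LINT x|lborel. indicator U x *\<^sub>R (f' x * partial_deriv b \<phi> x))"
      by (rule integral_lebesgue_on_eq[OF UB m e])
    also have "\<dots> = l \<phi>" unfolding l_def
      using Cc_infinity_zero_outside[OF p] by (intro Bochner_Integration.integral_cong) (auto simp: indicator_def)
    also have "\<dots> = - inner (- W) (toL2 \<phi>)" by (simp add: W[OF \<phi>])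
    also have "inner (- W) (toL2 \<phi>) = (LINT x|lborel. ofL2 (- W) x * \<phi> x)"
      by (simp add: inner_toL2_right[OF Cc_infinity_sqint[OF \<phi>]])
    also have "\<dots> = inner (toL2 w) (toL2 \<phi>)"
      unfolding inner_toL2[OF wS Cc_infinity_sqint[OF \<phi>]]
      using Cc_infinity_zero_outside[OF \<phi>] by (intro Bochner_Integration.integral_cong) (auto simp: w_def indicator_def)
    also have "\<dots> = (LINT x|lebesgue_on U. w x * \<phi> x)"
      using integral_lebesgue_on_inner(1)[OF UB wS _ _ Cc_infinity_sqint[OF \<phi>], of w \<phi>] by (simp add: w_def)
    finally show ?thesis .
  qed
  then show ?thesis
    using wL loc L2_space_locally_integrable[OF UB wL] by (auto simp: has_weak_partial_def)
qed

subsection \<open>Slices of space-time test functions\<close>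

text \<open>The factor \<kappa> is bounded only on the spatial support, so that the same statement
  covers the indicator of \<open>D\<close> and its product with the growing weight.\<close>

lemma slice_tendsto:
  fixes \<Psi> :: "'a::euclidean_space \<times> real \<Rightarrow> 'b::euclidean_space" and \<kappa> :: "'a \<Rightarrow> real"
  assumes c: "continuous_on UNIV \<Psi>" and K: "compact K" "\<And>x t. x \<notin> K \<Longrightarrow> \<Psi> (x, t) = 0"
    and M: "\<And>z. norm (\<Psi> z) \<le> M"
    and k [measurable]: "\<kappa> \<in> borel_measurable borel" and kb: "\<And>x. x \<in> K \<Longrightarrow> \<bar>\<kappa> x\<bar> \<le> C"
  shows "sqint (\<lambda>x. \<kappa> x *\<^sub>R \<Psi> (x, t))"
    and "s \<longlonglongrightarrow> t \<Longrightarrow> (\<lambda>n. toL2 (\<lambda>x. \<kappa> x *\<^sub>R \<Psi> (x, s n))) \<longlonglongrightarrow> toL2 (\<lambda>x. \<kappa> x *\<^sub>R \<Psi> (x, t))"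
proof -
  have m: "(\<lambda>x. \<kappa> x *\<^sub>R \<Psi> (x, t)) \<in> borel_measurable borel" for t
  proof -
    have "(\<lambda>x. \<Psi> (x, t)) \<in> borel_measurable borel"
      by (intro borel_measurable_continuous_onI continuous_on_compose2[OF c] continuous_intros) auto
    then show ?thesis by measurable
  qed
  have M0: "0 \<le> M" using M[of undefined] norm_ge_zero order_trans by blast
  have le: "norm (\<kappa> x *\<^sub>R \<Psi> (x, t)) \<le> norm ((\<bar>C\<bar> * M) * indicator K x :: real)" for x t
  proof (cases "x \<in> K")
    case True
    have "\<bar>\<kappa> x\<bar> * norm (\<Psi> (x, t)) \<le> \<bar>C\<bar> * M" using kb[OF True] M M0 by (intro mult_mono) auto
    then show ?thesis using True M0 by simp
  qed (simp add: K)
  have g: "sqint (\<lambda>x. (\<bar>C\<bar> * M) * indicator K x :: real)"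
    using sqint_scaleR[OF sqint_indicator_compact[OF K(1)], of "\<bar>C\<bar> * M"] by simp
  show "sqint (\<lambda>x. \<kappa> x *\<^sub>R \<Psi> (x, t))"
    by (rule sqint_bound[OF m sqint_integrable[OF g]]) (intro AE_I2 power_mono le norm_ge_zero)
  assume s: "s \<longlonglongrightarrow> t"
  show "(\<lambda>n. toL2 (\<lambda>x. \<kappa> x *\<^sub>R \<Psi> (x, s n))) \<longlonglongrightarrow> toL2 (\<lambda>x. \<kappa> x *\<^sub>R \<Psi> (x, t))"
  proof (rule toL2_dominated_convergence)
    show "sqint (\<lambda>x. (\<bar>C\<bar> * M) * indicator K x :: real)" by (rule g)
    show "norm (\<kappa> x *\<^sub>R \<Psi> (x, s n)) \<le> norm ((\<bar>C\<bar> * M) * indicator K x :: real)" for n x by (rule le)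
    show "(\<lambda>n. \<kappa> x *\<^sub>R \<Psi> (x, s n)) \<longlonglongrightarrow> \<kappa> x *\<^sub>R \<Psi> (x, t)" for x
    proof (intro tendsto_intros)
      have "isCont \<Psi> (x, t)" using c by (simp add: continuous_on_eq_continuous_at)
      moreover have "(\<lambda>n. (x, s n)) \<longlonglongrightarrow> (x, t)" by (intro tendsto_intros s)
      ultimately show "(\<lambda>n. \<Psi> (x, s n)) \<longlonglongrightarrow> \<Psi> (x, t)" by (rule isCont_tendsto_compose)
    qed
  qed (rule m)
qed

lemma Cc_infinity_slice_support:
  fixes \<eta> :: "'a::euclidean_space \<times> real \<Rightarrow> real"
  assumes \<eta>: "\<eta> \<in> Cc_infinity W"
  shows "compact (fst ` closure {z. \<eta> z \<noteq> 0})" "x \<notin> fst ` closure {z. \<eta> z \<noteq> 0} \<Longrightarrow> \<eta> (x, t) = 0"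
    "b \<in> Basis \<Longrightarrow> x \<notin> fst ` closure {z. \<eta> z \<noteq> 0} \<Longrightarrow> partial_deriv b \<eta> (x, t) = 0"
proof -
  show "compact (fst ` closure {z. \<eta> z \<noteq> 0})"
    by (intro compact_continuous_image continuous_intros Cc_infinityD(2)[OF \<eta>])
  assume x: "x \<notin> fst ` closure {z. \<eta> z \<noteq> 0}"
  then have "(x, t) \<notin> closure {z. \<eta> z \<noteq> 0}" by force
  then show "\<eta> (x, t) = 0" "b \<in> Basis \<Longrightarrow> partial_deriv b \<eta> (x, t) = 0"
    by (rule Cc_infinity_support_zero, rule partial_deriv_zero_outside)
qed

text \<open>Differentiability in time as a map into L2: the difference quotients converge pointwise
  and are dominated by the mean value bound on the compact spatial support.\<close>

lemma slice_derivative: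
  fixes \<eta> :: "'a::euclidean_space \<times> real \<Rightarrow> real" and \<kappa> :: "'a \<Rightarrow> real"
  assumes \<eta>: "\<eta> \<in> Cc_infinity W" and k [measurable]: "\<kappa> \<in> borel_measurable borel"
    and kb: "\<And>x. x \<in> fst ` closure {z. \<eta> z \<noteq> 0} \<Longrightarrow> \<bar>\<kappa> x\<bar> \<le> C"
  shows "((\<lambda>h. (1 / h) *\<^sub>R (toL2 (\<lambda>x. \<kappa> x * \<eta> (x, t + h)) - toL2 (\<lambda>x. \<kappa> x * \<eta> (x, t))))
           \<longlongrightarrow> toL2 (\<lambda>x. \<kappa> x * partial_deriv (0, 1) \<eta> (x, t))) (at 0)"
  unfolding tendsto_at_iff_sequentially
proof (intro allI impI)
  let ?K = "fst ` closure {z. \<eta> z \<noteq> 0}"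
  fix s :: "nat \<Rightarrow> real" assume s: "\<forall>i. s i \<in> UNIV - {0}" "s \<longlonglongrightarrow> 0"
  have B: "(0, 1) \<in> (Basis :: ('a \<times> real) set)" by (simp add: Basis_prod_def)
  note p = Cc_infinity_partial_deriv[OF \<eta> B]
  obtain M0 where M0: "\<And>z. \<bar>\<eta> z\<bar> \<le> M0" using Cc_infinity_bounded[OF \<eta>] by blast
  obtain M where M: "\<And>z. \<bar>partial_deriv (0, 1) \<eta> z\<bar> \<le> M" using Cc_infinity_bounded[OF p] by blast
  have Mn: "0 \<le> M" using M[of undefined] by linarith
  have sq: "sqint (\<lambda>x. \<kappa> x * \<eta> (x, t))" for t
  proof -
    have n: "norm (\<eta> z) \<le> M0" for z using M0[of z] by simp
    have "sqint (\<lambda>x. \<kappa> x *\<^sub>R \<eta> (x, t))"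
      by (rule slice_tendsto(1)[where K="?K" and M=M0 and C=C])
         (rule Cc_infinityD(5)[OF \<eta>] Cc_infinity_slice_support[OF \<eta>] n k kb; assumption)+
    then show ?thesis by (simp only: real_scaleR_def)
  qed
  have g: "sqint (\<lambda>x. (\<bar>C\<bar> * M) * indicator ?K x :: real)"
    using sqint_scaleR[OF sqint_indicator_compact[OF Cc_infinity_slice_support(1)[OF \<eta>]], of "\<bar>C\<bar> * M"] by simp
  have "(\<lambda>n. toL2 (\<lambda>x. (1 / s n) *\<^sub>R (\<kappa> x * \<eta> (x, t + s n) - \<kappa> x * \<eta> (x, t)))) \<longlonglongrightarrow> toL2 (\<lambda>x. \<kappa> x * partial_deriv (0, 1) \<eta> (x, t))"
  proof (rule toL2_dominated_convergence[OF g])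
    show "(\<lambda>x. (1 / s n) *\<^sub>R (\<kappa> x * \<eta> (x, t + s n) - \<kappa> x * \<eta> (x, t))) \<in> borel_measurable borel" for n
      using sqint_measurable[OF sq] by (intro borel_measurable_scaleR borel_measurable_diff) auto
    show "norm ((1 / s n) *\<^sub>R (\<kappa> x * \<eta> (x, t + s n) - \<kappa> x * \<eta> (x, t))) \<le> norm ((\<bar>C\<bar> * M) * indicator ?K x :: real)" for n x
    proof (cases "x \<in> ?K")
      case True
      have "\<bar>\<eta> ((x, t) + s n *\<^sub>R (0, 1)) - \<eta> (x, t)\<bar> \<le> M * \<bar>s n\<bar>"
        by (rule directional_mean_value[OF Cc_infinityD(4)[OF \<eta>] M])
      then have "\<bar>\<eta> (x, t + s n) - \<eta> (x, t)\<bar> / \<bar>s n\<bar> \<le> M" using s(1) by (simp add: divide_le_eq)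
      then have "\<bar>\<kappa> x\<bar> * (\<bar>\<eta> (x, t + s n) - \<eta> (x, t)\<bar> / \<bar>s n\<bar>) \<le> \<bar>C\<bar> * M"
        using kb[OF True] Mn by (intro mult_mono) auto
      then show ?thesis using True Mn by (simp add: abs_mult right_diff_distrib[symmetric] mult.commute)
    next
      case False
      then show ?thesis using Cc_infinity_slice_support(2)[OF \<eta> False] by simp
    qed
    show "(\<lambda>n. (1 / s n) *\<^sub>R (\<kappa> x * \<eta> (x, t + s n) - \<kappa> x * \<eta> (x, t))) \<longlonglongrightarrow> \<kappa> x * partial_deriv (0, 1) \<eta> (x, t)" for x
    proof -
      have "((\<lambda>h. (\<eta> (x, t + h) - \<eta> (x, t)) / h) \<longlongrightarrow> partial_deriv (0, 1) \<eta> (x, t)) (at 0)"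
        using has_derivative_time[OF Cc_infinityD(4)[OF \<eta>]] by (simp add: DERIV_def)
      then have "(\<lambda>n. (\<eta> (x, t + s n) - \<eta> (x, t)) / s n) \<longlonglongrightarrow> partial_deriv (0, 1) \<eta> (x, t)"
        using s by (auto simp: tendsto_at_iff_sequentially comp_def)
      then have "(\<lambda>n. \<kappa> x * ((\<eta> (x, t + s n) - \<eta> (x, t)) / s n)) \<longlonglongrightarrow> \<kappa> x * partial_deriv (0, 1) \<eta> (x, t)"
        by (intro tendsto_intros)
      then show ?thesis by (simp add: right_diff_distrib[symmetric])
    qed
  qed
  then show "((\<lambda>h. (1 / h) *\<^sub>R (toL2 (\<lambda>x. \<kappa> x * \<eta> (x, t + h)) - toL2 (\<lambda>x. \<kappa> x * \<eta> (x, t)))) \<circ> s)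
      \<longlonglongrightarrow> toL2 (\<lambda>x. \<kappa> x * partial_deriv (0, 1) \<eta> (x, t))"
    by (simp add: comp_def toL2_scaleR[OF sqint_diff[OF sq sq]] toL2_diff[OF sq sq] del: real_scaleR_def)
qed

subsection \<open>Step functions in time\<close>

lemma step_function_has_integral:
  fixes f :: "nat \<Rightarrow> real"
  assumes h: "h > 0"
  shows "((\<lambda>s. f (nat \<lfloor>s / h\<rfloor>)) has_integral h * (\<Sum>k<n. f k)) {0..real n * h}"
proof (induction n)
  case (Suc n)
  have "((\<lambda>s. f (nat \<lfloor>s / h\<rfloor>)) has_integral h * f n) {real n * h..real (Suc n) * h}"
  proof (rule has_integral_spike_finite[where S="{real (Suc n) * h}"])
    show "((\<lambda>s. f n) has_integral h * f n) {real n * h..real (Suc n) * h}"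
      using has_integral_const_real[of "f n" "real n * h" "real (Suc n) * h"] h by (simp add: algebra_simps)
    fix s assume s: "s \<in> {real n * h..real (Suc n) * h} - {real (Suc n) * h}"
    then have "\<lfloor>s / h\<rfloor> = int n" using h by (intro floor_unique) (auto simp: field_simps)
    then show "f (nat \<lfloor>s / h\<rfloor>) = f n" by simp
  qed simp
  from has_integral_combine[OF _ _ Suc this] h show ?case
    by (simp add: distrib_left mult_right_mono)
qed (simp add: has_integral_refl)

text \<open>The second summand is the contribution of the incomplete last cell; for a general end
  time it appears as an error of the order of the step.\<close>

lemma step_function_has_integral':
  fixes f :: "nat \<Rightarrow> real"
  assumes h: "h > 0" and t: "0 \<le> t"
  defines "n \<equiv> nat \<lfloor>t / h\<rfloor>"
  shows "((\<lambda>s. f (nat \<lfloor>s / h\<rfloor>)) has_integral h * (\<Sum>k<n. f k) + (t - real n * h) * f n) {0..t}"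
proof -
  have nt: "real n * h \<le> t" "t < real (Suc n) * h"
  proof -
    have "0 \<le> t / h" using h t by simp
    then have "real n \<le> t / h" "t / h < real n + 1" unfolding n_def by linarith+
    then show "real n * h \<le> t" "t < real (Suc n) * h" using h by (simp_all add: field_simps)
  qed
  have "((\<lambda>s. f (nat \<lfloor>s / h\<rfloor>)) has_integral (t - real n * h) * f n) {real n * h..t}"
  proof (rule has_integral_eq)
    show "((\<lambda>s. f n) has_integral (t - real n * h) * f n) {real n * h..t}"
      using has_integral_const_real[of "f n" "real n * h" t] nt by simp
    fix s assume s: "s \<in> {real n * h..t}"
    then have "\<lfloor>s / h\<rfloor> = int n" using h nt by (intro floor_unique) (auto simp: field_simps)
    then show "f n = f (nat \<lfloor>s / h\<rfloor>)" by simp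
  qed
  from has_integral_combine[OF _ nt(1) step_function_has_integral[OF h] this] h show ?thesis by simp
qed

section \<open>Convergence of the scheme\<close>

text \<open>The component of the weak limit orthogonal to \<open>V\<close> is tested with
  itself.\<close>

lemma weakly_closed_subspace:
  fixes V :: "'h::{real_inner, complete_space} set"
  assumes V: "subspace V" "closed V" and x: "\<And>n. x n \<in> V"
    and weak: "\<And>\<phi>. (\<lambda>n. inner (x n) \<phi>) \<longlonglongrightarrow> inner y \<phi>"
  shows "y \<in> V"
proof -
  obtain v where v: "v \<in> V" "\<forall>w\<in>V. inner (y - v) w = 0"
    using subspace_projection[OF V] by blast
  have "(\<lambda>n. 0) \<longlonglongrightarrow> inner y (y - v)"
    using weak[of "y - v"] v(2) x by (simp add: inner_commute)
  then have "inner y (y - v) = 0" by (simp add: LIMSEQ_const_iff)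
  moreover have "inner v (y - v) = 0" using v by (simp add: inner_commute)
  ultimately have "inner (y - v) (y - v) = 0" by (simp add: inner_diff_left)
  then show ?thesis using v by simp
qed

text \<open>The norm bound makes approximation of the test vector uniform in time, so continuity
  passes from a total set to all vectors as a uniform limit.\<close>

lemma weakly_continuous_of_total:
  fixes X :: "real \<Rightarrow> 'h::{real_inner, complete_space}"
  assumes bd: "\<And>t. t \<in> T \<Longrightarrow> norm (X t) \<le> B"
    and tot: "\<And>f. (\<And>\<phi>. \<phi> \<in> S \<Longrightarrow> inner f \<phi> = 0) \<Longrightarrow> f = 0"
    and cont: "\<And>\<phi>. \<phi> \<in> S \<Longrightarrow> continuous_on T (\<lambda>t. inner (X t) \<phi>)"
  shows "continuous_on T (\<lambda>t. inner (X t) \<phi>)"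
proof -
  let ?W = "{\<phi>. continuous_on T (\<lambda>t. inner (X t) \<phi>)}"
  have "?W = UNIV"
  proof (rule orthogonal_total_imp_closed_subspace_UNIV[OF tot])
    show "subspace ?W"
      by (rule subspaceI) (auto simp: inner_add_right intro!: continuous_intros)
    show "closed ?W"
    proof (subst closed_sequential_limits, intro allI impI)
      fix f \<phi> assume f: "(\<forall>n. f n \<in> ?W) \<and> f \<longlonglongrightarrow> \<phi>"
      have "continuous_on T (\<lambda>t. inner (X t) \<phi>)"
      proof (rule uniform_limit_theorem[where F=sequentially])
        show "\<forall>\<^sub>F n in sequentially. continuous_on T (\<lambda>t. inner (X t) (f n))" using f by simp
        show "uniform_limit T (\<lambda>n t. inner (X t) (f n)) (\<lambda>t. inner (X t) \<phi>) sequentially"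
        proof (rule uniform_limitI)
          fix e :: real assume e: "0 < e"
          have "0 < e / (\<bar>B\<bar> + 1)" using e by simp
          then obtain N where N: "\<And>n. n \<ge> N \<Longrightarrow> norm (f n - \<phi>) < e / (\<bar>B\<bar> + 1)"
            using f LIMSEQ_D by blast
          have "dist (inner (X t) (f n)) (inner (X t) \<phi>) < e" if "n \<ge> N" "t \<in> T" for n t
          proof -
            have "\<bar>inner (X t) (f n - \<phi>)\<bar> \<le> norm (X t) * norm (f n - \<phi>)" by (rule Cauchy_Schwarz_ineq2)
            also have "\<dots> \<le> (\<bar>B\<bar> + 1) * norm (f n - \<phi>)"
              using bd[OF that(2)] by (intro mult_right_mono) auto
            also have "\<dots> < e" using N[OF that(1)] by (simp add: pos_less_divide_eq mult.commute)
            finally show ?thesis by (simp add: dist_real_def inner_diff_right)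
          qed
          then show "\<forall>\<^sub>F n in sequentially. \<forall>t\<in>T. dist (inner (X t) (f n)) (inner (X t) \<phi>) < e"
            by (auto simp: eventually_sequentially)
        qed
      qed simp
      then show "\<phi> \<in> ?W" by simp
    qed
  qed (use cont in auto)
  then show ?thesis by auto
qed

text \<open>\<open>R \<rho>\<close> stands for restriction to the ball of radius \<rho>,
  \<open>S\<close> for a total set of vector fields with square integrable divergence
  \<open>d\<close>. In \<open>cut\<close> the constant \<open>c\<close> precedes \<epsilon>; only so
  can the gradient of the cutoff be made small without losing the lower bound on the ball.\<close>

locale enthalpy_limit = enthalpy_scheme \<Gamma> F \<gamma> G\<^sub>0
  for \<Gamma> :: "('h::{real_inner, complete_space} \<times> 'k::{real_inner, complete_space}) set"
    and F :: 'k and \<gamma> :: "'h \<Rightarrow> 'h" and G\<^sub>0 :: 'k +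
  fixes R :: "nat \<Rightarrow> 'h \<Rightarrow> 'h" and S :: "'k set"
  assumes R_lin: "\<And>\<rho>. linear (R \<rho>)"
    and R_sa: "\<And>\<rho> a b. inner (R \<rho> a) b = inner a (R \<rho> b)"
    and R_idem: "\<And>\<rho> a. R \<rho> (R \<rho> a) = R \<rho> a"
    and R_total: "\<And>f. (\<And>\<rho>. R \<rho> f = 0) \<Longrightarrow> f = 0"
    and cut: "\<And>\<rho>. \<exists>c>0. \<forall>\<epsilon>>0. \<exists>X Y B N. 0 \<le> N \<and> cutoff X Y B N \<epsilon> \<and>
               (\<forall>x. inner (R \<rho> x) x \<le> c * inner (X x) x)"
    and S_total: "\<And>f. (\<And>L. L \<in> S \<Longrightarrow> inner f L = 0) \<Longrightarrow> f = 0"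
    and S_div: "\<And>L. L \<in> S \<Longrightarrow> \<exists>d. \<forall>(p, G)\<in>\<Gamma>. inner G L = - inner p d"
begin

section \<open>Limits at every time\<close>

definition P :: "nat \<Rightarrow> real \<Rightarrow> 'h" where "P n t = p (1 / 2 ^ n) (nat \<lfloor>t * 2 ^ n\<rfloor>)"
definition Q :: "nat \<Rightarrow> real \<Rightarrow> 'k" where "Q n t = q (1 / 2 ^ n) (nat \<lfloor>t * 2 ^ n\<rfloor>)"
definition Z :: "nat \<Rightarrow> real \<Rightarrow> 'h" where "Z n t = z (1 / 2 ^ n) (nat \<lfloor>t * 2 ^ n\<rfloor>)"

lemma UZ: "U n t = \<gamma> (Z n t)"
  by (simp add: U_def Z_def u_def)

lemma PQ_mem: "(P n t, Q n t) \<in> \<Gamma>"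
  unfolding P_def Q_def by (rule pq_mem) simp

lemma Q_bound: "norm (Q n t + F) \<le> A"
  unfolding Q_def by (rule q_bound) simp

lemma Q_bound': "norm (Q n t) \<le> A + norm F"
  using norm_triangle_ineq4[of "Q n t + F" F] Q_bound[of n t] by simp

lemma P_minus_U: "norm (P n t - U n t) \<le> A * sqrt (1 / 2 ^ n)"
  unfolding P_def U_def \<delta>_eq[symmetric] by (rule \<delta>_bound) simp

lemma U_hoelder:
  assumes "0 \<le> s" "s \<le> t"
  shows "norm (U n t - U n s) \<le> A * sqrt (t - s + 1 / 2 ^ n)"
  unfolding U_def
proof (rule u_dist_le)
  have "s * 2 ^ n \<le> t * 2 ^ n" using assms by simp
  then show le: "nat \<lfloor>s * 2 ^ n\<rfloor> \<le> nat \<lfloor>t * 2 ^ n\<rfloor>" by (intro nat_mono floor_mono)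
  have "real (nat \<lfloor>t * 2 ^ n\<rfloor>) \<le> t * 2 ^ n" "s * 2 ^ n - 1 \<le> real (nat \<lfloor>s * 2 ^ n\<rfloor>)"
    using assms by (simp, linarith)
  then have "real (nat \<lfloor>t * 2 ^ n\<rfloor> - nat \<lfloor>s * 2 ^ n\<rfloor>) \<le> (t - s) * 2 ^ n + 1"
    using le by (simp add: of_nat_diff left_diff_distrib)
  then have "1 / 2 ^ n * real (nat \<lfloor>t * 2 ^ n\<rfloor> - nat \<lfloor>s * 2 ^ n\<rfloor>) \<le> 1 / 2 ^ n * ((t - s) * 2 ^ n + 1)"
    by (intro mult_left_mono) auto
  also have "\<dots> = t - s + 1 / 2 ^ n" by (simp add: distrib_left)
  finally show "1 / 2 ^ n * real (nat \<lfloor>t * 2 ^ n\<rfloor> - nat \<lfloor>s * 2 ^ n\<rfloor>) \<le> t - s + 1 / 2 ^ n" .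
qed simp

lemma U_0: "U n 0 = \<gamma> 0"
  by (simp add: U_def u_def)

lemma U_bound:
  assumes t: "0 \<le> t"
  shows "norm (U n t) \<le> norm (\<gamma> 0) + A * (1 + t)"
proof -
  have "1 / 2 ^ n \<le> (1::real)" by simp
  then have "sqrt (t - 0 + 1 / 2 ^ n) \<le> sqrt (1 + t)" by simp
  also have "\<dots> \<le> 1 + t" using t by (intro real_le_lsqrt) (auto simp: power2_eq_square algebra_simps)
  finally have "A * sqrt (t - 0 + 1 / 2 ^ n) \<le> A * (1 + t)" by (intro mult_left_mono) auto
  then have "norm (U n t - U n 0) \<le> A * (1 + t)" using U_hoelder[of 0 t n] t by linarith
  then show ?thesis using norm_triangle_ineq[of "U n t - U n 0" "U n 0"] by (simp add: U_0)
qed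

lemma R_norm: "(norm (R \<rho> x))\<^sup>2 = inner (R \<rho> x) x"
  by (simp add: power2_norm_eq_inner R_sa R_idem inner_commute)

lemma R_Cauchy:
  assumes t: "0 \<le> t"
  shows "Cauchy (\<lambda>n. R \<rho> (U n t))"
proof (rule CauchyI')
  fix e :: real assume e: "0 < e"
  obtain c where c: "c > 0" "\<And>\<epsilon>. \<epsilon> > 0 \<Longrightarrow> \<exists>X Y B N. 0 \<le> N \<and> cutoff X Y B N \<epsilon> \<and>
               (\<forall>x. inner (R \<rho> x) x \<le> c * inner (X x) x)"
    using cut[of \<rho>] by blast
  have "0 < e\<^sup>2" using e by simp
  from locally_Cauchy[OF c(2,1) t this]
  obtain n0 where n0: "\<And>m n. m \<ge> n0 \<Longrightarrow> n \<ge> m \<Longrightarrow> inner (R \<rho> (U m t - U n t)) (U m t - U n t) < e\<^sup>2"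
    by blast
  have "dist (R \<rho> (U m t)) (R \<rho> (U n t)) < e" if "m \<ge> n0" "n > m" for m n
  proof -
    have "(norm (R \<rho> (U m t - U n t)))\<^sup>2 < e\<^sup>2" using n0[of m n] that by (simp add: R_norm)
    then have "norm (R \<rho> (U m t - U n t)) < e" using e by (simp add: power2_less_imp_less)
    then show ?thesis by (simp add: dist_norm linear_diff[OF R_lin])
  qed
  then show "\<exists>M. \<forall>m\<ge>M. \<forall>n>m. dist (R \<rho> (U m t)) (R \<rho> (U n t)) < e" by blast
qed

text \<open>Vectors supported in a ball form a total set, and against them the local Cauchy property
  gives convergence. Globally the temperatures converge only weakly.\<close>

lemma U_weak_limit_ex:
  assumes t: "0 \<le> t"
  shows "\<exists>y. \<forall>\<phi>. (\<lambda>n. inner (U n t) \<phi>) \<longlonglongrightarrow> inner y \<phi>"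
proof (rule weak_limit_exists[OF U_bound[OF t]])
  let ?S = "{\<phi>. \<exists>\<rho>. R \<rho> \<phi> = \<phi>}"
  fix f assume f: "\<And>\<phi>. \<phi> \<in> ?S \<Longrightarrow> inner f \<phi> = 0"
  show "f = 0"
  proof (rule R_total)
    fix \<rho>
    have "inner f (R \<rho> f) = 0" by (rule f) (intro CollectI exI[of _ \<rho>] R_idem)
    then have "(norm (R \<rho> f))\<^sup>2 = 0" by (simp add: R_norm inner_commute)
    then show "R \<rho> f = 0" by simp
  qed
next
  fix \<phi> assume "\<phi> \<in> {\<phi>. \<exists>\<rho>. R \<rho> \<phi> = \<phi>}"
  then obtain \<rho> where r: "R \<rho> \<phi> = \<phi>" by auto
  obtain l where "(\<lambda>n. R \<rho> (U n t)) \<longlonglongrightarrow> l"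
    using R_Cauchy[OF t] Cauchy_convergent convergent_def by blast
  then have "(\<lambda>n. inner (R \<rho> (U n t)) \<phi>) \<longlonglongrightarrow> inner l \<phi>" by (intro tendsto_intros)
  then show "convergent (\<lambda>n. inner (U n t) \<phi>)" by (auto simp: convergent_def R_sa r)
qed

definition ulim :: "real \<Rightarrow> 'h" where
  "ulim t = (SOME y. \<forall>\<phi>. (\<lambda>n. inner (U n t) \<phi>) \<longlonglongrightarrow> inner y \<phi>)"

lemma U_weak: "0 \<le> t \<Longrightarrow> (\<lambda>n. inner (U n t) \<phi>) \<longlonglongrightarrow> inner (ulim t) \<phi>"
  using someI_ex[OF U_weak_limit_ex, folded ulim_def] by blast

text \<open>\<open>R \<rho>\<close> is self-adjoint, so the strong limit of the restrictions is the
  restriction of the weak limit. This strong convergence is what the nonlinear phase relation will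
  need.\<close>

lemma U_local_strong:
  assumes t: "0 \<le> t"
  shows "(\<lambda>n. R \<rho> (U n t)) \<longlonglongrightarrow> R \<rho> (ulim t)"
proof -
  obtain l where l: "(\<lambda>n. R \<rho> (U n t)) \<longlonglongrightarrow> l"
    using R_Cauchy[OF t] Cauchy_convergent convergent_def by blast
  have "inner (R \<rho> (ulim t) - l) \<phi> = 0" for \<phi>
  proof -
    have "(\<lambda>n. inner (R \<rho> (U n t)) \<phi>) \<longlonglongrightarrow> inner (R \<rho> (ulim t)) \<phi>"
      using U_weak[OF t, of "R \<rho> \<phi>"] by (simp add: R_sa)
    moreover have "(\<lambda>n. inner (R \<rho> (U n t)) \<phi>) \<longlonglongrightarrow> inner l \<phi>" by (intro tendsto_intros l)
    ultimately have "inner (R \<rho> (ulim t)) \<phi> = inner l \<phi>" by (rule LIMSEQ_unique)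
    then show ?thesis by (simp add: inner_diff_left)
  qed
  from this[of "R \<rho> (ulim t) - l"] have "R \<rho> (ulim t) = l" by simp
  then show ?thesis using l by simp
qed

lemma P_weak:
  assumes t: "0 \<le> t"
  shows "(\<lambda>n. inner (P n t) \<phi>) \<longlonglongrightarrow> inner (ulim t) \<phi>"
proof -
  have "(\<lambda>n. A * sqrt ((1/2) ^ n)) \<longlonglongrightarrow> A * sqrt 0"
    by (intro tendsto_intros LIMSEQ_power_zero) simp
  then have "(\<lambda>n. A * sqrt (1 / 2 ^ n)) \<longlonglongrightarrow> 0" by (simp add: power_divide)
  then have "(\<lambda>n. P n t - U n t) \<longlonglongrightarrow> 0" by (rule Lim_null_comparison[rotated]) (simp add: P_minus_U)
  then have "(\<lambda>n. inner (P n t - U n t) \<phi>) \<longlonglongrightarrow> inner 0 \<phi>" by (intro tendsto_intros)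
  from tendsto_add[OF this U_weak[OF t, of \<phi>]] show ?thesis by (simp add: inner_diff_left)
qed

text \<open>Against a field from \<open>S\<close> the gradient becomes a pairing of \<open>P\<close>
  with a fixed vector, and \<open>P\<close> has the same weak limit as \<open>U\<close>. Hence
  gradients converge weakly at every time, not just at almost every time.\<close>

lemma Q_weak_limit_ex:
  assumes t: "0 \<le> t"
  shows "\<exists>y. \<forall>\<phi>. (\<lambda>n. inner (Q n t) \<phi>) \<longlonglongrightarrow> inner y \<phi>"
proof (rule weak_limit_exists[OF Q_bound' S_total])
  fix L assume "L \<in> S"
  then obtain d where d: "\<And>p G. (p, G) \<in> \<Gamma> \<Longrightarrow> inner G L = - inner p d" using S_div by blast
  show "convergent (\<lambda>n. inner (Q n t) L)"
    using tendsto_minus[OF P_weak[OF t, of d]] by (auto simp: convergent_def d[OF PQ_mem])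
qed

definition Glim :: "real \<Rightarrow> 'k" where
  "Glim t = (SOME y. \<forall>\<phi>. (\<lambda>n. inner (Q n t) \<phi>) \<longlonglongrightarrow> inner y \<phi>)"

lemma Q_weak: "0 \<le> t \<Longrightarrow> (\<lambda>n. inner (Q n t) \<phi>) \<longlonglongrightarrow> inner (Glim t) \<phi>"
  using someI_ex[OF Q_weak_limit_ex, folded Glim_def] by blast

text \<open>The graph is a closed subspace of the product space and therefore weakly closed.\<close>

lemma lim_mem:
  assumes t: "0 \<le> t"
  shows "(ulim t, Glim t) \<in> \<Gamma>"
proof (rule weakly_closed_subspace[OF sub cl, where x="\<lambda>n. (P n t, Q n t)"])
  fix \<phi> :: "'h \<times> 'k"
  show "(\<lambda>n. inner (P n t, Q n t) \<phi>) \<longlonglongrightarrow> inner (ulim t, Glim t) \<phi>"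
    unfolding inner_prod_def fst_conv snd_conv by (intro tendsto_add P_weak Q_weak t)
qed (rule PQ_mem)

lemma Glim_bound:
  assumes t: "0 \<le> t"
  shows "norm (Glim t + F) \<le> A" "norm (Glim t) \<le> A + norm F"
proof -
  show *: "norm (Glim t + F) \<le> A"
  proof (rule weak_limit_norm_le)
    show "(\<lambda>n. inner (Q n t + F) (Glim t + F)) \<longlonglongrightarrow> inner (Glim t + F) (Glim t + F)"
      unfolding inner_add_left[of _ F] by (intro tendsto_add Q_weak t tendsto_const)
  qed (use Q_bound in auto)
  show "norm (Glim t) \<le> A + norm F"
    using norm_triangle_ineq4[of "Glim t + F" F] * by simp
qed

lemma ulim_0: "ulim 0 = \<gamma> 0"
proof -
  have "inner (ulim 0) \<phi> = inner (\<gamma> 0) \<phi>" for \<phi>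
    using U_weak[of 0 \<phi>] by (simp add: U_0 LIMSEQ_const_iff)
  then have "inner (ulim 0 - \<gamma> 0) (ulim 0 - \<gamma> 0) = 0" unfolding inner_diff_left by simp
  then show ?thesis by simp
qed

lemma ulim_bound:
  assumes t: "0 \<le> t"
  shows "norm (ulim t) \<le> norm (\<gamma> 0) + A * (1 + t)"
  by (rule weak_limit_norm_le[OF U_weak[OF t]]) (use U_bound[OF t] in auto)

lemma ulim_hoelder:
  assumes "0 \<le> s" "s \<le> t"
  shows "norm (ulim t - ulim s) \<le> A * sqrt (t - s)"
proof -
  have t: "0 \<le> t" using assms by simp
  have w: "(\<lambda>n. inner (U n t - U n s) \<phi>) \<longlonglongrightarrow> inner (ulim t - ulim s) \<phi>" for \<phi>
    unfolding inner_diff_left by (intro tendsto_diff U_weak t assms)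
  \<comment> \<open>The grid error \<open>1 / 2 ^ n\<close> is first frozen at
    \<open>(1/2) ^ m\<close>, so that one bound holds for all late \<open>n\<close>; then
    \<open>m\<close> tends to infinity.\<close>
  have "norm (ulim t - ulim s) \<le> A * sqrt (t - s + (1/2) ^ m)" for m
  proof (rule weak_limit_norm_le[OF w])
    have "norm (U n t - U n s) \<le> A * sqrt (t - s + (1/2) ^ m)" if "n \<ge> m" for n
    proof -
      have "1 / 2 ^ n \<le> (1/2::real) ^ m" using that power_decreasing[of m n "1/2::real"] by (simp add: power_divide)
      then have "A * sqrt (t - s + 1 / 2 ^ n) \<le> A * sqrt (t - s + (1/2) ^ m)" by (intro mult_left_mono) auto
      then show ?thesis using U_hoelder[OF assms, of n] by linarith
    qed
    then show "\<exists>N. \<forall>n\<ge>N. norm (U n t - U n s) \<le> A * sqrt (t - s + (1/2) ^ m)" by blast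
  qed
  moreover have "(\<lambda>m. A * sqrt (t - s + (1/2) ^ m)) \<longlonglongrightarrow> A * sqrt (t - s + 0)"
    by (intro tendsto_intros LIMSEQ_power_zero) simp
  ultimately show ?thesis by (intro LIMSEQ_le_const[where X="\<lambda>m. A * sqrt (t - s + (1/2) ^ m)"]) auto
qed

lemma ulim_continuous: "continuous_on {0..} ulim"
proof (rule continuous_onI)
  fix t e :: real assume t: "t \<in> {0..}" and e: "0 < e"
  define d where "d = (e / (A + 1))\<^sup>2"
  have A1: "0 < A + 1" using A_nonneg by linarith
  have d: "0 < d" using e A1 by (simp add: d_def)
  have "dist (ulim s) (ulim t) \<le> e" if s: "s \<in> {0..}" "dist s t < d" for s
  proof -
    have "norm (ulim s - ulim t) \<le> A * sqrt \<bar>s - t\<bar>"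
    proof (cases "s \<le> t")
      case True
      then show ?thesis using ulim_hoelder[of s t] s t by (simp add: norm_minus_commute)
    next
      case False
      then show ?thesis using ulim_hoelder[of t s] s t by simp
    qed
    also have "\<dots> \<le> (A + 1) * sqrt d"
      using s A1 by (intro mult_mono real_sqrt_le_mono) (auto simp: dist_real_def)
    also have "\<dots> = e" using e A1 by (simp add: d_def)
    finally show ?thesis by (simp add: dist_norm)
  qed
  then show "\<exists>d>0. \<forall>s\<in>{0..}. dist s t < d \<longrightarrow> dist (ulim s) (ulim t) \<le> e" using d by blast
qed

text \<open>On fields from \<open>S\<close> weak continuity is inherited from the norm continuity of
  \<open>ulim\<close> through the divergence; the uniform bound extends it to all fields.\<close>

lemma Glim_weakly_continuous: "continuous_on {0..} (\<lambda>t. inner (Glim t) L)"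
proof (rule weakly_continuous_of_total[OF _ S_total])
  show "norm (Glim t) \<le> A + norm (F :: 'k)" if "t \<in> {0..}" for t using Glim_bound(2) that by simp
  fix L assume "L \<in> S"
  then obtain d where d: "\<And>p G. (p, G) \<in> \<Gamma> \<Longrightarrow> inner G L = - inner p d" using S_div by blast
  have "continuous_on {0..} (\<lambda>t. - inner (ulim t) d)" by (intro continuous_intros ulim_continuous)
  then show "continuous_on {0..} (\<lambda>t. inner (Glim t) L)"
    by (rule continuous_on_eq) (simp add: d[OF lim_mem])
qed

lemma z_inner:
  assumes "(\<phi>, L) \<in> \<Gamma>" "h > 0"
  shows "inner (z h k) \<phi> = - (h * (\<Sum>i<k. inner (q h i + F) L))"
proof (induction k)
  case (Suc k)
  have "inner (z h (Suc k)) \<phi> = inner (z h k) \<phi> + inner (\<delta> h k) \<phi>"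
    by (simp add: \<delta>_def inner_diff_left del: z.simps)
  then show ?case using Suc pq_eq[OF assms(2,1), of k] by (simp add: distrib_left del: z.simps)
qed simp

text \<open>The bound on single increments is too weak to control \<open>Z\<close> in norm as the
  step shrinks. Tested with an element of \<Gamma>, however, \<open>Z\<close> is a time integral of
  the flux up to an incomplete cell, and that passes to the limit by dominated convergence.\<close>

lemma Z_weak:
  assumes mem: "(\<phi>, L) \<in> \<Gamma>" and t: "0 \<le> t"
  shows "(\<lambda>n. inner (Z n t) \<phi>) \<longlonglongrightarrow> - integral {0..t} (\<lambda>s. inner (Glim s + F) L)"
proof -
  define f where "f n s = inner (Q n s + F) L" for n s
  define k where "k n = nat \<lfloor>t * 2 ^ n\<rfloor>" for n
  have fb: "\<bar>f n s\<bar> \<le> A * norm L" for n s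
    unfolding f_def by (rule order_trans[OF Cauchy_Schwarz_ineq2]) (intro mult_right_mono Q_bound norm_ge_zero)
  have I: "(f n has_integral (1 / 2 ^ n * (\<Sum>i<k n. inner (q (1 / 2 ^ n) i + F) L) + (t - real (k n) * (1 / 2 ^ n)) * f n t)) {0..t}" for n
    using step_function_has_integral'[of "1 / 2 ^ n" t "\<lambda>i. inner (q (1 / 2 ^ n) i + F) L"] t
    by (simp add: f_def[abs_def] Q_def k_def)
  then have Z: "inner (Z n t) \<phi> = - integral {0..t} (f n) + (t - real (k n) * (1 / 2 ^ n)) * f n t" for n
    using z_inner[OF mem, of "1 / 2 ^ n" "k n"] integral_unique[OF I[of n]] by (simp add: Z_def k_def)
  have "(\<lambda>n. integral {0..t} (f n)) \<longlonglongrightarrow> integral {0..t} (\<lambda>s. inner (Glim s + F) L)"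
  proof (rule dominated_convergence(2))
    show "f n integrable_on {0..t}" for n using I by blast
    show "(\<lambda>s. A * norm L) integrable_on {0..t}" by (rule integrable_const_ivl)
    show "norm (f n s) \<le> A * norm L" for n s using fb by simp
    show "(\<lambda>n. f n s) \<longlonglongrightarrow> inner (Glim s + F) L" if "s \<in> {0..t}" for s
      unfolding f_def inner_add_left[of _ F] using that by (intro tendsto_add Q_weak tendsto_const) auto
  qed
  moreover have "(\<lambda>n. (t - real (k n) * (1 / 2 ^ n)) * f n t) \<longlonglongrightarrow> 0"
  proof (rule Lim_null_comparison)
    show "\<forall>\<^sub>F n in sequentially. norm ((t - real (k n) * (1 / 2 ^ n)) * f n t) \<le> (1/2) ^ n * (A * norm L)"
    proof (rule always_eventually, rule allI)
      fix n
      have "0 \<le> t * 2 ^ n" using t by simp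
      then have "real (k n) \<le> t * 2 ^ n" "t * 2 ^ n \<le> real (k n) + 1" unfolding k_def by linarith+
      then have "real (k n) / 2 ^ n \<le> t" "t \<le> (real (k n) + 1) / 2 ^ n" by (simp_all add: pos_divide_le_eq pos_le_divide_eq)
      then have "\<bar>t - real (k n) * (1 / 2 ^ n)\<bar> \<le> (1/2) ^ n" by (simp add: power_divide add_divide_distrib)
      then show "norm ((t - real (k n) * (1 / 2 ^ n)) * f n t) \<le> (1/2) ^ n * (A * norm L)"
        unfolding real_norm_def abs_mult using fb by (intro mult_mono) auto
    qed
    have "(\<lambda>n. (1/2) ^ n * (A * norm L)) \<longlonglongrightarrow> 0 * (A * norm L)"
      by (intro tendsto_intros LIMSEQ_power_zero) simp
    then show "(\<lambda>n. (1/2) ^ n * (A * norm L)) \<longlonglongrightarrow> 0" by simp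
  qed
  ultimately have "(\<lambda>n. - integral {0..t} (f n) + (t - real (k n) * (1 / 2 ^ n)) * f n t)
      \<longlonglongrightarrow> - integral {0..t} (\<lambda>s. inner (Glim s + F) L) + 0" by (intro tendsto_intros)
  then show ?thesis by (simp add: Z)
qed

end

section \<open>The Stefan problem\<close>

lemma C_k_compose_scaleR: "C_k k f \<Longrightarrow> C_k k (\<lambda>x. f (c *\<^sub>R x))"
  and partial_deriv_compose_scaleR:
    "f differentiable (at (c *\<^sub>R x)) \<Longrightarrow> partial_deriv b (\<lambda>x. f (c *\<^sub>R x)) x = c * partial_deriv b f (c *\<^sub>R x)"
proof -
  have D: "((\<lambda>x. f (c *\<^sub>R x)) has_derivative (\<lambda>h. frechet_derivative f (at (c *\<^sub>R x)) (c *\<^sub>R h))) (at x)"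
    if "f differentiable (at (c *\<^sub>R x))" for f :: "'a \<Rightarrow> real" and x
  proof -
    have "((\<lambda>x. c *\<^sub>R x) has_derivative (\<lambda>h. c *\<^sub>R h)) (at x)" by (auto intro!: derivative_eq_intros)
    from has_derivative_compose[OF this has_derivative_frechet[OF that]] show ?thesis .
  qed
  have P: "partial_deriv b (\<lambda>x. f (c *\<^sub>R x)) x = c * partial_deriv b f (c *\<^sub>R x)"
    if "f differentiable (at (c *\<^sub>R x))" for f :: "'a \<Rightarrow> real" and x b
    using partial_deriv_eq[OF D[OF that]] linear_scale[OF linear_frechet_derivative[OF that]]
    by (simp add: partial_deriv_def)
  show "partial_deriv b (\<lambda>x. f (c *\<^sub>R x)) x = c * partial_deriv b f (c *\<^sub>R x)" if "f differentiable (at (c *\<^sub>R x))"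
    by (rule P[OF that])
  show "C_k k f \<Longrightarrow> C_k k (\<lambda>x. f (c *\<^sub>R x))"
  proof (induction k arbitrary: f)
    case 0
    then show ?case by (auto intro!: continuous_on_compose2[of UNIV f] continuous_intros)
  next
    case (Suc k)
    then have d: "f differentiable (at x)" for x by simp
    have "partial_deriv b (\<lambda>x. f (c *\<^sub>R x)) = (\<lambda>x. c * partial_deriv b f (c *\<^sub>R x))" for b
      using P[OF d] by auto
    moreover have "(\<lambda>x. f (c *\<^sub>R x)) differentiable (at x)" for x using D[OF d] by (auto simp: differentiable_def)
    ultimately show ?case using Suc by (auto intro!: C_k_mult)
  qed
qed

lemma classical_grad_bounded:
  assumes "\<phi> \<in> Cc_infinity U"
  shows "\<exists>M>0. \<forall>x. norm (classical_grad \<phi> x) \<le> M"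
proof -
  have "\<forall>b\<in>Basis. \<exists>M. \<forall>x. \<bar>partial_deriv b \<phi> x\<bar> \<le> M"
    using Cc_infinity_bounded[OF Cc_infinity_partial_deriv[OF assms]] by blast
  then obtain M where M: "\<And>b x. b \<in> Basis \<Longrightarrow> \<bar>partial_deriv b \<phi> x\<bar> \<le> M b" by metis
  have le: "norm (classical_grad \<phi> x) \<le> (\<Sum>b\<in>Basis. M b)" for x
    unfolding classical_grad_def by (intro sum_norm_le) (use M in auto)
  then have "norm (classical_grad \<phi> x) \<le> \<bar>\<Sum>b\<in>Basis. M b\<bar> + 1" for x using le[of x] by linarith
  then show ?thesis by (intro exI[of _ "\<bar>\<Sum>b\<in>Basis. M b\<bar> + 1"]) auto
qed

definition unit_bump :: "'a::euclidean_space \<Rightarrow> real" where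
  "unit_bump = box_bump 1 (- One) One"

text \<open>For \<open>x\<close> of norm at most 1/2 each argument of \<open>bump1 0\<close> is at
  least 1/2, where \<open>bump1 0\<close> is at least \<open>exp (-2)\<close>; every coordinate
  contributes two such factors.\<close>

lemma unit_bump_lower:
  "\<exists>b>0. \<forall>x::'a::euclidean_space. norm x \<le> 1 / 2 \<longrightarrow> b \<le> unit_bump x"
proof (intro exI[of _ "\<Prod>b\<in>(Basis::'a set). exp (-2) * exp (-2::real)"] conjI allI impI)
  show "0 < (\<Prod>b\<in>(Basis::'a set). exp (-2) * exp (-2::real))" by (intro prod_pos) auto
  fix x :: 'a assume x: "norm x \<le> 1 / 2"
  have bump: "exp (-2) \<le> bump1 0 s" if "1 / 2 \<le> s" for s
    using that by (simp add: bump1_def divide_le_eq)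
  show "(\<Prod>b\<in>(Basis::'a set). exp (-2) * exp (-2::real)) \<le> unit_bump x"
    unfolding unit_bump_def box_bump_def
  proof (rule prod_mono)
    fix b :: 'a assume b: "b \<in> Basis"
    have "\<bar>x \<bullet> b\<bar> \<le> 1 / 2" using Basis_le_norm[OF b, of x] x by linarith
    then have "exp (-2) \<le> bump1 0 (1 * (x \<bullet> b) + - (1 * (- One \<bullet> b)))" "exp (-2) \<le> bump1 0 (- 1 * (x \<bullet> b) + 1 * (One \<bullet> b))"
      using b by (auto intro!: bump)
    then show "0 \<le> exp (-2) * exp (-2::real) \<and> exp (-2) * exp (-2)
        \<le> bump1 0 (1 * (x \<bullet> b) + - (1 * (- One \<bullet> b))) * bump1 0 (- 1 * (x \<bullet> b) + 1 * (One \<bullet> b))"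
      by (auto intro!: mult_mono simp: bump1_0_le)
  qed
qed

text \<open>Dilations of one bump: stretching shrinks the gradient but keeps the lower bound near
  the centre, so \<open>c\<close> depends neither on \<epsilon> nor on the radius.\<close>

lemma cutoff_functions:
  fixes \<rho> :: real
  shows "\<exists>c>0. \<forall>\<epsilon>>0. \<exists>\<kappa>::'a::euclidean_space \<Rightarrow> real. \<kappa> \<in> Cc_infinity UNIV \<and> (\<forall>x. 0 \<le> \<kappa> x \<and> \<kappa> x \<le> 1) \<and>
           (\<forall>x. norm (classical_grad \<kappa> x) \<le> \<epsilon>) \<and> (\<forall>x. norm x \<le> \<rho> \<longrightarrow> 1 \<le> c * \<kappa> x)"
proof -
  have B: "unit_bump \<in> Cc_infinity (UNIV :: 'a set)"
    unfolding unit_bump_def by (rule box_bump_in_Cc) auto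
  obtain b where b: "b > 0" "\<And>x::'a. norm x \<le> 1 / 2 \<Longrightarrow> b \<le> unit_bump x" using unit_bump_lower by blast
  obtain M where M: "M > 0" "\<And>x::'a. norm (classical_grad unit_bump x) \<le> M" using classical_grad_bounded[OF B] by blast
  show ?thesis
  proof (intro exI[of _ "1 / b"] conjI allI impI)
    fix \<epsilon> :: real assume e: "0 < \<epsilon>"
    \<comment> \<open>The first bound brings the ball of radius \<rho> into the ball of radius 1/2,
      where the bump is bounded below; the second makes the gradient at most \<epsilon>.\<close>
    define s where "s = min (1 / (2 * (\<bar>\<rho>\<bar> + 1))) (\<epsilon> / M)"
    have s: "s > 0" "s \<le> 1 / (2 * (\<bar>\<rho>\<bar> + 1))" "s \<le> \<epsilon> / M" using e M by (auto simp: s_def)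
    define \<kappa> :: "'a \<Rightarrow> real" where "\<kappa> x = unit_bump (s *\<^sub>R x)" for x
    have "\<kappa> \<in> Cc_infinity UNIV"
    proof (rule Cc_infinityI)
      show "C_k k \<kappa>" for k unfolding \<kappa>_def[abs_def] by (intro C_k_compose_scaleR Cc_infinityD(1)[OF B])
      show "compact ((\<lambda>x. (1 / s) *\<^sub>R x) ` closure {x::'a. unit_bump x \<noteq> 0})"
        by (intro compact_scaling Cc_infinityD(2)[OF B])
      show "{x. \<kappa> x \<noteq> 0} \<subseteq> (\<lambda>x. (1 / s) *\<^sub>R x) ` closure {x. unit_bump x \<noteq> 0}"
      proof
        fix x assume "x \<in> {x. \<kappa> x \<noteq> 0}"
        then have "s *\<^sub>R x \<in> closure {x. unit_bump x \<noteq> 0}"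
          using closure_subset[of "{x::'a. unit_bump x \<noteq> 0}"] by (auto simp: \<kappa>_def)
        then show "x \<in> (\<lambda>x. (1 / s) *\<^sub>R x) ` closure {x. unit_bump x \<noteq> 0}"
          by (rule rev_image_eqI) (use s in simp)
      qed
    qed auto
    moreover have "0 \<le> \<kappa> x \<and> \<kappa> x \<le> 1" for x
      by (simp add: \<kappa>_def unit_bump_def box_bump_nonneg box_bump_le_1)
    moreover have "norm (classical_grad \<kappa> x) \<le> \<epsilon>" for x
    proof -
      have "classical_grad \<kappa> x = s *\<^sub>R classical_grad unit_bump (s *\<^sub>R x)"
        unfolding classical_grad_def \<kappa>_def[abs_def]
        by (simp add: partial_deriv_compose_scaleR Cc_infinityD(4)[OF B] scaleR_sum_right)
      then have "norm (classical_grad \<kappa> x) = s * norm (classical_grad unit_bump (s *\<^sub>R x))" using s by simp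
      also have "\<dots> \<le> (\<epsilon> / M) * M" using s M e by (intro mult_mono) auto
      finally show ?thesis using M by simp
    qed
    moreover have "1 \<le> 1 / b * \<kappa> x" if "norm x \<le> \<rho>" for x
    proof -
      have "norm (s *\<^sub>R x) \<le> 1 / (2 * (\<bar>\<rho>\<bar> + 1)) * (\<bar>\<rho>\<bar> + 1)"
        unfolding norm_scaleR using s that by (intro mult_mono) auto
      moreover have "1 / (2 * r) * r = 1 / 2" if "r > 0" for r :: real using that by simp
      then have "1 / (2 * (\<bar>\<rho>\<bar> + 1)) * (\<bar>\<rho>\<bar> + 1) = 1 / 2" by (metis abs_ge_zero add_nonneg_pos zero_less_one)
      ultimately have "norm (s *\<^sub>R x) \<le> 1 / 2" by (metis (no_types))
      from b(2)[OF this] show ?thesis using b(1) by (simp add: \<kappa>_def)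
    qed
    ultimately show "\<exists>\<kappa>::'a \<Rightarrow> real. \<kappa> \<in> Cc_infinity UNIV \<and> (\<forall>x. 0 \<le> \<kappa> x \<and> \<kappa> x \<le> 1) \<and>
           (\<forall>x. norm (classical_grad \<kappa> x) \<le> \<epsilon>) \<and> (\<forall>x. norm x \<le> \<rho> \<longrightarrow> 1 \<le> 1 / b * \<kappa> x)" by blast
  qed (use b in simp)
qed

definition clamp1 :: "real \<Rightarrow> real" where "clamp1 r = max (- 1) (min 1 r)"

lemma mulL2_indicator_idem:
  assumes "B \<in> sets borel"
  shows "mulL2 (indicator B) (mulL2 (indicator B) f) = mulL2 (indicator B) f"
  unfolding mulL2_indicator_eq_iff[OF assms] using ofL2_mulL2_indicator[OF assms, of f] by eventually_elim simp

text \<open>Borel representatives of the data, with \<open>g\<close> and \<open>F\<close> extended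
  by zero. The melting temperature is only measurable; it enters pointwise through the phase and
  never as a vector of a function space.\<close>

locale stefan =
  fixes D :: "'a::euclidean_space set" and u\<^sub>M g :: "'a \<Rightarrow> real" and F :: "'a \<Rightarrow> 'a" and G\<^sub>0 :: "('a, 'a) L2"
  assumes D: "open D" and uM [measurable]: "u\<^sub>M \<in> borel_measurable borel"
    and g: "sqint g" "\<And>x. x \<notin> D \<Longrightarrow> g x = 0" and G0: "(toL2 g, G\<^sub>0) \<in> gradL2 D"
    and F: "sqint F" "\<And>x. x \<notin> D \<Longrightarrow> F x = 0"
begin

lemma DB [measurable]: "D \<in> sets borel" using D by simp

lemma g_measurable [measurable]: "g \<in> borel_measurable borel" using g(1) by (rule sqint_measurable)

definition \<mu>\<^sub>0 :: "'a \<Rightarrow> real" where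
  "\<mu>\<^sub>0 x = indicator D x * (if g x > u\<^sub>M x then 1 else if g x < u\<^sub>M x then - 1 else 0)"

text \<open>The phase and the temperature as functions of the increment \<open>s\<close> of the enthalpy \<open>g + \<mu>\<^sub>0\<close>;
  outside \<open>D\<close> the phase vanishes and the temperature is the increment itself.\<close>

definition phase :: "'a \<Rightarrow> real \<Rightarrow> real" where
  "phase x s = indicator D x * clamp1 (g x + \<mu>\<^sub>0 x + s - u\<^sub>M x)"

definition temp :: "'a \<Rightarrow> real \<Rightarrow> real" where
  "temp x s = g x + \<mu>\<^sub>0 x + s - phase x s"

definition \<gamma> :: "('a, real) L2 \<Rightarrow> ('a, real) L2" where
  "\<gamma> z = toL2 (\<lambda>x. temp x (ofL2 z x))"

lemma \<mu>0_measurable [measurable]: "\<mu>\<^sub>0 \<in> borel_measurable borel"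
  unfolding \<mu>\<^sub>0_def[abs_def] by measurable

lemma phase_measurable:
  assumes [measurable]: "f \<in> borel_measurable borel"
  shows "(\<lambda>x. phase x (f x)) \<in> borel_measurable borel"
  unfolding phase_def clamp1_def by measurable

lemma temp_measurable:
  assumes [measurable]: "f \<in> borel_measurable borel"
  shows "(\<lambda>x. temp x (f x)) \<in> borel_measurable borel"
proof -
  have [measurable]: "(\<lambda>x. phase x (f x)) \<in> borel_measurable borel" by (rule phase_measurable[OF assms])
  show ?thesis unfolding temp_def by measurable
qed

text \<open>The argument of the clamp is \<open>g - u\<^sub>M\<close> shifted by its own sign: it is
  beyond 1 in absolute value off the melting level and zero on it. Thus the scheme started at
  increment \<open>0\<close> carries exactly the required initial phase.\<close>

lemma phase_0: "phase x 0 = \<mu>\<^sub>0 x"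
  by (auto simp: phase_def \<mu>\<^sub>0_def clamp1_def indicator_def)

lemma phase_bound: "\<bar>phase x s\<bar> \<le> 1"
  by (auto simp: phase_def clamp1_def indicator_def)

lemma temp_0: "temp x 0 = g x"
  by (simp add: temp_def phase_0)

lemma phase_mono: "s \<le> t \<Longrightarrow> 0 \<le> phase x t - phase x s \<and> phase x t - phase x s \<le> t - s"
  by (auto simp: phase_def clamp1_def indicator_def)

lemma temp_Lipschitz: "\<bar>temp x s - temp x t\<bar> \<le> \<bar>s - t\<bar>"
  using phase_mono[of s t x] phase_mono[of t s x] by (cases "s \<le> t") (auto simp: temp_def)

text \<open>Temperature and phase are both nondecreasing in the increment, so the product of their
  differences is nonnegative. On \<open>D\<close> the temperature is the soft thresholding of the
  enthalpy around the melting temperature.\<close>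

lemma temp_firm: "(temp x s - temp x t)\<^sup>2 \<le> (temp x s - temp x t) * (s - t)"
proof -
  have "0 \<le> (temp x s - temp x t) * (phase x s - phase x t)"
    using phase_mono[of s t x] phase_mono[of t s x]
    by (cases "s \<le> t") (auto simp: temp_def zero_le_mult_iff)
  also have "phase x s - phase x t = (s - t) - (temp x s - temp x t)" by (simp add: temp_def)
  finally show ?thesis by (simp add: power2_eq_square right_diff_distrib)
qed

text \<open>A temperature off the melting level means that the clamp is saturated; every iterate
  thus satisfies the phase relation exactly.\<close>

lemma phase_cases:
  "x \<in> D \<Longrightarrow> (temp x s > u\<^sub>M x \<longrightarrow> phase x s = 1) \<and> (temp x s < u\<^sub>M x \<longrightarrow> phase x s = - 1)"
  by (auto simp: temp_def phase_def clamp1_def max_def min_def split: if_splits)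

lemma sqint_temp: "sqint (\<lambda>x. temp x (ofL2 z x))"
proof -
  have "sqint (\<lambda>x. temp x (ofL2 z x) - g x)"
  proof (rule sqint_bound)
    show "(\<lambda>x. temp x (ofL2 z x) - g x) \<in> borel_measurable borel"
      using temp_measurable[OF measurable_ofL2[of z]] by measurable
    show "integrable lborel (\<lambda>x. (norm (ofL2 z x))\<^sup>2)" by (rule sqint_integrable[OF sqint_ofL2])
    show "AE x in lborel. (norm (temp x (ofL2 z x) - g x))\<^sup>2 \<le> (norm (ofL2 z x))\<^sup>2"
      using temp_Lipschitz[of _ _ 0] by (intro AE_I2 power_mono) (auto simp: temp_0)
  qed
  from sqint_add[OF this g(1)] show ?thesis by simp
qed

lemma ofL2_\<gamma>: "AE x in lborel. ofL2 (\<gamma> z) x = temp x (ofL2 z x)"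
  unfolding \<gamma>_def by (rule ofL2_toL2[OF sqint_temp])

lemma ofL2_\<gamma>_diff: "AE x in lborel. ofL2 (\<gamma> a - \<gamma> b) x = temp x (ofL2 a x) - temp x (ofL2 b x)"
  using ofL2_diff[of "\<gamma> a" "\<gamma> b"] ofL2_\<gamma>[of a] ofL2_\<gamma>[of b] by eventually_elim simp

lemma \<gamma>_firm_weighted:
  assumes k [measurable]: "\<kappa> \<in> borel_measurable borel" and kb: "\<And>x. 0 \<le> \<kappa> x \<and> \<kappa> x \<le> 1"
  shows "inner (mulL2 \<kappa> (\<gamma> a - \<gamma> b)) (\<gamma> a - \<gamma> b) \<le> inner (mulL2 \<kappa> (a - b)) (\<gamma> a - \<gamma> b)"
proof -
  have kb': "\<bar>\<kappa> x\<bar> \<le> 1" for x using kb[of x] by auto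
  have int: "integrable lborel (\<lambda>x. \<kappa> x * (ofL2 f x \<bullet> ofL2 h x))" for f h :: "('a, real) L2"
    using sqint_inner_integrable[OF sqint_mult[OF sqint_ofL2[of f] k kb'] sqint_ofL2[of h]] by (simp add: mult.assoc)
  show ?thesis
    unfolding inner_mulL2[OF k kb']
  proof (rule integral_mono_AE[OF int int])
    show "AE x in lborel. \<kappa> x * (ofL2 (\<gamma> a - \<gamma> b) x \<bullet> ofL2 (\<gamma> a - \<gamma> b) x)
        \<le> \<kappa> x * (ofL2 (a - b) x \<bullet> ofL2 (\<gamma> a - \<gamma> b) x)"
      using ofL2_\<gamma>_diff[of a b] ofL2_diff[of a b]
    proof eventually_elim
      case (elim x)
      then show ?case
        using temp_firm[of x "ofL2 a x" "ofL2 b x"] kb[of x]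
        by (auto intro!: mult_left_mono simp: power2_eq_square mult.commute)
    qed
  qed
qed

lemma \<gamma>_firm: "(norm (\<gamma> a - \<gamma> b))\<^sup>2 \<le> inner (\<gamma> a - \<gamma> b) (a - b)"
proof -
  have "mulL2 (\<lambda>x. 1) f = f" for f :: "('a, real) L2" by (simp add: mulL2_def)
  then show ?thesis using \<gamma>_firm_weighted[of "\<lambda>x. 1" a b] by (simp add: power2_norm_eq_inner inner_commute)
qed

lemma \<gamma>_0: "\<gamma> 0 = toL2 g"
proof -
  have z: "AE x in lborel. ofL2 (0 :: ('a, real) L2) x = 0" by (rule ofL2_0)
  show ?thesis unfolding \<gamma>_def toL2_eq_iff[OF sqint_temp g(1)]
    using z by eventually_elim (simp add: temp_0)
qed

sublocale enthalpy_scheme "gradL2 D" "toL2 F" \<gamma> G\<^sub>0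
  by unfold_locales (auto intro: gradL2_subspace gradL2_closed \<gamma>_firm simp: \<gamma>_0 G0)

text \<open>Enthalpy minus temperature is a difference of two phases, hence at most 2 in absolute
  value; after multiplication with \<kappa> its norm is at most
  \<open>2 * norm (toL2 \<kappa>)\<close>, which serves as \<open>N\<close>.\<close>

lemma cutoff_mulL2:
  assumes \<kappa>: "\<kappa> \<in> Cc_infinity UNIV" and kb: "\<And>x. 0 \<le> \<kappa> x \<and> \<kappa> x \<le> 1"
    and grad: "\<And>x. norm (classical_grad \<kappa> x) \<le> \<epsilon>"
  shows "cutoff (mulL2 \<kappa>) (mulL2 \<kappa>) (\<lambda>p. toL2 (\<lambda>x. ofL2 p x *\<^sub>R classical_grad \<kappa> x)) (2 * norm (toL2 \<kappa>)) \<epsilon>"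
proof -
  have kb': "\<bar>\<kappa> x\<bar> \<le> 1" for x using kb[of x] by auto
  note k [measurable] = Cc_infinity_measurable[OF \<kappa>]
  note C = Cc_infinityD(1)[OF \<kappa>]
  have bd: "\<bar>inner (mulL2 \<kappa> (a - b)) e\<bar> \<le> (2 * norm (toL2 \<kappa>) + norm (\<gamma> a - \<gamma> b)) * norm e" for a b e
  proof -
    define w where "w = (a - b) - (\<gamma> a - \<gamma> b)"
    have "AE x in lborel. ofL2 w x = phase x (ofL2 a x) - phase x (ofL2 b x)"
      using ofL2_\<gamma>_diff[of a b] ofL2_diff[of a b] ofL2_diff[of "a - b" "\<gamma> a - \<gamma> b"]
      unfolding w_def by eventually_elim (simp add: temp_def)
    then have "AE x in lborel. norm (\<kappa> x *\<^sub>R ofL2 w x) \<le> norm (2 * \<kappa> x)"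
    proof eventually_elim
      case (elim x)
      have "\<bar>ofL2 w x\<bar> \<le> 2" using elim phase_bound[of x "ofL2 a x"] phase_bound[of x "ofL2 b x"] by linarith
      then have "\<bar>\<kappa> x\<bar> * \<bar>ofL2 w x\<bar> \<le> \<bar>\<kappa> x\<bar> * 2" by (intro mult_left_mono) auto
      then show ?case by (simp add: abs_mult)
    qed
    then have "norm (mulL2 \<kappa> w) \<le> norm (toL2 (\<lambda>x. 2 * \<kappa> x))"
      unfolding mulL2_def
      using sqint_scaleR[OF Cc_infinity_sqint[OF \<kappa>], of 2]
      by (intro norm_L2_mono sqint_mult[OF sqint_ofL2 k kb']) auto
    then have nw: "norm (mulL2 \<kappa> w) \<le> 2 * norm (toL2 \<kappa>)"
      using toL2_scaleR[OF Cc_infinity_sqint[OF \<kappa>], of 2] by simp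
    have "mulL2 \<kappa> (a - b) = mulL2 \<kappa> w + mulL2 \<kappa> (\<gamma> a - \<gamma> b)"
      unfolding w_def by (simp add: linear_diff[OF linear_mulL2[OF k kb']])
    then have "norm (mulL2 \<kappa> (a - b)) \<le> 2 * norm (toL2 \<kappa>) + norm (\<gamma> a - \<gamma> b)"
      using norm_triangle_ineq[of "mulL2 \<kappa> w" "mulL2 \<kappa> (\<gamma> a - \<gamma> b)"] nw norm_mulL2_le[OF k kb', of "\<gamma> a - \<gamma> b"]
      by simp
    then show ?thesis by (intro order_trans[OF Cauchy_Schwarz_ineq2] mult_right_mono) auto
  qed
  show ?thesis
    unfolding cutoff_def
  proof (intro conjI allI impI)
    fix a b :: "('a, real) L2" and G H :: "('a, 'a) L2"
    show "linear (mulL2 \<kappa> :: ('a, real) L2 \<Rightarrow> _)" "linear (mulL2 \<kappa> :: ('a, 'a) L2 \<Rightarrow> _)"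
      by (rule linear_mulL2[OF k kb'])+
    show "inner (mulL2 \<kappa> a) b = inner a (mulL2 \<kappa> b)" "inner (mulL2 \<kappa> G) H = inner G (mulL2 \<kappa> H)"
      by (rule mulL2_self_adjoint[OF k kb'])+
    show "norm (mulL2 \<kappa> a) \<le> norm a" "norm (mulL2 \<kappa> G) \<le> norm G"
      using norm_mulL2_le[OF k kb', of a] norm_mulL2_le[OF k kb', of G] by simp_all
    show "0 \<le> inner (mulL2 \<kappa> a) a" "0 \<le> inner (mulL2 \<kappa> G) G"
      by (rule inner_mulL2_nonneg[OF k kb']; use kb in simp)+
    show "inner (mulL2 \<kappa> (\<gamma> a - \<gamma> b)) (\<gamma> a - \<gamma> b) \<le> inner (mulL2 \<kappa> (a - b)) (\<gamma> a - \<gamma> b)"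
      by (rule \<gamma>_firm_weighted[OF k kb])
  next
    fix a b e
    show "\<bar>inner (mulL2 \<kappa> (a - b)) e\<bar> \<le> (2 * norm (toL2 \<kappa>) + norm (\<gamma> a - \<gamma> b)) * norm e" by (rule bd)
  next
    fix p show "norm (toL2 (\<lambda>x. ofL2 p x *\<^sub>R classical_grad \<kappa> x)) \<le> \<epsilon> * norm p"
      by (rule times_classical_grad(2)[OF C grad])
  next
    fix p G assume "(p, G) \<in> gradL2 D"
    then show "(mulL2 \<kappa> p, mulL2 \<kappa> G + toL2 (\<lambda>x. ofL2 p x *\<^sub>R classical_grad \<kappa> x)) \<in> gradL2 D"
      by (rule gradL2_cutoff[OF DB C kb' grad])
  qed
qed

definition R :: "nat \<Rightarrow> ('a, real) L2 \<Rightarrow> ('a, real) L2" where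
  "R \<rho> = mulL2 (indicator (cball 0 (real \<rho>)))"

text \<open>Smooth fields supported in \<open>D\<close> have a classical divergence. Fields
  vanishing on \<open>D\<close> are added because vectors live on the whole space; against gradients
  extended by zero they contribute nothing.\<close>

definition S :: "('a, 'a) L2 set" where
  "S = {L. (\<exists>b\<in>Basis. \<exists>\<phi>\<in>Cc_infinity D. L = toL2 (\<lambda>x. \<phi> x *\<^sub>R b)) \<or> mulL2 (indicator D) L = 0}"

lemma indicator_mul: "B \<in> sets borel \<Longrightarrow> indicator B \<in> borel_measurable borel" "\<bar>indicator B x :: real\<bar> \<le> 1"
  by (auto simp: indicator_def)

sublocale enthalpy_limit "gradL2 D" "toL2 F" \<gamma> G\<^sub>0 R S
proof (rule enthalpy_limit.intro[OF enthalpy_scheme_axioms], rule enthalpy_limit_axioms.intro)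
  have m: "(indicator (cball 0 (real \<rho>)) :: 'a \<Rightarrow> real) \<in> borel_measurable borel" for \<rho>
    by (intro borel_measurable_indicator borel_closed closed_cball)
  show "linear (R \<rho>)" for \<rho> unfolding R_def by (rule linear_mulL2[OF m indicator_mul(2)])
  show "inner (R \<rho> a) b = inner a (R \<rho> b)" for \<rho> a b unfolding R_def by (rule mulL2_self_adjoint[OF m indicator_mul(2)])
  show "R \<rho> (R \<rho> a) = R \<rho> a" for \<rho> a
    unfolding R_def by (rule mulL2_indicator_idem) (intro borel_closed closed_cball)
  show "f = 0" if f: "\<And>\<rho>. R \<rho> f = 0" for f
  proof -
    have z: "AE x in lborel. ofL2 (0 :: ('a, real) L2) x = 0" by (rule ofL2_0)
    have "AE x in lborel. indicator (cball 0 (real \<rho>)) x *\<^sub>R ofL2 f x = 0" for \<rho>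
    proof -
      have "AE x in lborel. ofL2 (R \<rho> f) x = indicator (cball 0 (real \<rho>)) x *\<^sub>R ofL2 f x"
        unfolding R_def by (rule ofL2_mulL2_indicator) (intro borel_closed closed_cball)
      then show ?thesis unfolding f using z by eventually_elim argo
    qed
    then have "AE x in lborel. \<forall>\<rho>::nat. indicator (cball 0 (real \<rho>)) x *\<^sub>R ofL2 f x = 0"
      unfolding AE_all_countable by blast
    then show ?thesis unfolding L2_eq_iff using z
    proof eventually_elim
      case (elim x)
      obtain \<rho> :: nat where "norm x \<le> real \<rho>" using real_arch_simple by blast
      then show ?case using elim(1)[rule_format, of \<rho>] elim(2) by simp
    qed
  qed
  show "\<exists>c>0. \<forall>\<epsilon>>0. \<exists>X Y B N. 0 \<le> N \<and> cutoff X Y B N \<epsilon> \<and> (\<forall>x. inner (R \<rho> x) x \<le> c * inner (X x) x)" for \<rho>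
  proof -
    obtain c where c: "c > 0" "\<And>\<epsilon>. \<epsilon> > 0 \<Longrightarrow> \<exists>\<kappa>::'a \<Rightarrow> real. \<kappa> \<in> Cc_infinity UNIV \<and> (\<forall>x. 0 \<le> \<kappa> x \<and> \<kappa> x \<le> 1) \<and>
           (\<forall>x. norm (classical_grad \<kappa> x) \<le> \<epsilon>) \<and> (\<forall>x. norm x \<le> real \<rho> \<longrightarrow> 1 \<le> c * \<kappa> x)"
      using cutoff_functions[of "real \<rho>"] by blast
    show ?thesis
    proof (intro exI[of _ c] conjI allI impI c(1))
      fix \<epsilon> :: real assume "\<epsilon> > 0"
      then obtain \<kappa> :: "'a \<Rightarrow> real" where k: "\<kappa> \<in> Cc_infinity UNIV" "\<And>x. 0 \<le> \<kappa> x \<and> \<kappa> x \<le> 1"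
           "\<And>x. norm (classical_grad \<kappa> x) \<le> \<epsilon>" "\<And>x. norm x \<le> real \<rho> \<Longrightarrow> 1 \<le> c * \<kappa> x" using c(2) by blast
      have kb': "\<bar>\<kappa> x\<bar> \<le> 1" for x using k(2)[of x] by auto
      note km [measurable] = Cc_infinity_measurable[OF k(1)]
      have int: "integrable lborel (\<lambda>x. w x * (ofL2 f x \<bullet> ofL2 f x))"
        if "w \<in> borel_measurable borel" "\<And>x. \<bar>w x\<bar> \<le> 1" for w and f :: "('a, real) L2"
        using sqint_inner_integrable[OF sqint_mult[OF sqint_ofL2[of f] that] sqint_ofL2[of f]] by (simp add: mult.assoc)
      have "inner (R \<rho> f) f \<le> c * inner (mulL2 \<kappa> f) f" for f
      proof -
        have "(LINT x|lborel. indicator (cball 0 (real \<rho>)) x * (ofL2 f x \<bullet> ofL2 f x))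
            \<le> (LINT x|lborel. c * (\<kappa> x * (ofL2 f x \<bullet> ofL2 f x)))"
        proof (rule integral_mono)
          show "integrable lborel (\<lambda>x. indicator (cball 0 (real \<rho>)) x * (ofL2 f x \<bullet> ofL2 f x))"
            by (rule int[OF m indicator_mul(2)])
          show "integrable lborel (\<lambda>x. c * (\<kappa> x * (ofL2 f x \<bullet> ofL2 f x)))"
            by (rule integrable_mult_right) (rule int[OF km kb'])
          fix x
          have "indicator (cball 0 (real \<rho>)) x \<le> c * \<kappa> x" using k(2,4)[of x] c(1) by (auto simp: indicator_def)
          then show "indicator (cball 0 (real \<rho>)) x * (ofL2 f x \<bullet> ofL2 f x) \<le> c * (\<kappa> x * (ofL2 f x \<bullet> ofL2 f x))"
            unfolding mult.assoc[symmetric] by (intro mult_right_mono) auto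
        qed
        then show ?thesis
          unfolding R_def inner_mulL2[OF m indicator_mul(2)] inner_mulL2[OF km kb'] integral_mult_right_zero .
      qed
      then show "\<exists>X Y B N. 0 \<le> N \<and> cutoff X Y B N \<epsilon> \<and> (\<forall>x. inner (R \<rho> x) x \<le> c * inner (X x) x)"
        using cutoff_mulL2[OF k(1-3)]
        by (intro exI[of _ "mulL2 \<kappa>"] exI[of _ "\<lambda>p. toL2 (\<lambda>x. ofL2 p x *\<^sub>R classical_grad \<kappa> x)"]
            exI[of _ "2 * norm (toL2 \<kappa>)"]) auto
    qed
  qed
  have iD: "indicator D \<in> borel_measurable borel" "\<And>x. \<bar>indicator D x :: real\<bar> \<le> 1" by (auto simp: indicator_def)
  show "f = 0" if f: "\<And>L. L \<in> S \<Longrightarrow> inner f L = 0" for f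
  proof (rule vector_test_functions_total[OF D])
    let ?h = "f - mulL2 (indicator D) f"
    have h0: "mulL2 (indicator D) ?h = 0" by (simp add: linear_diff[OF mulL2_indicator_linear[OF DB]] mulL2_indicator_idem[OF DB])
    then have "inner f ?h = 0" by (intro f) (simp add: S_def)
    moreover have "inner (mulL2 (indicator D) f) ?h = 0" by (simp add: mulL2_self_adjoint[OF iD] h0)
    ultimately have "inner ?h ?h = 0" by (simp only: inner_diff_left)
    then show "mulL2 (indicator D) f = f" by simp
  qed (use f in \<open>auto simp: S_def\<close>)
  show "\<exists>d. \<forall>(p, G)\<in>gradL2 D. inner G L = - inner p d" if L: "L \<in> S" for L
  proof (cases "mulL2 (indicator D) L = 0")
    case True
    have "inner G L = 0" if "(p, G) \<in> gradL2 D" for p G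
    proof -
      have "inner (mulL2 (indicator D) G) L = 0" by (simp add: mulL2_self_adjoint[OF iD] True)
      then show ?thesis using that by (simp add: gradL2_def)
    qed
    then show ?thesis by (intro exI[of _ 0]) auto
  next
    case False
    then obtain b \<phi> where "b \<in> Basis" "\<phi> \<in> Cc_infinity D" "L = toL2 (\<lambda>x. \<phi> x *\<^sub>R b)" using L by (auto simp: S_def)
    then show ?thesis by (intro exI[of _ "toL2 (partial_deriv b \<phi>)"]) (auto simp: gradL2_def)
  qed
qed

end

text \<open>The phases are bounded but need not be square integrable; divided by this weight they are, and
  their weak limits are taken in the weighted form.\<close>

definition weight :: "'a::euclidean_space \<Rightarrow> real" where
  "weight x = (\<Prod>b\<in>Basis. 1 + \<bar>x \<bullet> b\<bar>)"

lemma weight_ge_1: "1 \<le> weight x"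
  unfolding weight_def by (rule prod_ge_1) auto

lemma weight_pos: "0 < weight x"
  using weight_ge_1[of x] by linarith

lemma weight_continuous: "continuous_on S weight"
  unfolding weight_def by (intro continuous_intros)

lemma weight_measurable [measurable]: "weight \<in> borel_measurable borel"
  by (intro borel_measurable_continuous_onI weight_continuous)

lemma integrable_inverse_square_abs: "integrable lborel (\<lambda>t::real. 1 / (1 + \<bar>t\<bar>)\<^sup>2)"
proof (rule Bochner_Integration.integrable_bound)
  let ?f = "\<lambda>t::real. indicator {0..} t / (1 + t)\<^sup>2 :: real"
  have "integrable lborel (\<lambda>t. ?f (0 + - 1 * t))"
    by (subst lborel_integrable_real_affine_iff) (auto intro: inverse_square_integrable)
  then show "integrable lborel (\<lambda>t. ?f t + ?f (0 + - 1 * t))"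
    by (intro Bochner_Integration.integrable_add inverse_square_integrable)
  show "AE t in lborel. norm (1 / (1 + \<bar>t\<bar>)\<^sup>2) \<le> norm (?f t + ?f (0 + - 1 * t))"
    by (intro AE_I2) (auto simp: indicator_def abs_real_def)
qed measurable

lemma sqint_inverse_weight: "sqint (\<lambda>x::'a::euclidean_space. 1 / weight x)"
proof -
  have fin: "(\<integral>\<^sup>+t. ennreal (1 / (1 + \<bar>t::real\<bar>)\<^sup>2) \<partial>lborel) < \<infinity>"
    using integrable_inverse_square_abs by (simp add: integrable_iff_bounded)
  have "(norm (1 / weight x))\<^sup>2 = (\<Prod>b\<in>Basis. 1 / (1 + \<bar>x \<bullet> b\<bar>)\<^sup>2)" for x :: 'a
    by (simp add: weight_def power_divide prod_power_distrib[symmetric] prod_dividef)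
  then have "(\<integral>\<^sup>+x. ennreal ((norm (1 / weight (x::'a)))\<^sup>2) \<partial>lborel)
      = (\<integral>\<^sup>+x. (\<Prod>b\<in>Basis. ennreal (1 / (1 + \<bar>(x::'a) \<bullet> b\<bar>)\<^sup>2)) \<partial>lborel)"
    by (simp add: prod_ennreal)
  also have "\<dots> = (\<Prod>b\<in>(Basis::'a set). \<integral>\<^sup>+t. ennreal (1 / (1 + \<bar>t\<bar>)\<^sup>2) \<partial>lborel)"
    by (rule nn_integral_lborel_prod) auto
  also have "\<dots> < \<infinity>"
    using fin by (simp add: ennreal_prod_eq_top less_top[symmetric] power_eq_top_ennreal)
  finally show ?thesis by (simp add: sqint_def integrable_iff_bounded)
qed

section \<open>Weighted phases and the integrated enthalpy balance\<close>

context stefan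
begin

definition weighted_phase :: "('a, real) L2 \<Rightarrow> ('a, real) L2" where
  "weighted_phase \<zeta> = toL2 (\<lambda>x. phase x (ofL2 \<zeta> x) / weight x)"

lemma sqint_weighted_phase: "sqint (\<lambda>x. phase x (ofL2 \<zeta> x) / weight x)"
proof -
  have [measurable]: "(\<lambda>x. phase x (ofL2 \<zeta> x)) \<in> borel_measurable borel"
    by (rule phase_measurable) measurable
  have "sqint (\<lambda>x. phase x (ofL2 \<zeta> x) *\<^sub>R (1 / weight x))"
    by (rule sqint_mult[OF sqint_inverse_weight]) (use phase_bound in auto)
  then show ?thesis by simp
qed

lemma ofL2_weighted_phase: "AE x in lborel. ofL2 (weighted_phase \<zeta>) x = phase x (ofL2 \<zeta> x) / weight x"
  unfolding weighted_phase_def by (rule ofL2_toL2[OF sqint_weighted_phase])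

definition \<Theta> :: real where "\<Theta> = norm (toL2 (\<lambda>x::'a. 1 / weight x))"

lemma norm_weighted_phase: "norm (weighted_phase \<zeta>) \<le> \<Theta>"
  unfolding weighted_phase_def \<Theta>_def
proof (rule norm_L2_mono[OF sqint_weighted_phase sqint_inverse_weight], rule AE_I2)
  fix x :: 'a
  show "norm (phase x (ofL2 \<zeta> x) / weight x) \<le> norm (1 / weight x)"
    using phase_bound[of x "ofL2 \<zeta> x"] weight_pos[of x] by (simp add: divide_right_mono)
qed

definition test :: "('a \<Rightarrow> real) \<Rightarrow> ('a, real) L2" where
  "test \<eta> = toL2 (\<lambda>x. indicator D x * \<eta> x)"
text \<open>The weight cancels the one in \<open>weighted_phase\<close>: their pairing is the plain
  integral of phase times \<eta> over \<open>D\<close>. For compactly supported \<eta> the product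
  remains square integrable.\<close>

definition wtest :: "('a \<Rightarrow> real) \<Rightarrow> ('a, real) L2" where
  "wtest \<eta> = toL2 (\<lambda>x. (indicator D x * weight x) * \<eta> x)"
definition gtest :: "('a \<Rightarrow> real) \<Rightarrow> ('a, 'a) L2" where
  "gtest \<eta> = toL2 (\<lambda>x. indicator D x *\<^sub>R classical_grad \<eta> x)"

lemma sqint_test:
  assumes "\<eta> \<in> Cc_infinity W"
  shows "sqint (\<lambda>x. indicator D x * \<eta> x)" "sqint (\<lambda>x. (indicator D x * weight x) * \<eta> x)"
    "sqint (\<lambda>x. indicator D x *\<^sub>R classical_grad \<eta> x)"
proof -
  have i: "indicator D \<in> borel_measurable borel" "\<And>x. \<bar>indicator D x :: real\<bar> \<le> 1" by (auto simp: indicator_def)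
  show "sqint (\<lambda>x. indicator D x * \<eta> x)"
    using sqint_mult[OF Cc_infinity_sqint[OF assms] i] by simp
  show "sqint (\<lambda>x. (indicator D x * weight x) * \<eta> x)"
    using sqint_mult[OF sqint_weighted_test[OF assms weight_continuous] i] by (simp add: mult.assoc)
  show "sqint (\<lambda>x. indicator D x *\<^sub>R classical_grad \<eta> x)"
    by (rule sqint_mult[OF sqint_classical_grad[OF assms] i])
qed

text \<open>Tests that are smooth on the whole space, not only those supported in \<open>D\<close>,
  are admissible in the limit equation; this yields the Neumann condition.\<close>

lemma test_mem:
  assumes \<eta>: "\<eta> \<in> Cc_infinity UNIV"
  shows "(test \<eta>, gtest \<eta>) \<in> gradL2 D"
proof -
  have i: "indicator D \<in> borel_measurable borel" "\<And>x. \<bar>indicator D x :: real\<bar> \<le> 1" by (auto simp: indicator_def)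
  show ?thesis
    using gradL2_smooth[OF DB \<eta>]
    by (simp add: test_def gtest_def mulL2_toL2[OF i Cc_infinity_sqint[OF \<eta>]] mulL2_toL2[OF i sqint_classical_grad[OF \<eta>]])
qed

definition init_enthalpy :: "('a \<Rightarrow> real) \<Rightarrow> real" where
  "init_enthalpy \<eta> = (LINT x|lborel. indicator D x * ((g x + \<mu>\<^sub>0 x) * \<eta> x))"

lemma \<mu>0_bound: "\<bar>\<mu>\<^sub>0 x\<bar> \<le> 1"
  using phase_bound[of x 0] by (simp add: phase_0)

lemma integrable_init:
  assumes \<eta>: "\<eta> \<in> Cc_infinity W"
  shows "integrable lborel (\<lambda>x. indicator D x * ((g x + \<mu>\<^sub>0 x) * \<eta> x))"
proof -
  have "sqint (\<lambda>x. \<mu>\<^sub>0 x *\<^sub>R (1 / weight x))"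
    by (rule sqint_mult[OF sqint_inverse_weight]) (use \<mu>0_bound in auto)
  from sqint_inner_integrable[OF this sqint_test(2)[OF \<eta>]]
  have "integrable lborel (\<lambda>x. indicator D x * (\<mu>\<^sub>0 x * \<eta> x))"
    using weight_pos by (simp add: mult_ac less_imp_neq[OF weight_pos, symmetric])
  moreover have "integrable lborel (\<lambda>x. indicator D x * (g x * \<eta> x))"
    using sqint_inner_integrable[OF g(1) sqint_test(1)[OF \<eta>]] by (simp add: mult_ac)
  ultimately show ?thesis
    using Bochner_Integration.integrable_add[of lborel] by (fastforce simp: distrib_left distrib_right)
qed

text \<open>The enthalpy \<open>g + \<mu>\<^sub>0 + \<zeta>\<close> splits into temperature and phase.\<close>

lemma weighted_phase_test:
  assumes \<eta>: "\<eta> \<in> Cc_infinity W"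
  shows "inner (weighted_phase \<zeta>) (wtest \<eta>) + inner (\<gamma> \<zeta>) (test \<eta>) = init_enthalpy \<eta> + inner \<zeta> (test \<eta>)"
proof -
  note s = sqint_test[OF \<eta>]
  have w: "inner (weighted_phase \<zeta>) (wtest \<eta>) = (LINT x|lborel. indicator D x * (phase x (ofL2 \<zeta> x) * \<eta> x))"
    unfolding weighted_phase_def wtest_def inner_toL2[OF sqint_weighted_phase s(2)]
    by (intro Bochner_Integration.integral_cong) (auto simp: mult_ac less_imp_neq[OF weight_pos, symmetric])
  have wi: "integrable lborel (\<lambda>x. indicator D x * (phase x (ofL2 \<zeta> x) * \<eta> x))"
    using sqint_inner_integrable[OF sqint_weighted_phase[of \<zeta>] s(2)]
    by (rule Bochner_Integration.integrable_cong[THEN iffD1, rotated 2])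
       (auto simp: mult_ac less_imp_neq[OF weight_pos, symmetric])
  have t: "inner (\<gamma> \<zeta>) (test \<eta>) = (LINT x|lborel. indicator D x * (temp x (ofL2 \<zeta> x) * \<eta> x))"
    unfolding \<gamma>_def test_def inner_toL2[OF sqint_temp s(1)] by (simp add: mult_ac)
  have ti: "integrable lborel (\<lambda>x. indicator D x * (temp x (ofL2 \<zeta> x) * \<eta> x))"
    using sqint_inner_integrable[OF sqint_temp[of \<zeta>] s(1)] by (simp add: mult_ac)
  have \<zeta>: "inner \<zeta> (test \<eta>) = (LINT x|lborel. indicator D x * (ofL2 \<zeta> x * \<eta> x))"
    unfolding test_def inner_toL2_right[OF s(1)] by (simp add: mult_ac)
  have zi: "integrable lborel (\<lambda>x. indicator D x * (ofL2 \<zeta> x * \<eta> x))"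
    using sqint_inner_integrable[OF sqint_ofL2[of \<zeta>] s(1)] by (simp add: mult_ac)
  show ?thesis
    unfolding w t \<zeta> init_enthalpy_def
    unfolding Bochner_Integration.integral_add[OF wi ti, symmetric]
      Bochner_Integration.integral_add[OF integrable_init[OF \<eta>] zi, symmetric]
    by (intro Bochner_Integration.integral_cong) (auto simp: temp_def algebra_simps)
qed

definition wtests :: "('a, real) L2 set" where
  "wtests = {f. (\<exists>\<eta>\<in>Cc_infinity D. f = wtest \<eta>) \<or> mulL2 (indicator D) f = 0}"

lemma indicator_D: "indicator D \<in> borel_measurable borel" "\<bar>indicator D x :: real\<bar> \<le> 1"
  by (auto simp: indicator_def)

lemma wtests_total:
  assumes f: "\<And>\<phi>. \<phi> \<in> wtests \<Longrightarrow> inner f \<phi> = 0"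
  shows "f = 0"
proof (rule weighted_test_functions_total[OF D _ weight_continuous weight_pos])
  let ?h = "f - mulL2 (indicator D) f"
  have h0: "mulL2 (indicator D) ?h = 0"
    by (simp add: linear_diff[OF mulL2_indicator_linear[OF DB]] mulL2_indicator_idem[OF DB])
  then have "inner f ?h = 0" by (intro f) (simp add: wtests_def)
  moreover have "inner (mulL2 (indicator D) f) ?h = 0" by (simp add: mulL2_self_adjoint[OF indicator_D] h0)
  ultimately have "inner ?h ?h = 0" by (simp only: inner_diff_left)
  then show "mulL2 (indicator D) f = f" by simp
next
  fix \<phi> assume \<phi>: "\<phi> \<in> Cc_infinity D"
  have "(\<lambda>x. (indicator D x * weight x) * \<phi> x) = (\<lambda>x. weight x * \<phi> x)"
    using Cc_infinity_zero_outside[OF \<phi>] by (auto simp: indicator_def fun_eq_iff)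
  then have "wtest \<phi> = toL2 (\<lambda>x. weight x * \<phi> x)" by (simp only: wtest_def)
  moreover have "wtest \<phi> \<in> wtests" using \<phi> by (auto simp: wtests_def)
  ultimately have "toL2 (\<lambda>x. weight x * \<phi> x) \<in> wtests" by simp
  then show "inner f (toL2 (\<lambda>x. weight x * \<phi> x)) = 0" by (rule f)
qed

lemma mul_weighted_phase: "mulL2 (indicator D) (weighted_phase \<zeta>) = weighted_phase \<zeta>"
  unfolding mulL2_indicator_eq_iff[OF DB]
  using ofL2_weighted_phase[of \<zeta>] by eventually_elim (simp add: phase_def)

lemma weighted_phase_wtests:
  assumes t: "0 \<le> t" and \<phi>: "mulL2 (indicator D) \<phi> = 0"
  shows "inner (weighted_phase \<zeta>) \<phi> = 0"
  using mulL2_self_adjoint[OF indicator_D, of "weighted_phase \<zeta>" \<phi>] by (simp add: mul_weighted_phase \<phi>)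

text \<open>The phase is the enthalpy minus the temperature. The tested enthalpy converges by the
  equation and the temperature by \<open>U_weak\<close>, so the tested phases converge at every
  time, although by themselves they are only bounded.\<close>

lemma phase_test_tendsto:
  assumes t: "0 \<le> t" and \<eta>: "\<eta> \<in> Cc_infinity UNIV"
  shows "(\<lambda>n. inner (weighted_phase (Z n t)) (wtest \<eta>)) \<longlonglongrightarrow>
    init_enthalpy \<eta> - integral {0..t} (\<lambda>s. inner (Glim s + toL2 F) (gtest \<eta>)) - inner (ulim t) (test \<eta>)"
proof -
  have "inner (weighted_phase (Z n t)) (wtest \<eta>) = init_enthalpy \<eta> + inner (Z n t) (test \<eta>) - inner (U n t) (test \<eta>)" for n
    using weighted_phase_test[OF \<eta>, of "Z n t"] by (simp add: UZ)
  moreover have "(\<lambda>n. init_enthalpy \<eta> + inner (Z n t) (test \<eta>) - inner (U n t) (test \<eta>)) \<longlonglongrightarrow>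
      init_enthalpy \<eta> + (- integral {0..t} (\<lambda>s. inner (Glim s + toL2 F) (gtest \<eta>))) - inner (ulim t) (test \<eta>)"
    by (intro tendsto_diff tendsto_add tendsto_const Z_weak test_mem U_weak t \<eta>)
  ultimately show ?thesis by simp
qed

lemma phase_weak_limit_ex:
  assumes t: "0 \<le> t"
  shows "\<exists>y. \<forall>\<phi>. (\<lambda>n. inner (weighted_phase (Z n t)) \<phi>) \<longlonglongrightarrow> inner y \<phi>"
proof (rule weak_limit_exists[OF norm_weighted_phase wtests_total])
  fix \<phi> assume "\<phi> \<in> wtests"
  then consider \<eta> where "\<eta> \<in> Cc_infinity D" "\<phi> = wtest \<eta>" | "mulL2 (indicator D) \<phi> = 0"
    by (auto simp: wtests_def)
  then show "convergent (\<lambda>n. inner (weighted_phase (Z n t)) \<phi>)"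
  proof cases
    case 1
    then show ?thesis using phase_test_tendsto[OF t Cc_infinity_mono[OF 1(1)]] by (auto simp: convergent_def)
  next
    case 2
    then show ?thesis using weighted_phase_wtests[OF t 2] by (simp add: convergent_const)
  qed
qed

definition Mlim :: "real \<Rightarrow> ('a, real) L2" where
  "Mlim t = (SOME y. \<forall>\<phi>. (\<lambda>n. inner (weighted_phase (Z n t)) \<phi>) \<longlonglongrightarrow> inner y \<phi>)"

lemma M_weak: "0 \<le> t \<Longrightarrow> (\<lambda>n. inner (weighted_phase (Z n t)) \<phi>) \<longlonglongrightarrow> inner (Mlim t) \<phi>"
  using someI_ex[OF phase_weak_limit_ex, folded Mlim_def] by blast

text \<open>The limit equation for a test function independent of time, already at every time and
  with the initial enthalpy built in.\<close>

lemma enthalpy_balance: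
  assumes t: "0 \<le> t" and \<eta>: "\<eta> \<in> Cc_infinity UNIV"
  shows "inner (ulim t) (test \<eta>) + inner (Mlim t) (wtest \<eta>)
    = init_enthalpy \<eta> - integral {0..t} (\<lambda>s. inner (Glim s + toL2 F) (gtest \<eta>))"
  using LIMSEQ_unique[OF M_weak[OF t] phase_test_tendsto[OF t \<eta>]] by simp

lemma Mlim_norm: "0 \<le> t \<Longrightarrow> norm (Mlim t) \<le> \<Theta>"
  by (rule weak_limit_norm_le[OF M_weak]) (auto intro: norm_weighted_phase)

lemma Glim_plus_F_continuous: "continuous_on {0..} (\<lambda>t. inner (Glim t + toL2 F) L)"
  unfolding inner_add_left by (intro continuous_intros Glim_weakly_continuous)


end

text \<open>The test is the negative part of \<open>h\<close>. In this form pointwise inequalities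
  pass to weak limits.\<close>

lemma L2_nonneg_of_tests:
  fixes h :: "('a::euclidean_space, real) L2"
  assumes "\<And>f. (AE x in lborel. 0 \<le> ofL2 f x) \<Longrightarrow> 0 \<le> inner h f"
  shows "AE x in lborel. 0 \<le> ofL2 h x"
proof -
  define f where "f x = max 0 (- ofL2 h x)" for x
  have [measurable]: "f \<in> borel_measurable borel" unfolding f_def by measurable
  have "norm (f x) \<le> norm (ofL2 h x)" for x by (simp add: f_def)
  then have f: "sqint f"
    by (intro sqint_bound[OF _ sqint_integrable[OF sqint_ofL2[of h]]] AE_I2 power_mono) auto
  have "AE x in lborel. 0 \<le> ofL2 (toL2 f) x"
    using ofL2_toL2[OF f] by eventually_elim (simp add: f_def)
  then have "0 \<le> inner h (toL2 f)" by (rule assms)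
  also have "inner h (toL2 f) = (LINT x|lborel. - (norm (f x))\<^sup>2)"
    unfolding inner_toL2_right[OF f]
    by (intro Bochner_Integration.integral_cong) (auto simp: f_def max_def power2_eq_square)
  also have "\<dots> = - (LINT x|lborel. (norm (f x))\<^sup>2)" by simp
  finally have "(LINT x|lborel. (norm (f x))\<^sup>2) \<le> 0" by simp
  moreover have "0 \<le> (LINT x|lborel. (norm (f x))\<^sup>2)" by (intro integral_nonneg_AE) simp
  ultimately have "(LINT x|lborel. (norm (f x))\<^sup>2) = 0" by linarith
  then have "AE x in lborel. (norm (f x))\<^sup>2 = 0"
    using integral_nonneg_eq_0_iff_AE[OF sqint_integrable[OF f]] by simp
  then show ?thesis by eventually_elim (simp add: f_def max_def split: if_splits)
qed

text \<open>Boundedness of the weakly convergent factor absorbs the error made by replacing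
  \<open>Y t\<close> with its limit.\<close>

lemma weak_strong_tendsto:
  fixes X Y :: "'b \<Rightarrow> 'h::real_inner"
  assumes bd: "\<forall>\<^sub>F t in G. norm (X t) \<le> B" and weak: "((\<lambda>t. inner (X t) y) \<longlongrightarrow> l) G" and Y: "(Y \<longlongrightarrow> y) G"
  shows "((\<lambda>t. inner (X t) (Y t)) \<longlongrightarrow> l) G"
proof -
  have "((\<lambda>t. inner (X t) (Y t - y)) \<longlongrightarrow> 0) G"
  proof (rule Lim_null_comparison)
    show "\<forall>\<^sub>F t in G. norm (inner (X t) (Y t - y)) \<le> B * norm (Y t - y)"
      using bd
    proof eventually_elim
      case (elim t)
      then show ?case using Cauchy_Schwarz_ineq2[of "X t" "Y t - y"] mult_right_mono[OF elim norm_ge_zero[of "Y t - y"]]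
        by simp
    qed
    have "((\<lambda>t. B * norm (Y t - y)) \<longlongrightarrow> B * norm (y - y)) G" by (intro tendsto_intros Y)
    then show "((\<lambda>t. B * norm (Y t - y)) \<longlongrightarrow> 0) G" by simp
  qed
  from tendsto_add[OF this weak] show ?thesis by (simp add: inner_diff_right)
qed

lemma weak_strong_continuous:
  fixes X Y :: "'b::topological_space \<Rightarrow> 'h::real_inner"
  assumes "\<And>t. t \<in> T \<Longrightarrow> norm (X t) \<le> B" "\<And>\<phi>. continuous_on T (\<lambda>t. inner (X t) \<phi>)" "continuous_on T Y"
  shows "continuous_on T (\<lambda>t. inner (X t) (Y t))"
  unfolding continuous_on_def
proof (rule ballI, rule weak_strong_tendsto)
  fix t assume "t \<in> T"
  show "\<forall>\<^sub>F t in at t within T. norm (X t) \<le> B" using assms(1) by (auto simp: eventually_at_filter)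
  show "((\<lambda>s. inner (X s) (Y t)) \<longlongrightarrow> inner (X t) (Y t)) (at t within T)"
    using assms(2)[of "Y t"] \<open>t \<in> T\<close> by (simp add: continuous_on_def)
  show "(Y \<longlongrightarrow> Y t) (at t within T)" using assms(3) \<open>t \<in> T\<close> by (simp add: continuous_on_def)
qed

lemma integral_half_line_derivative:
  fixes f :: "real \<Rightarrow> real"
  assumes f: "continuous_on {0..} f" and t: "0 \<le> t"
  shows "((\<lambda>s. integral {0..s} f) has_real_derivative f t) (at t within {0..})"
proof -
  have "((\<lambda>s. integral {0..s} f) has_vector_derivative f t) (at t within {0..t + 1})"
    using t by (intro integral_has_vector_derivative continuous_on_subset[OF f]) auto
  moreover have "at t within {0..} = at t within {0..t + 1}"
    by (rule at_within_nhd[of t "{..<t + 1}"]) auto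
  ultimately show ?thesis by (simp add: has_real_derivative_iff_has_vector_derivative)
qed

lemma integral_half_line_continuous:
  fixes f :: "real \<Rightarrow> real"
  assumes "continuous_on {0..} f"
  shows "continuous_on {0..} (\<lambda>s. integral {0..s} f)"
  by (rule DERIV_continuous_on[OF integral_half_line_derivative[OF assms]]) auto

lemma classical_grad_slice:
  assumes "\<eta> \<in> Cc_infinity W"
  shows "classical_grad (\<lambda>x. \<eta> (x, t)) x = (\<Sum>b\<in>Basis. partial_deriv (b, 0) \<eta> (x, t) *\<^sub>R b)"
  unfolding classical_grad_def using partial_deriv_slice[OF Cc_infinityD(4)[OF assms]] by simp

section \<open>The phase relation in the limit\<close>

context stefan
begin

text \<open>With \<open>\<sigma> = 1\<close> and \<open>\<sigma> = - 1\<close> these are the two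
  one-sided bounds on the phase, each of which survives weak convergence.\<close>

lemma Mlim_bound:
  assumes t: "0 \<le> t" and \<sigma>: "\<bar>\<sigma>\<bar> \<le> (1::real)"
  shows "AE x in lborel. 0 \<le> ofL2 (toL2 (\<lambda>x. 1 / weight x) - \<sigma> *\<^sub>R Mlim t) x"
proof (rule L2_nonneg_of_tests)
  fix f :: "('a, real) L2" assume f: "AE x in lborel. 0 \<le> ofL2 f x"
  let ?W = "\<lambda>n. toL2 (\<lambda>x. 1 / weight x) - \<sigma> *\<^sub>R weighted_phase (Z n t)"
  have "0 \<le> inner (?W n) f" for n
    unfolding inner_ofL2
  proof (rule integral_nonneg_AE)
    show "AE x in lborel. 0 \<le> ofL2 (?W n) x \<bullet> ofL2 f x"
      using f ofL2_diff[of "toL2 (\<lambda>x. 1 / weight x)" "\<sigma> *\<^sub>R weighted_phase (Z n t)"] ofL2_scaleR[of \<sigma> "weighted_phase (Z n t)"]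
        ofL2_weighted_phase[of "Z n t"] ofL2_toL2[OF sqint_inverse_weight[where 'a='a]]
    proof eventually_elim
      case (elim x)
      have "\<bar>\<sigma> * phase x (ofL2 (Z n t) x)\<bar> \<le> 1"
        unfolding abs_mult using \<sigma> phase_bound by (intro mult_le_one) auto
      then have "\<sigma> * phase x (ofL2 (Z n t) x) \<le> 1" by linarith
      then have "0 \<le> (1 - \<sigma> * phase x (ofL2 (Z n t) x)) / weight x" using weight_pos[of x] by simp
      then show ?case using elim by (simp add: diff_divide_distrib)
    qed
  qed
  moreover have "(\<lambda>n. inner (?W n) f) \<longlonglongrightarrow> inner (toL2 (\<lambda>x. 1 / weight x) - \<sigma> *\<^sub>R Mlim t) f"
    unfolding inner_diff_left inner_scaleR_left by (intro tendsto_intros M_weak t)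
  ultimately show "0 \<le> inner (toL2 (\<lambda>x. 1 / weight x) - \<sigma> *\<^sub>R Mlim t) f"
    by (intro LIMSEQ_le_const) auto
qed

lemma Mlim_abs_le:
  assumes t: "0 \<le> t"
  shows "AE x in lborel. \<bar>weight x * ofL2 (Mlim t) x\<bar> \<le> 1"
proof -
  have 1: "AE x in lborel. 0 \<le> 1 / weight x - \<sigma> * ofL2 (Mlim t) x" if "\<bar>\<sigma>\<bar> \<le> 1" for \<sigma> :: real
    using Mlim_bound[OF t that] ofL2_diff[of "toL2 (\<lambda>x. 1 / weight x)" "\<sigma> *\<^sub>R Mlim t"]
      ofL2_scaleR[of \<sigma> "Mlim t"] ofL2_toL2[OF sqint_inverse_weight[where 'a='a]]
    by eventually_elim simp
  have p: "AE x in lborel. 0 \<le> 1 / weight x - 1 * ofL2 (Mlim t) x" by (rule 1) simp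
  have m: "AE x in lborel. 0 \<le> 1 / weight x - (- 1) * ofL2 (Mlim t) x" by (rule 1) simp
  show ?thesis
    using p m
  proof eventually_elim
    case (elim x)
    then have "\<bar>ofL2 (Mlim t) x\<bar> \<le> 1 / weight x" by auto
    then have "\<bar>ofL2 (Mlim t) x\<bar> * weight x \<le> 1" using weight_pos[of x] by (simp add: pos_le_divide_eq)
    then show ?case using weight_pos[of x] by (simp add: abs_mult mult.commute)
  qed
qed

text \<open>The nonnegative defect \<open>h\<close>, the weighted difference between saturation and
  phase, is tested with a nonnegative function that is positive where the limit temperature lies on
  the side \<sigma> of the melting level. Along the scheme the pairing is controlled by the local
  distance of the temperatures, hence it vanishes in the limit, and so does the defect on that
  set.\<close>

lemma phase_lim:
  assumes t: "0 \<le> t" and \<sigma>: "\<sigma> = 1 \<or> \<sigma> = (- 1 :: real)"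
  shows "AE x in lborel. x \<in> D \<longrightarrow> 0 < \<sigma> * (ofL2 (ulim t) x - u\<^sub>M x) \<longrightarrow> weight x * ofL2 (Mlim t) x = \<sigma>"
proof -
  define h where "h = toL2 (\<lambda>x. 1 / weight x) - \<sigma> *\<^sub>R Mlim t"
  have \<sigma>1: "\<bar>\<sigma>\<bar> \<le> 1" "\<sigma> * \<sigma> = 1" using \<sigma> by auto
  have h0: "AE x in lborel. 0 \<le> ofL2 h x" unfolding h_def by (rule Mlim_bound[OF t \<sigma>1(1)])
  have main: "AE x in lborel. x \<in> D \<longrightarrow> norm x \<le> real \<rho> \<longrightarrow> 0 < \<sigma> * (ofL2 (ulim t) x - u\<^sub>M x) \<longrightarrow> ofL2 h x = 0" for \<rho> :: nat
  proof -
    \<comment> \<open>Truncation at \<open>1\<close> and restriction to a ball make the test square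
      integrable without any integrability of the melting temperature.\<close>
    define f where "f x = indicator D x * indicator (cball 0 (real \<rho>)) x * max 0 (min 1 (\<sigma> * (ofL2 (ulim t) x - u\<^sub>M x)))" for x
    have B [measurable]: "cball (0::'a) (real \<rho>) \<in> sets borel" by (intro borel_closed closed_cball)
    have f: "sqint f"
      by (rule sqint_bounded_compact_support[where M=1 and K="cball 0 (real \<rho>)"])
         (auto simp: f_def[abs_def] indicator_def)
    define w where "w n = toL2 (\<lambda>x. 1 / weight x) - \<sigma> *\<^sub>R weighted_phase (Z n t)" for n
    have lim: "(\<lambda>n. inner (w n) (toL2 f)) \<longlonglongrightarrow> inner h (toL2 f)"
      unfolding w_def h_def inner_diff_left inner_scaleR_left by (intro tendsto_intros M_weak t)
    have le: "inner (w n) (toL2 f) \<le> (2 * \<Theta>) * norm (R \<rho> (U n t) - R \<rho> (ulim t))" for n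
    proof -
      define v where "v = R \<rho> (U n t) - R \<rho> (ulim t)"
      have sv: "sqint (\<lambda>x. \<bar>ofL2 v x\<bar>)"
        by (rule sqint_bound[OF _ sqint_integrable[OF sqint_ofL2[of v]]]) auto
      have "inner (w n) (toL2 f) \<le> inner (toL2 (\<lambda>x. 2 *\<^sub>R (1 / weight x))) (toL2 (\<lambda>x. \<bar>ofL2 v x\<bar>))"
        unfolding inner_toL2_right[OF f] inner_toL2[OF sqint_scaleR[OF sqint_inverse_weight] sv]
      proof (rule integral_mono_AE)
        show "integrable lborel (\<lambda>x. ofL2 (w n) x \<bullet> f x)" by (rule sqint_inner_integrable[OF sqint_ofL2 f])
        show "integrable lborel (\<lambda>x. (2 *\<^sub>R (1 / weight x)) \<bullet> \<bar>ofL2 v x\<bar>)"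
          by (rule sqint_inner_integrable[OF sqint_scaleR[OF sqint_inverse_weight] sv])
        show "AE x in lborel. ofL2 (w n) x \<bullet> f x \<le> (2 *\<^sub>R (1 / weight x)) \<bullet> \<bar>ofL2 v x\<bar>"
          using ofL2_diff[of "toL2 (\<lambda>x. 1 / weight x)" "\<sigma> *\<^sub>R weighted_phase (Z n t)"] ofL2_scaleR[of \<sigma> "weighted_phase (Z n t)"]
            ofL2_weighted_phase[of "Z n t"] ofL2_toL2[OF sqint_inverse_weight[where 'a='a]]
            ofL2_diff[of "R \<rho> (U n t)" "R \<rho> (ulim t)"]
            ofL2_mulL2_indicator[OF B, of "U n t"] ofL2_mulL2_indicator[OF B, of "ulim t"] ofL2_\<gamma>[of "Z n t"]
        proof eventually_elim
          case (elim x)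
          define s where "s = ofL2 (Z n t) x"
          have wx: "ofL2 (w n) x = (1 - \<sigma> * phase x s) / weight x"
            using elim by (simp add: w_def s_def diff_divide_distrib)
          have vx: "ofL2 v x = indicator (cball 0 (real \<rho>)) x * (temp x s - ofL2 (ulim t) x)"
            using elim by (simp add: v_def s_def R_def UZ right_diff_distrib)
          have "(1 - \<sigma> * phase x s) * f x \<le> 2 * \<bar>ofL2 v x\<bar>"
          proof (cases "x \<in> D \<and> x \<in> cball 0 (real \<rho>)")
            case True
            then have fx: "f x = max 0 (min 1 (\<sigma> * (ofL2 (ulim t) x - u\<^sub>M x)))" and vx': "ofL2 v x = temp x s - ofL2 (ulim t) x"
              using vx by (auto simp: f_def)
            show ?thesis
            \<comment> \<open>If the approximate temperature is on the side \<sigma>, its phase is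
              saturated and the defect is zero. Otherwise it lies on the other side of the melting
              level, so the truncated distance \<open>f x\<close> is at most the distance of the two
              temperatures, while the defect is at most 2.\<close>
            proof (cases "0 < \<sigma> * (temp x s - u\<^sub>M x)")
              case pos: True
              then have "phase x s = \<sigma>" using phase_cases[of x s] True \<sigma> by auto
              then show ?thesis using \<sigma>1 by simp
            next
              case False
              have "f x \<le> \<bar>ofL2 v x\<bar>" unfolding fx vx' using False \<sigma> by (auto simp: max_def min_def)
              moreover have "0 \<le> 1 - \<sigma> * phase x s" "1 - \<sigma> * phase x s \<le> 2"
                using phase_bound[of x s] \<sigma> by auto
              moreover have "0 \<le> f x" by (simp add: f_def)
              ultimately show ?thesis by (intro mult_mono) auto
            qed
          next
            case False
            then have "f x = 0" by (auto simp: f_def)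
            then show ?thesis by simp
          qed
          then have "(1 - \<sigma> * phase x s) * f x / weight x \<le> 2 * \<bar>ofL2 v x\<bar> / weight x"
            using weight_pos[of x] by (intro divide_right_mono) auto
          then show ?case by (simp add: wx)
        qed
      qed
      also have "\<dots> \<le> norm (toL2 (\<lambda>x::'a. 2 *\<^sub>R (1 / weight x))) * norm (toL2 (\<lambda>x. \<bar>ofL2 v x\<bar>))"
        by (rule norm_cauchy_schwarz)
      also have "norm (toL2 (\<lambda>x::'a. 2 *\<^sub>R (1 / weight x))) = 2 * \<Theta>"
        by (simp add: toL2_scaleR[OF sqint_inverse_weight] \<Theta>_def del: real_scaleR_def)
      also have "(2 * \<Theta>) * norm (toL2 (\<lambda>x. \<bar>ofL2 v x\<bar>)) \<le> (2 * \<Theta>) * norm (toL2 (ofL2 v))"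
        by (intro mult_left_mono norm_L2_mono sv sqint_ofL2) (auto simp: \<Theta>_def)
      finally show ?thesis by (simp add: v_def)
    qed
    have "(\<lambda>n. (2 * \<Theta>) * norm (R \<rho> (U n t) - R \<rho> (ulim t))) \<longlonglongrightarrow> (2 * \<Theta>) * norm (R \<rho> (ulim t) - R \<rho> (ulim t))"
      by (intro tendsto_intros U_local_strong t)
    then have "inner h (toL2 f) \<le> 0" using LIMSEQ_le[OF lim _] le by fastforce
    moreover have hf: "AE x in lborel. 0 \<le> ofL2 h x \<bullet> f x"
      using h0 by eventually_elim (simp add: f_def)
    moreover have "inner h (toL2 f) = (LINT x|lborel. ofL2 h x \<bullet> f x)" by (rule inner_toL2_right[OF f])
    ultimately have "(LINT x|lborel. ofL2 h x \<bullet> f x) = 0" using integral_nonneg_AE[OF hf] by simp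
    then have "AE x in lborel. ofL2 h x \<bullet> f x = 0"
      using integral_nonneg_eq_0_iff_AE[OF sqint_inner_integrable[OF sqint_ofL2[of h] f] hf] by blast
    then show ?thesis by eventually_elim (auto simp: f_def)
  qed
  then have "AE x in lborel. \<forall>\<rho>::nat. x \<in> D \<longrightarrow> norm x \<le> real \<rho> \<longrightarrow> 0 < \<sigma> * (ofL2 (ulim t) x - u\<^sub>M x) \<longrightarrow> ofL2 h x = 0"
    unfolding AE_all_countable by blast
  then show ?thesis
    using ofL2_diff[of "toL2 (\<lambda>x. 1 / weight x)" "\<sigma> *\<^sub>R Mlim t"] ofL2_scaleR[of \<sigma> "Mlim t"]
      ofL2_toL2[OF sqint_inverse_weight[where 'a='a]]
  proof eventually_elim
    case (elim x)
    show ?case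
    proof (intro impI)
      assume "x \<in> D" "0 < \<sigma> * (ofL2 (ulim t) x - u\<^sub>M x)"
      moreover obtain \<rho> :: nat where "norm x \<le> real \<rho>" using real_arch_simple by blast
      ultimately have "ofL2 h x = 0" using elim(1) by blast
      then have "1 / weight x = \<sigma> * ofL2 (Mlim t) x" using elim by (simp add: h_def)
      then have "1 = \<sigma> * (weight x * ofL2 (Mlim t) x)" using weight_pos[of x] by (simp add: divide_eq_eq mult_ac)
      then show "weight x * ofL2 (Mlim t) x = \<sigma>" using \<sigma> by auto
    qed
  qed
qed

lemma Mlim_0: "AE x in lborel. weight x * ofL2 (Mlim 0) x = \<mu>\<^sub>0 x"
proof -
  have "inner (Mlim 0) \<phi> = inner (weighted_phase 0) \<phi>" for \<phi>
    using M_weak[of 0 \<phi>] by (simp add: Z_def LIMSEQ_const_iff)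
  then have "inner (Mlim 0 - weighted_phase 0) (Mlim 0 - weighted_phase 0) = 0" unfolding inner_diff_left by simp
  then have M: "Mlim 0 = weighted_phase 0" by simp
  have z: "AE x in lborel. ofL2 (0 :: ('a, real) L2) x = 0" by (rule ofL2_0)
  show ?thesis unfolding M
    using ofL2_weighted_phase[of 0] z
    by eventually_elim (simp add: phase_0 less_imp_neq[OF weight_pos, symmetric])
qed

text \<open>Against smooth tests the balance expresses the phase through a time integral and the
  temperature, both continuous in time.\<close>

lemma Mlim_weakly_continuous: "continuous_on {0..} (\<lambda>t. inner (Mlim t) \<phi>)"
proof (rule weakly_continuous_of_total[OF _ wtests_total])
  show "norm (Mlim t) \<le> \<Theta>" if "t \<in> {0..}" for t using Mlim_norm that by simp
  fix \<phi> assume "\<phi> \<in> wtests"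
  then consider \<eta> where "\<eta> \<in> Cc_infinity D" "\<phi> = wtest \<eta>" | "mulL2 (indicator D) \<phi> = 0"
    by (auto simp: wtests_def)
  then show "continuous_on {0..} (\<lambda>t. inner (Mlim t) \<phi>)"
  proof cases
    case 1
    have \<eta>: "\<eta> \<in> Cc_infinity UNIV" using 1(1) by (rule Cc_infinity_mono) simp
    have "continuous_on {0..} (\<lambda>t. init_enthalpy \<eta> - integral {0..t} (\<lambda>s. inner (Glim s + toL2 F) (gtest \<eta>)) - inner (ulim t) (test \<eta>))"
      by (intro continuous_intros integral_half_line_continuous Glim_plus_F_continuous ulim_continuous)
    then show ?thesis
      by (rule continuous_on_eq) (use enthalpy_balance[OF _ \<eta>] in \<open>simp add: 1(2) algebra_simps\<close>)
  next
    case 2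
    have "inner (Mlim t) \<phi> = 0" if "0 \<le> t" for t
      using M_weak[OF that, of \<phi>] weighted_phase_wtests[OF that 2] by (simp add: LIMSEQ_const_iff)
    then show ?thesis by (intro continuous_on_eq[OF continuous_on_const[of _ 0]]) simp
  qed
qed


section \<open>The integral identity for test functions depending on time\<close>

definition dtest :: "('a \<times> real \<Rightarrow> real) \<Rightarrow> real \<Rightarrow> ('a, real) L2" where
  "dtest \<eta> t = test (\<lambda>x. partial_deriv (0, 1) \<eta> (x, t))"
definition dwtest :: "('a \<times> real \<Rightarrow> real) \<Rightarrow> real \<Rightarrow> ('a, real) L2" where
  "dwtest \<eta> t = wtest (\<lambda>x. partial_deriv (0, 1) \<eta> (x, t))"

lemma time_Basis: "(0, 1) \<in> (Basis :: ('a \<times> real) set)"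
  by (simp add: Basis_prod_def)

lemma indicator_weight_bounded:
  assumes "compact K"
  shows "\<exists>C. \<forall>x\<in>K. \<bar>indicator D x * weight x\<bar> \<le> C"
proof -
  obtain C where "\<And>x. x \<in> K \<Longrightarrow> norm (weight x) \<le> C"
    using compact_imp_bounded[OF compact_continuous_image[OF weight_continuous assms]] by (auto simp: bounded_iff)
  then show ?thesis
    by (intro exI[of _ "\<bar>C\<bar>"] ballI) (auto simp: indicator_def intro: order_trans[OF _ abs_ge_self])
qed

lemma slice_continuous:
  fixes \<eta> :: "'a \<times> real \<Rightarrow> real"
  assumes \<eta>: "\<eta> \<in> Cc_infinity W"
  shows "continuous_on T (\<lambda>t. test (\<lambda>x. \<eta> (x, t)))" "continuous_on T (\<lambda>t. wtest (\<lambda>x. \<eta> (x, t)))"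
    "continuous_on T (\<lambda>t. gtest (\<lambda>x. \<eta> (x, t)))"
proof -
  let ?K = "fst ` closure {z. \<eta> z \<noteq> 0}"
  note K = Cc_infinity_slice_support[OF \<eta>]
  obtain M where M: "\<And>z. norm (\<eta> z) \<le> M" using Cc_infinity_bounded[OF \<eta>] by auto
  obtain C where C: "\<And>x. x \<in> ?K \<Longrightarrow> \<bar>indicator D x * weight x\<bar> \<le> C" using indicator_weight_bounded[OF K(1)] by blast
  define \<Psi> where "\<Psi> z = (\<Sum>b\<in>Basis. partial_deriv (b, 0) \<eta> z *\<^sub>R b)" for z
  have pB: "(b, 0) \<in> (Basis :: ('a \<times> real) set)" if "b \<in> Basis" for b using that by (simp add: Basis_prod_def)
  have \<Psi>c: "continuous_on UNIV \<Psi>"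
    unfolding \<Psi>_def[abs_def] using Cc_infinityD(5)[OF Cc_infinity_partial_deriv[OF \<eta> pB]]
    by (intro continuous_intros) auto
  have \<Psi>0: "\<Psi> (x, t) = 0" if "x \<notin> ?K" for x t
    unfolding \<Psi>_def using K(3)[OF pB that] by simp
  have "\<forall>b\<in>Basis. \<exists>M. \<forall>z. \<bar>partial_deriv (b, 0) \<eta> z\<bar> \<le> M"
    using Cc_infinity_bounded[OF Cc_infinity_partial_deriv[OF \<eta> pB]] by blast
  then obtain N where N: "\<And>b z. b \<in> Basis \<Longrightarrow> \<bar>partial_deriv (b, 0) \<eta> z\<bar> \<le> N b" by metis
  have \<Psi>M: "norm (\<Psi> z) \<le> (\<Sum>b\<in>Basis. N b)" for z
    unfolding \<Psi>_def by (intro sum_norm_le) (use N in auto)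
  have m: "(\<lambda>x. indicator D x * weight x) \<in> borel_measurable borel" by measurable
  show "continuous_on T (\<lambda>t. test (\<lambda>x. \<eta> (x, t)))"
  proof (rule continuous_on_sequentiallyI)
    fix s :: "nat \<Rightarrow> real" and t assume "s \<longlonglongrightarrow> t"
    then show "(\<lambda>n. test (\<lambda>x. \<eta> (x, s n))) \<longlonglongrightarrow> test (\<lambda>x. \<eta> (x, t))"
      using slice_tendsto(2)[OF Cc_infinityD(5)[OF \<eta>] K(1) K(2) M indicator_D(1) indicator_D(2)] by (simp add: test_def)
  qed
  show "continuous_on T (\<lambda>t. wtest (\<lambda>x. \<eta> (x, t)))"
  proof (rule continuous_on_sequentiallyI)
    fix s :: "nat \<Rightarrow> real" and t assume "s \<longlonglongrightarrow> t"
    then show "(\<lambda>n. wtest (\<lambda>x. \<eta> (x, s n))) \<longlonglongrightarrow> wtest (\<lambda>x. \<eta> (x, t))"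
      using slice_tendsto(2)[OF Cc_infinityD(5)[OF \<eta>] K(1) K(2) M m C] by (simp add: wtest_def)
  qed
  show "continuous_on T (\<lambda>t. gtest (\<lambda>x. \<eta> (x, t)))"
  proof (rule continuous_on_sequentiallyI)
    fix s :: "nat \<Rightarrow> real" and t assume "s \<longlonglongrightarrow> t"
    then show "(\<lambda>n. gtest (\<lambda>x. \<eta> (x, s n))) \<longlonglongrightarrow> gtest (\<lambda>x. \<eta> (x, t))"
      using slice_tendsto(2)[OF \<Psi>c K(1) \<Psi>0 \<Psi>M indicator_D(1) indicator_D(2)]
      by (simp add: gtest_def classical_grad_slice[OF \<eta>] \<Psi>_def)
  qed
qed

lemma slice_difference_quotient:
  fixes \<eta> :: "'a \<times> real \<Rightarrow> real"
  assumes \<eta>: "\<eta> \<in> Cc_infinity W"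
  shows "((\<lambda>h. (1 / h) *\<^sub>R (test (\<lambda>x. \<eta> (x, t + h)) - test (\<lambda>x. \<eta> (x, t)))) \<longlongrightarrow> dtest \<eta> t) (at 0)"
    "((\<lambda>h. (1 / h) *\<^sub>R (wtest (\<lambda>x. \<eta> (x, t + h)) - wtest (\<lambda>x. \<eta> (x, t)))) \<longlongrightarrow> dwtest \<eta> t) (at 0)"
proof -
  let ?K = "fst ` closure {z. \<eta> z \<noteq> 0}"
  obtain C where C: "\<And>x. x \<in> ?K \<Longrightarrow> \<bar>indicator D x * weight x\<bar> \<le> C"
    using indicator_weight_bounded[OF Cc_infinity_slice_support(1)[OF \<eta>]] by blast
  have m: "(\<lambda>x. indicator D x * weight x) \<in> borel_measurable borel" by measurable
  show "((\<lambda>h. (1 / h) *\<^sub>R (test (\<lambda>x. \<eta> (x, t + h)) - test (\<lambda>x. \<eta> (x, t)))) \<longlongrightarrow> dtest \<eta> t) (at 0)"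
    unfolding test_def dtest_def by (rule slice_derivative[OF \<eta> indicator_D])
  show "((\<lambda>h. (1 / h) *\<^sub>R (wtest (\<lambda>x. \<eta> (x, t + h)) - wtest (\<lambda>x. \<eta> (x, t)))) \<longlongrightarrow> dwtest \<eta> t) (at 0)"
    unfolding wtest_def dwtest_def by (rule slice_derivative[OF \<eta> m C])
qed

definition pairing :: "('a \<times> real \<Rightarrow> real) \<Rightarrow> real \<Rightarrow> real" where
  "pairing \<eta> t = inner (ulim t) (test (\<lambda>x. \<eta> (x, t))) + inner (Mlim t) (wtest (\<lambda>x. \<eta> (x, t)))"

definition pairing_deriv :: "('a \<times> real \<Rightarrow> real) \<Rightarrow> real \<Rightarrow> real" where
  "pairing_deriv \<eta> t = inner (ulim t) (dtest \<eta> t) + inner (Mlim t) (dwtest \<eta> t)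
     - inner (Glim t + toL2 F) (gtest (\<lambda>x. \<eta> (x, t)))"

lemma Mlim_pair_continuous: "continuous_on {0..} Y \<Longrightarrow> continuous_on {0..} (\<lambda>t. inner (Mlim t) (Y t))"
  by (rule weak_strong_continuous[OF _ Mlim_weakly_continuous]) (auto intro: Mlim_norm)

lemma pairing_continuous:
  fixes \<eta> :: "'a \<times> real \<Rightarrow> real"
  assumes \<eta>: "\<eta> \<in> Cc_infinity W"
  shows "continuous_on {0..} (pairing \<eta>)" "continuous_on {0..} (pairing_deriv \<eta>)"
proof -
  show "continuous_on {0..} (pairing \<eta>)"
    unfolding pairing_def[abs_def]
    by (intro continuous_intros Mlim_pair_continuous ulim_continuous slice_continuous[OF \<eta>])
  have G: "continuous_on {0..} (\<lambda>t. inner (Glim t + toL2 F) (gtest (\<lambda>x. \<eta> (x, t))))"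
    by (rule weak_strong_continuous[OF _ Glim_plus_F_continuous slice_continuous(3)[OF \<eta>]]) (auto intro: Glim_bound(1))
  show "continuous_on {0..} (pairing_deriv \<eta>)"
    unfolding pairing_deriv_def[abs_def] dtest_def dwtest_def
    by (intro continuous_intros Mlim_pair_continuous ulim_continuous G
        slice_continuous[OF Cc_infinity_partial_deriv[OF \<eta> time_Basis]])
qed

lemma pairing_has_derivative:
  assumes \<eta>: "\<eta> \<in> Cc_infinity UNIV" and t: "0 < t"
  shows "(pairing \<eta> has_real_derivative pairing_deriv \<eta> t) (at t)"
  unfolding DERIV_def
proof -
  define e where "e s = test (\<lambda>x. \<eta> (x, s))" for s
  define w where "w s = wtest (\<lambda>x. \<eta> (x, s))" for s
  have \<eta>t: "(\<lambda>x. \<eta> (x, t)) \<in> Cc_infinity UNIV" by (rule Cc_infinity_slice[OF \<eta>]) auto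
  define k where "k s = inner (Glim s + toL2 F) (gtest (\<lambda>x. \<eta> (x, t)))" for s
  \<comment> \<open>The enthalpy against the test function frozen at time \<open>t\<close>; by the
    balance it is a constant minus the integral of the continuous function \<open>k\<close>.\<close>
  define N where "N s = inner (ulim s) (e t) + inner (Mlim s) (w t)" for s
  have N: "N s = init_enthalpy (\<lambda>x. \<eta> (x, t)) - integral {0..s} k" if "0 \<le> s" for s
    using enthalpy_balance[OF that \<eta>t] by (simp add: N_def e_def w_def k_def[abs_def])
  have at_t: "at t within {0..} = at t"
    by (rule at_within_interior) (use t in \<open>simp add: interior_real_atLeast\<close>)
  have "((\<lambda>s. init_enthalpy (\<lambda>x. \<eta> (x, t)) - integral {0..s} k) has_real_derivative 0 - k t) (at t)"
    using integral_half_line_derivative[of k t] Glim_plus_F_continuous t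
    by (intro derivative_intros) (simp_all add: k_def[abs_def] at_t)
  then have "(N has_real_derivative - k t) (at t)"
    by (rule has_field_derivative_transform_within_open[where S="{0<..}", THEN DERIV_cong])
       (use t N in auto)
  then have lN: "((\<lambda>h. (N (t + h) - N t) / h) \<longlongrightarrow> - k t) (at 0)" by (simp add: DERIV_def)
  have ev: "\<forall>\<^sub>F h in at 0. 0 \<le> t + h"
    using t unfolding eventually_at by (intro exI[of _ t]) (auto simp: dist_real_def)
  have filt: "filterlim (\<lambda>h. t + h) (at t within {0..}) (at 0)"
    unfolding filterlim_at at_t
    by (auto simp: at_t eventually_at_filter intro!: tendsto_eq_intros)
  have lu: "((\<lambda>h. inner (ulim (t + h)) \<phi>) \<longlongrightarrow> inner (ulim t) \<phi>) (at 0)" for \<phi>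
  proof -
    have "continuous_on {0..} (\<lambda>s. inner (ulim s) \<phi>)" by (intro continuous_intros ulim_continuous)
    then show ?thesis
      using filterlim_compose[OF _ filt, of "\<lambda>s. inner (ulim s) \<phi>" "nhds (inner (ulim t) \<phi>)"] t
      by (auto simp: continuous_on_def)
  qed
  have lM: "((\<lambda>h. inner (Mlim (t + h)) \<phi>) \<longlongrightarrow> inner (Mlim t) \<phi>) (at 0)" for \<phi>
    using filterlim_compose[OF _ filt, of "\<lambda>s. inner (Mlim s) \<phi>" "nhds (inner (Mlim t) \<phi>)"]
      Mlim_weakly_continuous[of \<phi>] t by (auto simp: continuous_on_def)
  have ub: "\<forall>\<^sub>F h in at 0. norm (ulim (t + h)) \<le> norm (\<gamma> 0) + A * (1 + (t + 1))"
  proof -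
    have "\<forall>\<^sub>F h in at 0. h < (1::real)" by (rule order_tendstoD(2)[OF tendsto_ident_at]) simp
    with ev show ?thesis
    proof eventually_elim
      case (elim h)
      have "A * (1 + (t + h)) \<le> A * (1 + (t + 1))" using elim by (intro mult_left_mono) auto
      then show ?case using ulim_bound[of "t + h"] elim by linarith
    qed
  qed
  have Mb: "\<forall>\<^sub>F h in at 0. norm (Mlim (t + h)) \<le> \<Theta>" using ev by eventually_elim (rule Mlim_norm)
  have L: "((\<lambda>h. inner (ulim (t + h)) ((1 / h) *\<^sub>R (e (t + h) - e t)) + inner (Mlim (t + h)) ((1 / h) *\<^sub>R (w (t + h) - w t))
      + (N (t + h) - N t) / h) \<longlongrightarrow> inner (ulim t) (dtest \<eta> t) + inner (Mlim t) (dwtest \<eta> t) + - k t) (at 0)"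
    unfolding e_def w_def
    by (intro tendsto_add lN weak_strong_tendsto[OF ub lu] weak_strong_tendsto[OF Mb lM] slice_difference_quotient[OF \<eta>])
  have "(pairing \<eta> (t + h) - pairing \<eta> t) / h = inner (ulim (t + h)) ((1 / h) *\<^sub>R (e (t + h) - e t))
      + inner (Mlim (t + h)) ((1 / h) *\<^sub>R (w (t + h) - w t)) + (N (t + h) - N t) / h" for h
    by (simp add: pairing_def N_def e_def w_def inner_diff_right diff_divide_distrib add_divide_distrib algebra_simps)
  with L show "((\<lambda>h. (pairing \<eta> (t + h) - pairing \<eta> t) / h) \<longlongrightarrow> pairing_deriv \<eta> t) (at 0)"
    by (simp add: pairing_deriv_def k_def)
qed

text \<open>The derivative is used only in the interior of the interval, continuity at its end
  points; thus the left end point may be \<open>0\<close>.\<close>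

lemma pairing_identity:
  assumes \<eta>: "\<eta> \<in> Cc_infinity UNIV" and t: "0 \<le> t\<^sub>1" "t\<^sub>1 < t\<^sub>2"
  shows "pairing \<eta> t\<^sub>2 - pairing \<eta> t\<^sub>1 = (LINT t|lebesgue_on {t\<^sub>1..t\<^sub>2}. pairing_deriv \<eta> t)"
proof -
  have c: "continuous_on {t\<^sub>1..t\<^sub>2} (pairing \<eta>)" "continuous_on {t\<^sub>1..t\<^sub>2} (pairing_deriv \<eta>)"
    using pairing_continuous[OF \<eta>] t by (auto intro: continuous_on_subset)
  have "(pairing_deriv \<eta> has_integral pairing \<eta> t\<^sub>2 - pairing \<eta> t\<^sub>1) {t\<^sub>1..t\<^sub>2}"
    using t by (intro fundamental_theorem_of_calculus_interior c(1))
      (auto simp: has_real_derivative_iff_has_vector_derivative[symmetric] intro: pairing_has_derivative[OF \<eta>])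
  then have "integral {t\<^sub>1..t\<^sub>2} (pairing_deriv \<eta>) = pairing \<eta> t\<^sub>2 - pairing \<eta> t\<^sub>1" by (rule integral_unique)
  moreover have "integrable (lebesgue_on {t\<^sub>1..t\<^sub>2}) (pairing_deriv \<eta>)"
    by (rule continuous_imp_integrable_real[OF c(2)])
  ultimately show ?thesis using lebesgue_integral_eq_integral[of "{t\<^sub>1..t\<^sub>2}" "pairing_deriv \<eta>"] by simp
qed

end

section \<open>Weak derivatives in space-time\<close>

text \<open>Fubini. The representative is known slicewise only at almost every time, which suffices
  here; continuity of the pairing makes the outer integral a gauge integral over an
  interval.\<close>

lemma joint_pairing:
  fixes Fu :: "'a::euclidean_space \<times> real \<Rightarrow> real" and X :: "real \<Rightarrow> ('a, real) L2" and \<psi> :: "'a \<times> real \<Rightarrow> real"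
  assumes Fu [measurable]: "Fu \<in> borel_measurable borel"
    and sl: "AE t in lborel. 0 \<le> t \<longrightarrow> (AE x in lborel. Fu (x, t) = ofL2 (X t) x)"
    and bd: "\<And>t. 0 \<le> t \<Longrightarrow> t \<le> T \<Longrightarrow> norm (X t) \<le> B"
    and \<psi>: "\<psi> \<in> Cc_infinity W" and W: "W \<subseteq> UNIV \<times> {0<..<T}"
    and cont: "continuous_on {0..T} (\<lambda>t. inner (X t) (toL2 (\<lambda>x. \<psi> (x, t))))"
  shows "(LINT z|lborel. Fu z * \<psi> z) = integral {0..T} (\<lambda>t. inner (X t) (toL2 (\<lambda>x. \<psi> (x, t))))"
proof -
  define \<omega> :: "real \<Rightarrow> real" where "\<omega> = indicator {0..T}"
  have w [measurable]: "\<omega> \<in> borel_measurable borel" by (simp add: \<omega>_def)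
  have \<psi>0: "\<psi> (x, t) = 0" if "t \<notin> {0..T}" for x t
  proof -
    have "(x, t) \<notin> W" using W that by auto
    then show ?thesis by (rule Cc_infinity_zero_outside[OF \<psi>])
  qed
  have \<psi>s: "sqint (\<lambda>x. \<psi> (x, t))" for t
    by (rule Cc_infinity_sqint[OF Cc_infinity_slice[OF \<psi>, of UNIV]]) simp
  have J: "sqint (\<lambda>z. \<omega> (snd z) * Fu z)"
  proof (rule joint_sqint(1)[OF Fu w])
    show "AE t in lborel. \<omega> t \<noteq> 0 \<longrightarrow> (AE x in lborel. Fu (x, t) = ofL2 (X t) x)"
      using sl by eventually_elim (auto simp: \<omega>_def indicator_def)
    show "(\<omega> t * norm (X t))\<^sup>2 \<le> B\<^sup>2 * indicator {0..T} t" if "\<omega> t \<noteq> 0" for t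
      using that bd[of t] by (auto simp: \<omega>_def indicator_def intro!: power_mono split: if_splits)
    show "integrable lborel (\<lambda>t. B\<^sup>2 * indicator {0..T} t)"
      by (intro integrable_mult_right integrable_indicator_compact compact_Icc)
  qed auto
  define f where "f z = Fu z * \<psi> z" for z
  have f_eq: "f z = (\<omega> (snd z) * Fu z) \<bullet> \<psi> z" for z
    using \<psi>0[of "snd z" "fst z"] by (auto simp: f_def \<omega>_def indicator_def)
  have fi: "integrable lborel f"
    unfolding f_eq[abs_def] by (rule sqint_inner_integrable[OF J Cc_infinity_sqint[OF \<psi>]])
  then have fi2: "integrable (lborel \<Otimes>\<^sub>M lborel) (\<lambda>(x, t). f (x, t))" by (simp add: lborel_prod)
  have "(LINT z|lborel. f z) = (LINT t|lborel. LINT x|lborel. f (x, t))"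
    using lborel_pair.integral_snd[OF fi2] by (simp add: lborel_prod)
  also have "\<dots> = (LINT t|lborel. indicator {0..T} t *\<^sub>R inner (X t) (toL2 (\<lambda>x. \<psi> (x, t))))"
  proof (rule integral_cong_AE)
    show "(\<lambda>t. LINT x|lborel. f (x, t)) \<in> borel_measurable lborel"
      using lborel_pair.integrable_snd[OF fi2] by (auto dest: borel_measurable_integrable)
    show "(\<lambda>t. indicator {0..T} t *\<^sub>R inner (X t) (toL2 (\<lambda>x. \<psi> (x, t)))) \<in> borel_measurable lborel"
      using borel_measurable_continuous_on_indicator[OF _ cont] by simp
    show "AE t in lborel. (LINT x|lborel. f (x, t)) = indicator {0..T} t *\<^sub>R inner (X t) (toL2 (\<lambda>x. \<psi> (x, t)))"
      using sl
    proof eventually_elim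
      case (elim t)
      show ?case
      proof (cases "t \<in> {0..T}")
        case True
        have [measurable]: "(\<lambda>x. Fu (x, t)) \<in> borel_measurable borel" "(\<lambda>x. \<psi> (x, t)) \<in> borel_measurable borel"
          using sqint_measurable[OF \<psi>s] by measurable
        have "(LINT x|lborel. f (x, t)) = (LINT x|lborel. ofL2 (X t) x \<bullet> \<psi> (x, t))"
          by (rule integral_cong_AE) (use elim True in \<open>auto simp: f_def elim!: AE_mp\<close>)
        then show ?thesis using True by (simp add: inner_toL2_right[OF \<psi>s])
      next
        case False
        then show ?thesis using \<psi>0[OF False] by (simp add: f_def)
      qed
    qed
  qed
  also have "\<dots> = (LINT t:{0..T}|lborel. inner (X t) (toL2 (\<lambda>x. \<psi> (x, t))))"
    by (simp add: set_lebesgue_integral_def)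
  also have "\<dots> = integral {0..T} (\<lambda>t. inner (X t) (toL2 (\<lambda>x. \<psi> (x, t))))"
    by (intro set_borel_integral_eq_integral borel_integrable_atLeastAtMost' cont)
  finally show ?thesis by (simp add: f_def)
qed

text \<open>Summation by parts moves the difference from \<open>e\<close> to \<open>v\<close>, with
  no boundary terms because \<open>e\<close> vanishes at both ends; then Cauchy-Schwarz against the
  dissipation bound. The two vanishing end values also undo the index shift.\<close>

lemma abel_summation_bound:
  fixes v e :: "nat \<Rightarrow> 'h::real_inner"
  assumes e: "e 0 = 0" "e K = 0" and v: "(\<Sum>k<K. (norm (v (Suc k) - v k))\<^sup>2) \<le> h * a\<^sup>2"
    and h: "h > 0" and a: "0 \<le> a"
  shows "\<bar>\<Sum>k<K. inner (v k) (e (Suc k) - e k)\<bar> \<le> a * sqrt (h * (\<Sum>k<K. (norm (e k))\<^sup>2))"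
proof -
  have "(\<Sum>k<K. inner (v k) (e (Suc k) - e k)) + (\<Sum>k<K. inner (v (Suc k) - v k) (e (Suc k)))
      = (\<Sum>k<K. inner (v (Suc k)) (e (Suc k)) - inner (v k) (e k))"
    by (simp add: sum.distrib[symmetric] inner_diff_left inner_diff_right)
  also have "\<dots> = 0" by (subst sum_lessThan_telescope) (simp add: e)
  finally have "\<bar>\<Sum>k<K. inner (v k) (e (Suc k) - e k)\<bar> = \<bar>\<Sum>k<K. inner (v (Suc k) - v k) (e (Suc k))\<bar>" by linarith
  also have "\<dots> \<le> (\<Sum>k<K. norm (v (Suc k) - v k) * norm (e (Suc k)))"
    by (rule order_trans[OF sum_abs]) (intro sum_mono Cauchy_Schwarz_ineq2)
  also have "\<dots> \<le> L2_set (\<lambda>k. norm (v (Suc k) - v k)) {..<K} * L2_set (\<lambda>k. norm (e (Suc k))) {..<K}"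
    using L2_set_mult_ineq[of "\<lambda>k. norm (v (Suc k) - v k)" "\<lambda>k. norm (e (Suc k))" "{..<K}"] by simp
  also have "\<dots> \<le> sqrt (h * a\<^sup>2) * sqrt (\<Sum>k<K. (norm (e (Suc k)))\<^sup>2)"
    unfolding L2_set_def using v by (intro mult_right_mono real_sqrt_le_mono) (auto intro: sum_nonneg)
  also have "(\<Sum>k<K. (norm (e (Suc k)))\<^sup>2) = (\<Sum>k<K. (norm (e k))\<^sup>2)"
    using sum_lessThan_telescope[of "\<lambda>k. (norm (e k))\<^sup>2" K] by (simp add: sum_subtractf e)
  also have "sqrt (h * a\<^sup>2) * sqrt (\<Sum>k<K. (norm (e k))\<^sup>2) = a * sqrt (h * (\<Sum>k<K. (norm (e k))\<^sup>2))"
    using a by (simp add: real_sqrt_mult)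
  finally show ?thesis .
qed

lemma integral_square_le:
  fixes f :: "real \<Rightarrow> real"
  assumes f: "continuous_on {0..T} f" and T: "T > 0"
  shows "(integral {0..T} f)\<^sup>2 \<le> T * integral {0..T} (\<lambda>t. (f t)\<^sup>2)"
proof -
  \<comment> \<open>Cauchy-Schwarz from the variance: the integral of the squared deviation from the
    mean \<open>m\<close> is nonnegative.\<close>
  define I m where "I = integral {0..T} f" and "m = I / T"
  have i: "f integrable_on {0..T}" "(\<lambda>t. (f t)\<^sup>2) integrable_on {0..T}"
    by (intro integrable_continuous_real continuous_intros f)+
  have "((\<lambda>t. (f t)\<^sup>2 - 2 * m * f t + m\<^sup>2) has_integral integral {0..T} (\<lambda>t. (f t)\<^sup>2) - 2 * m * I + m\<^sup>2 * T) {0..T}"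
    using T has_integral_const_real[of "m\<^sup>2" 0 T] unfolding I_def
    by (intro has_integral_add has_integral_diff has_integral_mult_right integrable_integral i) (simp add: mult.commute)
  then have "0 \<le> integral {0..T} (\<lambda>t. (f t)\<^sup>2) - 2 * m * I + m\<^sup>2 * T"
  proof (rule has_integral_nonneg)
    fix t
    have "0 \<le> (f t - m)\<^sup>2" by simp
    then show "0 \<le> (f t)\<^sup>2 - 2 * m * f t + m\<^sup>2" by (simp add: power2_diff algebra_simps)
  qed
  then have "0 \<le> integral {0..T} (\<lambda>t. (f t)\<^sup>2) - I\<^sup>2 / T"
    using T by (simp add: m_def field_simps power2_eq_square)
  then show ?thesis using T by (simp add: I_def field_simps)
qed

lemma compact_time_bound:
  fixes K :: "('a::euclidean_space \<times> real) set"
  assumes K: "compact K" "K \<subseteq> D \<times> {0<..}"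
  shows "\<exists>T>0. K \<subseteq> D \<times> {0<..<real T}"
proof -
  obtain B where B: "\<And>x. x \<in> K \<Longrightarrow> norm x \<le> B" using compact_imp_bounded[OF K(1)] bounded_iff by metis
  obtain T :: nat where T: "B < real T" using reals_Archimedean2 by blast
  have "K \<subseteq> D \<times> {0<..<real (Suc T)}"
  proof
    fix \<zeta> assume \<zeta>: "\<zeta> \<in> K"
    then have "\<bar>snd \<zeta>\<bar> < real (Suc T)" using norm_snd_le[of "snd \<zeta>" "fst \<zeta>"] B[OF \<zeta>] T by simp
    then show "\<zeta> \<in> D \<times> {0<..<real (Suc T)}" using \<zeta> K(2) by (cases \<zeta>) auto
  qed
  then show ?thesis by (intro exI[of _ "Suc T"]) simp
qed

section \<open>Space-time derivatives of the temperature\<close>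

context stefan
begin

lemma test_eq_toL2:
  assumes "\<And>x. x \<notin> D \<Longrightarrow> \<phi> x = 0"
  shows "test \<phi> = toL2 \<phi>"
proof -
  have "(\<lambda>x. indicator D x * \<phi> x) = \<phi>" using assms by (auto simp: indicator_def fun_eq_iff)
  then show ?thesis by (simp add: test_def)
qed

context
  fixes \<phi> :: "'a \<times> real \<Rightarrow> real" and T :: nat and e :: "real \<Rightarrow> ('a, real) L2"
  assumes \<phi>: "\<phi> \<in> Cc_infinity (D \<times> {0<..<real T})" and T: "T > 0"
  defines "e \<equiv> \<lambda>t. toL2 (\<lambda>x. \<phi> (x, t))"
begin

lemma slice_sqint: "sqint (\<lambda>x. \<phi> (x, t))"
  by (rule Cc_infinity_sqint[OF Cc_infinity_slice[OF \<phi>, of UNIV]]) simp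

lemma slice_test: "test (\<lambda>x. \<phi> (x, t)) = e t"
  unfolding e_def by (rule test_eq_toL2) (rule Cc_infinity_zero_outside[OF \<phi>], simp)

lemma slice_partial: "b \<in> Basis \<Longrightarrow> test (\<lambda>x. partial_deriv b \<phi> (x, t)) = toL2 (\<lambda>x. partial_deriv b \<phi> (x, t))"
  by (rule test_eq_toL2) (rule Cc_infinity_zero_outside[OF Cc_infinity_partial_deriv[OF \<phi>]], simp_all)

lemma e_continuous: "continuous_on I e"
  using slice_continuous(1)[OF \<phi>, of I] by (simp add: slice_test)

lemma e_0: "t \<le> 0 \<Longrightarrow> e t = 0" "real T \<le> t \<Longrightarrow> e t = 0"
proof -
  have "e t = toL2 (\<lambda>x. 0)" if "t \<notin> {0<..<real T}" for t
    unfolding e_def by (intro arg_cong[of _ _ toL2] ext Cc_infinity_zero_outside[OF \<phi>]) (use that in simp)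
  then show "t \<le> 0 \<Longrightarrow> e t = 0" "real T \<le> t \<Longrightarrow> e t = 0" by (simp_all add: toL2_0)
qed

lemma e_square_integral: "integral {0..real T} (\<lambda>t. (norm (e t))\<^sup>2) = (norm (toL2 \<phi>))\<^sup>2"
proof -
  have "compact (e ` {0..real T})" by (intro compact_continuous_image e_continuous compact_Icc)
  then obtain B where B: "\<And>t. t \<in> {0..real T} \<Longrightarrow> norm (e t) \<le> B"
    using compact_imp_bounded bounded_iff by (metis image_eqI)
  have "(LINT \<zeta>|lborel. \<phi> \<zeta> * \<phi> \<zeta>) = integral {0..real T} (\<lambda>t. inner (e t) (toL2 (\<lambda>x. \<phi> (x, t))))"
  proof (rule joint_pairing[OF Cc_infinity_measurable[OF \<phi>] _ _ \<phi>])
    show "AE t in lborel. 0 \<le> t \<longrightarrow> (AE x in lborel. \<phi> (x, t) = ofL2 (e t) x)"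
    proof (rule AE_I2, rule impI)
      fix t
      show "AE x in lborel. \<phi> (x, t) = ofL2 (e t) x"
        using ofL2_toL2[OF slice_sqint[of t]] by (auto simp: e_def elim!: AE_mp)
    qed
    show "norm (e t) \<le> B" if "0 \<le> t" "t \<le> real T" for t using B that by auto
    show "continuous_on {0..real T} (\<lambda>t. inner (e t) (toL2 (\<lambda>x. \<phi> (x, t))))"
      using e_continuous[of "{0..real T}"] unfolding e_def by (intro continuous_intros)
  qed auto
  moreover have "toL2 (\<lambda>x. \<phi> (x, t)) = e t" for t by (simp add: e_def)
  ultimately show ?thesis
    by (simp add: power2_norm_eq_inner inner_toL2[OF Cc_infinity_sqint[OF \<phi>] Cc_infinity_sqint[OF \<phi>]])
qed

lemma dtest_continuous: "continuous_on I (dtest \<phi>)"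
  using slice_continuous(1)[OF Cc_infinity_partial_deriv[OF \<phi> time_Basis], of I] unfolding dtest_def .

text \<open>On a cell where the scheme is constant, integration in time replaces the time derivative
  of the test function by its increment, which prepares the summation by parts.\<close>

lemma cell_integral:
  assumes "a \<le> b"
  shows "((\<lambda>s. inner x (dtest \<phi> s)) has_integral inner x (e b - e a)) {a..b}"
proof -
  have "(e has_vector_derivative dtest \<phi> s) (at s within {a..b})" for s
  proof -
    have "((\<lambda>h. (1 / h) *\<^sub>R (e (s + h) - e s)) \<longlongrightarrow> dtest \<phi> s) (at 0)"
      using slice_difference_quotient(1)[OF \<phi>, of s] by (simp add: slice_test)
    then have L: "((\<lambda>h. norm ((1 / h) *\<^sub>R (e (s + h) - e s) - dtest \<phi> s)) \<longlongrightarrow> 0) (at 0)"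
      by (rule tendsto_norm_zero[OF LIM_zero])
    have "norm (e (s + h) - e s - h *\<^sub>R dtest \<phi> s) / norm h = norm ((1 / h) *\<^sub>R (e (s + h) - e s) - dtest \<phi> s)"
      if "h \<noteq> 0" for h
    proof -
      have "(1 / h) *\<^sub>R (e (s + h) - e s) - dtest \<phi> s = (1 / h) *\<^sub>R (e (s + h) - e s - h *\<^sub>R dtest \<phi> s)"
        using that by (simp add: scaleR_diff_right)
      then show ?thesis by (simp add: divide_inverse mult.commute)
    qed
    then have "\<forall>\<^sub>F h in at 0. norm ((1 / h) *\<^sub>R (e (s + h) - e s) - dtest \<phi> s)
        = norm (e (s + h) - e s - h *\<^sub>R dtest \<phi> s) / norm h"
      by (simp add: eventually_at_filter)
    from Lim_transform_eventually[OF L this] have "(e has_derivative (\<lambda>h. h *\<^sub>R dtest \<phi> s)) (at s)"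
      by (simp add: has_derivative_at bounded_linear_scaleR_left)
    then show ?thesis
      by (rule has_vector_derivative_at_within[OF iffD2[OF has_vector_derivative_def]])
  qed
  then have d: "((\<lambda>s. inner x (e s)) has_vector_derivative inner x (dtest \<phi> s)) (at s within {a..b})" for s
    by (rule bounded_linear.has_vector_derivative[OF bounded_linear_inner_right])
  have "((\<lambda>s. inner x (dtest \<phi> s)) has_integral inner x (e b) - inner x (e a)) {a..b}"
    by (rule fundamental_theorem_of_calculus[OF assms]) (rule d)
  then show ?thesis by (simp add: inner_diff_right)
qed

lemma step_integral:
  assumes h: "h > 0"
  shows "((\<lambda>s. inner (v (nat \<lfloor>s / h\<rfloor>)) (dtest \<phi> s)) has_integral
     (\<Sum>k<K. inner (v k) (e (real (Suc k) * h) - e (real k * h)))) {0..real K * h}"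
proof (induction K)
  case 0
  show ?case by (simp add: has_integral_refl)
next
  case (Suc K)
  have le: "real K * h \<le> real (Suc K) * h" using h by (intro mult_right_mono) auto
  have "((\<lambda>s. inner (v (nat \<lfloor>s / h\<rfloor>)) (dtest \<phi> s)) has_integral
      inner (v K) (e (real (Suc K) * h) - e (real K * h))) {real K * h..real (Suc K) * h}"
  proof (rule has_integral_spike_finite[OF _ _ cell_integral[OF le], of "{real (Suc K) * h}"])
    fix s assume s: "s \<in> {real K * h..real (Suc K) * h} - {real (Suc K) * h}"
    then have "real K \<le> s / h" "s / h < real K + 1" using h by (auto simp: field_simps)
    then have "nat \<lfloor>s / h\<rfloor> = K" by linarith
    then show "inner (v (nat \<lfloor>s / h\<rfloor>)) (dtest \<phi> s) = inner (v K) (dtest \<phi> s)" by simp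
  qed simp
  from has_integral_combine[OF _ le Suc.IH this] h show ?case by simp
qed

text \<open>For each level the integral is a sum over cells to which
  \<open>abel_summation_bound\<close> and \<open>dissipation\<close> apply; the resulting
  \<open>E n\<close> is a Riemann sum converging to the squared space-time norm of
  \<open>\<phi>\<close>. The constant does not involve \<open>T\<close>.\<close>

lemma time_integral_bound:
  "\<bar>integral {0..real T} (\<lambda>t. inner (ulim t) (dtest \<phi> t))\<bar> \<le> A * norm (toL2 \<phi>)"
proof -
  define h :: "nat \<Rightarrow> real" where "h n = 1 / 2 ^ n" for n
  define K :: "nat \<Rightarrow> nat" where "K n = T * 2 ^ n" for n
  have h: "h n > 0" "real (K n) * h n = real T" "s / h n = s * 2 ^ n" for n s by (simp_all add: h_def K_def)
  have "compact (e ` {0..real T})" by (intro compact_continuous_image e_continuous compact_Icc)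
  then obtain B where B: "\<And>t. t \<in> {0..real T} \<Longrightarrow> norm (e t) \<le> B"
    using compact_imp_bounded bounded_iff by (metis image_eqI)
  have "compact (dtest \<phi> ` {0..real T})" by (intro compact_continuous_image dtest_continuous compact_Icc)
  then obtain B' where B': "\<And>t. t \<in> {0..real T} \<Longrightarrow> norm (dtest \<phi> t) \<le> B'"
    using compact_imp_bounded bounded_iff by (metis image_eqI)
  define I where "I n = integral {0..real T} (\<lambda>s. inner (U n s) (dtest \<phi> s))" for n
  define E where "E n = h n * (\<Sum>k<K n. (norm (e (real k * h n)))\<^sup>2)" for n
  have hi: "((\<lambda>s. inner (U n s) (dtest \<phi> s)) has_integral
      (\<Sum>k<K n. inner (u (h n) k) (e (real (Suc k) * h n) - e (real k * h n)))) {0..real T}" for n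
    using step_integral[OF h(1)[of n], of "u (h n)" "K n"] by (simp add: h U_def) (simp add: h_def)
  have le: "\<bar>I n\<bar> \<le> A * sqrt (E n)" for n
    unfolding I_def integral_unique[OF hi] E_def
    by (rule abel_summation_bound[where e="\<lambda>k. e (real k * h n)"])
       (use dissipation[OF h(1)] h in \<open>simp_all add: e_0\<close>)
  have "I \<longlonglongrightarrow> integral {0..real T} (\<lambda>s. inner (ulim s) (dtest \<phi> s))"
    unfolding I_def[abs_def]
  proof (rule dominated_convergence(2)[where h="\<lambda>s. (norm (\<gamma> 0) + A * (1 + real T)) * B'"])
    show "(\<lambda>s. inner (U n s) (dtest \<phi> s)) integrable_on {0..real T}" for n using hi by blast
    show "norm (inner (U n s) (dtest \<phi> s)) \<le> (norm (\<gamma> 0) + A * (1 + real T)) * B'" if s: "s \<in> {0..real T}" for n s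
    proof -
      have "A * (1 + s) \<le> A * (1 + real T)" using s by (intro mult_left_mono) auto
      then have "norm (U n s) \<le> norm (\<gamma> 0) + A * (1 + real T)" using U_bound[of s n] s by simp
      then have "norm (U n s) * norm (dtest \<phi> s) \<le> (norm (\<gamma> 0) + A * (1 + real T)) * B'"
        by (intro mult_mono B' s) auto
      then show ?thesis using Cauchy_Schwarz_ineq2[of "U n s" "dtest \<phi> s"] by simp
    qed
    show "(\<lambda>n. inner (U n s) (dtest \<phi> s)) \<longlonglongrightarrow> inner (ulim s) (dtest \<phi> s)" if "s \<in> {0..real T}" for s
      using U_weak that by simp
  qed auto
  moreover have "E \<longlonglongrightarrow> integral {0..real T} (\<lambda>s. (norm (e s))\<^sup>2)"
  proof -
    \<comment> \<open>The left end of the grid cell containing \<open>s\<close>; \<open>E n\<close>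
      is the integral of the squared norm of \<open>e\<close> sampled there.\<close>
    define r where "r n s = real (nat \<lfloor>s / h n\<rfloor>) * h n" for n s
    have E: "((\<lambda>s. (norm (e (r n s)))\<^sup>2) has_integral E n) {0..real T}" for n
      using step_function_has_integral[OF h(1)[of n], of "\<lambda>k. (norm (e (real k * h n)))\<^sup>2" "K n"]
      by (simp add: h(2) E_def r_def)
    have r: "s - h n \<le> r n s" "r n s \<le> s" "0 \<le> r n s" if "0 \<le> s" for n s
    proof -
      have "0 \<le> s / h n" using that h(1)[of n] by simp
      then have "real (nat \<lfloor>s / h n\<rfloor>) \<le> s / h n" "s / h n - 1 \<le> real (nat \<lfloor>s / h n\<rfloor>)" by linarith+
      then show "s - h n \<le> r n s" "r n s \<le> s" using h(1)[of n] by (simp_all add: r_def field_simps)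
      show "0 \<le> r n s" using h(1)[of n] by (simp add: r_def)
    qed
    have "(\<lambda>n. integral {0..real T} (\<lambda>s. (norm (e (r n s)))\<^sup>2)) \<longlonglongrightarrow> integral {0..real T} (\<lambda>s. (norm (e s))\<^sup>2)"
    proof (rule dominated_convergence(2)[where h="\<lambda>s. B\<^sup>2"])
      show "(\<lambda>s. (norm (e (r n s)))\<^sup>2) integrable_on {0..real T}" for n using E by blast
      show "norm ((norm (e (r n s)))\<^sup>2) \<le> B\<^sup>2" if "s \<in> {0..real T}" for n s
        using B[of "r n s"] r[of s n] that by (auto intro: power_mono)
      show "(\<lambda>n. (norm (e (r n s)))\<^sup>2) \<longlonglongrightarrow> (norm (e s))\<^sup>2" if s: "s \<in> {0..real T}" for s
      proof -
        have h0: "h \<longlonglongrightarrow> 0" unfolding h_def[abs_def] using LIMSEQ_inverse_realpow_zero[of 2] by (simp add: divide_inverse)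
        have "(\<lambda>n. r n s) \<longlonglongrightarrow> s"
        proof (rule tendsto_sandwich)
          show "(\<lambda>n. s - h n) \<longlonglongrightarrow> s" using tendsto_diff[OF tendsto_const h0, of s] by simp
        qed (use r s in auto)
        then have "(\<lambda>n. e (r n s)) \<longlonglongrightarrow> e s"
          by (rule continuous_on_tendsto_compose[OF e_continuous[of UNIV]]) simp_all
        then show ?thesis by (intro tendsto_intros)
      qed
    qed auto
    then show ?thesis by (simp add: integral_unique[OF E])
  qed
  then have "(\<lambda>n. A * sqrt (E n)) \<longlonglongrightarrow> A * norm (toL2 \<phi>)"
    unfolding e_square_integral by (auto intro!: tendsto_eq_intros)
  ultimately show ?thesis
    using le by (intro LIMSEQ_le[OF tendsto_rabs]) auto
qed

text \<open>At a fixed time the slice of \<open>\<phi>\<close> is a test function on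
  \<open>D\<close>, so the derivative passes to \<open>Glim\<close>. The gradient is bounded
  uniformly in time, and Cauchy-Schwarz in time produces \<open>sqrt (real T)\<close>.\<close>

lemma space_integral_bound:
  assumes b: "b \<in> Basis"
  shows "\<bar>integral {0..real T} (\<lambda>t. inner (ulim t) (toL2 (\<lambda>x. partial_deriv (b, 0) \<phi> (x, t))))\<bar>
    \<le> (A + norm (toL2 F)) * sqrt (real T) * norm (toL2 \<phi>)"
proof -
  define C where "C = A + norm (toL2 F)"
  have C: "0 \<le> C" by (simp add: C_def)
  have b0: "(b, 0) \<in> (Basis :: ('a \<times> real) set)" using b by (auto simp: Basis_prod_def)
  have pt: "\<bar>inner (ulim t) (toL2 (\<lambda>x. partial_deriv (b, 0) \<phi> (x, t)))\<bar> \<le> C * norm (e t)" if t: "0 \<le> t" for t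
  proof -
    have "(\<lambda>x. \<phi> (x, t)) \<in> Cc_infinity D" by (rule Cc_infinity_slice[OF \<phi>]) auto
    then have "inner (ulim t) (toL2 (partial_deriv b (\<lambda>x. \<phi> (x, t)))) = - inner (Glim t) (toL2 (\<lambda>x. \<phi> (x, t) *\<^sub>R b))"
      using lim_mem[OF t] b by (auto simp: gradL2_def)
    also have "partial_deriv b (\<lambda>x. \<phi> (x, t)) = (\<lambda>x. partial_deriv (b, 0) \<phi> (x, t))"
      by (intro ext partial_deriv_slice Cc_infinityD(4)[OF \<phi>])
    finally have "\<bar>inner (ulim t) (toL2 (\<lambda>x. partial_deriv (b, 0) \<phi> (x, t)))\<bar>
        \<le> norm (Glim t) * norm (toL2 (\<lambda>x. \<phi> (x, t) *\<^sub>R b))"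
      using Cauchy_Schwarz_ineq2[of "Glim t"] by simp
    also have "\<dots> \<le> C * norm (e t)"
      unfolding e_def C_def
    proof (intro mult_mono Glim_bound t)
      show "norm (toL2 (\<lambda>x. \<phi> (x, t) *\<^sub>R b)) \<le> norm (toL2 (\<lambda>x. \<phi> (x, t)))"
        using b by (intro norm_L2_mono slice_sqint sqint_scaleR_left) auto
    qed auto
    finally show ?thesis .
  qed
  have c: "continuous_on {0..real T} (\<lambda>t. inner (ulim t) (toL2 (\<lambda>x. partial_deriv (b, 0) \<phi> (x, t))))"
    using slice_continuous(1)[OF Cc_infinity_partial_deriv[OF \<phi> b0], of "{0..real T}"] slice_partial[OF b0]
    by (intro continuous_intros continuous_on_subset[OF ulim_continuous]) auto
  have cn: "continuous_on {0..real T} (\<lambda>t. norm (e t))" by (intro continuous_intros e_continuous)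
  have "\<bar>integral {0..real T} (\<lambda>t. inner (ulim t) (toL2 (\<lambda>x. partial_deriv (b, 0) \<phi> (x, t))))\<bar>
      \<le> integral {0..real T} (\<lambda>t. C * norm (e t))"
    using integral_norm_bound_integral[of "\<lambda>t. inner (ulim t) (toL2 (\<lambda>x. partial_deriv (b, 0) \<phi> (x, t)))" "{0..real T}"
      "\<lambda>t. C * norm (e t)"] pt
    by (simp add: integrable_continuous_real c cn continuous_intros)
  also have "\<dots> = C * integral {0..real T} (\<lambda>t. norm (e t))" by simp
  also have "\<dots> \<le> C * (sqrt (real T) * norm (toL2 \<phi>))"
  proof (intro mult_left_mono C)
    have "(integral {0..real T} (\<lambda>t. norm (e t)))\<^sup>2 \<le> (sqrt (real T) * norm (toL2 \<phi>))\<^sup>2"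
      using integral_square_le[OF cn] T e_square_integral by (simp add: power_mult_distrib)
    then show "integral {0..real T} (\<lambda>t. norm (e t)) \<le> sqrt (real T) * norm (toL2 \<phi>)"
      by (rule power2_le_imp_le) simp
  qed
  finally show ?thesis by (simp add: C_def mult.assoc)
qed

lemma joint_partial:
  assumes Fu: "Fu \<in> borel_measurable borel" "AE t in lborel. 0 \<le> t \<longrightarrow> (AE x in lborel. Fu (x, t) = ofL2 (ulim t) x)"
    and b: "b \<in> Basis"
  shows "(LINT \<zeta>|lborel. Fu \<zeta> * partial_deriv b \<phi> \<zeta>)
    = integral {0..real T} (\<lambda>t. inner (ulim t) (toL2 (\<lambda>x. partial_deriv b \<phi> (x, t))))"
proof (rule joint_pairing[OF Fu _ Cc_infinity_partial_deriv[OF \<phi> b]])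
  show "norm (ulim t) \<le> norm (\<gamma> 0) + A * (1 + real T)" if t: "0 \<le> t" "t \<le> real T" for t
  proof -
    have "A * (1 + t) \<le> A * (1 + real T)" using t by (intro mult_left_mono) auto
    then show ?thesis using ulim_bound[of t] t by simp
  qed
  show "continuous_on {0..real T} (\<lambda>t. inner (ulim t) (toL2 (\<lambda>x. partial_deriv b \<phi> (x, t))))"
    using slice_continuous(1)[OF Cc_infinity_partial_deriv[OF \<phi> b], of "{0..real T}"] slice_partial[OF b]
    by (intro continuous_intros continuous_on_subset[OF ulim_continuous]) auto
qed auto

end

text \<open>Compact support confines \<open>\<phi>\<close> to some finite time, and the bound is
  independent of it; hence the time derivative is square integrable over the whole infinite
  cylinder.\<close>

lemma time_derivative_bound:
  fixes \<phi> :: "'a \<times> real \<Rightarrow> real"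
  assumes \<phi>: "\<phi> \<in> Cc_infinity (D \<times> {0<..})"
    and Fu: "Fu \<in> borel_measurable borel" "AE t in lborel. 0 \<le> t \<longrightarrow> (AE x in lborel. Fu (x, t) = ofL2 (ulim t) x)"
  shows "\<bar>LINT \<zeta>|lborel. Fu \<zeta> * partial_deriv (0, 1) \<phi> \<zeta>\<bar> \<le> A * norm (toL2 \<phi>)"
proof -
  obtain T where T: "T > 0" "\<phi> \<in> Cc_infinity (D \<times> {0<..<real T})" 
    using compact_time_bound[OF Cc_infinityD(2,3)[OF \<phi>]] \<phi> by (auto simp: Cc_infinity_def)
  show ?thesis
    using time_integral_bound[OF T(2,1)] joint_partial[OF T(2,1) Fu time_Basis]
    by (simp add: dtest_def slice_partial[OF T(2,1) time_Basis])
qed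

lemma space_derivative_bound:
  fixes \<phi> :: "'a \<times> real \<Rightarrow> real"
  assumes \<phi>: "\<phi> \<in> Cc_infinity (D \<times> {0<..<real T})" and T: "T > 0"
    and Fu: "Fu \<in> borel_measurable borel" "AE t in lborel. 0 \<le> t \<longrightarrow> (AE x in lborel. Fu (x, t) = ofL2 (ulim t) x)"
    and b: "b \<in> Basis"
  shows "\<bar>LINT \<zeta>|lborel. Fu \<zeta> * partial_deriv (b, 0) \<phi> \<zeta>\<bar> \<le> (A + norm (toL2 F)) * sqrt (real T) * norm (toL2 \<phi>)"
proof -
  have "(b, 0) \<in> (Basis :: ('a \<times> real) set)" using b by (auto simp: Basis_prod_def)
  then show ?thesis using space_integral_bound[OF \<phi> T b] joint_partial[OF \<phi> T Fu] by simp
qed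

end

lemma step_function_measurable:
  fixes v :: "nat \<Rightarrow> ('a::euclidean_space, real) L2" and c :: real
  shows "(\<lambda>z. ofL2 (v (nat \<lfloor>snd z * c\<rfloor>)) (fst z)) \<in> borel_measurable borel"
proof (rule measurable_compose_countable[where f="\<lambda>i z. ofL2 (v i) (fst z)" and g="\<lambda>z. nat \<lfloor>snd z * c\<rfloor>"])
  have [measurable]: "fst \<in> borel_measurable (borel :: ('a \<times> real) measure)"
    "snd \<in> borel_measurable (borel :: ('a \<times> real) measure)"
    by (auto intro!: borel_measurable_continuous_onI continuous_intros)
  show "(\<lambda>z. ofL2 (v i) (fst z)) \<in> borel_measurable (borel :: ('a \<times> real) measure)" for i by measurable
  show "(\<lambda>z::'a \<times> real. nat \<lfloor>snd z * c\<rfloor>) \<in> measurable borel (count_space UNIV)" by measurable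
qed

lemma L2_space_subset:
  fixes f :: "'a::euclidean_space \<Rightarrow> 'b::euclidean_space"
  assumes S: "S \<in> sets borel" and S': "S' \<in> sets borel" "S' \<subseteq> S" and f: "f \<in> L2_space S"
  shows "f \<in> L2_space S'"
proof -
  obtain f' where f': "sqint f'" "AE x in lborel. x \<in> S \<longrightarrow> f x = f' x"
    using L2_space_representative[OF S f] by blast
  have "AE x in lborel. x \<in> S' \<longrightarrow> f x = f' x" using f'(2) by eventually_elim (use S'(2) in auto)
  then show ?thesis
    using S' f'(1) by (subst L2_space_iff[OF S'(1) sqint_measurable[OF f'(1)]])
      (auto intro!: sqint_mult[where K=1] simp: indicator_def)
qed

lemma integral_lebesgue_on_L2:
  fixes p :: "('a::euclidean_space, 'b::euclidean_space) L2"
  assumes D: "D \<in> sets borel" and p: "mulL2 (indicator D) p = p" and f: "AE x in lborel. x \<in> D \<longrightarrow> f x = ofL2 p x"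
    and \<psi>': "sqint \<psi>'" "AE x in lborel. x \<in> D \<longrightarrow> \<psi> x = \<psi>' x"
  shows "(LINT x|lebesgue_on D. f x \<bullet> \<psi> x) = inner p (toL2 \<psi>')"
    and "integrable (lebesgue_on D) (\<lambda>x. f x \<bullet> \<psi> x)"
proof -
  define f' where "f' x = (indicator D x :: real) *\<^sub>R ofL2 p x" for x
  have f': "sqint f'" unfolding f'_def by (rule sqint_mult[where K=1]) (use D in \<open>auto simp: indicator_def\<close>)
  have eq: "AE x in lborel. x \<in> D \<longrightarrow> f x = f' x" using f by eventually_elim (simp add: f'_def)
  have p_eq: "toL2 f' = p" using p by (simp add: mulL2_def f'_def[abs_def])
  have "x \<notin> D \<Longrightarrow> f' x = 0" for x by (simp add: f'_def)
  note int = integral_lebesgue_on_inner[OF D f' this eq \<psi>']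
  show "(LINT x|lebesgue_on D. f x \<bullet> \<psi> x) = inner p (toL2 \<psi>')" "integrable (lebesgue_on D) (\<lambda>x. f x \<bullet> \<psi> x)"
    using int unfolding p_eq by simp_all
qed

lemma gradL2_supported: "(p, G) \<in> gradL2 D \<Longrightarrow> mulL2 (indicator D) p = p \<and> mulL2 (indicator D) G = G"
  by (auto simp: gradL2_def)

text \<open>The norm of a weakly continuous curve is lower semicontinuous, so its sublevel sets are
  closed. It provides the measurability in time of the H1 norm, since the gradient is only weakly
  continuous.\<close>

lemma measurable_weakly_continuous_norm:
  fixes X :: "real \<Rightarrow> 'h::real_inner"
  assumes "\<And>\<phi>. continuous_on UNIV (\<lambda>t. inner (X t) \<phi>)"
  shows "(\<lambda>t. norm (X t)) \<in> borel_measurable borel"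
proof (rule borel_measurableI_le)
  fix c
  have "closed {t. norm (X t) \<le> c}"
  proof (subst closed_sequential_limits, safe)
    fix s :: "nat \<Rightarrow> real" and t
    assume s: "\<forall>n. s n \<in> {t. norm (X t) \<le> c}" "s \<longlonglongrightarrow> t"
    have "(\<lambda>n. inner (X (s n)) (X t)) \<longlonglongrightarrow> inner (X t) (X t)"
      using continuous_on_tendsto_compose[OF assms s(2)] by simp
    then show "norm (X t) \<le> c" by (rule weak_limit_norm_le) (use s(1) in auto)
  qed
  then show "{t \<in> space borel. norm (X t) \<le> c} \<in> sets borel" by simp
qed

lemma time_ivl_infinity: "time_ivl \<infinity> = {0..}"
  by (auto simp: time_ivl_def)

section \<open>The temperature as a function on the cylinder\<close>

context stefan
begin

lemma joint_U:
  "\<exists>v Fv. Fv \<in> borel_measurable borel \<and> (AE \<zeta> in lborel. v \<zeta> = Fv \<zeta>) \<and>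
     (AE t in lborel. 0 \<le> t \<longrightarrow> (AE x in lborel. Fv (x, t) = ofL2 (ulim t) x)) \<and>
     (\<forall>t\<ge>0. AE x in lborel. v (x, t) = ofL2 (ulim t) x)"
proof (rule joint_representative[of "\<lambda>n \<zeta>. ofL2 (U n (snd \<zeta>)) (fst \<zeta>)" "norm (\<gamma> 0) + A" ulim])
  show "(\<lambda>\<zeta>. ofL2 (U n (snd \<zeta>)) (fst \<zeta>)) \<in> borel_measurable borel" for n
    unfolding U_def by (rule step_function_measurable)
  show "norm (toL2 (\<lambda>x. ofL2 (U n (snd (x, t))) (fst (x, t)))) \<le> (norm (\<gamma> 0) + A) * (1 + t)" if "0 \<le> t" for n t
  proof -
    have "0 \<le> norm (\<gamma> 0) * t" using that by simp
    then show ?thesis using U_bound[OF that, of n] by (simp add: algebra_simps)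
  qed
qed (simp_all add: U_weak)

lemma joint_M:
  "\<exists>m Fm. Fm \<in> borel_measurable borel \<and> (AE \<zeta> in lborel. m \<zeta> = Fm \<zeta>) \<and>
     (AE t in lborel. 0 \<le> t \<longrightarrow> (AE x in lborel. Fm (x, t) = ofL2 (Mlim t) x)) \<and>
     (\<forall>t\<ge>0. AE x in lborel. m (x, t) = ofL2 (Mlim t) x)"
proof (rule joint_representative[of "\<lambda>n \<zeta>. ofL2 (weighted_phase (Z n (snd \<zeta>))) (fst \<zeta>)" \<Theta> Mlim])
  show "(\<lambda>\<zeta>. ofL2 (weighted_phase (Z n (snd \<zeta>))) (fst \<zeta>)) \<in> borel_measurable borel" for n
    unfolding Z_def by (rule step_function_measurable)
  show "norm (toL2 (\<lambda>x. ofL2 (weighted_phase (Z n (snd (x, t)))) (fst (x, t)))) \<le> \<Theta> * (1 + t)" if "0 \<le> t" for n t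
  proof -
    have "0 \<le> \<Theta> * t" using that by (simp add: \<Theta>_def)
    then show ?thesis using norm_weighted_phase[of "Z n t"] by (simp add: algebra_simps)
  qed
qed (simp_all add: M_weak)

lemma Mlim_supported:
  assumes t: "0 \<le> t"
  shows "mulL2 (indicator D) (Mlim t) = Mlim t"
proof -
  have "inner (mulL2 (indicator D) (Mlim t)) \<phi> = inner (Mlim t) \<phi>" for \<phi>
  proof (rule LIMSEQ_unique)
    show "(\<lambda>n. inner (weighted_phase (Z n t)) \<phi>) \<longlonglongrightarrow> inner (Mlim t) \<phi>" using M_weak[OF t] .
    show "(\<lambda>n. inner (weighted_phase (Z n t)) \<phi>) \<longlonglongrightarrow> inner (mulL2 (indicator D) (Mlim t)) \<phi>"
      using M_weak[OF t, of "mulL2 (indicator D) \<phi>"]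
      by (simp add: mulL2_self_adjoint[OF indicator_D, symmetric] mul_weighted_phase)
  qed
  then have "inner (mulL2 (indicator D) (Mlim t) - Mlim t) \<phi> = 0" for \<phi> by (simp add: inner_diff_left)
  then show ?thesis using inner_eq_zero_iff[of "mulL2 (indicator D) (Mlim t) - Mlim t"] by simp
qed

lemma norm_ulim_le: "0 \<le> t \<Longrightarrow> t \<le> T \<Longrightarrow> norm (ulim t) \<le> norm (\<gamma> 0) + A * (1 + T)"
proof -
  assume t: "0 \<le> t" "t \<le> T"
  then have "A * (1 + t) \<le> A * (1 + T)" by (intro mult_left_mono) auto
  then show ?thesis using ulim_bound[OF t(1)] by simp
qed

context
  fixes v Fv :: "'a \<times> real \<Rightarrow> real"
  assumes Fv [measurable]: "Fv \<in> borel_measurable borel" and v_eq: "AE \<zeta> in lborel. v \<zeta> = Fv \<zeta>"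
    and Fv_slice: "AE t in lborel. 0 \<le> t \<longrightarrow> (AE x in lborel. Fv (x, t) = ofL2 (ulim t) x)"
    and v_slice: "\<And>t. 0 \<le> t \<Longrightarrow> AE x in lborel. v (x, t) = ofL2 (ulim t) x"
begin

lemma v_slice_D: "0 \<le> t \<Longrightarrow> AE x in lborel. x \<in> D \<longrightarrow> v (x, t) = ofL2 (ulim t) x"
  using v_slice[of t] by (auto elim: AE_mp)

lemma v_H1: "0 \<le> t \<Longrightarrow> slice v t \<in> H1_space D"
  by (rule gradL2_imp_H1(1)[OF D lim_mem v_slice_D])

lemma v_weak_grad: "0 \<le> t \<Longrightarrow> AE x in lborel. x \<in> D \<longrightarrow> weak_grad D (slice v t) x = ofL2 (Glim t) x"
  by (rule gradL2_imp_H1(2)[OF D lim_mem v_slice_D])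

lemma v_H1_norm: "0 \<le> t \<Longrightarrow> H1_norm_sq D (slice v t) = (norm (ulim t))\<^sup>2 + (norm (Glim t))\<^sup>2"
  by (rule gradL2_imp_H1(3)[OF D lim_mem v_slice_D])

lemma v_eq_on: "AE \<zeta> in lborel. \<zeta> \<in> V \<longrightarrow> v \<zeta> = Fv \<zeta>"
  using v_eq by eventually_elim simp

lemma v_measurable: "V \<in> sets borel \<Longrightarrow> v \<in> borel_measurable (lebesgue_on V)"
  by (rule measurable_lebesgue_on[OF _ Fv v_eq_on])

lemma v_L2_loc_H1: "L2_loc_H1 D \<infinity> v"
  unfolding L2_loc_H1_def time_ivl_infinity
proof (intro conjI allI impI)
  show "v \<in> borel_measurable (lebesgue_on (D \<times> {0..}))" by (intro v_measurable borel_Times) auto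
  show "AE t in lebesgue_on {0..}. slice v t \<in> H1_space D" by (simp add: AE_lebesgue_on_iff v_H1)
  fix T :: real assume T: "0 < T"
  \<comment> \<open>Constant continuation to negative times, so that weak continuity holds on the
    whole line.\<close>
  define h where "h t = (norm (ulim (max 0 t)))\<^sup>2 + (norm (Glim (max 0 t)))\<^sup>2" for t
  have "continuous_on UNIV (\<lambda>t. inner (ulim (max 0 t)) \<phi>)" for \<phi>
    by (intro continuous_intros continuous_on_compose2[OF ulim_continuous]) auto
  moreover have "continuous_on UNIV (\<lambda>t. inner (Glim (max 0 t)) \<phi>)" for \<phi>
    by (rule continuous_on_compose2[OF Glim_weakly_continuous]) (auto intro!: continuous_intros)
  ultimately have [measurable]: "h \<in> borel_measurable borel"
    unfolding h_def by (intro borel_measurable_add borel_measurable_power measurable_weakly_continuous_norm)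
  have "integrable lborel (\<lambda>t. indicator {0..T} t *\<^sub>R h t)"
  proof (rule integrable_compact_support[where M="(norm (\<gamma> 0) + A * (1 + T))\<^sup>2 + (A + norm (toL2 F))\<^sup>2" and K="{0..T}"])
    show "\<bar>indicator {0..T} t *\<^sub>R h t\<bar> \<le> (norm (\<gamma> 0) + A * (1 + T))\<^sup>2 + (A + norm (toL2 F))\<^sup>2" for t
      using T by (auto simp: indicator_def h_def intro!: add_mono power_mono norm_ulim_le Glim_bound)
  qed auto
  then show "integrable (lebesgue_on {0..T}) (\<lambda>t. H1_norm_sq D (slice v t))"
    by (subst integrable_lebesgue_on_iff[of "{0..T}" h]) (auto simp: v_H1_norm h_def max_def)
qed

lemma v_L2_space:
  assumes T: "0 \<le> T"
  shows "v \<in> L2_space (D \<times> {0<..<T})"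
proof -
  define B where "B = norm (\<gamma> 0) + A * (1 + T)"
  have "sqint (\<lambda>\<zeta>. indicator {0<..<T} (snd \<zeta>) * Fv \<zeta>)"
  proof (rule joint_sqint(1)[OF Fv])
    show "AE t in lborel. (indicator {0<..<T} t :: real) \<noteq> 0 \<longrightarrow> (AE x in lborel. Fv (x, t) = ofL2 (ulim t) x)"
      using Fv_slice by eventually_elim (auto simp: indicator_def)
    show "(indicator {0<..<T} t * norm (ulim t))\<^sup>2 \<le> B\<^sup>2 * indicator {0..T} t"
      if "(indicator {0<..<T} t :: real) \<noteq> 0" for t
      using that norm_ulim_le[of t T] by (auto simp: indicator_def B_def intro!: power_mono split: if_splits)
    show "integrable lborel (\<lambda>t. B\<^sup>2 * indicator {0..T} t)"
      by (intro integrable_mult_right integrable_indicator_compact compact_Icc)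
  qed auto
  moreover have "D \<times> (UNIV :: real set) \<in> sets borel" by (intro borel_Times) auto
  ultimately have "sqint (\<lambda>\<zeta>. indicator (D \<times> UNIV) \<zeta> *\<^sub>R (indicator {0<..<T} (snd \<zeta>) * Fv \<zeta>))"
    by (intro sqint_mult[where K=1]) (auto simp: indicator_def)
  also have "(\<lambda>\<zeta>. indicator (D \<times> UNIV) \<zeta> *\<^sub>R (indicator {0<..<T} (snd \<zeta>) * Fv \<zeta>))
      = (\<lambda>\<zeta>. indicator (D \<times> {0<..<T}) \<zeta> *\<^sub>R Fv \<zeta>)"
    by (auto simp: indicator_def)
  finally show ?thesis
    by (subst L2_space_iff[OF _ Fv v_eq_on]) (auto intro!: borel_Times)
qed

lemma v_time_derivative: "time_deriv_L2_loc D \<infinity> v"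
proof -
  have open_cyl: "open (D \<times> {0::real<..})" using D by (intro open_Times) auto
  have loc: "locally_integrable_on (D \<times> {0<..}) v"
    unfolding locally_integrable_on_def
  proof (intro allI impI)
    fix K :: "('a \<times> real) set" assume K: "compact K" "K \<subseteq> D \<times> {0<..}"
    then obtain T :: nat where T: "K \<subseteq> D \<times> {0<..<real T}" using compact_time_bound by blast
    have "locally_integrable_on (D \<times> {0<..<real T}) v"
      by (intro L2_space_locally_integrable v_L2_space borel_Times) auto
    then show "integrable (lebesgue_on K) v" using K(1) T by (simp add: locally_integrable_on_def)
  qed
  obtain w where w: "w \<in> L2_space (D \<times> {0<..})" "has_weak_partial (D \<times> {0<..}) (0, 1) v w"
    using weak_partial_from_bound[OF open_cyl time_Basis Fv v_eq_on loc time_derivative_bound[OF _ Fv Fv_slice]] by blast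
  have "w \<in> L2_space (D \<times> {0<..<T})" for T :: real
    by (rule L2_space_subset[OF _ _ _ w(1)]) (auto intro!: borel_Times)
  then show ?thesis
    using w(2) by (auto simp: time_deriv_L2_loc_def greaterThan_def)
qed

lemma v_space_U: "v \<in> space_U D"
proof -
  have "v \<in> H1_space (D \<times> {0<..<T})" if T: "0 < T" for T :: real
  proof -
    let ?S = "D \<times> {0<..<T}"
    \<comment> \<open>The bound for spatial derivatives is stated for integer time horizons; a test
      function on the shorter cylinder is one on the longer.\<close>
    obtain N :: nat where N: "T < real N" using reals_Archimedean2 by blast
    have cyl: "open ?S" "?S \<in> sets borel" using D by (auto intro!: open_Times borel_Times)
    have L2: "v \<in> L2_space ?S" using T by (intro v_L2_space) simp
    have "\<exists>w\<in>L2_space ?S. has_weak_partial ?S b v w" if b: "b \<in> Basis" for b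
    proof -
      have "\<exists>C. \<forall>\<phi>\<in>Cc_infinity ?S. \<bar>LINT \<zeta>|lborel. Fv \<zeta> * partial_deriv b \<phi> \<zeta>\<bar> \<le> C * norm (toL2 \<phi>)"
      proof (cases "b = (0, 1)")
        case True
        have "\<phi> \<in> Cc_infinity (D \<times> {0<..})" if "\<phi> \<in> Cc_infinity ?S" for \<phi>
          using that by (rule Cc_infinity_mono) auto
        then show ?thesis using time_derivative_bound[OF _ Fv Fv_slice] True by blast
      next
        case False
        then obtain c where c: "c \<in> Basis" "b = (c, 0)" using b by (auto simp: Basis_prod_def)
        have "\<phi> \<in> Cc_infinity (D \<times> {0<..<real N})" if "\<phi> \<in> Cc_infinity ?S" for \<phi>
          using that by (rule Cc_infinity_mono) (use N in auto)
        then show ?thesis using space_derivative_bound[OF _ _ Fv Fv_slice c(1)] N T c(2) by fastforce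
      qed
      then show ?thesis
        using weak_partial_from_bound[OF cyl(1) b Fv v_eq_on L2_space_locally_integrable[OF cyl(2) L2]] by blast
    qed
    then obtain w where w: "\<And>b. b \<in> Basis \<Longrightarrow> w b \<in> L2_space ?S" "\<And>b. b \<in> Basis \<Longrightarrow> has_weak_partial ?S b v (w b)"
      by metis
    have "\<forall>b\<in>Basis. \<exists>h. sqint h \<and> (AE x in lborel. x \<in> ?S \<longrightarrow> w b x = h x)"
      using L2_space_representative[OF cyl(2) w(1)] by blast
    from bchoice[OF this] obtain h where h: "\<And>b. b \<in> Basis \<Longrightarrow> sqint (h b)"
      "\<And>b. b \<in> Basis \<Longrightarrow> AE x in lborel. x \<in> ?S \<longrightarrow> w b x = h b x" by blast
    define W where "W x = (\<Sum>b\<in>Basis. w b x *\<^sub>R b)" for x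
    have sq: "sqint (\<lambda>x. \<Sum>b\<in>Basis. h b x *\<^sub>R b)" by (intro sqint_sum sqint_scaleR_left h) auto
    have "AE x in lborel. \<forall>b\<in>Basis. x \<in> ?S \<longrightarrow> w b x = h b x"
      by (intro AE_finite_allI h finite_Basis)
    then have "AE x in lborel. x \<in> ?S \<longrightarrow> W x = (\<Sum>b\<in>Basis. h b x *\<^sub>R b)"
      by eventually_elim (simp add: W_def)
    then have "W \<in> L2_space ?S"
      using cyl(2) by (subst L2_space_iff[OF cyl(2) sqint_measurable[OF sq]])
        (auto intro!: sqint_mult[where K=1] sq simp: indicator_def)
    moreover have "has_weak_gradient ?S v W"
      using w(2) by (simp add: has_weak_gradient_def W_def)
    ultimately show ?thesis using L2 by (auto simp: H1_space_def)
  qed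
  then show ?thesis by (simp add: space_U_def)
qed

lemma v_continuous_L2_valued: "continuous_L2_valued D \<infinity> v"
  unfolding continuous_L2_valued_def time_ivl_infinity
proof (intro conjI ballI)
  show "slice v t \<in> L2_space D" if "t \<in> {0..}" for t using v_H1[of t] that by (simp add: H1_space_def)
  fix t :: real assume t: "t \<in> {0..}"
  have eq: "(LINT x|lebesgue_on D. (v (x, s) - v (x, t))\<^sup>2) = (norm (ulim s - ulim t))\<^sup>2" if s: "0 \<le> s" for s
  proof -
    have p: "mulL2 (indicator D) (ulim s - ulim t) = ulim s - ulim t"
      using gradL2_supported[OF lim_mem] s t by (simp add: linear_diff[OF linear_mulL2[OF indicator_D]])
    have "AE x in lborel. x \<in> D \<longrightarrow> v (x, s) - v (x, t) = ofL2 (ulim s - ulim t) x"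
      using ofL2_diff[of "ulim s" "ulim t"] v_slice[OF s] v_slice[of t] t by (auto elim!: AE_mp)
    from integral_lebesgue_on_L2(1)[OF DB p this sqint_ofL2 this] show ?thesis
      by (simp add: power2_eq_square power2_norm_eq_inner[unfolded power2_eq_square])
  qed
  have "((\<lambda>s. (norm (ulim s - ulim t))\<^sup>2) \<longlongrightarrow> (norm (ulim t - ulim t))\<^sup>2) (at t within {0..})"
    using ulim_continuous t by (intro tendsto_intros) (auto simp: continuous_on_def)
  moreover have "\<forall>\<^sub>F s in at t within {0..}. (norm (ulim s - ulim t))\<^sup>2 = (LINT x|lebesgue_on D. (v (x, s) - v (x, t))\<^sup>2)"
    by (simp add: eventually_at_filter eq)
  ultimately show "((\<lambda>s. LINT x|lebesgue_on D. (v (x, s) - v (x, t))\<^sup>2) \<longlongrightarrow> 0) (at t within {0..})"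
    by (simp add: filterlim_cong)
qed

end

end

lemma grad_x_eq: "grad_x \<eta> (x, t) = classical_grad (\<lambda>x. \<eta> (x, t)) x"
  by (simp add: grad_x_def classical_grad_def)

lemma deriv_t_eq:
  assumes "\<zeta> \<in> Cc_infinity UNIV" and "\<And>s. s > 0 \<Longrightarrow> \<eta> (x, s) = \<zeta> (x, s)" and t: "t > 0"
  shows "deriv_t \<eta> (x, t) = partial_deriv (0, 1) \<zeta> (x, t)"
proof -
  have "((\<lambda>s. \<zeta> (x, s)) has_real_derivative partial_deriv (0, 1) \<zeta> (x, t)) (at t)"
    by (intro has_derivative_time Cc_infinityD(4)[OF assms(1)])
  then have "((\<lambda>s. \<eta> (x, s)) has_real_derivative partial_deriv (0, 1) \<zeta> (x, t)) (at t)"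
    by (rule has_field_derivative_transform_within_open[where S="{0<..}"]) (use t assms(2) in auto)
  then show ?thesis by (simp add: deriv_t_def DERIV_imp_deriv)
qed

lemma clamp1_measurable [measurable]: "clamp1 \<in> borel_measurable borel"
  unfolding clamp1_def[abs_def] by measurable

lemma clamp1_id: "\<bar>r\<bar> \<le> 1 \<Longrightarrow> clamp1 r = r"
  by (auto simp: clamp1_def)

lemma clamp1_le: "\<bar>clamp1 r\<bar> \<le> 1"
  by (auto simp: clamp1_def)

section \<open>The phase as a function on the cylinder, and the existence theorem\<close>

context stefan
begin

context
  fixes m Fm \<mu> :: "'a \<times> real \<Rightarrow> real"
  assumes Fm [measurable]: "Fm \<in> borel_measurable borel" and m_eq: "AE \<zeta> in lborel. m \<zeta> = Fm \<zeta>"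
    and m_slice: "\<And>t. 0 \<le> t \<Longrightarrow> AE x in lborel. m (x, t) = ofL2 (Mlim t) x"
  defines "\<mu> \<equiv> \<lambda>\<zeta>. clamp1 (weight (fst \<zeta>) * m \<zeta>)"
begin

text \<open>The limit phase is bounded by 1 at every time, almost everywhere in space, so the clamp
  in \<mu> changes no slice up to null sets; it makes the bound hold everywhere.\<close>

lemma mu_slice: "0 \<le> t \<Longrightarrow> AE x in lborel. \<mu> (x, t) = weight x * ofL2 (Mlim t) x"
  using m_slice[of t] Mlim_abs_le[of t] by (auto simp: \<mu>_def clamp1_id elim!: AE_mp)

lemma mu_measurable: "V \<in> sets borel \<Longrightarrow> \<mu> \<in> borel_measurable (lebesgue_on V)"
proof (rule measurable_lebesgue_on)
  have [measurable]: "fst \<in> borel_measurable (borel :: ('a \<times> real) measure)"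
    by (auto intro!: borel_measurable_continuous_onI continuous_intros)
  show "(\<lambda>\<zeta>. clamp1 (weight (fst \<zeta>) * Fm \<zeta>)) \<in> borel_measurable borel" by measurable
  show "AE \<zeta> in lborel. \<zeta> \<in> V \<longrightarrow> \<mu> \<zeta> = clamp1 (weight (fst \<zeta>) * Fm \<zeta>)"
    using m_eq by eventually_elim (simp add: \<mu>_def)
qed

lemma mu_le: "\<bar>\<mu> \<zeta>\<bar> \<le> 1"
  by (simp add: \<mu>_def clamp1_le)

lemma mu_Linf: "\<mu> \<in> Linf_space (D \<times> {0..})"
  unfolding Linf_space_def by (auto intro!: mu_measurable borel_Times exI[of _ 1] AE_I2 mu_le)

lemma mu_slice_on: "0 \<le> t \<Longrightarrow> AE x in lborel. x \<in> D \<longrightarrow> \<mu> (x, t) = weight x * ofL2 (Mlim t) x"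
  using mu_slice[of t] by (auto elim: AE_mp)

lemma mu_slice_Linf: "0 \<le> t \<Longrightarrow> slice \<mu> t \<in> Linf_space D"
  unfolding Linf_space_def
  by (auto intro!: measurable_lebesgue_on[OF DB _ mu_slice_on] exI[of _ 1] AE_I2 mu_le)

text \<open>Weak continuity in L2 only covers tests whose product with the weight is square
  integrable. A general integrable test is approximated by truncations; as the phase is bounded by
  1, the error is at most their L1 distance, uniformly in time, and a uniform limit of continuous
  functions is continuous.\<close>

lemma mu_weak_star_continuous: "weak_star_continuous D \<infinity> \<mu>"
  unfolding weak_star_continuous_def time_ivl_infinity
proof (intro conjI ballI allI impI)
  show "slice \<mu> t \<in> Linf_space D" if "t \<in> {0..}" for t using mu_slice_Linf that by simp
  fix f :: "'a \<Rightarrow> real" assume f: "integrable (lebesgue_on D) f"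
  obtain f' where f' [measurable]: "f' \<in> borel_measurable borel" and f0: "\<And>x. x \<notin> D \<Longrightarrow> f' x = 0"
    and ff': "AE x in lborel. x \<in> D \<longrightarrow> f x = f' x"
    using lebesgue_on_borel_representative_real[OF DB borel_measurable_integrable[OF f]] by blast
  have ind: "indicator D x *\<^sub>R f' x = f' x" for x using f0[of x] by (auto simp: indicator_def)
  have int: "integrable lborel f'"
    using f unfolding integrable_lebesgue_on_iff[OF DB f' ff'] ind .
  \<comment> \<open>Truncation in space and in height: the weight is bounded on the ball, so the
    weighted truncation is bounded with bounded support.\<close>
  define K where "K k = {x. norm x \<le> real k \<and> \<bar>f' x\<bar> \<le> real k}" for k
  have [measurable]: "K k \<in> sets borel" for k unfolding K_def by measurable
  define c where "c k = (\<lambda>x. indicator (K k) x * f' x)" for k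
  have [measurable]: "c k \<in> borel_measurable borel" for k unfolding c_def by measurable
  have wc: "sqint (\<lambda>x. weight x * c k x)" for k
  proof -
    have "compact (weight ` cball (0::'a) (real k))" by (intro compact_continuous_image weight_continuous compact_cball)
    then obtain W where W: "\<And>x::'a. x \<in> cball 0 (real k) \<Longrightarrow> norm (weight x) \<le> W"
      using compact_imp_bounded bounded_iff by (metis image_eqI)
    have "0 \<le> W" using W[of 0] norm_ge_zero[of "weight (0::'a)"] by (smt (verit) centre_in_cball of_nat_0_le_iff)
    have b: "norm (weight x * c k x) \<le> W * real k" for x
    proof (cases "x \<in> K k")
      case True
      then show ?thesis using W[of x] \<open>0 \<le> W\<close> by (auto simp: c_def K_def abs_mult intro!: mult_mono)
    qed (simp add: c_def \<open>0 \<le> W\<close>)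
    show ?thesis
      by (rule sqint_bounded_compact_support[OF _ b, where K="cball 0 (real k)"])
         (simp_all add: c_def K_def)
  qed
  have eq: "(LINT x|lebesgue_on D. \<mu> (x, t) * f x) = (LINT x|lborel. weight x * ofL2 (Mlim t) x * f' x)"
    if t: "0 \<le> t" for t
  proof -
    have ae: "AE x in lborel. x \<in> D \<longrightarrow> \<mu> (x, t) * f x = weight x * ofL2 (Mlim t) x * f' x"
      using mu_slice[OF t] ff' by eventually_elim simp
    have meas: "(\<lambda>x. weight x * ofL2 (Mlim t) x * f' x) \<in> borel_measurable borel" by measurable
    have ind': "indicator D x *\<^sub>R (weight x * ofL2 (Mlim t) x * f' x) = weight x * ofL2 (Mlim t) x * f' x" for x
      using f0[of x] by (auto simp: indicator_def)
    show ?thesis unfolding integral_lebesgue_on_eq[OF DB meas ae] ind' ..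
  qed
  have tail: "\<bar>(LINT x|lborel. weight x * ofL2 (Mlim t) x * f' x) - inner (Mlim t) (toL2 (\<lambda>x. weight x * c k x))\<bar>
      \<le> (LINT x|lborel. \<bar>f' x - c k x\<bar>)" if t: "0 \<le> t" for t k
  proof -
    have ci: "integrable lborel (c k)"
      by (rule Bochner_Integration.integrable_bound[OF int]) (auto simp: c_def indicator_def)
    have b1: "AE x in lborel. norm (weight x * ofL2 (Mlim t) x * f' x) \<le> norm (f' x)"
      using Mlim_abs_le[OF t] by eventually_elim (auto simp: abs_mult[of _ "f' _"] intro: mult_left_le_one_le)
    have i1: "integrable lborel (\<lambda>x. weight x * ofL2 (Mlim t) x * f' x)"
      by (rule Bochner_Integration.integrable_bound[OF int _ b1]) measurable
    have i2: "integrable lborel (\<lambda>x. ofL2 (Mlim t) x \<bullet> (weight x * c k x))"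
      by (rule sqint_inner_integrable[OF sqint_ofL2 wc])
    have "\<bar>(LINT x|lborel. weight x * ofL2 (Mlim t) x * f' x) - inner (Mlim t) (toL2 (\<lambda>x. weight x * c k x))\<bar>
        = \<bar>LINT x|lborel. weight x * ofL2 (Mlim t) x * f' x - ofL2 (Mlim t) x \<bullet> (weight x * c k x)\<bar>"
      by (simp only: inner_toL2_right[OF wc] Bochner_Integration.integral_diff[OF i1 i2])
    also have "\<dots> \<le> (LINT x|lborel. \<bar>f' x - c k x\<bar>)"
    proof (rule order_trans[OF integral_abs_bound], rule integral_mono_AE)
      show "AE x in lborel. \<bar>weight x * ofL2 (Mlim t) x * f' x - ofL2 (Mlim t) x \<bullet> (weight x * c k x)\<bar> \<le> \<bar>f' x - c k x\<bar>"
        using Mlim_abs_le[OF t]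
      proof eventually_elim
        case (elim x)
        have "weight x * ofL2 (Mlim t) x * f' x - ofL2 (Mlim t) x \<bullet> (weight x * c k x)
            = (weight x * ofL2 (Mlim t) x) * (f' x - c k x)" by (simp add: algebra_simps)
        then show ?case using elim by (simp only: abs_mult[of _ "f' x - c k x"]) (simp add: mult_left_le_one_le)
      qed
    qed (use i1 i2 int ci in auto)
    finally show ?thesis .
  qed
  have "(\<lambda>k. LINT x|lborel. \<bar>f' x - c k x\<bar>) \<longlonglongrightarrow> (LINT x|(lborel :: 'a measure). 0)"
  proof (rule integral_dominated_convergence[where w="\<lambda>x. \<bar>f' x\<bar>"])
    show "AE x in lborel. (\<lambda>k. \<bar>f' x - c k x\<bar>) \<longlonglongrightarrow> 0"
    proof (rule AE_I2)
      fix x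
      obtain N :: nat where N: "max (norm x) \<bar>f' x\<bar> \<le> real N" using real_arch_simple by blast
      then have "c k x = f' x" if "N \<le> k" for k
        using that order_trans[of "max (norm x) \<bar>f' x\<bar>" "real N" "real k"] by (simp add: c_def K_def)
      then have "\<forall>\<^sub>F k in sequentially. \<bar>f' x - c k x\<bar> = 0"
        unfolding eventually_sequentially by (intro exI[of _ N]) simp
      then show "(\<lambda>k. \<bar>f' x - c k x\<bar>) \<longlonglongrightarrow> 0" by (rule tendsto_eventually)
    qed
    show "AE x in lborel. norm \<bar>f' x - c k x\<bar> \<le> \<bar>f' x\<bar>" for k by (auto simp: c_def indicator_def)
  qed (use int in auto)
  then have lim: "(\<lambda>k. LINT x|lborel. \<bar>f' x - c k x\<bar>) \<longlonglongrightarrow> 0" by simp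
  have "uniform_limit {0..} (\<lambda>k t. inner (Mlim t) (toL2 (\<lambda>x. weight x * c k x)))
      (\<lambda>t. LINT x|lebesgue_on D. \<mu> (x, t) * f x) sequentially"
  proof (rule uniform_limitI)
    fix \<epsilon> :: real assume "0 < \<epsilon>"
    with lim have "\<forall>\<^sub>F k in sequentially. (LINT x|lborel. \<bar>f' x - c k x\<bar>) < \<epsilon>" by (rule order_tendstoD(2))
    then show "\<forall>\<^sub>F k in sequentially. \<forall>t\<in>{0..}. dist (inner (Mlim t) (toL2 (\<lambda>x. weight x * c k x)))
        (LINT x|lebesgue_on D. \<mu> (x, t) * f x) < \<epsilon>"
    proof eventually_elim
      case (elim k)
      show ?case
      proof
        fix t :: real assume "t \<in> {0..}"
        then have t: "0 \<le> t" by simp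
        show "dist (inner (Mlim t) (toL2 (\<lambda>x. weight x * c k x))) (LINT x|lebesgue_on D. \<mu> (x, t) * f x) < \<epsilon>"
          unfolding eq[OF t] dist_real_def using tail[OF t, of k] elim by linarith
      qed
    qed
  qed
  then show "continuous_on {0..} (\<lambda>t. LINT x|lebesgue_on D. \<mu> (x, t) * f x)"
    by (rule uniform_limit_theorem[rotated]) (auto intro!: always_eventually Mlim_weakly_continuous)
qed

context
  fixes v Fv :: "'a \<times> real \<Rightarrow> real"
  assumes Fv: "Fv \<in> borel_measurable borel" and v_eq: "AE \<zeta> in lborel. v \<zeta> = Fv \<zeta>"
    and Fv_slice: "AE t in lborel. 0 \<le> t \<longrightarrow> (AE x in lborel. Fv (x, t) = ofL2 (ulim t) x)"
    and v_slice: "\<And>t. 0 \<le> t \<Longrightarrow> AE x in lborel. v (x, t) = ofL2 (ulim t) x"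
begin

lemma phases:
  assumes t: "0 \<le> t"
  shows "AE x in lborel. x \<in> D \<longrightarrow> (v (x, t) > u\<^sub>M x \<longrightarrow> \<mu> (x, t) = 1) \<and> (v (x, t) < u\<^sub>M x \<longrightarrow> \<mu> (x, t) = - 1)"
  using phase_lim[OF t, of 1] phase_lim[OF t, of "- 1"] v_slice[OF t] mu_slice[OF t]
  by (auto elim!: AE_mp)

lemma initial_phase: "AE x in lborel. \<mu> (x, 0) = \<mu>\<^sub>0 x"
  using mu_slice[of 0] Mlim_0 by (auto elim!: AE_mp)

lemma initial_temperature: "AE x in lborel. v (x, 0) = g x"
  using v_slice[of 0] ofL2_toL2[OF g(1)] by (auto simp: ulim_0 \<gamma>_0 elim!: AE_mp)

text \<open>The phase integral is rewritten as the pairing of the phase divided by the weight with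
  the test multiplied by it, which returns from functions on \<open>D\<close> to the two Hilbert
  space pairings.\<close>

lemma enthalpy_pairing:
  assumes t: "0 \<le> t" and \<psi>: "\<psi> \<in> Cc_infinity UNIV"
  shows "(LINT x|lebesgue_on D. (v (x, t) + \<mu> (x, t)) * \<psi> x) = inner (ulim t) (test \<psi>) + inner (Mlim t) (wtest \<psi>)"
    and "integrable (lebesgue_on D) (\<lambda>x. (v (x, t) + \<mu> (x, t)) * \<psi> x)"
proof -
  have v: "AE x in lborel. x \<in> D \<longrightarrow> v (x, t) = ofL2 (ulim t) x" using v_slice[OF t] by eventually_elim simp
  have m: "AE x in lborel. x \<in> D \<longrightarrow> \<mu> (x, t) / weight x = ofL2 (Mlim t) x"
    using mu_slice[OF t] by eventually_elim (simp add: weight_pos less_imp_neq[OF weight_pos, symmetric])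
  have \<psi>1: "AE x in lborel. x \<in> D \<longrightarrow> \<psi> x = indicator D x * \<psi> x"
    and \<psi>2: "AE x in lborel. x \<in> D \<longrightarrow> weight x * \<psi> x = (indicator D x * weight x) * \<psi> x" by simp_all
  note a = integral_lebesgue_on_L2[OF DB gradL2_supported[OF lim_mem[OF t], THEN conjunct1] v sqint_test(1)[OF \<psi>] \<psi>1]
  note b = integral_lebesgue_on_L2[OF DB Mlim_supported[OF t] m sqint_test(2)[OF \<psi>] \<psi>2]
  have eq: "(\<lambda>x. (v (x, t) + \<mu> (x, t)) * \<psi> x) = (\<lambda>x. v (x, t) \<bullet> \<psi> x + (\<mu> (x, t) / weight x) \<bullet> (weight x * \<psi> x))"
    by (auto simp: fun_eq_iff field_simps less_imp_neq[OF weight_pos, symmetric])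
  show "(LINT x|lebesgue_on D. (v (x, t) + \<mu> (x, t)) * \<psi> x) = inner (ulim t) (test \<psi>) + inner (Mlim t) (wtest \<psi>)"
    unfolding eq Bochner_Integration.integral_add[OF a(2) b(2)] a(1) b(1) test_def wtest_def ..
  show "integrable (lebesgue_on D) (\<lambda>x. (v (x, t) + \<mu> (x, t)) * \<psi> x)"
    unfolding eq by (rule Bochner_Integration.integrable_add[OF a(2) b(2)])
qed

context
  fixes \<zeta> :: "'a \<times> real \<Rightarrow> real"
  assumes \<zeta>: "\<zeta> \<in> Cc_infinity UNIV"
begin

lemma flux_pairing:
  assumes t: "0 \<le> t" and F0: "AE x in lborel. x \<in> D \<longrightarrow> F0 x = F x"
  shows "(LINT x|lebesgue_on D. (v (x, t) + \<mu> (x, t)) * partial_deriv (0, 1) \<zeta> (x, t)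
      - weak_grad D (slice v t) x \<bullet> grad_x \<zeta> (x, t) - F0 x \<bullet> grad_x \<zeta> (x, t)) = pairing_deriv \<zeta> t"
proof -
  have d: "(\<lambda>x. partial_deriv (0, 1) \<zeta> (x, t)) \<in> Cc_infinity UNIV"
    by (rule Cc_infinity_slice[OF Cc_infinity_partial_deriv[OF \<zeta> time_Basis]]) auto
  have s: "(\<lambda>x. \<zeta> (x, t)) \<in> Cc_infinity UNIV" by (rule Cc_infinity_slice[OF \<zeta>]) auto
  let ?\<psi> = "classical_grad (\<lambda>x. \<zeta> (x, t))"
  have \<psi>: "AE x in lborel. x \<in> D \<longrightarrow> ?\<psi> x = indicator D x *\<^sub>R ?\<psi> x" by simp
  have G: "AE x in lborel. x \<in> D \<longrightarrow> weak_grad D (slice v t) x = ofL2 (Glim t) x"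
    by (rule v_weak_grad[OF Fv v_eq Fv_slice v_slice t])
  have FF: "AE x in lborel. x \<in> D \<longrightarrow> F0 x = ofL2 (toL2 F) x"
    using F0 ofL2_toL2[OF F(1)] by eventually_elim simp
  note a = enthalpy_pairing[OF t d]
  note b = integral_lebesgue_on_L2[OF DB gradL2_supported[OF lim_mem[OF t], THEN conjunct2] G sqint_test(3)[OF s] \<psi>]
  have FD: "mulL2 (indicator D) (toL2 F) = toL2 F" by (rule mulL2_indicator_toL2[OF DB F])
  note c = integral_lebesgue_on_L2[OF DB FD FF sqint_test(3)[OF s] \<psi>]
  note ab = Bochner_Integration.integrable_diff[OF a(2) b(2)]
  have "(LINT x|lebesgue_on D. (v (x, t) + \<mu> (x, t)) * partial_deriv (0, 1) \<zeta> (x, t)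
      - weak_grad D (slice v t) x \<bullet> ?\<psi> x - F0 x \<bullet> ?\<psi> x)
    = inner (ulim t) (dtest \<zeta> t) + inner (Mlim t) (dwtest \<zeta> t)
      - inner (Glim t) (gtest (\<lambda>x. \<zeta> (x, t))) - inner (toL2 F) (gtest (\<lambda>x. \<zeta> (x, t)))"
    by (subst Bochner_Integration.integral_diff[OF ab c(2)], subst Bochner_Integration.integral_diff[OF a(2) b(2)])
       (simp only: a(1) b(1) c(1) dtest_def dwtest_def gtest_def)
  then show ?thesis by (simp add: grad_x_eq pairing_deriv_def inner_add_left)
qed

text \<open>Covers both kinds of test functions: those on all of space-time and those given only for
  nonnegative times through an extension \<zeta>.\<close>

lemma enthalpy_identity_half:
  assumes \<eta>: "\<And>x t. 0 \<le> t \<Longrightarrow> \<eta> (x, t) = \<zeta> (x, t)" and t: "0 \<le> t\<^sub>1" "t\<^sub>1 < t\<^sub>2"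
    and F0: "AE x in lborel. x \<in> D \<longrightarrow> F0 x = F x"
  shows "enthalpy_identity D F0 v \<mu> t\<^sub>1 t\<^sub>2 \<eta>"
proof -
  have s: "(\<lambda>x. \<zeta> (x, t)) \<in> Cc_infinity UNIV" for t by (rule Cc_infinity_slice[OF \<zeta>]) auto
  have p: "(LINT x|lebesgue_on D. (v (x, t) + \<mu> (x, t)) * \<eta> (x, t)) = pairing \<zeta> t" if t: "0 \<le> t" for t
    using enthalpy_pairing(1)[OF t s] by (simp add: \<eta>[OF t] pairing_def)
  define h where "h t = indicator {0..} t *\<^sub>R pairing_deriv \<zeta> t" for t
  have h: "h \<in> borel_measurable borel"
    unfolding h_def by (rule borel_measurable_continuous_on_indicator[OF _ pairing_continuous(2)[OF \<zeta>]]) simp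
  define I where "I t = (LINT x|lebesgue_on D. (v (x, t) + \<mu> (x, t)) * deriv_t \<eta> (x, t)
        - weak_grad D (slice v t) x \<bullet> grad_x \<eta> (x, t) - F0 x \<bullet> grad_x \<eta> (x, t))" for t
  have I: "I t = pairing_deriv \<zeta> t" if "0 < t" for t
  proof -
    have "deriv_t \<eta> (x, t) = partial_deriv (0, 1) \<zeta> (x, t)" for x by (rule deriv_t_eq[OF \<zeta> _ that]) (simp add: \<eta>)
    moreover have "grad_x \<eta> (x, t) = grad_x \<zeta> (x, t)" for x using that by (simp add: grad_x_def \<eta>)
    ultimately show ?thesis using flux_pairing[OF _ F0, of t] that by (simp add: I_def)
  qed
  \<comment> \<open>At time \<open>0\<close> the two-sided \<open>deriv_t\<close> may see values of
    \<eta> at negative times, which are arbitrary; the integrands are therefore compared at positive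
    times only, a single time being negligible.\<close>
  have "AE t in lborel. t \<in> {t\<^sub>1..t\<^sub>2} \<longrightarrow> I t = h t"
    using AE_lborel_singleton[of "0::real"] by eventually_elim (use t in \<open>auto simp: I h_def\<close>)
  moreover have "AE s in lborel. s \<in> {t\<^sub>1..t\<^sub>2} \<longrightarrow> pairing_deriv \<zeta> s = h s"
    using t by (intro AE_I2) (simp add: h_def)
  ultimately have "(LINT t|lebesgue_on {t\<^sub>1..t\<^sub>2}. I t) = (LINT t|lebesgue_on {t\<^sub>1..t\<^sub>2}. pairing_deriv \<zeta> t)"
    by (simp add: integral_lebesgue_on_eq[OF _ h])
  then show ?thesis
    using pairing_identity[OF \<zeta> t] t by (simp add: enthalpy_identity_def p I_def)
qed

end

end

end

text \<open>Stated for data agreeing almost everywhere on \<open>D\<close> with the Borel data of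
  the locale, since the given functions are only determined up to null sets and arbitrary outside
  \<open>D\<close>.\<close>

theorem enthalpy_solution_ex:
  assumes uM0: "AE x in lborel. x \<in> D \<longrightarrow> uM0 x = u\<^sub>M x" and F0: "AE x in lborel. x \<in> D \<longrightarrow> F0 x = F x"
    and g0: "AE x in lborel. x \<in> D \<longrightarrow> g0 x = g x"
  shows "\<exists>v \<mu>. v \<in> space_U_N D g0 \<and> \<mu> \<in> Linf_space (D \<times> {0..}) \<and>
           enthalpy_solution_Neumann D \<infinity> uM0 F0 v \<mu> \<and>
           (\<forall>t\<ge>0. slice v t \<in> H1_space D) \<and>
           (\<forall>t\<^sub>1 t\<^sub>2. 0 \<le> t\<^sub>1 \<longrightarrow> t\<^sub>1 < t\<^sub>2 \<longrightarrow>
              (\<forall>\<eta>\<in>Cc_infinity_half. enthalpy_identity D F0 v \<mu> t\<^sub>1 t\<^sub>2 \<eta>)) \<and>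
           (AE x in lebesgue_on D. v (x, 0) = g0 x) \<and>
           (AE x in lebesgue_on D.
              \<mu> (x, 0) = indicator (Omega_plus D uM0 g0) x - indicator (Omega_minus D uM0 g0) x)"
proof -
  obtain v Fv where v: "Fv \<in> borel_measurable borel" "AE \<zeta> in lborel. v \<zeta> = Fv \<zeta>"
    "AE t in lborel. 0 \<le> t \<longrightarrow> (AE x in lborel. Fv (x, t) = ofL2 (ulim t) x)"
    "\<And>t. 0 \<le> t \<Longrightarrow> AE x in lborel. v (x, t) = ofL2 (ulim t) x"
    using joint_U by blast
  obtain m Fm where m: "Fm \<in> borel_measurable borel" "AE \<zeta> in lborel. m \<zeta> = Fm \<zeta>"
    "\<And>t. 0 \<le> t \<Longrightarrow> AE x in lborel. m (x, t) = ofL2 (Mlim t) x"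
    using joint_M by blast
  define \<mu> where "\<mu> = (\<lambda>\<zeta>. clamp1 (weight (fst \<zeta>) * m \<zeta>))"
  have id: "enthalpy_identity D F0 v \<mu> t\<^sub>1 t\<^sub>2 \<eta>" if "\<eta> \<in> Cc_infinity_half" "0 \<le> t\<^sub>1" "t\<^sub>1 < t\<^sub>2" for t\<^sub>1 t\<^sub>2 \<eta>
    using that enthalpy_identity_half[OF m v _ _ that(2,3) F0] unfolding \<mu>_def Cc_infinity_half_def by blast
  have half: "\<eta> \<in> Cc_infinity UNIV \<Longrightarrow> \<eta> \<in> Cc_infinity_half" for \<eta> :: "'a \<times> real \<Rightarrow> real"
    by (auto simp: Cc_infinity_half_def)
  have init: "AE x in lebesgue_on D. v (x, 0) = g0 x"
  proof -
    have "AE x in lborel. v (x, 0) = g x" by (rule initial_temperature[OF m v])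
    then show ?thesis unfolding AE_lebesgue_on_iff[OF DB] using g0 by eventually_elim simp
  qed
  have init': "AE x in lebesgue_on D. \<mu> (x, 0) = indicator (Omega_plus D uM0 g0) x - indicator (Omega_minus D uM0 g0) x"
  proof -
    have "AE x in lborel. \<mu> (x, 0) = \<mu>\<^sub>0 x" unfolding \<mu>_def by (rule initial_phase[OF m v])
    then show ?thesis unfolding AE_lebesgue_on_iff[OF DB] using g0 uM0
      by eventually_elim (auto simp: \<mu>\<^sub>0_def Omega_plus_def Omega_minus_def indicator_def)
  qed
  have cyl: "D \<times> {0::real..} \<in> sets borel" by (intro borel_Times) auto
  have ph: "AE x in lebesgue_on D. (v (x, t) > uM0 x \<longrightarrow> \<mu> (x, t) = 1) \<and> (v (x, t) < uM0 x \<longrightarrow> \<mu> (x, t) = - 1)"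
    if "0 \<le> t" for t
  proof -
    have "AE x in lborel. x \<in> D \<longrightarrow> (v (x, t) > u\<^sub>M x \<longrightarrow> \<mu> (x, t) = 1) \<and> (v (x, t) < u\<^sub>M x \<longrightarrow> \<mu> (x, t) = - 1)"
      unfolding \<mu>_def by (rule phases[OF m v that])
    then show ?thesis unfolding AE_lebesgue_on_iff[OF DB] using uM0 by eventually_elim simp
  qed
  have "enthalpy_solution_Neumann D \<infinity> uM0 F0 v \<mu>"
    unfolding enthalpy_solution_Neumann_def
    using v_measurable[OF v cyl] mu_measurable[OF m cyl] v_L2_loc_H1[OF v] v_time_derivative[OF v]
      v_continuous_L2_valued[OF v] mu_weak_star_continuous[OF m] id half ph
    by (simp add: time_ivl_infinity flip: \<mu>_def)
  moreover have "v \<in> space_U_N D g0"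
    using v_space_U[OF v] v_continuous_L2_valued[OF v] init by (simp add: space_U_N_def)
  moreover have "\<mu> \<in> Linf_space (D \<times> {0..})" using mu_Linf[OF m] by (simp add: \<mu>_def)
  ultimately show ?thesis using v_H1[OF v] id init init' by blast
qed

end

theorem corollary1p9:
  fixes D :: "(real ^ 'd) set"
    and u\<^sub>M g :: "real ^ 'd \<Rightarrow> real"
    and F :: "real ^ 'd \<Rightarrow> real ^ 'd"
  assumes "open D"
    and "u\<^sub>M \<in> borel_measurable (lebesgue_on D)"
    and "g \<in> H1_space D"
    and "F \<in> L2_space D"
  shows "\<exists>u \<mu>. u \<in> space_U_N D g \<and> \<mu> \<in> Linf_space (D \<times> {0..}) \<and>
           enthalpy_solution_Neumann D \<infinity> u\<^sub>M F u \<mu> \<and>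
           (\<forall>t\<ge>0. slice u t \<in> H1_space D) \<and>
           (\<forall>t\<^sub>1 t\<^sub>2. 0 \<le> t\<^sub>1 \<longrightarrow> t\<^sub>1 < t\<^sub>2 \<longrightarrow>
              (\<forall>\<eta>\<in>Cc_infinity_half. enthalpy_identity D F u \<mu> t\<^sub>1 t\<^sub>2 \<eta>)) \<and>
           (AE x in lebesgue_on D. u (x, 0) = g x) \<and>
           (AE x in lebesgue_on D.
              \<mu> (x, 0) = indicator (Omega_plus D u\<^sub>M g) x - indicator (Omega_minus D u\<^sub>M g) x)"
proof -
  have D: "D \<in> sets borel" using assms(1) by simp
  obtain m where m: "m \<in> borel_measurable borel" "AE x in lborel. x \<in> D \<longrightarrow> u\<^sub>M x = m x"
    using lebesgue_on_borel_representative_real[OF D assms(2)] by blast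
  obtain F' where F': "sqint F'" "\<And>x. x \<notin> D \<Longrightarrow> F' x = 0" "AE x in lborel. x \<in> D \<longrightarrow> F x = F' x"
    using L2_space_representative[OF D assms(4)] by blast
  obtain g' G where g': "sqint g'" "\<And>x. x \<notin> D \<Longrightarrow> g' x = 0" "AE x in lborel. x \<in> D \<longrightarrow> g x = g' x"
    "(toL2 g', G) \<in> gradL2 D"
    using H1_space_imp_gradL2[OF D assms(3)] by blast
  \<comment> \<open>All data are replaced by Borel representatives; \<open>G\<close> is a weak
    gradient of the initial temperature, which starts the energy estimate.\<close>
  interpret stefan D m g' F' G
    by standard (use assms(1) m(1) F' g' in auto)
  show ?thesis by (rule enthalpy_solution_ex[OF m(2) F'(3) g'(3)])
qed

end
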